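(* Let $\mathfrak g$ be a Kac--Moody Lie algebra without Serre's relations, $M=M(\Lambda_1)\otimes\cdots\otimes M(\Lambda_n)$ a tensor product of Verma modules with highest weights $\Lambda_1,\dots,\Lambda_n\in\mathfrak h^*$, $\lambda=(m_1,\dots,m_r)\in\mathbb N^r$, $m=\sum_im_i$. Let $u(\mu,z)=\sum_{I\in P(\lambda,n)}u_I\,f_Iv$ be a hypergeometric integral with values in the weight space $M_\lambda$, i.e. $$u_I=\int_{\gamma(z)}\Phi_\mu^{1/\kappa}\Big(\sum_{\sigma\in\Sigma(I)}(-1)^{|\sigma|}\omega_{I,\sigma}\Big),$$ where $\gamma(z)$ is a horizontal family of twisted cycles in $\{z\}\times\mathbb C^m$. Then $u(\mu,z)$ solves the dynamical differential equations in $M_\lambda$: $$\kappa\,\partial_{\mu'}u=\sum_{i=1}^nz_i(\mu')^{(i)}u+\sum_{\alpha>0}\frac{\langle\alpha,\mu'\rangle}{\langle\alpha,\mu\rangle}\Delta_{+,\alpha}u,\qquad\mu'\in\mathfrak h.$$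
   Context: Lie algebra. Let $\mathfrak h$ be a finite dimensional complex vector space with a non-degenerate symmetric bilinear form $(\,,)$, and $\alpha_1,\dots,\alpha_r\in\mathfrak h^*$ linearly independent. $b:\mathfrak h\to\mathfrak h^*$ is the induced isomorphism, the form is transported to $\mathfrak h^*$, $h_i=b^{-1}(\alpha_i)$. The Kac--Moody Lie algebra without Serre's relations $\mathfrak g$ is generated by $\mathfrak h$, $e_i,f_i$ ($1\le i\le r$) with relations $[h,e_i]=\langle\alpha_i,h\rangle e_i$, $[h,f_i]=-\langle\alpha_i,h\rangle f_i$, $[e_i,f_j]=\delta_{ij}h_i$, $[h,h']=0$. $\mathfrak n_-$ is the subalgebra generated by the $f_i$. For $\alpha=\sum k_i\alpha_i$, $k_i\in\mathbb N$, $(\mathfrak n_-)_\alpha=\{x\in\mathfrak n_-:[h,x]=-\langle\alpha,h\rangle x\ \forall h\in\mathfrak h\}$; $\alpha$ is a positive root ($\alpha>0$) if $\alpha\neq0$ and $(\mathfrak n_-)_\alpha\ne0$. $M(\Lambda)$ is the Verma module with highest weight $\Lambda$ and generating vector $v$; $M_\lambda$ is the subspace of $M$ of weight $\sum_j\Lambda_j-\sum_im_i\alpha_i$. $x^{(i)}$ means $x$ acting on the $i$th factor. $\kappa\in\mathbb C\setminus\{0\}$, $\mu\in\mathfrak h$; $\partial_{\mu'}$ is the derivative in $\mu$ in direction $\mu'$. Operators. $\nu_-:M(\Lambda)\to\mathfrak n_-\otimes M(\Lambda)$ is the linear map with $\nu_-(v)=0$, $\nu_-(f_ix)=f_i\otimes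 h_ix+f_i\cdot\nu_-(x)$, where $a\cdot(d\otimes y)=[a,d]\otimes y+d\otimes ay$. On $M$, $\nu_{M-}=\sum_{k=1}^n\nu^{(k)}:M\to\mathfrak n_-\otimes M$, where $\nu^{(k)}$ applies $\nu_-$ to the $k$th factor and moves the $\mathfrak n_-$-component to the front. For $\alpha>0$, $$\Delta_{+,\alpha}u=\sum_kx_k\,\big((x_k^*\otimes\mathrm{id})\,\nu_{M-}(u)\big),$$ where $(x_k)$ is a basis of $(\mathfrak n_-)_\alpha$, $(x_k^* )$ the dual basis of $(\mathfrak n_-)^*_\alpha$ (extended by $0$ to the other root spaces), and $x_k$ acts by the standard action on $M$. On $M_\lambda$ only finitely many $\Delta_{+,\alpha}$ are non-zero; $\mu$ is assumed to satisfy $\langle\alpha,\mu\rangle\ne0$ for the relevant $\alpha$. Integrand. $c:\{1,\dots,m\}\to\{1,\dots,r\}$ is the unique non-decreasing function with $\#c^{-1}(i)=m_i$; $$\Phi_\mu=\exp\Big(-\sum_{i=1}^m\langle\alpha_{c(i)},\mu\rangle t_i+\sum_{j=1}^n\langle\Lambda_j,\mu\rangle z_j\Big)\prod_{i<j}(z_i-z_j)^{(\Lambda_i,\Lambda_j)}\prod_{k,j}(t_k-z_j)^{-(\alpha_{c(k)},\Lambda_j)}\prod_{k<l}(t_k-t_l)^{(\alpha_{c(k)},\alpha_{c(l)})}.$$ $P(\lambda,n)$ is the set of sequences $I=(i^1_1,\dots,i^1_{s_1};\dots;i^n_1,\dots,i^n_{s_n})$, $s_j\ge0$, in $\{1,\dots,r\}$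 in which each $i$ appears exactly $m_i$ times. For a permutation $\sigma$ of $\{1,\dots,m\}$, $\sigma_j(l)=\sigma(s_1+\cdots+s_{j-1}+l)$, $1\le l\le s_j$; $\Sigma(I)$ is the set of $\sigma$ with $c(\sigma_j(l))=i^j_l$ for all $j,l$; $(-1)^{|\sigma|}$ is the sign. $f_Iv=f_{i^1_1}\cdots f_{i^1_{s_1}}v_1\otimes\cdots\otimes f_{i^n_1}\cdots f_{i^n_{s_n}}v_n$ with $v_j$ the generating vector of $M(\Lambda_j)$. $\omega_{i_1,\dots,i_s}(x)=d\log(t_{i_1}-t_{i_2})\wedge\cdots\wedge d\log(t_{i_{s-1}}-t_{i_s})\wedge d\log(t_{i_s}-x)$ (equal to $1$ if $s=0$), $\omega_{I,\sigma}=\omega_{\sigma_1(1),\dots,\sigma_1(s_1)}(z_1)\wedge\cdots\wedge\omega_{\sigma_n(1),\dots,\sigma_n(s_n)}(z_n)$. Twisted cycles. For fixed $z$ with distinct coordinates, a twisted cycle is an $m$-cycle in the complement in $\mathbb C^m$ of the hyperplanes $t_k=z_j$, $t_k=t_l$, with coefficients in the local system of branches of $\Phi_\mu^{1/\kappa}$ (compact, or non-compact such that the integrals converge and $\int_\gamma d_t(\Phi_\mu^{1/\kappa}\eta)=0$ for forms $\eta$ that are products of $d\log$'s of the functions defining the hyperplanes). A horizontal family is one locally constant in the parameters $z,\mu$, so that one may differentiate under the integral sign. *)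

theory Defs
  imports "HOL-Analysis.Analysis" "HOL-Library.Poly_Mapping" "HOL-Combinatorics.Permutations"
begin

section \<open>Complex vector spaces and tensor products\<close>

class complex_vector = ab_group_add +
  fixes scaleC :: "complex \<Rightarrow> 'a \<Rightarrow> 'a"  (infixr \<open>*\<^sub>C\<close> 75)
  assumes scaleC_add_right: "c *\<^sub>C (x + y) = c *\<^sub>C x + c *\<^sub>C y"
    and scaleC_add_left: "(c + d) *\<^sub>C x = c *\<^sub>C x + d *\<^sub>C x"
    and scaleC_scaleC: "c *\<^sub>C (d *\<^sub>C x) = (c * d) *\<^sub>C x"
    and scaleC_one: "1 *\<^sub>C x = x"

global_interpretation complex_vector:
  vector_space "scaleC :: complex \<Rightarrow> 'a \<Rightarrow> 'a::complex_vector"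
  by unfold_locales (fact scaleC_add_right scaleC_add_left scaleC_scaleC scaleC_one)+

abbreviation clinear :: "('a::complex_vector \<Rightarrow> 'b::complex_vector) \<Rightarrow> bool"
  where "clinear \<equiv> Vector_Spaces.linear scaleC scaleC"

lemma clinearI:
  assumes "\<And>x y. f (x + y) = f x + f y" "\<And>c x. f (c *\<^sub>C x) = c *\<^sub>C f x"
  shows "clinear f"
  by unfold_locales (use assms in auto)

lemma clinear_add: "clinear f \<Longrightarrow> f (x + y) = f x + f y"
  and clinear_scale: "clinear f \<Longrightarrow> f (c *\<^sub>C x) = c *\<^sub>C f x"
  and clinear_zero: "clinear f \<Longrightarrow> f 0 = 0"
  and clinear_diff: "clinear f \<Longrightarrow> f (x - y) = f x - f y"
  by (auto simp: linear_iff_module_hom module_hom.add module_hom.scale module_hom.zero module_hom.diff)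

instantiation complex :: complex_vector
begin
definition scaleC_complex :: "complex \<Rightarrow> complex \<Rightarrow> complex"
  where "scaleC_complex = (*)"
instance by standard (auto simp: scaleC_complex_def algebra_simps)
end

instantiation poly_mapping :: (type, complex_vector) complex_vector
begin
lift_definition scaleC_poly_mapping :: "complex \<Rightarrow> ('a \<Rightarrow>\<^sub>0 'b) \<Rightarrow> ('a \<Rightarrow>\<^sub>0 'b)"
  is "\<lambda>c p x. c *\<^sub>C p x"
  by (erule finite_subset[rotated]) (auto simp: complex_vector.scale_eq_0_iff)
instance
  by standard (transfer; simp add: fun_eq_iff scaleC_add_right scaleC_add_left
      scaleC_scaleC scaleC_one)+
end

lemma lookup_scaleC: "Poly_Mapping.lookup (c *\<^sub>C p) x = c *\<^sub>C Poly_Mapping.lookup p x"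
  by transfer simp

text \<open>The linear extension of \<^term>\<open>f\<close> to the vector space \<^typ>\<open>'x \<Rightarrow>\<^sub>0 complex\<close> freely spanned by \<^typ>\<open>'x\<close>.\<close>

definition lin_ext :: "('x \<Rightarrow> 'w::complex_vector) \<Rightarrow> ('x \<Rightarrow>\<^sub>0 complex) \<Rightarrow> 'w"
  where "lin_ext f p = (\<Sum>x\<in>Poly_Mapping.keys p. Poly_Mapping.lookup p x *\<^sub>C f x)"

lemma lin_ext_superset:
  assumes "finite S" "Poly_Mapping.keys p \<subseteq> S"
  shows "lin_ext f p = (\<Sum>x\<in>S. Poly_Mapping.lookup p x *\<^sub>C f x)"
  unfolding lin_ext_def using assms
  by (intro sum.mono_neutral_left) (auto simp: in_keys_iff)

lemma clinear_lin_ext: "clinear (lin_ext f)"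
proof (rule clinearI)
  fix p q :: "'a \<Rightarrow>\<^sub>0 complex"
  let ?S = "Poly_Mapping.keys p \<union> Poly_Mapping.keys q"
  have "Poly_Mapping.keys (p + q) \<subseteq> ?S" by (rule keys_add)
  then show "lin_ext f (p + q) = lin_ext f p + lin_ext f q"
    by (simp add: lin_ext_superset[of ?S] lookup_add scaleC_add_left sum.distrib)
next
  fix c and p :: "'a \<Rightarrow>\<^sub>0 complex"
  have "Poly_Mapping.keys (c *\<^sub>C p) \<subseteq> Poly_Mapping.keys p" by (auto simp: in_keys_iff lookup_scaleC)
  then show "lin_ext f (c *\<^sub>C p) = c *\<^sub>C lin_ext f p"
    by (simp add: lin_ext_superset[of "Poly_Mapping.keys p"] lookup_scaleC complex_vector.scale_sum_right
        scaleC_complex_def)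
qed

lemma lin_ext_single [simp]: "lin_ext f (Poly_Mapping.single x 1) = f x"
  by (simp add: lin_ext_def scaleC_one)

lemma lin_ext_span_zero:
  assumes "\<And>p. p \<in> R \<Longrightarrow> lin_ext f p = 0" "p \<in> complex_vector.span R"
  shows "lin_ext f p = 0"
  using assms(2)
proof (induction rule: complex_vector.span_induct)
  case base
  show ?case
    by (simp add: complex_vector.subspace_def clinear_zero[OF clinear_lin_ext]
        clinear_add[OF clinear_lin_ext] clinear_scale[OF clinear_lin_ext])
qed (use assms(1) in auto)

abbreviation pure :: "'x \<Rightarrow> 'x \<Rightarrow>\<^sub>0 complex" where "pure x \<equiv> Poly_Mapping.single x 1"

lemma pure_decompose: "p = (\<Sum>x\<in>Poly_Mapping.keys p. Poly_Mapping.lookup p x *\<^sub>C pure x)"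
  by (rule poly_mapping_eqI)
    (auto simp: lookup_sum lookup_scaleC lookup_single scaleC_complex_def when_def in_keys_iff
      sum.delta if_distrib cong: if_cong)

lemma clinear_free_ext:
  assumes "clinear F" "clinear G" "\<And>x. F (pure x) = G (pure x)"
  shows "F p = G p"
proof -
  have "H p = (\<Sum>x\<in>Poly_Mapping.keys p. Poly_Mapping.lookup p x *\<^sub>C H (pure x))" if "clinear H" for H :: "('a \<Rightarrow>\<^sub>0 complex) \<Rightarrow> 'b"
  proof -
    interpret Vector_Spaces.linear scaleC scaleC H by (fact that)
    have "H p = H (\<Sum>x\<in>Poly_Mapping.keys p. Poly_Mapping.lookup p x *\<^sub>C pure x)"
      by (rule arg_cong[OF pure_decompose])
    then show ?thesis by (simp only: sum scale)
  qed
  note expand = this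
  show ?thesis
    by (simp only: expand[OF assms(1)] expand[OF assms(2)] assms(3))
qed

subsection \<open>The tensor product of two spaces\<close>

inductive_set bilinear_relators :: "('a::complex_vector \<times> 'b::complex_vector \<Rightarrow>\<^sub>0 complex) set" where
  add_left: "pure (x + x', y) - (pure (x, y) + pure (x', y)) \<in> bilinear_relators"
| add_right: "pure (x, y + y') - (pure (x, y) + pure (x, y')) \<in> bilinear_relators"
| scale_left: "pure (c *\<^sub>C x, y) - c *\<^sub>C pure (x, y) \<in> bilinear_relators"
| scale_right: "pure (x, c *\<^sub>C y) - c *\<^sub>C pure (x, y) \<in> bilinear_relators"

definition tensor_rel ::
    "('a::complex_vector \<times> 'b::complex_vector \<Rightarrow>\<^sub>0 complex) \<Rightarrow> ('a \<times> 'b \<Rightarrow>\<^sub>0 complex) \<Rightarrow> bool"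
  where "tensor_rel p q \<longleftrightarrow> p - q \<in> complex_vector.span bilinear_relators"

lemma equivp_span_diff:
  "equivp (\<lambda>p q. p - q \<in> complex_vector.span (R :: 'a::complex_vector set))"
proof (rule equivpI)
  show "reflp (\<lambda>p q. p - q \<in> complex_vector.span R)"
    by (simp add: reflp_def complex_vector.span_zero)
  show "symp (\<lambda>p q. p - q \<in> complex_vector.span R)"
  proof (rule sympI)
    fix p q :: 'a
    assume "p - q \<in> complex_vector.span R"
    from complex_vector.span_neg[OF this] show "q - p \<in> complex_vector.span R" by simp
  qed
  show "transp (\<lambda>p q. p - q \<in> complex_vector.span R)"
  proof (rule transpI)
    fix p q r :: 'a
    assume "p - q \<in> complex_vector.span R" "q - r \<in> complex_vector.span R"
    from complex_vector.span_add[OF this] show "p - r \<in> complex_vector.span R" by simp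
  qed
qed

lemma span_diff_cong:
  fixes R :: "'a::complex_vector set"
  assumes "p - p' \<in> complex_vector.span R"
  shows "q - q' \<in> complex_vector.span R \<Longrightarrow> (p + q) - (p' + q') \<in> complex_vector.span R"
    and "q - q' \<in> complex_vector.span R \<Longrightarrow> (p - q) - (p' - q') \<in> complex_vector.span R"
    and "- p - - p' \<in> complex_vector.span R"
    and "c *\<^sub>C p - c *\<^sub>C p' \<in> complex_vector.span R"
proof -
  show "(p + q) - (p' + q') \<in> complex_vector.span R" if "q - q' \<in> complex_vector.span R"
    using complex_vector.span_add[OF assms that] by (simp only: add_diff_add)
  show "(p - q) - (p' - q') \<in> complex_vector.span R" if "q - q' \<in> complex_vector.span R"
  proof -
    have "(p - q) - (p' - q') = (p - p') - (q - q')" by (simp add: algebra_simps)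
    with complex_vector.span_diff[OF assms that] show ?thesis by (simp only:)
  qed
  have "- p - - p' = - (p - p')" by simp
  then show "- p - - p' \<in> complex_vector.span R"
    using complex_vector.span_neg[OF assms] by (simp only:)
  show "c *\<^sub>C p - c *\<^sub>C p' \<in> complex_vector.span R"
    using complex_vector.span_scale[OF assms, of c]
    by (simp only: complex_vector.scale_right_diff_distrib)
qed

quotient_type (overloaded) ('a, 'b) tensor =
  "('a::complex_vector \<times> 'b::complex_vector) \<Rightarrow>\<^sub>0 complex" / tensor_rel
  unfolding tensor_rel_def[abs_def] by (rule equivp_span_diff)

instantiation tensor :: (complex_vector, complex_vector) complex_vector
begin
lift_definition zero_tensor :: "('a, 'b) tensor" is 0 .
lift_definition plus_tensor :: "('a, 'b) tensor \<Rightarrow> ('a, 'b) tensor \<Rightarrow> ('a, 'b) tensor" is "(+)"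
  unfolding tensor_rel_def by (rule span_diff_cong(1))
lift_definition minus_tensor :: "('a, 'b) tensor \<Rightarrow> ('a, 'b) tensor \<Rightarrow> ('a, 'b) tensor" is "(-)"
  unfolding tensor_rel_def by (rule span_diff_cong(2))
lift_definition uminus_tensor :: "('a, 'b) tensor \<Rightarrow> ('a, 'b) tensor" is uminus
  unfolding tensor_rel_def by (rule span_diff_cong(3))
lift_definition scaleC_tensor :: "complex \<Rightarrow> ('a, 'b) tensor \<Rightarrow> ('a, 'b) tensor" is scaleC
  unfolding tensor_rel_def by (rule span_diff_cong(4))
instance
proof
  fix x y z :: "('a, 'b) tensor" and c d :: complex
  show "x + y + z = x + (y + z)" "x + y = y + x" "0 + x = x" "- x + x = 0" "x - y = x + - y"
    "c *\<^sub>C (x + y) = c *\<^sub>C x + c *\<^sub>C y" "(c + d) *\<^sub>C x = c *\<^sub>C x + d *\<^sub>C x"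
    "c *\<^sub>C d *\<^sub>C x = (c * d) *\<^sub>C x" "1 *\<^sub>C x = x"
    by (transfer, simp add: tensor_rel_def complex_vector.span_zero add.assoc add.commute
        scaleC_add_right scaleC_add_left scaleC_scaleC scaleC_one)+
qed
end

lift_definition tens :: "'a::complex_vector \<Rightarrow> 'b::complex_vector \<Rightarrow> ('a, 'b) tensor"  (infixr \<open>\<otimes>\<close> 72)
  is "\<lambda>x y. pure (x, y)" .

definition cbilinear :: "('a::complex_vector \<Rightarrow> 'b::complex_vector \<Rightarrow> 'c::complex_vector) \<Rightarrow> bool"
  where "cbilinear F \<longleftrightarrow> (\<forall>x. clinear (F x)) \<and> (\<forall>y. clinear (\<lambda>x. F x y))"

text \<open>The linear map on the tensor product induced by a bilinear map.\<close>

definition tensor_lift ::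
    "('a::complex_vector \<Rightarrow> 'b::complex_vector \<Rightarrow> 'c::complex_vector) \<Rightarrow> ('a, 'b) tensor \<Rightarrow> 'c"
  where "tensor_lift F = (THE G. clinear G \<and> (\<forall>x y. G (x \<otimes> y) = F x y))"

lemma tens_eqI:
  assumes "p - q \<in> bilinear_relators"
  shows "abs_tensor p = abs_tensor q"
  using assms by (simp add: tensor.abs_eq_iff tensor_rel_def complex_vector.span_base)

lemma tens_add_left: "(x + x') \<otimes> y = x \<otimes> y + x' \<otimes> y"
  and tens_add_right: "x \<otimes> (y + y') = x \<otimes> y + x \<otimes> y'"
  and tens_scale_left: "(c *\<^sub>C x) \<otimes> y = c *\<^sub>C (x \<otimes> y)"
  and tens_scale_right: "x \<otimes> (c *\<^sub>C y) = c *\<^sub>C (x \<otimes> y)"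
  unfolding tens.abs_eq plus_tensor.abs_eq scaleC_tensor.abs_eq
  by (rule tens_eqI, rule bilinear_relators.intros)+

lemma tensor_lift_ex1:
  fixes F :: "'a::complex_vector \<Rightarrow> 'b::complex_vector \<Rightarrow> 'c::complex_vector"
  assumes "cbilinear F"
  shows "\<exists>!G. clinear G \<and> (\<forall>x y. G (x \<otimes> y) = F x y)"
proof -
  let ?E = "lin_ext (\<lambda>(x, y). F x y)"
  have lin: "clinear (F x)" "clinear (\<lambda>x. F x y)" for x y
    using assms by (auto simp: cbilinear_def)
  have F: "F (x + x') y = F x y + F x' y" "F x (y + y') = F x y + F x y'"
    "F (c *\<^sub>C x) y = c *\<^sub>C F x y" "F x (c *\<^sub>C y) = c *\<^sub>C F x y" for x x' y y' c
    by (fact clinear_add[OF lin(2)] clinear_add[OF lin(1)] clinear_scale[OF lin(2)] clinear_scale[OF lin(1)])+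
  have zero: "?E p = 0" if "p \<in> bilinear_relators" for p
    using that
    by cases (simp_all add: clinear_diff[OF clinear_lin_ext] clinear_add[OF clinear_lin_ext]
        clinear_scale[OF clinear_lin_ext] F)
  have resp: "?E p = ?E q" if "tensor_rel p q" for p q
    using lin_ext_span_zero[OF zero that[unfolded tensor_rel_def]]
    by (simp add: clinear_diff[OF clinear_lin_ext])
  define G where "G t = ?E (rep_tensor t)" for t
  have G_abs: "G (abs_tensor p) = ?E p" for p
    unfolding G_def by (rule resp) (metis Quotient_tensor tensor.abs_eq_iff Quotient_abs_rep)
  have lin_G: "clinear G"
  proof (rule clinearI)
    show "G (s + t) = G s + G t" for s t
      by (rule tensor.abs_induct[of _ s], rule tensor.abs_induct[of _ t])
        (simp add: plus_tensor.abs_eq G_abs clinear_add[OF clinear_lin_ext])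
    show "G (c *\<^sub>C t) = c *\<^sub>C G t" for c t
      by (rule tensor.abs_induct[of _ t])
        (simp add: scaleC_tensor.abs_eq G_abs clinear_scale[OF clinear_lin_ext])
  qed
  have val: "G (x \<otimes> y) = F x y" for x y
    by (simp add: tens.abs_eq G_abs)
  have uniq: "G' = G" if "clinear G'" "\<forall>x y. G' (x \<otimes> y) = F x y" for G'
  proof
    fix t :: "('a, 'b) tensor"
    have abs: "clinear (\<lambda>p. H (abs_tensor p))" if "clinear H" for H :: "('a, 'b) tensor \<Rightarrow> 'c"
      by (rule clinearI)
        (simp_all add: plus_tensor.abs_eq[symmetric] scaleC_tensor.abs_eq[symmetric]
          clinear_add[OF that] clinear_scale[OF that])
    obtain p where t: "t = abs_tensor p" by (metis Quotient_tensor Quotient_abs_rep)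
    show "G' t = G t" unfolding t
      by (rule clinear_free_ext[OF abs[OF that(1)] abs[OF lin_G], of p])
        (metis prod.exhaust tens.abs_eq that(2) val)
  qed
  show ?thesis
  proof (rule ex1I)
    show "clinear G \<and> (\<forall>x y. G (x \<otimes> y) = F x y)"
      using lin_G val by simp
  next
    fix G'
    assume "clinear G' \<and> (\<forall>x y. G' (x \<otimes> y) = F x y)"
    then show "G' = G" using uniq by simp
  qed
qed

lemma tensor_lift_props: "cbilinear F \<Longrightarrow> clinear (tensor_lift F) \<and> (\<forall>x y. tensor_lift F (x \<otimes> y) = F x y)"
  unfolding tensor_lift_def by (rule theI'[OF tensor_lift_ex1])

lemma clinear_tensor_lift: "cbilinear F \<Longrightarrow> clinear (tensor_lift F)"
  and tensor_lift_tens: "cbilinear F \<Longrightarrow> tensor_lift F (x \<otimes> y) = F x y"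
  using tensor_lift_props by blast+

subsection \<open>The tensor product of a finite family of spaces\<close>

inductive_set multilinear_relators :: "(('n \<Rightarrow> 'v::complex_vector) \<Rightarrow>\<^sub>0 complex) set" where
  add: "pure (y(k := x + x')) - (pure (y(k := x)) + pure (y(k := x'))) \<in> multilinear_relators"
| scale: "pure (y(k := c *\<^sub>C x)) - c *\<^sub>C pure (y(k := x)) \<in> multilinear_relators"

definition mtensor_rel ::
    "(('n \<Rightarrow> 'v::complex_vector) \<Rightarrow>\<^sub>0 complex) \<Rightarrow> (('n \<Rightarrow> 'v) \<Rightarrow>\<^sub>0 complex) \<Rightarrow> bool"
  where "mtensor_rel p q \<longleftrightarrow> p - q \<in> complex_vector.span multilinear_relators"

quotient_type (overloaded) ('n, 'v) mtensor = "('n \<Rightarrow> 'v::complex_vector) \<Rightarrow>\<^sub>0 complex" / mtensor_rel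
  unfolding mtensor_rel_def[abs_def] by (rule equivp_span_diff)

instantiation mtensor :: (type, complex_vector) complex_vector
begin
lift_definition zero_mtensor :: "('a, 'b) mtensor" is 0 .
lift_definition plus_mtensor :: "('a, 'b) mtensor \<Rightarrow> ('a, 'b) mtensor \<Rightarrow> ('a, 'b) mtensor" is "(+)"
  unfolding mtensor_rel_def by (rule span_diff_cong(1))
lift_definition minus_mtensor :: "('a, 'b) mtensor \<Rightarrow> ('a, 'b) mtensor \<Rightarrow> ('a, 'b) mtensor" is "(-)"
  unfolding mtensor_rel_def by (rule span_diff_cong(2))
lift_definition uminus_mtensor :: "('a, 'b) mtensor \<Rightarrow> ('a, 'b) mtensor" is uminus
  unfolding mtensor_rel_def by (rule span_diff_cong(3))
lift_definition scaleC_mtensor :: "complex \<Rightarrow> ('a, 'b) mtensor \<Rightarrow> ('a, 'b) mtensor" is scaleC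
  unfolding mtensor_rel_def by (rule span_diff_cong(4))
instance
proof
  fix x y z :: "('a, 'b) mtensor" and c d :: complex
  show "x + y + z = x + (y + z)" "x + y = y + x" "0 + x = x" "- x + x = 0" "x - y = x + - y"
    "c *\<^sub>C (x + y) = c *\<^sub>C x + c *\<^sub>C y" "(c + d) *\<^sub>C x = c *\<^sub>C x + d *\<^sub>C x"
    "c *\<^sub>C d *\<^sub>C x = (c * d) *\<^sub>C x" "1 *\<^sub>C x = x"
    by (transfer, simp add: mtensor_rel_def complex_vector.span_zero add.assoc add.commute
        scaleC_add_right scaleC_add_left scaleC_scaleC scaleC_one)+
qed
end

lift_definition mtens :: "('n \<Rightarrow> 'v::complex_vector) \<Rightarrow> ('n, 'v) mtensor" is "\<lambda>y. pure y" .

definition cmultilinear :: "(('n \<Rightarrow> 'v::complex_vector) \<Rightarrow> 'c::complex_vector) \<Rightarrow> bool"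
  where "cmultilinear F \<longleftrightarrow> (\<forall>y k. clinear (\<lambda>x. F (y(k := x))))"

definition mtensor_lift ::
    "(('n \<Rightarrow> 'v::complex_vector) \<Rightarrow> 'c::complex_vector) \<Rightarrow> ('n, 'v) mtensor \<Rightarrow> 'c"
  where "mtensor_lift F = (THE G. clinear G \<and> (\<forall>y. G (mtens y) = F y))"

lemma mtens_eqI:
  assumes "p - q \<in> multilinear_relators"
  shows "abs_mtensor p = abs_mtensor q"
  using assms by (simp add: mtensor.abs_eq_iff mtensor_rel_def complex_vector.span_base)

lemma mtens_add: "mtens (y(k := x + x')) = mtens (y(k := x)) + mtens (y(k := x'))"
  and mtens_scale: "mtens (y(k := c *\<^sub>C x)) = c *\<^sub>C mtens (y(k := x))"
  unfolding mtens.abs_eq plus_mtensor.abs_eq scaleC_mtensor.abs_eq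
  by (rule mtens_eqI, rule multilinear_relators.intros)+

lemma mtensor_lift_ex1:
  fixes F :: "('a \<Rightarrow> 'b::complex_vector) \<Rightarrow> 'c::complex_vector"
  assumes "cmultilinear F"
  shows "\<exists>!G. clinear G \<and> (\<forall>y. G (mtens y) = F y)"
proof -
  let ?E = "lin_ext F"
  have lin: "clinear (\<lambda>x. F (y(k := x)))" for y k
    using assms by (auto simp: cmultilinear_def)
  have F: "F (y(k := x + x')) = F (y(k := x)) + F (y(k := x'))"
    "F (y(k := c *\<^sub>C x)) = c *\<^sub>C F (y(k := x))" for y k x x' c
    by (fact clinear_add[OF lin] clinear_scale[OF lin])+
  have zero: "?E p = 0" if "p \<in> multilinear_relators" for p
    using that
    by cases (simp_all add: clinear_diff[OF clinear_lin_ext] clinear_add[OF clinear_lin_ext]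
        clinear_scale[OF clinear_lin_ext] F)
  have resp: "?E p = ?E q" if "mtensor_rel p q" for p q
    using lin_ext_span_zero[OF zero that[unfolded mtensor_rel_def]]
    by (simp add: clinear_diff[OF clinear_lin_ext])
  define G where "G t = ?E (rep_mtensor t)" for t
  have G_abs: "G (abs_mtensor p) = ?E p" for p
    unfolding G_def by (rule resp) (metis Quotient_mtensor mtensor.abs_eq_iff Quotient_abs_rep)
  have lin_G: "clinear G"
  proof (rule clinearI)
    show "G (s + t) = G s + G t" for s t
      by (rule mtensor.abs_induct[of _ s], rule mtensor.abs_induct[of _ t])
        (simp add: plus_mtensor.abs_eq G_abs clinear_add[OF clinear_lin_ext])
    show "G (c *\<^sub>C t) = c *\<^sub>C G t" for c t
      by (rule mtensor.abs_induct[of _ t])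
        (simp add: scaleC_mtensor.abs_eq G_abs clinear_scale[OF clinear_lin_ext])
  qed
  have val: "G (mtens y) = F y" for y
    by (simp add: mtens.abs_eq G_abs)
  have uniq: "G' = G" if "clinear G'" "\<forall>y. G' (mtens y) = F y" for G'
  proof
    fix t :: "('a, 'b) mtensor"
    have abs: "clinear (\<lambda>p. H (abs_mtensor p))" if "clinear H" for H :: "('a, 'b) mtensor \<Rightarrow> 'c"
      by (rule clinearI)
        (simp_all add: plus_mtensor.abs_eq[symmetric] scaleC_mtensor.abs_eq[symmetric]
          clinear_add[OF that] clinear_scale[OF that])
    obtain p where t: "t = abs_mtensor p" by (metis Quotient_mtensor Quotient_abs_rep)
    show "G' t = G t" unfolding t
      by (rule clinear_free_ext[OF abs[OF that(1)] abs[OF lin_G], of p])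
        (metis mtens.abs_eq that(2) val)
  qed
  show ?thesis
  proof (rule ex1I)
    show "clinear G \<and> (\<forall>y. G (mtens y) = F y)"
      using lin_G val by simp
  next
    fix G'
    assume "clinear G' \<and> (\<forall>y. G' (mtens y) = F y)"
    then show "G' = G" using uniq by simp
  qed
qed

lemma mtensor_lift_props: "cmultilinear F \<Longrightarrow> clinear (mtensor_lift F) \<and> (\<forall>y. mtensor_lift F (mtens y) = F y)"
  unfolding mtensor_lift_def by (rule theI'[OF mtensor_lift_ex1])

lemma clinear_mtensor_lift: "cmultilinear F \<Longrightarrow> clinear (mtensor_lift F)"
  and mtensor_lift_mtens: "cmultilinear F \<Longrightarrow> mtensor_lift F (mtens y) = F y"
  using mtensor_lift_props by blast+

section \<open>Lie algebras and modules given by generators and relations\<close>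

definition lie_algebra :: "('g::complex_vector \<Rightarrow> 'g \<Rightarrow> 'g) \<Rightarrow> bool" where
  "lie_algebra brk \<longleftrightarrow> cbilinear brk \<and> (\<forall>x. brk x x = 0) \<and>
     (\<forall>x y z. brk x (brk y z) + brk y (brk z x) + brk z (brk x y) = 0)"

definition representation ::
    "('g::complex_vector \<Rightarrow> 'g \<Rightarrow> 'g) \<Rightarrow> ('g \<Rightarrow> 'v::complex_vector \<Rightarrow> 'v) \<Rightarrow> bool" where
  "representation brk act \<longleftrightarrow> cbilinear act \<and>
     (\<forall>x y w. act (brk x y) w = act x (act y w) - act y (act x w))"

text \<open>
  A Lie algebra is presented by generators \<^typ>\<open>'x\<close> and relations \<open>R\<close> if every element is the value
  of a term in the generators, and two terms have the same value exactly if their equality follows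
  from \<open>R\<close> and the axioms of complex Lie algebras. (This is the quotient of the free Lie algebra;
  the universal property itself quantifies over types.)
\<close>

datatype 'x lie_term =
    LGen 'x | LZero | LAdd "'x lie_term" "'x lie_term"
  | LScale complex "'x lie_term" | LBrk "'x lie_term" "'x lie_term"

primrec lie_eval ::
    "('g::complex_vector \<Rightarrow> 'g \<Rightarrow> 'g) \<Rightarrow> ('x \<Rightarrow> 'g) \<Rightarrow> 'x lie_term \<Rightarrow> 'g" where
  "lie_eval brk \<rho> (LGen x) = \<rho> x"
| "lie_eval brk \<rho> LZero = 0"
| "lie_eval brk \<rho> (LAdd s t) = lie_eval brk \<rho> s + lie_eval brk \<rho> t"
| "lie_eval brk \<rho> (LScale a s) = a *\<^sub>C lie_eval brk \<rho> s"
| "lie_eval brk \<rho> (LBrk s t) = brk (lie_eval brk \<rho> s) (lie_eval brk \<rho> t)"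

inductive lie_eq :: "('x lie_term \<times> 'x lie_term) set \<Rightarrow> 'x lie_term \<Rightarrow> 'x lie_term \<Rightarrow> bool"
  for R where
  rel: "(s, t) \<in> R \<Longrightarrow> lie_eq R s t"
| refl: "lie_eq R s s"
| sym: "lie_eq R s t \<Longrightarrow> lie_eq R t s"
| trans: "lie_eq R s t \<Longrightarrow> lie_eq R t u \<Longrightarrow> lie_eq R s u"
| cong_add: "lie_eq R s s' \<Longrightarrow> lie_eq R t t' \<Longrightarrow> lie_eq R (LAdd s t) (LAdd s' t')"
| cong_scale: "lie_eq R s s' \<Longrightarrow> lie_eq R (LScale a s) (LScale a s')"
| cong_brk: "lie_eq R s s' \<Longrightarrow> lie_eq R t t' \<Longrightarrow> lie_eq R (LBrk s t) (LBrk s' t')"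
| add_assoc: "lie_eq R (LAdd (LAdd s t) u) (LAdd s (LAdd t u))"
| add_comm: "lie_eq R (LAdd s t) (LAdd t s)"
| add_zero: "lie_eq R (LAdd s LZero) s"
| add_inverse: "lie_eq R (LAdd s (LScale (-1) s)) LZero"
| scale_add: "lie_eq R (LScale a (LAdd s t)) (LAdd (LScale a s) (LScale a t))"
| add_scale: "lie_eq R (LScale (a + b) s) (LAdd (LScale a s) (LScale b s))"
| scale_scale: "lie_eq R (LScale a (LScale b s)) (LScale (a * b) s)"
| scale_one: "lie_eq R (LScale 1 s) s"
| brk_add_left: "lie_eq R (LBrk (LAdd s t) u) (LAdd (LBrk s u) (LBrk t u))"
| brk_add_right: "lie_eq R (LBrk s (LAdd t u)) (LAdd (LBrk s t) (LBrk s u))"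
| brk_scale_left: "lie_eq R (LBrk (LScale a s) t) (LScale a (LBrk s t))"
| brk_scale_right: "lie_eq R (LBrk s (LScale a t)) (LScale a (LBrk s t))"
| brk_self: "lie_eq R (LBrk s s) LZero"
| jacobi: "lie_eq R (LAdd (LBrk s (LBrk t u)) (LAdd (LBrk t (LBrk u s)) (LBrk u (LBrk s t)))) LZero"

definition lie_presented ::
    "('g::complex_vector \<Rightarrow> 'g \<Rightarrow> 'g) \<Rightarrow> ('x \<Rightarrow> 'g) \<Rightarrow> ('x lie_term \<times> 'x lie_term) set \<Rightarrow> bool" where
  "lie_presented brk \<rho> R \<longleftrightarrow> lie_algebra brk \<and> surj (lie_eval brk \<rho>) \<and>
     (\<forall>s t. lie_eval brk \<rho> s = lie_eval brk \<rho> t \<longleftrightarrow> lie_eq R s t)"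

text \<open>In the same way, modules over a Lie algebra that are presented by one generator and relations.\<close>

datatype 'g mod_term =
    MGen | MZero | MAdd "'g mod_term" "'g mod_term"
  | MScale complex "'g mod_term" | MAct 'g "'g mod_term"

primrec mod_eval ::
    "('g \<Rightarrow> 'v::complex_vector \<Rightarrow> 'v) \<Rightarrow> 'v \<Rightarrow> 'g mod_term \<Rightarrow> 'v" where
  "mod_eval act v MGen = v"
| "mod_eval act v MZero = 0"
| "mod_eval act v (MAdd s t) = mod_eval act v s + mod_eval act v t"
| "mod_eval act v (MScale a s) = a *\<^sub>C mod_eval act v s"
| "mod_eval act v (MAct x s) = act x (mod_eval act v s)"

inductive mod_eq ::
    "('g::complex_vector \<Rightarrow> 'g \<Rightarrow> 'g) \<Rightarrow> ('g mod_term \<times> 'g mod_term) set \<Rightarrow>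
      'g mod_term \<Rightarrow> 'g mod_term \<Rightarrow> bool"
  for brk R where
  rel: "(s, t) \<in> R \<Longrightarrow> mod_eq brk R s t"
| refl: "mod_eq brk R s s"
| sym: "mod_eq brk R s t \<Longrightarrow> mod_eq brk R t s"
| trans: "mod_eq brk R s t \<Longrightarrow> mod_eq brk R t u \<Longrightarrow> mod_eq brk R s u"
| cong_add: "mod_eq brk R s s' \<Longrightarrow> mod_eq brk R t t' \<Longrightarrow> mod_eq brk R (MAdd s t) (MAdd s' t')"
| cong_scale: "mod_eq brk R s s' \<Longrightarrow> mod_eq brk R (MScale a s) (MScale a s')"
| cong_act: "mod_eq brk R s s' \<Longrightarrow> mod_eq brk R (MAct x s) (MAct x s')"
| add_assoc: "mod_eq brk R (MAdd (MAdd s t) u) (MAdd s (MAdd t u))"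
| add_comm: "mod_eq brk R (MAdd s t) (MAdd t s)"
| add_zero: "mod_eq brk R (MAdd s MZero) s"
| add_inverse: "mod_eq brk R (MAdd s (MScale (-1) s)) MZero"
| scale_add: "mod_eq brk R (MScale a (MAdd s t)) (MAdd (MScale a s) (MScale a t))"
| add_scale: "mod_eq brk R (MScale (a + b) s) (MAdd (MScale a s) (MScale b s))"
| scale_scale: "mod_eq brk R (MScale a (MScale b s)) (MScale (a * b) s)"
| scale_one: "mod_eq brk R (MScale 1 s) s"
| act_add_left: "mod_eq brk R (MAct (x + y) s) (MAdd (MAct x s) (MAct y s))"
| act_scale_left: "mod_eq brk R (MAct (a *\<^sub>C x) s) (MScale a (MAct x s))"
| act_add_right: "mod_eq brk R (MAct x (MAdd s t)) (MAdd (MAct x s) (MAct x t))"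
| act_scale_right: "mod_eq brk R (MAct x (MScale a s)) (MScale a (MAct x s))"
| act_brk: "mod_eq brk R (MAct (brk x y) s) (MAdd (MAct x (MAct y s)) (MScale (-1) (MAct y (MAct x s))))"

definition mod_presented ::
    "('g::complex_vector \<Rightarrow> 'g \<Rightarrow> 'g) \<Rightarrow> ('g \<Rightarrow> 'v::complex_vector \<Rightarrow> 'v) \<Rightarrow> 'v \<Rightarrow>
      ('g mod_term \<times> 'g mod_term) set \<Rightarrow> bool" where
  "mod_presented brk act v R \<longleftrightarrow> representation brk act \<and> surj (mod_eval act v) \<and>
     (\<forall>s t. mod_eval act v s = mod_eval act v t \<longleftrightarrow> mod_eq brk R s t)"

section \<open>The Kac--Moody algebra without Serre's relations and its Verma modules\<close>

text \<open>Elements of the dual space are represented as functions on \<open>\<hh> = complex^'d\<close>.\<close>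

abbreviation functional :: "(complex^'d \<Rightarrow> complex) \<Rightarrow> bool" where
  "functional \<equiv> Vector_Spaces.linear (*s) (*)"

definition cartan_datum ::
    "(complex^'d \<Rightarrow> complex^'d \<Rightarrow> complex) \<Rightarrow> ('r::finite \<Rightarrow> complex^'d \<Rightarrow> complex) \<Rightarrow> bool" where
  "cartan_datum form \<alpha> \<longleftrightarrow>
     (\<forall>h. functional (form h)) \<and> (\<forall>h h'. form h h' = form h' h) \<and>
     (\<forall>h. (\<forall>h'. form h h' = 0) \<longrightarrow> h = 0) \<and>
     (\<forall>i. functional (\<alpha> i)) \<and>
     (\<forall>a. (\<forall>h. (\<Sum>i\<in>UNIV. a i * \<alpha> i h) = 0) \<longrightarrow> (\<forall>i. a i = 0))"

text \<open>\<open>dual_vec form\<close> is the inverse of the isomorphism \<open>b\<close>: \<open>h \<mapsto> (h, -)\<close>.\<close>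

definition dual_vec :: "(complex^'d \<Rightarrow> complex^'d \<Rightarrow> complex) \<Rightarrow> (complex^'d \<Rightarrow> complex) \<Rightarrow> complex^'d"
  where "dual_vec form \<beta> = (THE h. form h = \<beta>)"

definition dual_form ::
    "(complex^'d \<Rightarrow> complex^'d \<Rightarrow> complex) \<Rightarrow> (complex^'d \<Rightarrow> complex) \<Rightarrow> (complex^'d \<Rightarrow> complex) \<Rightarrow> complex"
  where "dual_form form \<beta> \<gamma> = form (dual_vec form \<beta>) (dual_vec form \<gamma>)"

datatype ('h, 'r) km_gen = GH 'h | GE 'r | GF 'r

inductive_set km_relations ::
    "(complex^'d \<Rightarrow> complex^'d \<Rightarrow> complex) \<Rightarrow> ('r \<Rightarrow> complex^'d \<Rightarrow> complex) \<Rightarrow>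
      ((complex^'d, 'r) km_gen lie_term \<times> (complex^'d, 'r) km_gen lie_term) set"
  for form \<alpha> where
  h_add: "(LGen (GH (h + h')), LAdd (LGen (GH h)) (LGen (GH h'))) \<in> km_relations form \<alpha>"
| h_scale: "(LGen (GH (a *s h)), LScale a (LGen (GH h))) \<in> km_relations form \<alpha>"
| h_e: "(LBrk (LGen (GH h)) (LGen (GE i)), LScale (\<alpha> i h) (LGen (GE i))) \<in> km_relations form \<alpha>"
| h_f: "(LBrk (LGen (GH h)) (LGen (GF i)), LScale (- \<alpha> i h) (LGen (GF i))) \<in> km_relations form \<alpha>"
| e_f: "(LBrk (LGen (GE i)) (LGen (GF j)),
         if i = j then LGen (GH (dual_vec form (\<alpha> i))) else LZero) \<in> km_relations form \<alpha>"
| h_h: "(LBrk (LGen (GH h)) (LGen (GH h')), LZero) \<in> km_relations form \<alpha>"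

definition kac_moody ::
    "(complex^'d \<Rightarrow> complex^'d \<Rightarrow> complex) \<Rightarrow> ('r \<Rightarrow> complex^'d \<Rightarrow> complex) \<Rightarrow>
      ('g::complex_vector \<Rightarrow> 'g \<Rightarrow> 'g) \<Rightarrow> (complex^'d \<Rightarrow> 'g) \<Rightarrow> ('r \<Rightarrow> 'g) \<Rightarrow> ('r \<Rightarrow> 'g) \<Rightarrow> bool" where
  "kac_moody form \<alpha> brk hh e f \<longleftrightarrow> lie_presented brk (case_km_gen hh e f) (km_relations form \<alpha>)"

definition verma ::
    "('g::complex_vector \<Rightarrow> 'g \<Rightarrow> 'g) \<Rightarrow> (complex^'d \<Rightarrow> 'g) \<Rightarrow> ('r \<Rightarrow> 'g) \<Rightarrow> (complex^'d \<Rightarrow> complex) \<Rightarrow>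
      ('g \<Rightarrow> 'v::complex_vector \<Rightarrow> 'v) \<Rightarrow> 'v \<Rightarrow> bool" where
  "verma brk hh e \<Lambda> act v \<longleftrightarrow> mod_presented brk act v
     ({(MAct (e i) MGen, MZero) |i. True} \<union> {(MAct (hh h) MGen, MScale (\<Lambda> h) MGen) |h. True})"

text \<open>The pairing of \<open>\<Sum>\<^sub>i k\<^sub>i \<alpha>\<^sub>i\<close> with \<open>h\<close>.\<close>

definition wt :: "('r::finite \<Rightarrow> complex^'d \<Rightarrow> complex) \<Rightarrow> ('r \<Rightarrow> nat) \<Rightarrow> complex^'d \<Rightarrow> complex"
  where "wt \<alpha> k h = (\<Sum>i\<in>UNIV. of_nat (k i) * \<alpha> i h)"

inductive_set n_minus :: "('g::complex_vector \<Rightarrow> 'g \<Rightarrow> 'g) \<Rightarrow> ('r \<Rightarrow> 'g) \<Rightarrow> 'g set"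
  for brk f where
  gen: "f i \<in> n_minus brk f"
| zero: "0 \<in> n_minus brk f"
| add: "x \<in> n_minus brk f \<Longrightarrow> y \<in> n_minus brk f \<Longrightarrow> x + y \<in> n_minus brk f"
| scale: "x \<in> n_minus brk f \<Longrightarrow> a *\<^sub>C x \<in> n_minus brk f"
| brk: "x \<in> n_minus brk f \<Longrightarrow> y \<in> n_minus brk f \<Longrightarrow> brk x y \<in> n_minus brk f"

definition root_space ::
    "('r::finite \<Rightarrow> complex^'d \<Rightarrow> complex) \<Rightarrow> ('g::complex_vector \<Rightarrow> 'g \<Rightarrow> 'g) \<Rightarrow>
      (complex^'d \<Rightarrow> 'g) \<Rightarrow> ('r \<Rightarrow> 'g) \<Rightarrow> ('r \<Rightarrow> nat) \<Rightarrow> 'g set" where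
  "root_space \<alpha> brk hh f k = {x \<in> n_minus brk f. \<forall>h. brk (hh h) x = (- wt \<alpha> k h) *\<^sub>C x}"

definition pos_root ::
    "('r::finite \<Rightarrow> complex^'d \<Rightarrow> complex) \<Rightarrow> ('g::complex_vector \<Rightarrow> 'g \<Rightarrow> 'g) \<Rightarrow>
      (complex^'d \<Rightarrow> 'g) \<Rightarrow> ('r \<Rightarrow> 'g) \<Rightarrow> ('r \<Rightarrow> nat) \<Rightarrow> bool" where
  "pos_root \<alpha> brk hh f k \<longleftrightarrow> k \<noteq> (\<lambda>_. 0) \<and> root_space \<alpha> brk hh f k \<noteq> {0}"

text \<open>
  A basis \<open>B\<close> of a root space and its dual basis \<open>(\<phi> x)\<^bsub>x \<in> B\<^esub>\<close>, extended by \<open>0\<close> to the other root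
  spaces. Only the restrictions of the functionals \<open>\<phi> x\<close> to the subalgebra generated by the
  \<open>f\<^sub>i\<close> matter below.
\<close>

definition root_dual_bases ::
    "('r::finite \<Rightarrow> complex^'d \<Rightarrow> complex) \<Rightarrow> ('g::complex_vector \<Rightarrow> 'g \<Rightarrow> 'g) \<Rightarrow>
      (complex^'d \<Rightarrow> 'g) \<Rightarrow> ('r \<Rightarrow> 'g) \<Rightarrow> ('r \<Rightarrow> nat) \<Rightarrow> 'g set \<Rightarrow> ('g \<Rightarrow> 'g \<Rightarrow> complex) \<Rightarrow> bool" where
  "root_dual_bases \<alpha> brk hh f k B \<phi> \<longleftrightarrow>
     finite B \<and> complex_vector.independent B \<and> complex_vector.span B = root_space \<alpha> brk hh f k \<and>
     (\<forall>x\<in>B. clinear (\<phi> x) \<and> (\<forall>y\<in>B. \<phi> x y = (if x = y then 1 else 0)) \<and>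
        (\<forall>k'. k' \<noteq> k \<longrightarrow> (\<forall>y\<in>root_space \<alpha> brk hh f k'. \<phi> x y = 0)))"

section \<open>Operators on the tensor product of Verma modules\<close>

text \<open>\<open>x\<^sup>(\<^sup>i\<^sup>)\<close>, the action of \<open>x\<close> on the \<open>i\<close>-th factor, and the standard action on the tensor product.\<close>

definition factor_act ::
    "('n \<Rightarrow> 'g \<Rightarrow> 'v::complex_vector \<Rightarrow> 'v) \<Rightarrow> 'n \<Rightarrow> 'g \<Rightarrow> ('n, 'v) mtensor \<Rightarrow> ('n, 'v) mtensor"
  where "factor_act act i x = mtensor_lift (\<lambda>y. mtens (y(i := act i x (y i))))"

definition total_act ::
    "('n::finite \<Rightarrow> 'g \<Rightarrow> 'v::complex_vector \<Rightarrow> 'v) \<Rightarrow> 'g \<Rightarrow> ('n, 'v) mtensor \<Rightarrow> ('n, 'v) mtensor"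
  where "total_act act x w = (\<Sum>i\<in>UNIV. factor_act act i x w)"

definition weight_space ::
    "('r::finite \<Rightarrow> complex^'d \<Rightarrow> complex) \<Rightarrow> (complex^'d \<Rightarrow> 'g) \<Rightarrow> ('n::finite \<Rightarrow> complex^'d \<Rightarrow> complex) \<Rightarrow>
      ('n \<Rightarrow> 'g \<Rightarrow> 'v::complex_vector \<Rightarrow> 'v) \<Rightarrow> ('r \<Rightarrow> nat) \<Rightarrow> ('n, 'v) mtensor set" where
  "weight_space \<alpha> hh \<Lambda> act mm =
     {w. \<forall>h. total_act act (hh h) w = ((\<Sum>j\<in>UNIV. \<Lambda> j h) - wt \<alpha> mm h) *\<^sub>C w}"

text \<open>The action \<open>a \<cdot> (d \<otimes> y) = [a, d] \<otimes> y + d \<otimes> a y\<close>.\<close>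

definition ad_act ::
    "('g::complex_vector \<Rightarrow> 'g \<Rightarrow> 'g) \<Rightarrow> ('g \<Rightarrow> 'v::complex_vector \<Rightarrow> 'v) \<Rightarrow> 'g \<Rightarrow>
      ('g, 'v) tensor \<Rightarrow> ('g, 'v) tensor"
  where "ad_act brk act a = tensor_lift (\<lambda>d y. brk a d \<otimes> y + d \<otimes> act a y)"

text \<open>
  The map \<open>\<nu>\<^sub>-\<close> takes its values in the subspace spanned by the \<open>d \<otimes> y\<close> with \<open>d\<close> in the subalgebra
  generated by the \<open>f\<^sub>i\<close>; over a field this is the tensor product of that subalgebra with the module.
\<close>

definition is_nu_minus ::
    "(complex^'d \<Rightarrow> complex^'d \<Rightarrow> complex) \<Rightarrow> ('r \<Rightarrow> complex^'d \<Rightarrow> complex) \<Rightarrow>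
      ('g::complex_vector \<Rightarrow> 'g \<Rightarrow> 'g) \<Rightarrow> (complex^'d \<Rightarrow> 'g) \<Rightarrow> ('r \<Rightarrow> 'g) \<Rightarrow>
      ('g \<Rightarrow> 'v::complex_vector \<Rightarrow> 'v) \<Rightarrow> 'v \<Rightarrow> ('v \<Rightarrow> ('g, 'v) tensor) \<Rightarrow> bool" where
  "is_nu_minus form \<alpha> brk hh f act v \<nu> \<longleftrightarrow> clinear \<nu> \<and> \<nu> v = 0 \<and>
     (\<forall>i x. \<nu> (act (f i) x) = f i \<otimes> act (hh (dual_vec form (\<alpha> i))) x + ad_act brk act (f i) (\<nu> x))"

definition nu_total ::
    "('n::finite \<Rightarrow> 'v::complex_vector \<Rightarrow> ('g::complex_vector, 'v) tensor) \<Rightarrow>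
      ('n, 'v) mtensor \<Rightarrow> ('g, ('n, 'v) mtensor) tensor" where
  "nu_total \<nu> w =
     (\<Sum>k\<in>UNIV. mtensor_lift (\<lambda>y. tensor_lift (\<lambda>d x. d \<otimes> mtens (y(k := x))) (\<nu> k (y k))) w)"

definition contract ::
    "('g::complex_vector \<Rightarrow> complex) \<Rightarrow> ('g, 'v::complex_vector) tensor \<Rightarrow> 'v"
  where "contract \<phi> = tensor_lift (\<lambda>d y. \<phi> d *\<^sub>C y)"

definition Delta_plus ::
    "('n::finite \<Rightarrow> 'g::complex_vector \<Rightarrow> 'v::complex_vector \<Rightarrow> 'v) \<Rightarrow> ('n \<Rightarrow> 'v \<Rightarrow> ('g, 'v) tensor) \<Rightarrow>
      'g set \<Rightarrow> ('g \<Rightarrow> 'g \<Rightarrow> complex) \<Rightarrow> ('n, 'v) mtensor \<Rightarrow> ('n, 'v) mtensor" where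
  "Delta_plus act \<nu> B \<phi> w = (\<Sum>x\<in>B. total_act act x (contract (\<phi> x) (nu_total \<nu> w)))"

text \<open>
  The derivative of a function with values in a finite dimensional subspace of a complex vector
  space (which carries no topology here).
\<close>

definition has_cderivative ::
    "(complex \<Rightarrow> 'w::complex_vector) \<Rightarrow> 'w \<Rightarrow> complex \<Rightarrow> bool" where
  "has_cderivative F D s0 \<longleftrightarrow> (\<exists>(N::nat) w g g'.
     (\<forall>\<^sub>F s in nhds s0. F s = (\<Sum>i<N. g i s *\<^sub>C w i)) \<and>
     (\<forall>i<N. (g i has_field_derivative g' i) (at s0)) \<and>
     D = (\<Sum>i<N. g' i *\<^sub>C w i))"

section \<open>Differential forms and twisted cycles\<close>

text \<open>
  A point \<open>t\<close> of \<open>\<complex>\<^sup>m\<close>, and likewise a tangent vector, is a function of which only the values at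
  \<open>0, \<dots>, m - 1\<close> matter. A form of degree \<open>p\<close> is evaluated at a point and at \<open>p\<close> tangent vectors.
\<close>

type_synonym point = "nat \<Rightarrow> complex"
type_synonym one_form = "point \<Rightarrow> point \<Rightarrow> complex"
type_synonym diff_form = "point \<Rightarrow> (nat \<Rightarrow> point) \<Rightarrow> complex"

definition wedge :: "one_form list \<Rightarrow> diff_form" where
  "wedge \<theta>s t V = (\<Sum>\<pi> | \<pi> permutes {..<length \<theta>s}.
     of_int (sign \<pi>) * (\<Prod>a<length \<theta>s. (\<theta>s ! a) t (V (\<pi> a))))"

text \<open>The functions \<open>t\<^sub>k - t\<^sub>l\<close>, \<open>t\<^sub>k - z\<^sub>j\<close>, \<open>z\<^sub>i - z\<^sub>j\<close>, and the differentials of the first two at fixed \<open>z\<close>.\<close>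

datatype 'n diff_fun = TT nat nat | TZ nat 'n | ZZ 'n 'n

primrec dval :: "complex^'n \<Rightarrow> 'n diff_fun \<Rightarrow> point \<Rightarrow> complex" where
  "dval z (TT k l) t = t k - t l"
| "dval z (TZ k j) t = t k - z $ j"
| "dval z (ZZ i j) t = z $ i - z $ j"

primrec ddiff :: "'n diff_fun \<Rightarrow> point \<Rightarrow> complex" where
  "ddiff (TT k l) w = w k - w l"
| "ddiff (TZ k j) w = w k"
| "ddiff (ZZ i j) w = 0"

definition dlog :: "complex^'n \<Rightarrow> 'n diff_fun \<Rightarrow> one_form" where
  "dlog z H t w = ddiff H w / dval z H t"

text \<open>Cells are parametrised by the cube \<open>[0,1]\<^sup>m\<close> or by its interior.\<close>

definition cube :: "nat \<Rightarrow> (nat \<Rightarrow> real) set" where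
  "cube m = {..<m} \<rightarrow>\<^sub>E {0..1}"

definition open_cube :: "nat \<Rightarrow> (nat \<Rightarrow> real) set" where
  "open_cube m = {..<m} \<rightarrow>\<^sub>E {0<..<1}"

definition partial :: "nat \<Rightarrow> ((nat \<Rightarrow> real) \<Rightarrow> complex) \<Rightarrow> (nat \<Rightarrow> real) \<Rightarrow> complex" where
  "partial l F s = vector_derivative (\<lambda>x. F (s(l := x))) (at (s l) within {0..1})"

primrec C_k :: "nat \<Rightarrow> (nat \<Rightarrow> real) set \<Rightarrow> nat \<Rightarrow> ((nat \<Rightarrow> real) \<Rightarrow> complex) \<Rightarrow> bool" where
  "C_k m S 0 F \<longleftrightarrow> continuous_on S F"
| "C_k m S (Suc r) F \<longleftrightarrow> continuous_on S F \<and>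
     (\<forall>l<m. (\<forall>s\<in>S. (\<lambda>x. F (s(l := x))) differentiable (at (s l) within {0..1})) \<and>
            C_k m S r (partial l F))"

text \<open>
  A cell of a twisted chain: a complex coefficient, a map to \<open>\<complex>\<^sup>m\<close>, and logarithms of the functions
  above along the cell; these determine a branch of \<open>\<Phi>\<^sub>\<mu>\<^bsup>1/\<kappa>\<^esup>\<close> for every \<open>\<mu>\<close>.
  A chain is a family of cells; non-compact chains may consist of infinitely many cells.
\<close>

record 'n cell =
  coef :: complex
  pos :: "(nat \<Rightarrow> real) \<Rightarrow> point"
  logb :: "'n diff_fun \<Rightarrow> (nat \<Rightarrow> real) \<Rightarrow> complex"

record 'n chain =
  chain_index :: "nat set"
  chain_cell :: "nat \<Rightarrow> 'n cell"

text \<open>The face \<open>s\<^sub>l = \<epsilon>\<close> of the cube.\<close>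

definition face :: "nat \<Rightarrow> nat \<Rightarrow> nat \<Rightarrow> (nat \<Rightarrow> real) \<Rightarrow> nat \<Rightarrow> real" where
  "face m l \<epsilon> s = (\<lambda>i\<in>{..<m}. if i < l then s i else if i = l then real \<epsilon> else s (i - 1))"

definition degenerate :: "nat \<Rightarrow> ((nat \<Rightarrow> real) \<Rightarrow> point) \<Rightarrow> bool" where
  "degenerate m \<tau> \<longleftrightarrow> (\<exists>l<m - 1. \<forall>s\<in>cube (m - 1). \<forall>x\<in>{0..1}. \<forall>k<m. \<tau> (s(l := x)) k = \<tau> s k)"

definition pullback :: "nat \<Rightarrow> 'n cell \<Rightarrow> diff_form \<Rightarrow> (nat \<Rightarrow> real) \<Rightarrow> complex" where
  "pullback m C \<omega> s = \<omega> (pos C s) (\<lambda>l k. if k < m then partial l (\<lambda>s. pos C s k) s else 0)"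

locale master_function =
  fixes form :: "complex^'d \<Rightarrow> complex^'d \<Rightarrow> complex"
    and \<alpha> :: "'r::{finite,linorder} \<Rightarrow> complex^'d \<Rightarrow> complex"
    and \<Lambda> :: "'n::{finite,linorder} \<Rightarrow> complex^'d \<Rightarrow> complex"
    and \<kappa> :: complex
    and m :: nat
    and c :: "nat \<Rightarrow> 'r"
begin

definition t_functions :: "'n diff_fun set" where
  "t_functions = {TT k l |k l. k < m \<and> l < m \<and> k \<noteq> l} \<union> {TZ k j |k j. k < m}"

definition log_functions :: "'n diff_fun set" where
  "log_functions = {TT k l |k l. k < l \<and> l < m} \<union> {TZ k j |k j. k < m} \<union> {ZZ i j |i j. i < j}"

definition complement :: "(complex, 'n) vec \<Rightarrow> point set" where
  "complement z = {t. \<forall>H\<in>t_functions. dval z H t \<noteq> 0}"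

text \<open>\<open>log \<Phi>\<^sub>\<mu>\<close> at \<open>t\<close>, for a choice \<open>L\<close> of logarithms of the factors.\<close>

definition log_Phi :: "(complex, 'n) vec \<Rightarrow> complex^'d \<Rightarrow> point \<Rightarrow> ('n diff_fun \<Rightarrow> complex) \<Rightarrow> complex" where
  "log_Phi z \<mu> t L =
     - (\<Sum>k<m. \<alpha> (c k) \<mu> * t k) + (\<Sum>j\<in>UNIV. \<Lambda> j \<mu> * z $ j)
     + (\<Sum>(i, j) | i < j. dual_form form (\<Lambda> i) (\<Lambda> j) * L (ZZ i j))
     - (\<Sum>k<m. \<Sum>j\<in>UNIV. dual_form form (\<alpha> (c k)) (\<Lambda> j) * L (TZ k j))
     + (\<Sum>(k, l) | k < l \<and> l < m. dual_form form (\<alpha> (c k)) (\<alpha> (c l)) * L (TT k l))"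

definition dlog_Phi :: "(complex, 'n) vec \<Rightarrow> complex^'d \<Rightarrow> one_form" where
  "dlog_Phi z \<mu> t w =
     - (\<Sum>k<m. \<alpha> (c k) \<mu> * w k)
     - (\<Sum>k<m. \<Sum>j\<in>UNIV. dual_form form (\<alpha> (c k)) (\<Lambda> j) * dlog z (TZ k j) t w)
     + (\<Sum>(k, l) | k < l \<and> l < m. dual_form form (\<alpha> (c k)) (\<alpha> (c l)) * dlog z (TT k l) t w)"

text \<open>\<open>\<Phi>\<^sub>\<mu>\<^bsup>1/\<kappa>\<^esup>\<close> along a cell, and its derivative in \<open>\<mu>\<close> in the direction \<open>\<mu>'\<close>.\<close>

definition branch :: "(complex, 'n) vec \<Rightarrow> complex^'d \<Rightarrow> 'n cell \<Rightarrow> (nat \<Rightarrow> real) \<Rightarrow> complex" where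
  "branch z \<mu> C s = exp (log_Phi z \<mu> (pos C s) (\<lambda>H. logb C H s) / \<kappa>)"

definition branch_deriv ::
    "(complex, 'n) vec \<Rightarrow> complex^'d \<Rightarrow> complex^'d \<Rightarrow> 'n cell \<Rightarrow> (nat \<Rightarrow> real) \<Rightarrow> complex" where
  "branch_deriv z \<mu> \<mu>' C s = deriv (\<lambda>a. branch z (\<mu> + a *s \<mu>') C s) 0"

abbreviation cube_measure :: "(nat \<Rightarrow> real) measure" where
  "cube_measure \<equiv> Pi\<^sub>M {..<m} (\<lambda>_. lborel)"

text \<open>The integral over a chain of \<open>\<Psi> \<omega>\<close>, where \<open>\<Psi>\<close> is a function given along each cell.\<close>

definition cell_integral :: "'n cell \<Rightarrow> ('n cell \<Rightarrow> (nat \<Rightarrow> real) \<Rightarrow> complex) \<Rightarrow> diff_form \<Rightarrow> complex" where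
  "cell_integral C \<Psi> \<omega> = coef C * (LINT s:open_cube m|cube_measure. \<Psi> C s * pullback m C \<omega> s)"

definition chain_converges ::
    "'n chain \<Rightarrow> ('n cell \<Rightarrow> (nat \<Rightarrow> real) \<Rightarrow> complex) \<Rightarrow> diff_form \<Rightarrow> bool" where
  "chain_converges \<Gamma> \<Psi> \<omega> \<longleftrightarrow>
     (\<forall>a\<in>chain_index \<Gamma>. set_integrable cube_measure (open_cube m)
        (\<lambda>s. \<Psi> (chain_cell \<Gamma> a) s * pullback m (chain_cell \<Gamma> a) \<omega> s)) \<and>
     (\<lambda>a. cell_integral (chain_cell \<Gamma> a) \<Psi> \<omega>) summable_on chain_index \<Gamma>"

definition chain_integral ::
    "'n chain \<Rightarrow> ('n cell \<Rightarrow> (nat \<Rightarrow> real) \<Rightarrow> complex) \<Rightarrow> diff_form \<Rightarrow> complex" where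
  "chain_integral \<Gamma> \<Psi> \<omega> = infsum (\<lambda>a. cell_integral (chain_cell \<Gamma> a) \<Psi> \<omega>) (chain_index \<Gamma>)"

definition twisted_cell :: "nat \<Rightarrow> (nat \<Rightarrow> real) set \<Rightarrow> (complex, 'n) vec \<Rightarrow> 'n cell \<Rightarrow> bool" where
  "twisted_cell r S z C \<longleftrightarrow>
     (\<forall>k<m. C_k m S r (\<lambda>s. pos C s k)) \<and> pos C ` S \<subseteq> complement z \<and>
     (\<forall>H\<in>log_functions. continuous_on S (logb C H) \<and>
        (\<forall>s\<in>S. exp (logb C H s) = dval z H (pos C s)))"

text \<open>
  The boundary of a twisted chain vanishes in the group of twisted cubical chains, where degenerate
  cubes are set to zero: for every nondegenerate \<open>(m - 1)\<close>-cube \<open>\<tau>\<close>, the branches (with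
  coefficients and signs) on the faces equal to \<open>\<tau>\<close> add up to zero.
\<close>

definition boundary_zero :: "(complex, 'n) vec \<Rightarrow> complex^'d \<Rightarrow> 'n chain \<Rightarrow> bool" where
  "boundary_zero z \<mu> \<Gamma> \<longleftrightarrow> (\<forall>\<tau>. \<not> degenerate m \<tau> \<longrightarrow> (\<forall>s\<in>cube (m - 1).
     (\<Sum>(a, l, \<epsilon>) | a \<in> chain_index \<Gamma> \<and> l < m \<and> \<epsilon> < 2 \<and>
          (\<forall>s'\<in>cube (m - 1). \<forall>k<m. pos (chain_cell \<Gamma> a) (face m l \<epsilon> s') k = \<tau> s' k).
        (-1) ^ (l + \<epsilon>) * coef (chain_cell \<Gamma> a) * branch z \<mu> (chain_cell \<Gamma> a) (face m l \<epsilon> s)) = 0))"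

definition compact_cycle :: "(complex, 'n) vec \<Rightarrow> complex^'d \<Rightarrow> 'n chain \<Rightarrow> bool" where
  "compact_cycle z \<mu> \<Gamma> \<longleftrightarrow> finite (chain_index \<Gamma>) \<and>
     (\<forall>a\<in>chain_index \<Gamma>. twisted_cell 2 (cube m) z (chain_cell \<Gamma> a)) \<and> boundary_zero z \<mu> \<Gamma>"

text \<open>
  Non-compact cycles: since a product \<open>\<eta>\<close> of logarithmic differentials is closed,
  \<open>d\<^sub>t(\<Phi>\<^sub>\<mu>\<^bsup>1/\<kappa>\<^esup> \<eta>) = \<Phi>\<^sub>\<mu>\<^bsup>1/\<kappa>\<^esup> (\<kappa>\<^sup>-\<^sup>1 d log \<Phi>\<^sub>\<mu>) \<and> \<eta>\<close>.
\<close>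

definition noncompact_cycle :: "(complex, 'n) vec \<Rightarrow> complex^'d \<Rightarrow> 'n chain \<Rightarrow> bool" where
  "noncompact_cycle z \<mu> \<Gamma> \<longleftrightarrow>
     (\<forall>a\<in>chain_index \<Gamma>. twisted_cell 1 (open_cube m) z (chain_cell \<Gamma> a)) \<and>
     (\<forall>Hs. length Hs = m \<and> set Hs \<subseteq> t_functions \<longrightarrow>
        chain_converges \<Gamma> (branch z \<mu>) (wedge (map (dlog z) Hs))) \<and>
     (\<forall>Hs. Suc (length Hs) = m \<and> set Hs \<subseteq> t_functions \<longrightarrow>
        (let d\<eta> = wedge ((\<lambda>t w. dlog_Phi z \<mu> t w / \<kappa>) # map (dlog z) Hs)
         in chain_converges \<Gamma> (branch z \<mu>) d\<eta> \<and> chain_integral \<Gamma> (branch z \<mu>) d\<eta> = 0))"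

text \<open>
  Locally in the parameters \<open>(z, \<mu>)\<close>, the cells do not depend on \<open>\<mu>\<close> and move continuously with \<open>z\<close>,
  the branches being continued along.
\<close>

definition locally_constant ::
    "(nat \<Rightarrow> real) set \<Rightarrow> ((complex, 'n) vec \<times> (complex, 'd) vec) set \<Rightarrow>
      ((complex, 'n) vec \<Rightarrow> complex^'d \<Rightarrow> 'n chain) \<Rightarrow> bool" where
  "locally_constant S D \<gamma> \<longleftrightarrow> (\<forall>p\<in>D. \<exists>U A co ps lb. open U \<and> p \<in> U \<and> U \<subseteq> D \<and>
     (\<forall>(z, \<mu>)\<in>U. chain_index (\<gamma> z \<mu>) = A \<and>
        (\<forall>a\<in>A. chain_cell (\<gamma> z \<mu>) a = \<lparr>coef = co a, pos = ps a z, logb = lb a z\<rparr>)) \<and>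
     (\<forall>a\<in>A. (\<forall>k<m. continuous_on (fst ` U \<times> S) (\<lambda>(z, s). ps a z s k)) \<and>
        (\<forall>H\<in>log_functions. continuous_on (fst ` U \<times> S) (\<lambda>(z, s). lb a z H s))))"

definition derivative_under_integral ::
    "((complex, 'n) vec \<times> (complex, 'd) vec) set \<Rightarrow> ((complex, 'n) vec \<Rightarrow> complex^'d \<Rightarrow> 'n chain) \<Rightarrow> bool" where
  "derivative_under_integral D \<gamma> \<longleftrightarrow> (\<forall>(z, \<mu>)\<in>D. \<forall>\<mu>' Hs. length Hs = m \<and> set Hs \<subseteq> t_functions \<longrightarrow>
     (let \<omega> = wedge (map (dlog z) Hs)
      in chain_converges (\<gamma> z \<mu>) (branch_deriv z \<mu> \<mu>') \<omega> \<and>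
         ((\<lambda>a. chain_integral (\<gamma> z (\<mu> + a *s \<mu>')) (branch z (\<mu> + a *s \<mu>')) \<omega>)
            has_field_derivative chain_integral (\<gamma> z \<mu>) (branch_deriv z \<mu> \<mu>') \<omega>) (at 0)))"

text \<open>
  For compact cycles, the possibility to differentiate under the integral sign is a consequence of
  local constancy.
\<close>

definition horizontal_family ::
    "((complex, 'n) vec \<times> (complex, 'd) vec) set \<Rightarrow> ((complex, 'n) vec \<Rightarrow> complex^'d \<Rightarrow> 'n chain) \<Rightarrow> bool" where
  "horizontal_family D \<gamma> \<longleftrightarrow> open D \<and> (\<forall>(z, \<mu>)\<in>D. \<forall>i j. i \<noteq> j \<longrightarrow> z $ i \<noteq> z $ j) \<and>
     ((\<forall>(z, \<mu>)\<in>D. compact_cycle z \<mu> (\<gamma> z \<mu>)) \<and> locally_constant (cube m) D \<gamma> \<or>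
      (\<forall>(z, \<mu>)\<in>D. noncompact_cycle z \<mu> (\<gamma> z \<mu>)) \<and> locally_constant (open_cube m) D \<gamma> \<and>
        derivative_under_integral D \<gamma>)"

text \<open>
  Sequences \<open>I\<close> are families of lists. Positions in the lists, and the arguments and values of
  permutations, are counted from \<open>0\<close>.
\<close>

definition offset :: "('n \<Rightarrow> 'r list) \<Rightarrow> 'n \<Rightarrow> nat" where
  "offset I j = (\<Sum>j'\<in>{..<j}. length (I j'))"

definition Sigma_perms :: "('n \<Rightarrow> 'r list) \<Rightarrow> (nat \<Rightarrow> nat) set" where
  "Sigma_perms I = {\<sigma>. \<sigma> permutes {..<m} \<and>
     (\<forall>j. \<forall>l<length (I j). c (\<sigma> (offset I j + l)) = I j ! l)}"

fun omega_functions :: "nat list \<Rightarrow> 'n \<Rightarrow> 'n diff_fun list" where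
  "omega_functions [] j = []"
| "omega_functions [a] j = [TZ a j]"
| "omega_functions (a # b # as) j = TT a b # omega_functions (b # as) j"

definition omega :: "(complex, 'n) vec \<Rightarrow> ('n \<Rightarrow> 'r list) \<Rightarrow> (nat \<Rightarrow> nat) \<Rightarrow> diff_form" where
  "omega z I \<sigma> = wedge (map (dlog z) (concat (map
     (\<lambda>j. omega_functions (map \<sigma> [offset I j..<offset I j + length (I j)]) j)
     (sorted_list_of_set UNIV))))"

definition hyp_coeff ::
    "((complex, 'n) vec \<Rightarrow> complex^'d \<Rightarrow> 'n chain) \<Rightarrow> (complex, 'n) vec \<Rightarrow> complex^'d \<Rightarrow> ('n \<Rightarrow> 'r list) \<Rightarrow> complex" where
  "hyp_coeff \<gamma> z \<mu> I = chain_integral (\<gamma> z \<mu>) (branch z \<mu>)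
     (\<lambda>t V. \<Sum>\<sigma>\<in>Sigma_perms I. of_int (sign \<sigma>) * omega z I \<sigma> t V)"

end

definition sequences :: "('r \<Rightarrow> nat) \<Rightarrow> ('n::finite \<Rightarrow> 'r list) set" where
  "sequences mm = {I. \<forall>i. (\<Sum>j\<in>UNIV. count_list (I j) i) = mm i}"

definition f_vector ::
    "('r \<Rightarrow> 'g) \<Rightarrow> ('n \<Rightarrow> 'g \<Rightarrow> 'v::complex_vector \<Rightarrow> 'v) \<Rightarrow> ('n \<Rightarrow> 'v) \<Rightarrow> ('n \<Rightarrow> 'r list) \<Rightarrow> ('n, 'v) mtensor"
  where "f_vector f act v I = mtens (\<lambda>j. foldr (\<lambda>i. act j (f i)) (I j) (v j))"

text \<open>The nondecreasing function \<open>c\<close> on \<open>{0, \<dots>, m - 1}\<close> taking each value \<open>i\<close> exactly \<open>m\<^sub>i\<close> times.\<close>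

definition is_coloring :: "('r::{finite,linorder} \<Rightarrow> nat) \<Rightarrow> (nat \<Rightarrow> 'r) \<Rightarrow> bool" where
  "is_coloring mm c \<longleftrightarrow> mono_on {..<sum mm UNIV} c \<and> (\<forall>i. card {k. k < sum mm UNIV \<and> c k = i} = mm i)"

end

theory Submission
  imports Defs "HOL-Combinatorics.Multiset_Permutations"
begin

text \<open>
  Write \<open>F\<^sub>J v\<close> for the vector \<open>f\<^sub>I v\<close> with the letters of \<open>I\<close> distinguished, so that \<open>J\<close> runs over the
  arrangements of the variables \<open>t\<^sub>0, \<dots>, t\<^bsub>m-1\<^esub>\<close> into \<open>n\<close> lists. The integrand becomes
  \<open>\<Phi> \<Sum>\<^sub>J \<rho>\<^sub>J F\<^sub>J v dt\<close>, where \<open>\<rho>\<^sub>J\<close> is a product of factors \<open>1 / (t\<^sub>k - t\<^sub>l)\<close> and \<open>1 / (t\<^sub>k - z\<^sub>j)\<close>, one for each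
  letter and its successor. Differentiation in the direction \<open>\<mu>'\<close> multiplies the integrand by
  \<open>\<kappa>\<^sup>-\<^sup>1 (\<Sum>\<^sub>j \<langle>\<Lambda>\<^sub>j, \<mu>'\<rangle> z\<^sub>j - \<Sum>\<^sub>k \<langle>\<alpha>\<^bsub>c(k)\<^esub>, \<mu>'\<rangle> t\<^sub>k)\<close>. Writing \<open>t\<^sub>k - z\<^sub>j\<close> as the sum of the differences along the rest of the
  list of \<open>k\<close>, every summand cancels one factor of \<open>\<rho>\<^sub>J\<close> and cuts off an initial segment of a list, with
  set of letters \<open>S\<close> say. The result is
  \<open>\<Sum>\<^sub>j z\<^sub>j (\<mu>')\<^sup>(\<^sup>j\<^sup>) u - \<Sum>\<^sub>S \<langle>\<alpha>\<^sub>S, \<mu>'\<rangle> \<integral> \<Phi> T\<^sub>S dt\<close> with \<open>\<alpha>\<^sub>S\<close> the sum of the \<open>\<alpha>\<^bsub>c(k)\<^esub>\<close>, \<open>k \<in> S\<close>.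

  Stokes' theorem for \<open>d log \<Phi>\<close> wedged with the logarithmic forms belonging to \<open>T\<^sub>S\<close> gives
  \<open>-\<langle>\<alpha>\<^sub>S, \<mu>\<rangle> \<integral> \<Phi> T\<^sub>S dt = \<integral> \<Phi> N\<^sub>S T\<^sub>S dt\<close>, where \<open>N\<^sub>S\<close> collects the poles of \<open>d log \<Phi>\<close> between the letters in \<open>S\<close>
  and the other letters and the \<open>z\<^sub>j\<close>. Finally \<open>N\<^sub>S T\<^sub>S = \<Sum>\<^sub>J \<rho>\<^sub>J \<Delta>\<^sub>S F\<^sub>J v\<close> holds pointwise, where \<open>\<Delta>\<^sub>S\<close> is the part of
  \<open>\<Sum>\<^sub>\<alpha> \<Delta>\<^bsub>+,\<alpha>\<^esub>\<close> that extracts the letters in \<open>S\<close>: this is a shuffle identity for the \<open>\<rho>\<^sub>J\<close>, combined with the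
  expansion of an iterated commutator acting on a tensor product.
\<close>

section \<open>Shuffles and iterated commutators\<close>

text \<open>Why Stokes' theorem yields \<langle>\<alpha>_S, \<mu>\<rangle>: cutting off a segment
  with letters S removes the one factor that ties S to the other variables, so the m - 1 differences
  that are left do not change when all t_k with k in S are translated together. Wedging their d
  log's with d log \<Phi> reads off only the derivative of log \<Phi> along this translation.

  Distinguishing the letters makes the subwords extracted by \<open>\<nu>\<close> correspond to
  subsets, so that analysis and algebra can be matched set by set, without multiplicities.

  Two obstacles shape the rest. Stokes' relation has to be divided by \<langle>\<alpha>_S,
  \<mu>\<rangle>, whereas \<langle>\<alpha>, \<mu>\<rangle> \<noteq> 0 is assumed only for the roots
  \<alpha> whose \<Delta> is nonzero on the weight space; the remaining \<mu> are reached as limits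
  along the line in direction \<mu>'. And the tensor product carries no topology, so vector-valued
  integrals and limits are tested against linear functionals, which separate vectors.\<close>

lemma shuffles_eq_filter:
  assumes "set xs \<inter> set ys = {}"
  shows "shuffles xs ys = {w. filter (\<lambda>x. x \<in> set xs) w = xs \<and> filter (\<lambda>x. x \<notin> set xs) w = ys}"
proof (intro set_eqI iffI)
  fix w assume "w \<in> shuffles xs ys"
  then show "w \<in> {w. filter (\<lambda>x. x \<in> set xs) w = xs \<and> filter (\<lambda>x. x \<notin> set xs) w = ys}"
    using filter_shuffles_disjoint1[OF assms] by auto
next
  fix w assume "w \<in> {w. filter (\<lambda>x. x \<in> set xs) w = xs \<and> filter (\<lambda>x. x \<notin> set xs) w = ys}"
  then show "w \<in> shuffles xs ys"
    using partition_in_shuffles[of w "\<lambda>x. x \<in> set xs"] by (auto simp: comp_def)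
qed

lemma rev_shuffles:
  assumes "set xs \<inter> set ys = {}"
  shows "rev ` shuffles xs ys = shuffles (rev xs) (rev ys)"
proof -
  have 1: "rev ` shuffles xs ys \<subseteq> shuffles (rev xs) (rev ys)"
    if "set xs \<inter> set ys = {}" for xs ys :: "'a list"
    using that by (auto simp: shuffles_eq_filter rev_filter[symmetric])
  have "rev ` rev ` shuffles (rev xs) (rev ys) \<subseteq> rev ` shuffles xs ys"
    using 1[of "rev xs" "rev ys"] assms by auto
  with 1[OF assms] show ?thesis by (simp add: image_image)
qed

text \<open>
  \<open>rho t (k\<^sub>1 \<dots> k\<^sub>s) x\<close> is the coefficient \<open>1 / ((t\<^bsub>k\<^sub>1\<^esub> - t\<^bsub>k\<^sub>2\<^esub>) \<cdots> (t\<^bsub>k\<^sub>s\<^esub> - x))\<close> of \<open>\<omega>\<^bsub>k\<^sub>1,\<dots>,k\<^sub>s\<^esub>(x)\<close>; \<open>rho0\<close> lacks the last factor.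
\<close>

fun rho_rev :: "point \<Rightarrow> complex \<Rightarrow> nat list \<Rightarrow> complex" where
  "rho_rev t x [] = 1"
| "rho_rev t x (k # w) = rho_rev t (t k) w / (t k - x)"

definition rho :: "point \<Rightarrow> nat list \<Rightarrow> complex \<Rightarrow> complex" where
  "rho t w x = rho_rev t x (rev w)"

definition rho0 :: "point \<Rightarrow> nat list \<Rightarrow> complex" where
  "rho0 t w = rho t (butlast w) (t (last w))"

text \<open>Partial fractions: the letter next to \<open>x\<close> is the first of one of the two
  words, and 1/((b - a)(a - x)) + 1/((a - b)(b - x)) = 1/((a - x)(b - x)) merges the two cases.
  Reversed words are used because \<open>shuffles\<close> recurses at the front, while these
  products recurse from the end next to \<open>x\<close>.\<close>

lemma rho_rev_shuffles:
  assumes "distinct xs" "distinct ys" "set xs \<inter> set ys = {}" "inj_on t (set xs \<union> set ys)"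
    "x \<notin> t ` (set xs \<union> set ys)"
  shows "(\<Sum>w\<in>shuffles xs ys. rho_rev t x w) = rho_rev t x xs * rho_rev t x ys"
  using assms
proof (induction xs ys arbitrary: x rule: shuffles.induct)
  case (3 a xs b ys)
  have ne: "t a \<noteq> t b" "t a \<noteq> x" "t b \<noteq> x"
    using 3(3-7) by (auto simp: inj_on_def)
  have 1: "(\<Sum>w\<in>shuffles xs (b # ys). rho_rev t (t a) w) = rho_rev t (t a) xs * rho_rev t (t a) (b # ys)"
    using 3(3-7) by (intro 3(1)) (auto simp: inj_on_def)
  have 2: "(\<Sum>w\<in>shuffles (a # xs) ys. rho_rev t (t b) w) = rho_rev t (t b) (a # xs) * rho_rev t (t b) ys"
    using 3(3-7) by (intro 3(2)) (auto simp: inj_on_def)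
  have "(\<Sum>w\<in>shuffles (a # xs) (b # ys). rho_rev t x w) =
      (\<Sum>w\<in>(#) a ` shuffles xs (b # ys). rho_rev t x w) + (\<Sum>w\<in>(#) b ` shuffles (a # xs) ys. rho_rev t x w)"
    unfolding shuffles.simps using 3(5) by (intro sum.union_disjoint) auto
  also have "\<dots> = rho_rev t (t a) xs * rho_rev t (t a) (b # ys) / (t a - x) +
      rho_rev t (t b) (a # xs) * rho_rev t (t b) ys / (t b - x)"
    by (simp add: sum.reindex 1[symmetric] 2[symmetric] del: rho_rev.simps) (simp add: sum_divide_distrib)
  also have "\<dots> = rho_rev t (t a) xs * rho_rev t (t b) ys *
      (1 / ((t b - t a) * (t a - x)) + 1 / ((t a - t b) * (t b - x)))"
    by (simp add: ring_distribs)
  also have "1 / ((t b - t a) * (t a - x)) + 1 / ((t a - t b) * (t b - x)) = 1 / ((t a - x) * (t b - x))"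
    using ne by (simp add: divide_simps) (simp add: algebra_simps)
  finally show ?case by simp
qed auto

text \<open>The weight is modelled on the coefficient with which \<open>\<nu>\<close> extracts the
  word ending in \<open>k\<close> (reversed here): \<open>b\<close> stands for a pairing with
  \<Lambda>_j, \<open>a l\<close> for one with the root of \<open>l\<close>. Summing over shuffles
  turns it into simple poles at t_k. If a letter \<open>l\<close> of \<open>y\<close> comes first,
  it lowers the weight by \<open>a l\<close>, and the unweighted identity converts this into the new
  pole a_l/(t_k - t_l); if \<open>k\<close> comes first, the weight is just
  \<open>b\<close>.\<close>

lemma rho_rev_shuffles_weighted:
  fixes a :: "nat \<Rightarrow> complex"
  assumes "distinct (k # p)" "distinct y" "set (k # p) \<inter> set y = {}" "inj_on t (set (k # p) \<union> set y)"
    "x \<notin> t ` (set (k # p) \<union> set y)"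
  shows "(\<Sum>w\<in>shuffles (k # p) y. rho_rev t x w * (b - (\<Sum>l\<leftarrow>takeWhile (\<lambda>i. i \<notin> set (k # p)) w. a l))) =
    rho_rev t (t k) p * rho_rev t x y * (b / (t k - x) - (\<Sum>l\<leftarrow>y. a l / (t k - t l)))"
  using assms
proof (induction y arbitrary: x)
  case (Cons l y)
  let ?s = "\<lambda>w. b - (\<Sum>l\<leftarrow>takeWhile (\<lambda>i. i \<notin> set (k # p)) w. a l)"
  let ?A = "\<Sum>l\<leftarrow>y. a l / (t k - t l)"
  have l: "l \<notin> set (k # p)" using Cons(4) by auto
  have ne: "t k \<noteq> t l" "t k \<noteq> x" "t l \<noteq> x"
    using Cons(2-6) by (auto simp: inj_on_def)
  have IH: "(\<Sum>w\<in>shuffles (k # p) y. rho_rev t (t l) w * ?s w) =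
    rho_rev t (t k) p * rho_rev t (t l) y * (b / (t k - t l) - ?A)"
    using Cons(2-6) by (intro Cons(1)) (auto simp: inj_on_def)
  have 1: "(\<Sum>w\<in>shuffles p (l # y). rho_rev t (t k) w) = rho_rev t (t k) p * rho_rev t (t k) (l # y)"
    using Cons(2-6) by (intro rho_rev_shuffles) (auto simp: inj_on_def)
  have 2: "(\<Sum>w\<in>shuffles (k # p) y. rho_rev t (t l) w) = rho_rev t (t l) (k # p) * rho_rev t (t l) y"
    using Cons(2-6) by (intro rho_rev_shuffles) (auto simp: inj_on_def)
  have "(\<Sum>w\<in>shuffles (k # p) (l # y). rho_rev t x w * ?s w) =
      (\<Sum>w\<in>(#) k ` shuffles p (l # y). rho_rev t x w * ?s w) +
      (\<Sum>w\<in>(#) l ` shuffles (k # p) y. rho_rev t x w * ?s w)"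
    unfolding shuffles.simps using l by (intro sum.union_disjoint) auto
  also have "(\<Sum>w\<in>(#) k ` shuffles p (l # y). rho_rev t x w * ?s w) =
      rho_rev t (t k) p * rho_rev t (t k) (l # y) * b / (t k - x)"
    by (simp add: sum.reindex 1[symmetric] del: rho_rev.simps(2) shuffles.simps)
      (simp add: sum_divide_distrib sum_distrib_right)
  also have "(\<Sum>w\<in>(#) l ` shuffles (k # p) y. rho_rev t x w * ?s w) =
      (\<Sum>w\<in>shuffles (k # p) y. (rho_rev t (t l) w * ?s w - a l * rho_rev t (t l) w) / (t l - x))"
    using l by (simp add: sum.reindex algebra_simps diff_divide_distrib add_divide_distrib)
  also have "\<dots> = (rho_rev t (t k) p * rho_rev t (t l) y * (b / (t k - t l) - ?A)
      - a l * (rho_rev t (t l) (k # p) * rho_rev t (t l) y)) / (t l - x)"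
    unfolding sum_divide_distrib[symmetric] sum_subtractf IH sum_distrib_left[symmetric] 2 ..
  also have "rho_rev t (t k) p * rho_rev t (t k) (l # y) * b / (t k - x) + \<dots> =
      rho_rev t (t k) p * rho_rev t (t l) y *
      (b * (1 / ((t l - t k) * (t k - x)) + 1 / ((t k - t l) * (t l - x))) - (?A + a l / (t k - t l)) / (t l - x))"
    by (simp add: ring_distribs diff_divide_distrib add_divide_distrib)
  also have "1 / ((t l - t k) * (t k - x)) + 1 / ((t k - t l) * (t l - x)) = 1 / ((t k - x) * (t l - x))"
    using ne by (simp add: divide_simps) (simp add: algebra_simps)
  finally show ?case by (simp add: diff_divide_distrib algebra_simps add_divide_distrib)
qed simp

lemma rho_Nil [simp]: "rho t [] x = 1"
  and rho_snoc [simp]: "rho t (w @ [k]) x = rho t w (t k) / (t k - x)"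
  by (simp_all add: rho_def)

lemma rho_singleton [simp]: "rho t [k] x = 1 / (t k - x)"
  by (simp add: rho_def)

lemma rho0_snoc [simp]: "rho0 t (w @ [k]) = rho t w (t k)"
  by (simp add: rho0_def)

lemma rho_append: "v \<noteq> [] \<Longrightarrow> rho t (w @ v) x = rho t w (t (hd v)) * rho t v x"
proof (induction v arbitrary: x rule: rev_induct)
  case (snoc k v)
  then show ?case by (cases "v = []") (auto simp flip: append_assoc)
qed auto

lemma rho0_append: "v \<noteq> [] \<Longrightarrow> rho0 t (w @ v) = rho t w (t (hd v)) * rho0 t v"
proof (cases v rule: rev_cases)
  case (snoc u k)
  then show ?thesis by (cases "u = []") (auto simp: rho_append rho0_def simp flip: append_assoc)
qed auto

lemma sum_rev_shuffles:
  assumes "set xs \<inter> set ys = {}"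
  shows "(\<Sum>w\<in>shuffles xs ys. G (rev w)) = (\<Sum>w\<in>shuffles (rev xs) (rev ys). G w)"
  unfolding rev_shuffles[OF assms, symmetric] by (simp add: sum.reindex)

lemma rho_shuffles:
  assumes "distinct xs" "distinct ys" "set xs \<inter> set ys = {}" "inj_on t (set xs \<union> set ys)"
    "x \<notin> t ` (set xs \<union> set ys)"
  shows "(\<Sum>w\<in>shuffles xs ys. rho t w x) = rho t xs x * rho t ys x"
  unfolding rho_def sum_rev_shuffles[OF assms(3)] using assms by (intro rho_rev_shuffles) auto

text \<open>To the right of the last letter of \<open>S\<close> stands the vector on which the
  Cartan element of that letter acts when \<open>\<nu>\<close> extracts \<open>S\<close>. The
  letters are listed backwards; only sums over them are taken.\<close>

definition letters_after :: "nat set \<Rightarrow> nat list \<Rightarrow> nat list" where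
  "letters_after S w = takeWhile (\<lambda>l. l \<notin> S) (rev w)"

lemma rho_shuffles_weighted:
  fixes a :: "nat \<Rightarrow> complex"
  assumes "distinct p" "p \<noteq> []" "distinct y" "set p \<inter> set y = {}" "inj_on t (set p \<union> set y)"
    "x \<notin> t ` (set p \<union> set y)"
  shows "(\<Sum>w\<in>shuffles p y. rho t w x * (b - (\<Sum>l\<leftarrow>letters_after (set p) w. a l))) =
    rho0 t p * rho t y x * (b / (t (last p) - x) - (\<Sum>l\<in>set y. a l / (t (last p) - t l)))"
proof -
  obtain p' k where p: "p = p' @ [k]" using assms(2) by (metis rev_exhaust)
  have "(\<Sum>w\<in>shuffles p y. rho t w x * (b - (\<Sum>l\<leftarrow>letters_after (set p) w. a l))) =
    (\<Sum>w\<in>shuffles (rev p) (rev y). rho_rev t x w * (b - (\<Sum>l\<leftarrow>takeWhile (\<lambda>i. i \<notin> set (rev p)) w. a l)))"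
    unfolding rho_def letters_after_def set_rev by (rule sum_rev_shuffles[OF assms(4)])
  also have "\<dots> = rho_rev t (t k) (rev p') * rho_rev t x (rev y) *
      (b / (t k - x) - (\<Sum>l\<leftarrow>rev y. a l / (t k - t l)))"
    unfolding p rev.simps rev_append append.simps using assms[unfolded p]
    by (intro rho_rev_shuffles_weighted) auto
  also have "(\<Sum>l\<leftarrow>rev y. a l / (t k - t l)) = (\<Sum>l\<in>set y. a l / (t k - t l))"
    using assms(3) by (simp add: sum_list_distinct_conv_sum_set rev_map[symmetric])
  finally show ?thesis by (simp add: p) (simp add: rho_def)
qed

text \<open>Reversing a word flips every difference of neighbours, whence one sign per
  factor.\<close>

lemma rho0_Cons_rev: "rho0 t (k # rev w) = (- 1) ^ length w * rho t w (t k)"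
proof (induction w arbitrary: k rule: rev_induct)
  case (snoc l w)
  have "rho0 t (k # rev (w @ [l])) = rho t [k] (t l) * rho0 t (l # rev w)"
    using rho0_append[of "l # rev w" t "[k]"] by simp
  also have "rho t [k] (t l) = - 1 / (t l - t k)"
    by (simp add: minus_divide_right)
  finally show ?case using snoc[of l] by simp
qed (simp add: rho0_def)

lemma rho0_split: "rho0 t (u @ k # rev v) = (- 1) ^ length v * (rho t u (t k) * rho t v (t k))"
  by (simp add: rho0_append rho0_Cons_rev)

text \<open>A word with a marked set \<open>S\<close> of letters is the same as a shuffle of its
  restrictions to \<open>S\<close> and to the complement.\<close>

lemma sum_permutations_subsets:
  assumes "finite T"
  shows "(\<Sum>w\<in>permutations_of_set T. \<Sum>S\<in>Pow T. H w S) =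
    (\<Sum>S\<in>Pow T. \<Sum>p\<in>permutations_of_set S. \<Sum>y\<in>permutations_of_set (T - S). \<Sum>w\<in>shuffles p y. H w S)"
proof -
  have "(\<Sum>w\<in>permutations_of_set T. H w S) =
      (\<Sum>p\<in>permutations_of_set S. \<Sum>y\<in>permutations_of_set (T - S). \<Sum>w\<in>shuffles p y. H w S)"
    if S: "S \<in> Pow T" for S
  proof -
    have fin: "finite S" "finite (T - S)" using assms S finite_subset by auto
    have "(\<Sum>p\<in>permutations_of_set S. \<Sum>y\<in>permutations_of_set (T - S). \<Sum>w\<in>shuffles p y. H w S) =
      (\<Sum>(p, y, w)\<in>(SIGMA p:permutations_of_set S. SIGMA y:permutations_of_set (T - S). shuffles p y). H w S)"
      using fin by (simp add: sum.Sigma)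
    also have "\<dots> = (\<Sum>w\<in>permutations_of_set T. H w S)"
    proof (rule sum.reindex_bij_witness[where j = "\<lambda>(p, y, w). w"
          and i = "\<lambda>w. (filter (\<lambda>x. x \<in> S) w, filter (\<lambda>x. x \<notin> S) w, w)"], goal_cases)
      case (1 a)
      then show ?case by (auto simp: permutations_of_set_def shuffles_eq_filter)
    next
      case (2 a)
      then obtain p y w where a: "a = (p, y, w)" "set p = S" "distinct p" "set y = T - S" "distinct y" "w \<in> shuffles p y"
        by (auto simp: permutations_of_set_def)
      then show ?case
        using set_shuffles[of w p y] distinct_disjoint_shuffles[of p y w] S
        by (auto simp: permutations_of_set_def)
    next
      case (3 w)
      then show ?case by auto
    next
      case (4 w)
      then have "set w = T" "distinct w" by (auto simp: permutations_of_set_def)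
      then show ?case using S partition_in_shuffles[of w "\<lambda>x. x \<in> S"]
        by (auto simp: permutations_of_set_def comp_def)
    qed auto
    finally show ?thesis by simp
  qed
  then show ?thesis
    by (subst sum.swap) (rule sum.cong, auto)
qed

lemma sum_Pow_insert:
  assumes "finite T" "i \<notin> T"
  shows "(\<Sum>A\<in>Pow (insert i T). g A) = (\<Sum>A\<in>Pow T. g A + g (insert i A))"
proof -
  have "(\<Sum>A\<in>Pow (insert i T). g A) = (\<Sum>A\<in>Pow T. g A) + (\<Sum>A\<in>insert i ` Pow T. g A)"
    unfolding Pow_insert using assms by (intro sum.union_disjoint) auto
  also have "(\<Sum>A\<in>insert i ` Pow T. g A) = (\<Sum>A\<in>Pow T. g (insert i A))"
    using assms by (subst sum.reindex) (auto simp: inj_on_def)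
  finally show ?thesis by (simp add: sum.distrib)
qed

section \<open>Iterated commutators\<close>

fun ad_word :: "('i \<Rightarrow> 'v \<Rightarrow> 'v::ab_group_add) \<Rightarrow> 'i list \<Rightarrow> 'v \<Rightarrow> 'v" where
  "ad_word F [] y = 0"
| "ad_word F [k] y = F k y"
| "ad_word F (i # j # w) y = F i (ad_word F (j # w) y) - ad_word F (j # w) (F i y)"

lemma clinear_sum: "clinear f \<Longrightarrow> f (sum g A) = (\<Sum>a\<in>A. f (g a))"
  by (auto simp: linear_iff_module_hom module_hom.sum)

text \<open>In a right-nested commutator every letter before the innermost \<open>k\<close>
  multiplies either from the left or, with a minus sign, from the right; those multiplying from the
  right accumulate in reverse order. \<open>A\<close> is the set of letters on the left.\<close>

lemma ad_word_expand:
  fixes F :: "'i \<Rightarrow> 'v \<Rightarrow> 'v::complex_vector"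
  assumes "\<And>i. clinear (F i)" "distinct w"
  shows "ad_word F (w @ [k]) y = (\<Sum>A\<in>Pow (set w). (- 1) ^ length (filter (\<lambda>x. x \<notin> A) w) *\<^sub>C
    foldr F (filter (\<lambda>x. x \<in> A) w @ k # rev (filter (\<lambda>x. x \<notin> A) w)) y)"
  using assms(2)
proof (induction w arbitrary: y)
  case (Cons i w)
  let ?s = "\<lambda>A w. (- 1) ^ length (filter (\<lambda>x. x \<notin> A) w) :: complex"
  let ?W = "\<lambda>A w. foldr F (filter (\<lambda>x. x \<in> A) w @ k # rev (filter (\<lambda>x. x \<notin> A) w))"
  have f: "filter (\<lambda>x. x = i \<or> x \<in> A) w = filter (\<lambda>x. x \<in> A) w"
    "filter (\<lambda>x. x \<noteq> i \<and> x \<notin> A) w = filter (\<lambda>x. x \<notin> A) w" for A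
    using Cons(2) by (auto intro!: filter_cong)
  have "ad_word F ((i # w) @ [k]) y = F i (ad_word F (w @ [k]) y) - ad_word F (w @ [k]) (F i y)"
    by (cases w) auto
  also have "\<dots> = (\<Sum>A\<in>Pow (set w). ?s A w *\<^sub>C F i (?W A w y)) - (\<Sum>A\<in>Pow (set w). ?s A w *\<^sub>C ?W A w (F i y))"
    using Cons by (simp add: clinear_sum[OF assms(1)] clinear_scale[OF assms(1)])
  also have "\<dots> = (\<Sum>A\<in>Pow (set w). ?s A (i # w) *\<^sub>C ?W A (i # w) y + ?s (insert i A) (i # w) *\<^sub>C ?W (insert i A) (i # w) y)"
    using Cons(2) unfolding sum_subtractf[symmetric] by (intro sum.cong HOL.refl) (auto simp: f)
  also have "\<dots> = (\<Sum>A\<in>Pow (set (i # w)). ?s A (i # w) *\<^sub>C ?W A (i # w) y)"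
    using Cons(2) by (subst list.set, subst sum_Pow_insert) auto
  finally show ?case .
qed (simp add: scaleC_one)

text \<open>Every word containing \<open>k\<close> once has the form p, k, reversed y'. By
  \<open>ad_word_expand\<close> it arises from all shuffles of p and y', with exactly the sign that
  reversing y' costs in \<open>rho0\<close>, and the shuffle identity adds up their coefficients. So
  commutators turn into plain words with coefficients \<open>rho0\<close>, which is the form in
  which cutting off initial segments produces them.\<close>

lemma sum_rho0_ad_word:
  fixes F :: "nat \<Rightarrow> 'v \<Rightarrow> 'v::complex_vector"
  assumes F: "\<And>i. clinear (F i)" and T: "finite T" "k \<notin> T" "inj_on t (insert k T)"
  shows "(\<Sum>w\<in>permutations_of_set T. rho t w (t k) *\<^sub>C ad_word F (w @ [k]) y) =
    (\<Sum>w\<in>permutations_of_set (insert k T). rho0 t w *\<^sub>C foldr F w y)"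
proof -
  let ?s = "\<lambda>A w. (- 1) ^ length (filter (\<lambda>x. x \<notin> A) w) :: complex"
  let ?W = "\<lambda>A w. foldr F (filter (\<lambda>x. x \<in> A) w @ k # rev (filter (\<lambda>x. x \<notin> A) w)) y"
  let ?H = "\<lambda>p y'. rho0 t (p @ k # rev y') *\<^sub>C foldr F (p @ k # rev y') y"
  have "(\<Sum>w\<in>permutations_of_set T. rho t w (t k) *\<^sub>C ad_word F (w @ [k]) y) =
     (\<Sum>w\<in>permutations_of_set T. \<Sum>A\<in>Pow T. (rho t w (t k) * ?s A w) *\<^sub>C ?W A w)"
    by (rule sum.cong[OF HOL.refl]) (auto simp: permutations_of_set_def ad_word_expand[OF F]
      complex_vector.scale_sum_right scaleC_scaleC)
  also have "\<dots> = (\<Sum>A\<in>Pow T. \<Sum>p\<in>permutations_of_set A. \<Sum>y'\<in>permutations_of_set (T - A).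
      \<Sum>w\<in>shuffles p y'. (rho t w (t k) * ?s A w) *\<^sub>C ?W A w)"
    by (rule sum_permutations_subsets[OF T(1)])
  also have "\<dots> = (\<Sum>A\<in>Pow T. \<Sum>p\<in>permutations_of_set A. \<Sum>y'\<in>permutations_of_set (T - A). ?H p y')"
  proof (intro sum.cong HOL.refl)
    fix A p y' assume A: "A \<in> Pow T" and p: "p \<in> permutations_of_set A" and y': "y' \<in> permutations_of_set (T - A)"
    have disj: "set p \<inter> set y' = {}" "set p \<union> set y' = T" "set p = A" "distinct p" "distinct y'"
      using A p y' by (auto simp: permutations_of_set_def)
    have "(\<Sum>w\<in>shuffles p y'. (rho t w (t k) * ?s A w) *\<^sub>C ?W A w) =
      (\<Sum>w\<in>shuffles p y'. (rho t w (t k) * (- 1) ^ length y') *\<^sub>C foldr F (p @ k # rev y') y)"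
      using disj(3) by (intro sum.cong HOL.refl) (auto simp: shuffles_eq_filter[OF disj(1)])
    also have "\<dots> = ?H p y'"
      unfolding complex_vector.scale_sum_left[symmetric] sum_distrib_right[symmetric]
      using T disj by (subst rho_shuffles) (auto simp: rho0_split inj_on_def)
    finally show "(\<Sum>w\<in>shuffles p y'. (rho t w (t k) * ?s A w) *\<^sub>C ?W A w) = ?H p y'" .
  qed
  also have "\<dots> = (\<Sum>(A, p, y')\<in>(SIGMA A:Pow T. SIGMA p:permutations_of_set A. permutations_of_set (T - A)). ?H p y')"
    using T(1) by (subst sum.Sigma, force, simp, subst sum.Sigma) (auto intro: finite_subset)
  also have "\<dots> = (\<Sum>w\<in>permutations_of_set (insert k T). rho0 t w *\<^sub>C foldr F w y)"
  proof (rule sum.reindex_bij_witness[where j = "\<lambda>(A, p, y'). p @ k # rev y'"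
        and i = "\<lambda>w. (set (takeWhile (\<lambda>x. x \<noteq> k) w), takeWhile (\<lambda>x. x \<noteq> k) w, rev (tl (dropWhile (\<lambda>x. x \<noteq> k) w)))"], goal_cases)
    case (1 a)
    then obtain A p y' where a: "a = (A, p, y')" "A \<subseteq> T" "set p = A" "set y' = T - A" "distinct p" "distinct y'"
      by (auto simp: permutations_of_set_def)
    then have "takeWhile (\<lambda>x. x \<noteq> k) (p @ k # rev y') = p" "dropWhile (\<lambda>x. x \<noteq> k) (p @ k # rev y') = k # rev y'"
      using T(2) by (auto simp: takeWhile_append dropWhile_append)
    with a show ?case by simp
  next
    case (2 a)
    then show ?case using T(2) by (auto simp: permutations_of_set_def)
  next
    case (3 w)
    then have "k \<in> set w" by (auto simp: permutations_of_set_def)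
    then obtain u v where "w = u @ k # v" "k \<notin> set u" by (meson split_list_first)
    then show ?case by (simp add: takeWhile_append dropWhile_append)
  next
    case (4 w)
    then have w: "k \<in> set w" "set w = insert k T" "distinct w" by (auto simp: permutations_of_set_def)
    then obtain u v where uv: "w = u @ k # v" "k \<notin> set u" by (meson split_list_first)
    then have "takeWhile (\<lambda>x. x \<noteq> k) w = u" "dropWhile (\<lambda>x. x \<noteq> k) w = k # v"
      by (auto simp: takeWhile_append dropWhile_append)
    then show ?case using w uv T(2) by (auto simp: permutations_of_set_def)
  qed auto
  finally show ?thesis .
qed

section \<open>Verma modules and the operators \<open>\<Delta>\<^bsub>+,\<alpha>\<^esub>\<close>\<close>

lemma clinear_compose: "clinear f \<Longrightarrow> clinear g \<Longrightarrow> clinear (\<lambda>x. f (g x))"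
  by (rule clinearI) (simp_all add: clinear_add clinear_scale)

lemma clinear_plus: "clinear f \<Longrightarrow> clinear g \<Longrightarrow> clinear (\<lambda>x. f x + g x)"
  by (rule clinearI) (simp_all add: clinear_add clinear_scale scaleC_add_right algebra_simps)

lemma clinear_sumI: "(\<And>i. i \<in> A \<Longrightarrow> clinear (f i)) \<Longrightarrow> clinear (\<lambda>x. \<Sum>i\<in>A. f i x)"
  by (rule clinearI) (simp_all add: clinear_add clinear_scale complex_vector.scale_sum_right sum.distrib)

lemma cbilinearI: "(\<And>x. clinear (F x)) \<Longrightarrow> (\<And>y. clinear (\<lambda>x. F x y)) \<Longrightarrow> cbilinear F"
  by (simp add: cbilinear_def)

lemma clinear_tens: "clinear (\<lambda>x. x \<otimes> y)" "clinear (\<lambda>y. x \<otimes> y)"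
  by (rule clinearI, simp_all add: tens_add_left tens_add_right tens_scale_left tens_scale_right)+

lemma tensor_eqI:
  assumes "clinear G" "clinear H" "\<And>x y. G (x \<otimes> y) = H (x \<otimes> y)"
  shows "G t = H t"
proof -
  have "cbilinear (\<lambda>x y. G (x \<otimes> y))"
    by (intro cbilinearI clinear_compose[OF assms(1)] clinear_tens)
  from tensor_lift_ex1[OF this] have "G = H" using assms by metis
  then show ?thesis by simp
qed

lemma clinear_mtens: "clinear (\<lambda>x. mtens (y(k := x)))"
  by (rule clinearI) (simp_all add: mtens_add mtens_scale)

lemma mtensor_in_span: "w \<in> complex_vector.span (range mtens)"
proof (rule mtensor.abs_induct)
  fix p :: "('a \<Rightarrow> 'b) \<Rightarrow>\<^sub>0 complex"
  have lin: "clinear abs_mtensor"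
    by (rule clinearI) (simp_all add: plus_mtensor.abs_eq scaleC_mtensor.abs_eq)
  have "abs_mtensor p = abs_mtensor (\<Sum>x\<in>Poly_Mapping.keys p. Poly_Mapping.lookup p x *\<^sub>C pure x)"
    by (rule arg_cong[OF pure_decompose])
  also have "\<dots> = (\<Sum>x\<in>Poly_Mapping.keys p. Poly_Mapping.lookup p x *\<^sub>C mtens x)"
    by (simp add: clinear_sum[OF lin] clinear_scale[OF lin] mtens.abs_eq)
  also have "\<dots> \<in> complex_vector.span (range mtens)"
    by (intro complex_vector.span_sum complex_vector.span_scale complex_vector.span_base) auto
  finally show "abs_mtensor p \<in> complex_vector.span (range mtens)" .
qed

text \<open>The factors are enlarged from \<open>P j\<close> to its span one at a time; in the
  induction \<open>A\<close> is the set of factors already enlarged.\<close>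

lemma mtens_in_span:
  fixes y :: "'n::finite \<Rightarrow> 'v::complex_vector"
  assumes "\<And>j. y j \<in> complex_vector.span (P j)"
  shows "mtens y \<in> complex_vector.span (mtens ` {y. \<forall>j. y j \<in> P j})" (is "_ \<in> complex_vector.span ?X")
proof -
  have "mtens y \<in> complex_vector.span ?X"
    if "finite A" "\<forall>j\<in>A. y j \<in> complex_vector.span (P j)" "\<forall>j\<in>-A. y j \<in> P j" for A y
    using that
  proof (induction A arbitrary: y rule: finite_induct)
    case empty
    then show ?case by (auto intro: complex_vector.span_base)
  next
    case (insert k A)
    have "y k \<in> complex_vector.span (P k)" using insert by auto
    then have "mtens (y(k := y k)) \<in> complex_vector.span ?X"
    proof (induction rule: complex_vector.span_induct)
      case base
      show ?case
      proof (rule complex_vector.subspaceI; unfold mem_Collect_eq)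
        show "mtens (y(k := 0)) \<in> complex_vector.span ?X"
          unfolding clinear_zero[OF clinear_mtens] by (rule complex_vector.span_zero)
      qed (unfold mtens_add mtens_scale, (rule complex_vector.span_add complex_vector.span_scale; assumption)+)
    next
      case (step x)
      then show ?case using insert by (intro insert.IH) auto
    qed
    then show ?case by simp
  qed
  from this[of UNIV] show ?thesis using assms by auto
qed

lemma functional_add: "functional \<beta> \<Longrightarrow> \<beta> (h + h') = \<beta> h + \<beta> h'"
  and functional_scale: "functional \<beta> \<Longrightarrow> \<beta> (a *s h) = a * \<beta> h"
  by (auto simp: linear_iff_module_hom module_hom.add module_hom.scale)

lemma functional_sum: "functional \<beta> \<Longrightarrow> \<beta> (sum h A) = (\<Sum>a\<in>A. \<beta> (h a))"
  by (auto simp: linear_iff_module_hom module_hom.sum)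

lemma functional_eq_sum:
  fixes \<beta> :: "complex^'d \<Rightarrow> complex"
  assumes "functional \<beta>"
  shows "\<beta> h = (\<Sum>i\<in>UNIV. h $ i * \<beta> (axis i 1))"
proof -
  have "h = (\<Sum>i\<in>UNIV. h $ i *s axis i 1)" by (rule basis_expansion[symmetric])
  from arg_cong[OF this, of \<beta>] show ?thesis
    by (simp add: functional_sum[OF assms] functional_scale[OF assms])
qed

text \<open>\<open>dual_vec\<close> is a definite description, so existence and uniqueness are
  required. In coordinates h \<mapsto> (h, -) becomes an endomorphism \<open>T\<close> of
  \<open>complex^'d\<close>; nondegeneracy makes it injective, and equality of dimensions makes it
  onto.\<close>

lemma form_dual_vec:
  assumes "cartan_datum form \<alpha>" "functional \<beta>"
  shows "form (dual_vec form \<beta>) = \<beta>"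
proof -
  have lin: "functional (form h)" and sym: "form h h' = form h' h"
    and nondeg: "(\<And>h'. form h h' = 0) \<Longrightarrow> h = 0" for h h'
    using assms(1) by (auto simp: cartan_datum_def)
  define T where "T h = (\<chi> i. form h (axis i 1))" for h
  have T: "Vector_Spaces.linear (*s) (*s) T"
  proof unfold_locales
    show "T (x + y) = T x + T y" for x y
      unfolding T_def by (simp add: vec_eq_iff, subst (1 2 3) sym) (simp add: functional_add[OF lin])
    show "T (a *s x) = a *s T x" for a x
      unfolding T_def by (simp add: vec_eq_iff, subst (1 2) sym) (simp add: functional_scale[OF lin])
  qed
  have T_eq: "T h = (\<chi> i. \<gamma> (axis i 1)) \<longleftrightarrow> form h = \<gamma>" if "functional \<gamma>" for h \<gamma>
  proof
    assume T: "T h = (\<chi> i. \<gamma> (axis i 1))"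
    show "form h = \<gamma>"
    proof
      fix x
      have "form h (axis i 1) = \<gamma> (axis i 1)" for i
        using arg_cong[OF T, of "\<lambda>x. x $ i"] by (simp add: T_def)
      then show "form h x = \<gamma> x"
        by (subst functional_eq_sum[OF lin], subst functional_eq_sum[OF that]) simp
    qed
  qed (simp add: T_def)
  have inj: "inj T"
  proof (rule injI)
    fix h h' assume "T h = T h'"
    then have "form h = form h'" using T_eq[OF lin, of h h'] by (simp add: T_def)
    then have eq: "form x h = form x h'" for x using sym by metis
    have "form (h - h') x = 0" for x
    proof -
      have "form x (h - h' + h') = form x (h - h') + form x h'" by (rule functional_add[OF lin])
      then have "form x (h - h') = 0" using eq[of x] by simp
      with sym[of x "h - h'"] show ?thesis by (rule HOL.trans[OF HOL.sym])
    qed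
    then show "h = h'" using nondeg[of "h - h'"] by simp
  qed
  then have "surj T" using T by (rule vec.linear_inj_imp_surj[rotated])
  then obtain h where h: "T h = (\<chi> i. \<beta> (axis i 1))" by (metis surjD)
  with T_eq[OF assms(2)] have fh: "form h = \<beta>" by simp
  have "\<exists>!h. form h = \<beta>"
  proof (rule ex1I)
    show "form h = \<beta>" by (fact fh)
    fix h' assume "form h' = \<beta>"
    then have "T h' = (\<chi> i. \<beta> (axis i 1))" using T_eq[OF assms(2), of h'] by blast
    with h have "T h' = T h" by simp
    with inj show "h' = h" by (simp add: inj_def)
  qed
  then show ?thesis unfolding dual_vec_def by (rule theI')
qed

lemma dual_form_eq:
  assumes "cartan_datum form \<alpha>" "functional \<beta>" "functional \<gamma>"
  shows "dual_form form \<beta> \<gamma> = \<gamma> (dual_vec form \<beta>)" "dual_form form \<beta> \<gamma> = dual_form form \<gamma> \<beta>"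
proof -
  have sym: "form h h' = form h' h" for h h' using assms(1) by (simp add: cartan_datum_def)
  show "dual_form form \<beta> \<gamma> = \<gamma> (dual_vec form \<beta>)" "dual_form form \<beta> \<gamma> = dual_form form \<gamma> \<beta>"
    unfolding dual_form_def
    by (metis sym form_dual_vec[OF assms(1,3)], rule sym)
qed

section \<open>Word vectors, iterated brackets and their weights\<close>

locale kz_data =
  fixes form :: "complex^'d \<Rightarrow> complex^'d \<Rightarrow> complex"
    and \<alpha> :: "'r::{finite,linorder} \<Rightarrow> complex^'d \<Rightarrow> complex"
    and brk :: "'g::complex_vector \<Rightarrow> 'g \<Rightarrow> 'g"
    and hh :: "complex^'d \<Rightarrow> 'g" and e f :: "'r \<Rightarrow> 'g"
    and \<Lambda> :: "'n::{finite,linorder} \<Rightarrow> complex^'d \<Rightarrow> complex"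
    and act :: "'n \<Rightarrow> 'g \<Rightarrow> 'v::complex_vector \<Rightarrow> 'v" and v :: "'n \<Rightarrow> 'v"
    and \<nu> :: "'n \<Rightarrow> 'v \<Rightarrow> ('g, 'v) tensor"
  assumes cartan: "cartan_datum form \<alpha>"
    and km: "kac_moody form \<alpha> brk hh e f"
    and fun_Lambda: "\<And>j. functional (\<Lambda> j)"
    and vermas: "\<And>j. verma brk hh e (\<Lambda> j) (act j) (v j)"
    and nu_minus: "\<And>j. is_nu_minus form \<alpha> brk hh f (act j) (v j) (\<nu> j)"
begin

lemma fun_alpha: "functional (\<alpha> i)"
  using cartan by (simp add: cartan_datum_def)

lemma brk_bilinear: "cbilinear brk" and jacobi: "brk x (brk y z) + brk y (brk z x) + brk z (brk x y) = 0"
  and brk_self: "brk x x = 0"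
  using km by (auto simp: kac_moody_def lie_presented_def lie_algebra_def)

lemma brk_linear: "clinear (brk x)" "clinear (\<lambda>x. brk x y)"
  using brk_bilinear by (auto simp: cbilinear_def)

lemma brk_skew: "brk x y = - brk y x"
proof -
  have "brk (x + y) (x + y) = brk x y + brk y x"
    using clinear_add[OF brk_linear(1), of "x + y" x y] clinear_add[OF brk_linear(2), of x y x]
      clinear_add[OF brk_linear(2), of x y y] by (simp add: brk_self add.commute)
  then show ?thesis unfolding brk_self by (metis eq_neg_iff_add_eq_0)
qed

lemma km_rel: "(s, t) \<in> km_relations form \<alpha> \<Longrightarrow> lie_eval brk (case_km_gen hh e f) s = lie_eval brk (case_km_gen hh e f) t"
  using km unfolding kac_moody_def lie_presented_def by (blast intro: lie_eq.rel)

lemma brk_h_f: "brk (hh h) (f i) = (- \<alpha> i h) *\<^sub>C f i"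
  and brk_e_f: "brk (e i) (f k) = (if i = k then hh (dual_vec form (\<alpha> i)) else 0)"
  using km_rel[OF km_relations.h_f] km_rel[OF km_relations.e_f, of i k]
  by (simp_all split: if_splits)

lemma rep: "representation brk (act j)"
  using vermas by (simp add: verma_def mod_presented_def)

lemma act_linear: "clinear (act j x)" "clinear (\<lambda>x. act j x y)"
  using rep by (auto simp: representation_def cbilinear_def)

lemma act_brk: "act j (brk x y) w = act j x (act j y w) - act j y (act j x w)"
  using rep by (simp add: representation_def)

lemma act_swap: "act j x (act j y w) = act j y (act j x w) + act j (brk x y) w"
  by (simp add: act_brk)

lemma verma_rel: "(s, t) \<in> {(MAct (e i) MGen, MZero) |i. True} \<union> {(MAct (hh h) MGen, MScale (\<Lambda> j h) MGen) |h. True}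
  \<Longrightarrow> mod_eval (act j) (v j) s = mod_eval (act j) (v j) t"
  using vermas[of j] unfolding verma_def mod_presented_def by (blast intro: mod_eq.rel)

lemma act_e_v: "act j (e i) (v j) = 0" and act_h_v: "act j (hh h) (v j) = \<Lambda> j h *\<^sub>C v j"
  using verma_rel[of "MAct (e i) MGen" MZero j] verma_rel[of "MAct (hh h) MGen" "MScale (\<Lambda> j h) MGen" j]
  by auto

definition vword :: "'n \<Rightarrow> 'r list \<Rightarrow> 'v" where
  "vword j w = foldr (\<lambda>i. act j (f i)) w (v j)"

lemma vword_simps [simp]: "vword j [] = v j" "vword j (i # w) = act j (f i) (vword j w)"
  by (simp_all add: vword_def)

lemma f_vector_eq: "f_vector f act v I = mtens (\<lambda>j. vword j (I j))"
  by (simp add: f_vector_def vword_def)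

lemma act_h_vword: "act j (hh h) (vword j w) = (\<Lambda> j h - (\<Sum>i\<leftarrow>w. \<alpha> i h)) *\<^sub>C vword j w"
proof (induction w)
  case (Cons i w)
  have "act j (hh h) (vword j (i # w)) = act j (f i) (act j (hh h) (vword j w)) + act j (brk (hh h) (f i)) (vword j w)"
    unfolding vword_simps by (rule act_swap)
  also have "\<dots> = (\<Lambda> j h - (\<Sum>i\<leftarrow>w. \<alpha> i h)) *\<^sub>C vword j (i # w) + (- \<alpha> i h) *\<^sub>C vword j (i # w)"
    unfolding Cons brk_h_f clinear_scale[OF act_linear(1)] clinear_scale[OF act_linear(2)] vword_simps ..
  also have "\<dots> = (\<Lambda> j h - (\<Sum>i\<leftarrow>i # w. \<alpha> i h)) *\<^sub>C vword j (i # w)"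
    unfolding scaleC_add_left[symmetric] by (rule arg_cong[where f = "\<lambda>a. a *\<^sub>C _"]) simp
  finally show ?case .
qed (simp add: act_h_v)

text \<open>Brackets nested to the right suffice, since in the recursion for \<open>\<nu>\<close> a
  generator \<open>f i\<close> only ever brackets from the left. The value 0 on the empty word makes
  the empty subset contribute nothing to \<open>\<nu>\<close>.\<close>

fun lie_word :: "'r list \<Rightarrow> 'g" where
  "lie_word [] = 0"
| "lie_word [i] = f i"
| "lie_word (i # k # w) = brk (f i) (lie_word (k # w))"

lemma act_lie_word: "act j (lie_word w) y = ad_word (\<lambda>i. act j (f i)) w y"
proof (induction w arbitrary: y rule: lie_word.induct)
  case (3 i k w)
  show ?case unfolding lie_word.simps act_brk 3 ad_word.simps ..
qed (simp_all add: clinear_zero[OF act_linear(2)])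

lemma wt_count_list: "wt \<alpha> (count_list w) h = (\<Sum>i\<leftarrow>w. \<alpha> i h)"
proof (induction w)
  case (Cons i w)
  have "wt \<alpha> (count_list (i # w)) h = (\<Sum>k\<in>UNIV. (if k = i then \<alpha> i h else 0) + of_nat (count_list w k) * \<alpha> k h)"
    unfolding wt_def by (rule sum.cong) (simp_all add: distrib_right)
  also have "\<dots> = \<alpha> i h + wt \<alpha> (count_list w) h"
    by (simp add: sum.distrib wt_def)
  finally show ?case by (simp only: Cons list.map sum_list.Cons)
qed (simp add: wt_def)

text \<open>The root space is indexed by the multiplicities of the letters. Weights add up under the
  bracket by the Jacobi identity, solved for its first term.\<close>

lemma lie_word_root_space: "lie_word w \<in> root_space \<alpha> brk hh f (count_list w)"
proof -
  have "lie_word w \<in> n_minus brk f"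
    by (induction w rule: lie_word.induct) (simp_all add: n_minus.gen n_minus.zero n_minus.brk)
  moreover have "brk (hh h) (lie_word w) = (- wt \<alpha> (count_list w) h) *\<^sub>C lie_word w" for h
    unfolding wt_count_list
  proof (induction w rule: lie_word.induct)
    case (3 i k w)
    let ?L = "lie_word (k # w)"
    have "brk (hh h) (brk (f i) ?L) = brk (f i) (brk (hh h) ?L) - brk ?L (brk (hh h) (f i))"
    proof -
      have "brk (f i) (brk ?L (hh h)) = - brk (f i) (brk (hh h) ?L)"
        unfolding brk_skew[of ?L "hh h"] using clinear_diff[OF brk_linear(1), of "f i" 0]
        by (simp add: clinear_zero[OF brk_linear(1)])
      with jacobi[of "hh h" "f i" ?L]
      have 0: "brk (hh h) (brk (f i) ?L) + - brk (f i) (brk (hh h) ?L) + brk ?L (brk (hh h) (f i)) = 0" by simp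
      have "a = b - c" if "a + - b + c = 0" for a b c :: 'g
        using arg_cong[OF that, of "\<lambda>x. x + (b - c)"] by simp
      then show ?thesis using 0 .
    qed
    also have "\<dots> = (- (\<Sum>i\<leftarrow>k # w. \<alpha> i h)) *\<^sub>C brk (f i) ?L + (- \<alpha> i h) *\<^sub>C brk (f i) ?L"
    proof -
      have "brk (f i) (brk (hh h) ?L) = (- (\<Sum>i\<leftarrow>k # w. \<alpha> i h)) *\<^sub>C brk (f i) ?L"
        unfolding 3 by (rule clinear_scale[OF brk_linear(1)])
      moreover have "brk ?L (brk (hh h) (f i)) = \<alpha> i h *\<^sub>C brk (f i) ?L"
        unfolding brk_h_f clinear_scale[OF brk_linear(1)] unfolding brk_skew[of ?L "f i"]
        by (rule complex_vector.scale_minus_left[THEN HOL.trans]) (simp only: complex_vector.scale_minus_right minus_minus)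
      ultimately show ?thesis by (simp only: complex_vector.scale_minus_left diff_conv_add_uminus)
    qed
    also have "\<dots> = (- (\<Sum>i\<leftarrow>k # w. \<alpha> i h) + - \<alpha> i h) *\<^sub>C brk (f i) ?L"
      by (rule scaleC_add_left[symmetric])
    also have "- (\<Sum>i\<leftarrow>k # w. \<alpha> i h) + - \<alpha> i h = - (\<Sum>i\<leftarrow>i # k # w. \<alpha> i h)"
      by (simp add: algebra_simps)
    finally show ?case unfolding lie_word.simps .
  next
    case 1
    show ?case unfolding lie_word.simps clinear_zero[OF brk_linear(1)] by simp
  next
    case (2 i)
    show ?case unfolding lie_word.simps brk_h_f by simp
  qed
  ultimately show ?thesis by (simp add: root_space_def)
qed

section \<open>The action on the tensor product and its weight spaces\<close>

lemma factor_act_multilinear: "cmultilinear (\<lambda>y. mtens (y(i := act i x (y i))))"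
  unfolding cmultilinear_def
proof (intro allI)
  fix y :: "'n \<Rightarrow> 'v" and k
  show "clinear (\<lambda>z. mtens ((y(k := z))(i := act i x ((y(k := z)) i))))"
  proof (cases "k = i")
    case True
    have "clinear (\<lambda>z. mtens (y(i := act i x z)))"
      by (rule clinear_compose[OF clinear_mtens act_linear(1)])
    then show ?thesis using True by simp
  next
    case False
    then have "(y(k := z))(i := act i x ((y(k := z)) i)) = (y(i := act i x (y i)))(k := z)" for z
      by auto
    then show ?thesis by (simp add: clinear_mtens)
  qed
qed

lemma factor_act_linear: "clinear (factor_act act i x)"
  and factor_act_mtens: "factor_act act i x (mtens y) = mtens (y(i := act i x (y i)))"
  using clinear_mtensor_lift[OF factor_act_multilinear] mtensor_lift_mtens[OF factor_act_multilinear]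
  unfolding factor_act_def by blast+

lemma total_act_linear: "clinear (total_act act x)"
  unfolding total_act_def by (intro clinear_sumI factor_act_linear)

lemma total_act_mtens: "total_act act x (mtens y) = (\<Sum>i\<in>UNIV. mtens (y(i := act i x (y i))))"
  by (simp add: total_act_def factor_act_mtens)

text \<open>Linearity in the Lie algebra element; it allows the sum over a basis in the definition
  of \<Delta> to be carried out inside the action.\<close>

lemma total_act_linear_left: "clinear (\<lambda>x. total_act act x (mtens y))"
  unfolding total_act_mtens
  by (intro clinear_sumI clinear_compose[OF clinear_mtens act_linear(2)])

lemma factor_act_h_f_vector:
  "factor_act act i (hh h) (f_vector f act v I) = (\<Lambda> i h - (\<Sum>k\<leftarrow>I i. \<alpha> k h)) *\<^sub>C f_vector f act v I"
proof -
  have "factor_act act i (hh h) (f_vector f act v I) =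
      mtens ((\<lambda>j. vword j (I j))(i := (\<Lambda> i h - (\<Sum>k\<leftarrow>I i. \<alpha> k h)) *\<^sub>C vword i (I i)))"
    unfolding f_vector_eq factor_act_mtens act_h_vword ..
  also have "\<dots> = (\<Lambda> i h - (\<Sum>k\<leftarrow>I i. \<alpha> k h)) *\<^sub>C mtens ((\<lambda>j. vword j (I j))(i := vword i (I i)))"
    by (rule mtens_scale)
  also have "(\<lambda>j. vword j (I j))(i := vword i (I i)) = (\<lambda>j. vword j (I j))" by auto
  finally show ?thesis by (simp add: f_vector_eq)
qed

definition total_count :: "('n \<Rightarrow> 'r list) \<Rightarrow> 'r \<Rightarrow> nat" where
  "total_count I i = (\<Sum>j\<in>UNIV. count_list (I j) i)"

lemma sequences_eq: "sequences mm = {I. total_count I = mm}"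
  by (auto simp: sequences_def total_count_def fun_eq_iff)

lemma wt_sum: "finite A \<Longrightarrow> wt \<alpha> (\<lambda>i. \<Sum>a\<in>A. g a i) h = (\<Sum>a\<in>A. wt \<alpha> (g a) h)"
  unfolding wt_def of_nat_sum sum_distrib_right by (rule sum.swap)

lemma total_act_h_f_vector:
  "total_act act (hh h) (f_vector f act v I) =
    ((\<Sum>j\<in>UNIV. \<Lambda> j h) - wt \<alpha> (total_count I) h) *\<^sub>C f_vector f act v I"
proof -
  have "total_act act (hh h) (f_vector f act v I) =
      (\<Sum>i\<in>UNIV. \<Lambda> i h - wt \<alpha> (count_list (I i)) h) *\<^sub>C f_vector f act v I"
    unfolding total_act_def factor_act_h_f_vector complex_vector.scale_sum_left wt_count_list ..
  also have "(\<Sum>i\<in>UNIV. \<Lambda> i h - wt \<alpha> (count_list (I i)) h) = (\<Sum>j\<in>UNIV. \<Lambda> j h) - wt \<alpha> (total_count I) h"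
    unfolding sum_subtractf total_count_def[abs_def] by (simp add: wt_sum)
  finally show ?thesis .
qed

lemma f_vector_weight_space: "I \<in> sequences mm \<Longrightarrow> f_vector f act v I \<in> weight_space \<alpha> hh \<Lambda> act mm"
  by (auto simp: weight_space_def sequences_eq total_act_h_f_vector)

lemma subspace_weight_space: "complex_vector.subspace (weight_space \<alpha> hh \<Lambda> act mm)"
  by (rule complex_vector.subspaceI)
    (simp_all add: weight_space_def clinear_zero[OF total_act_linear] clinear_add[OF total_act_linear]
      clinear_scale[OF total_act_linear] scaleC_add_right scaleC_scaleC mult.commute)

text \<open>\<open>\<nu>\<^sub>-\<close> on words in the letters of \<open>w\<close>, where the letter \<open>k\<close> stands for \<open>f\<^bsub>col k\<^esub>\<close>.\<close>

definition nu_coeff :: "'n \<Rightarrow> (nat \<Rightarrow> 'r) \<Rightarrow> nat set \<Rightarrow> nat list \<Rightarrow> complex" where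
  "nu_coeff j col S w = (let k = last (filter (\<lambda>x. x \<in> S) w) in
     \<Lambda> j (dual_vec form (\<alpha> (col k))) - (\<Sum>l\<leftarrow>letters_after S w. \<alpha> (col l) (dual_vec form (\<alpha> (col k)))))"

lemma ad_act_tens: "ad_act brk (act j) a (d \<otimes> y) = brk a d \<otimes> y + d \<otimes> act j a y"
  and ad_act_linear: "clinear (ad_act brk (act j) a)"
proof -
  have "cbilinear (\<lambda>d y. brk a d \<otimes> y + d \<otimes> act j a y)"
    by (intro cbilinearI clinear_plus clinear_tens clinear_compose[OF clinear_tens(1) brk_linear(1)]
        clinear_compose[OF clinear_tens(2) act_linear(1)])
  from tensor_lift_tens[OF this] clinear_tensor_lift[OF this]
  show "ad_act brk (act j) a (d \<otimes> y) = brk a d \<otimes> y + d \<otimes> act j a y" "clinear (ad_act brk (act j) a)"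
    by (simp_all add: ad_act_def)
qed

lemma nu_props: "clinear (\<nu> j)" "\<nu> j (v j) = 0"
  "\<nu> j (act j (f i) x) = f i \<otimes> act j (hh (dual_vec form (\<alpha> i))) x + ad_act brk (act j) (f i) (\<nu> j x)"
  using nu_minus[of j] by (auto simp: is_nu_minus_def)

lemma zero_tens [simp]: "0 \<otimes> y = 0"
  by (rule clinear_zero[OF clinear_tens(1)])

text \<open>The letters are distinct, so subwords are subsets. A new first letter \<open>i\<close>
  may bracket with an extracted word (\<open>i\<close> joins \<open>S\<close>), stay in the
  remaining vector (\<open>S\<close> unchanged), or be extracted alone, the term f_i \<otimes> h_i
  x. For nonempty \<open>S\<close> the coefficient looks only at the last letter of \<open>S\<close>
  and the letters to its right, so that putting \<open>i\<close> in front does not change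
  it.\<close>

lemma nu_vword:
  assumes "distinct w"
  shows "\<nu> j (vword j (map col w)) = (\<Sum>S\<in>Pow (set w). nu_coeff j col S w *\<^sub>C
    (lie_word (map col (filter (\<lambda>x. x \<in> S) w)) \<otimes> vword j (map col (filter (\<lambda>x. x \<notin> S) w))))"
  using assms
proof (induction w)
  case Nil
  then show ?case by (simp add: nu_props)
next
  case (Cons i w)
  let ?L = "\<lambda>S w. lie_word (map col (filter (\<lambda>x. x \<in> S) w))"
  let ?W = "\<lambda>S w. vword j (map col (filter (\<lambda>x. x \<notin> S) w))"
  have iw: "i \<notin> set w" using Cons(2) by simp
  have fi: "filter (\<lambda>x. x \<in> insert i S) w = filter (\<lambda>x. x \<in> S) w"
    "filter (\<lambda>x. x \<notin> insert i S) w = filter (\<lambda>x. x \<notin> S) w" for S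
    using iw by (auto intro!: filter_cong)
  have after0: "letters_after S (i # w) = letters_after S w" if "S \<in> Pow (set w)" "S \<noteq> {}" for S
  proof -
    have "\<exists>x\<in>set (rev w). \<not> x \<notin> S" using that by auto
    then show ?thesis unfolding letters_after_def by (auto simp: takeWhile_append1)
  qed
  have after1: "letters_after (insert i S) (i # w) = letters_after S w" if "S \<in> Pow (set w)" for S
  proof -
    have eq: "takeWhile (\<lambda>l. l \<notin> insert i S) (rev w) = takeWhile (\<lambda>l. l \<notin> S) (rev w)"
      using iw by (intro takeWhile_cong) auto
    show ?thesis unfolding letters_after_def rev.simps by (subst takeWhile_tail) (simp_all add: eq[simplified])
  qed
  have ne: "filter (\<lambda>x. x \<in> S) w \<noteq> []" if "S \<in> Pow (set w)" "S \<noteq> {}" for S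
    using that by (auto simp: filter_empty_conv)
  have c0: "nu_coeff j col S (i # w) = nu_coeff j col S w" if "S \<in> Pow (set w)" "S \<noteq> {}" for S
  proof -
    have "i \<notin> S" using that iw by auto
    then show ?thesis using that by (simp add: nu_coeff_def after0)
  qed
  have c1: "nu_coeff j col (insert i S) (i # w) = nu_coeff j col S w" if "S \<in> Pow (set w)" "S \<noteq> {}" for S
    unfolding nu_coeff_def after1[OF that(1)] using fi(1)[of S] ne[OF that] by simp
  \<comment> \<open>For the singleton the coefficient is the eigenvalue of h_i on the whole word
    that follows.\<close>
  have c2: "nu_coeff j col {i} (i # w) *\<^sub>C y = act j (hh (dual_vec form (\<alpha> (col i)))) y"
    if "y = vword j (map col w)" for y
  proof -
    have la: "letters_after {i} (i # w) = rev w"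
      using after1[of "{}"] by (simp add: letters_after_def takeWhile_eq_all_conv)
    have "filter (\<lambda>x. x \<in> {i}) w = []" using fi(1)[of "{}"] by simp
    then have "last (filter (\<lambda>x. x \<in> {i}) (i # w)) = i" by simp
    then have "nu_coeff j col {i} (i # w) = \<Lambda> j (dual_vec form (\<alpha> (col i))) -
        (\<Sum>l\<leftarrow>rev w. \<alpha> (col l) (dual_vec form (\<alpha> (col i))))"
      unfolding nu_coeff_def la Let_def by simp
    also have "(\<Sum>l\<leftarrow>rev w. \<alpha> (col l) (dual_vec form (\<alpha> (col i)))) =
        (\<Sum>k\<leftarrow>map col w. \<alpha> k (dual_vec form (\<alpha> (col i))))"
      unfolding rev_map[symmetric] sum_list_rev by (simp add: comp_def)
    finally show ?thesis unfolding that act_h_vword by simp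
  qed
  let ?T = "\<lambda>S w. nu_coeff j col S w *\<^sub>C (?L S w \<otimes> ?W S w)"
  have "\<nu> j (vword j (map col (i # w))) =
      f (col i) \<otimes> act j (hh (dual_vec form (\<alpha> (col i)))) (vword j (map col w)) +
      (\<Sum>S\<in>Pow (set w). nu_coeff j col S w *\<^sub>C (brk (f (col i)) (?L S w) \<otimes> ?W S w + ?L S w \<otimes> act j (f (col i)) (?W S w)))"
    using Cons by (simp add: nu_props clinear_sum[OF ad_act_linear] clinear_scale[OF ad_act_linear] ad_act_tens)
  \<comment> \<open>The empty set has to be treated apart, since its coefficient is formed with
    \<open>last []\<close>. Its term is 0; the new term f_i \<otimes> h_i x then fills the places of
    \<open>{}\<close> and \<open>{i}\<close> together.\<close>
  also have "\<dots> = f (col i) \<otimes> act j (hh (dual_vec form (\<alpha> (col i)))) (vword j (map col w)) +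
      (\<Sum>S\<in>Pow (set w) - {{}}. nu_coeff j col S w *\<^sub>C (brk (f (col i)) (?L S w) \<otimes> ?W S w + ?L S w \<otimes> act j (f (col i)) (?W S w)))"
    by (intro arg_cong2[of _ _ _ _ "(+)"] HOL.refl sum.mono_neutral_right)
      (auto simp: clinear_zero[OF brk_linear(1)])
  also have "\<dots> = (?T {} (i # w) + ?T {i} (i # w)) + (\<Sum>S\<in>Pow (set w) - {{}}. ?T S (i # w) + ?T (insert i S) (i # w))"
  proof (rule arg_cong2[of _ _ _ _ "(+)"])
    show "f (col i) \<otimes> act j (hh (dual_vec form (\<alpha> (col i)))) (vword j (map col w)) = ?T {} (i # w) + ?T {i} (i # w)"
      using fi[of "{}"] by (simp add: tens_scale_right[symmetric] c2)
    show "(\<Sum>S\<in>Pow (set w) - {{}}. nu_coeff j col S w *\<^sub>C (brk (f (col i)) (?L S w) \<otimes> ?W S w + ?L S w \<otimes> act j (f (col i)) (?W S w)))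
      = (\<Sum>S\<in>Pow (set w) - {{}}. ?T S (i # w) + ?T (insert i S) (i # w))"
    proof (rule sum.cong[OF HOL.refl])
      fix S assume S: "S \<in> Pow (set w) - {{}}"
      then have iS: "i \<notin> S" using iw by auto
      have "?L (insert i S) (i # w) = brk (f (col i)) (?L S w)" "?W (insert i S) (i # w) = ?W S w"
        using fi[of S] ne[of S] S by (auto simp: neq_Nil_conv)
      then show "nu_coeff j col S w *\<^sub>C (brk (f (col i)) (?L S w) \<otimes> ?W S w + ?L S w \<otimes> act j (f (col i)) (?W S w))
        = ?T S (i # w) + ?T (insert i S) (i # w)"
        using S iS by (simp add: c0 c1 scaleC_add_right)
    qed
  qed
  also have "\<dots> = (\<Sum>S\<in>Pow (set w). ?T S (i # w) + ?T (insert i S) (i # w))"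
    by (subst (2) sum.remove[of _ "{}"]) auto
  also have "\<dots> = (\<Sum>S\<in>Pow (set (i # w)). ?T S (i # w))"
    using iw by (subst list.set, subst sum_Pow_insert) auto
  finally show ?case .
qed

lemma contract_tens: "clinear \<psi> \<Longrightarrow> contract \<psi> (d \<otimes> (y :: 'w::complex_vector)) = \<psi> d *\<^sub>C y"
  and contract_linear: "clinear \<psi> \<Longrightarrow> clinear (contract \<psi> :: ('g, 'w) tensor \<Rightarrow> 'w)"
proof -
  assume lin: "clinear \<psi>"
  have "cbilinear (\<lambda>d y. \<psi> d *\<^sub>C (y :: 'w))"
    by (intro cbilinearI clinearI)
      (simp_all add: clinear_add[OF lin] clinear_scale[OF lin] scaleC_add_left scaleC_add_right scaleC_scaleC
        scaleC_complex_def mult.commute)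
  from tensor_lift_tens[OF this] clinear_tensor_lift[OF this]
  show "contract \<psi> (d \<otimes> y) = \<psi> d *\<^sub>C y" "clinear (contract \<psi> :: ('g, 'w) tensor \<Rightarrow> 'w)"
    by (simp_all add: contract_def)
qed

definition insert_tensor :: "'n \<Rightarrow> ('n \<Rightarrow> 'v) \<Rightarrow> ('g, 'v) tensor \<Rightarrow> ('g, ('n, 'v) mtensor) tensor" where
  "insert_tensor k y = tensor_lift (\<lambda>d x. d \<otimes> mtens (y(k := x)))"

lemma insert_tensor_tens: "insert_tensor k y (d \<otimes> x) = d \<otimes> mtens (y(k := x))"
  and insert_tensor_linear: "clinear (insert_tensor k y)"
proof -
  have "cbilinear (\<lambda>d x. (d :: 'g) \<otimes> mtens (y(k := x)))"
    by (intro cbilinearI clinear_tens clinear_compose[OF clinear_tens(2) clinear_mtens])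
  from tensor_lift_tens[OF this] clinear_tensor_lift[OF this]
  show "insert_tensor k y (d \<otimes> x) = d \<otimes> mtens (y(k := x))" "clinear (insert_tensor k y)"
    by (simp_all add: insert_tensor_def)
qed

text \<open>For \<open>i = k\<close> this is linearity of \<open>\<nu> k\<close>. For
  \<open>i \<noteq> k\<close> the factor \<open>i\<close> is a spectator, and two linear maps on a
  tensor product are compared on pure tensors.\<close>

lemma insert_tensor_multilinear: "cmultilinear (\<lambda>y. insert_tensor k y (\<nu> k (y k)))"
  unfolding cmultilinear_def
proof (intro allI)
  fix y :: "'n \<Rightarrow> 'v" and i
  show "clinear (\<lambda>z. insert_tensor k (y(i := z)) (\<nu> k ((y(i := z)) k)))"
  proof (cases "i = k")
    case True
    have "insert_tensor k (y(k := z)) = insert_tensor k y" for z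
      by (simp add: insert_tensor_def)
    then show ?thesis using True
      by (simp add: clinear_compose[OF insert_tensor_linear nu_props(1)])
  next
    case False
    have swap: "(y(i := z))(k := x) = (y(k := x))(i := z)" for z x using False by auto
    have "insert_tensor k (y(i := a + b)) T = insert_tensor k (y(i := a)) T + insert_tensor k (y(i := b)) T" for a b T
      by (rule tensor_eqI[OF insert_tensor_linear clinear_plus[OF insert_tensor_linear insert_tensor_linear]])
        (simp add: insert_tensor_tens swap mtens_add tens_add_right)
    moreover have "insert_tensor k (y(i := c *\<^sub>C a)) T = c *\<^sub>C insert_tensor k (y(i := a)) T" for c a T
    proof (rule tensor_eqI[OF insert_tensor_linear])
      show "clinear (\<lambda>T. c *\<^sub>C insert_tensor k (y(i := a)) T)"
        by (rule clinear_compose[OF _ insert_tensor_linear])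
          (simp add: clinearI scaleC_add_right scaleC_scaleC mult.commute)
      fix d x
      show "insert_tensor k (y(i := c *\<^sub>C a)) (d \<otimes> x) = c *\<^sub>C insert_tensor k (y(i := a)) (d \<otimes> x)"
        unfolding insert_tensor_tens swap mtens_scale tens_scale_right ..
    qed
    ultimately show ?thesis using False by (auto intro!: clinearI)
  qed
qed

lemma nu_total_mtens: "nu_total \<nu> (mtens y) = (\<Sum>k\<in>UNIV. insert_tensor k y (\<nu> k (y k)))"
  and nu_total_linear: "clinear (nu_total \<nu>)"
  using mtensor_lift_mtens[OF insert_tensor_multilinear] clinear_mtensor_lift[OF insert_tensor_multilinear]
  unfolding nu_total_def insert_tensor_def by (auto intro!: clinear_sumI)

section \<open>The operators \<Delta>_{+,\<alpha>} on word vectors\<close>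

lemma dual_bases_expand:
  assumes "root_dual_bases \<alpha> brk hh f k B \<phi>" "d \<in> root_space \<alpha> brk hh f k'"
  shows "(\<Sum>x\<in>B. \<phi> x d *\<^sub>C x) = (if k' = k then d else 0)"
proof (cases "k' = k")
  case True
  have fin: "finite B" and dual: "\<And>x y. x \<in> B \<Longrightarrow> y \<in> B \<Longrightarrow> \<phi> x y = (if x = y then 1 else 0)"
    and lin: "\<And>x. x \<in> B \<Longrightarrow> clinear (\<phi> x)" and dB: "d \<in> complex_vector.span B"
    using assms True by (auto simp: root_dual_bases_def)
  from dB have "(\<Sum>x\<in>B. \<phi> x d *\<^sub>C x) = d"
  proof (induction rule: complex_vector.span_induct)
    case base
    show ?case
    proof (rule complex_vector.subspaceI; unfold mem_Collect_eq)
      show "(\<Sum>x\<in>B. \<phi> x 0 *\<^sub>C x) = 0"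
        by (simp add: clinear_zero[OF lin])
      show "(\<Sum>x\<in>B. \<phi> x (a + b) *\<^sub>C x) = a + b"
        if "(\<Sum>x\<in>B. \<phi> x a *\<^sub>C x) = a" "(\<Sum>x\<in>B. \<phi> x b *\<^sub>C x) = b" for a b
      proof -
        have "(\<Sum>x\<in>B. \<phi> x (a + b) *\<^sub>C x) = (\<Sum>x\<in>B. \<phi> x a *\<^sub>C x + \<phi> x b *\<^sub>C x)"
          by (rule sum.cong) (simp_all add: clinear_add[OF lin] scaleC_add_left)
        then show ?thesis using that by (simp add: sum.distrib)
      qed
      show "(\<Sum>x\<in>B. \<phi> x (c *\<^sub>C a) *\<^sub>C x) = c *\<^sub>C a" if "(\<Sum>x\<in>B. \<phi> x a *\<^sub>C x) = a" for c a
      proof -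
        have "(\<Sum>x\<in>B. \<phi> x (c *\<^sub>C a) *\<^sub>C x) = (\<Sum>x\<in>B. c *\<^sub>C \<phi> x a *\<^sub>C x)"
          by (rule sum.cong) (simp_all add: clinear_scale[OF lin] scaleC_scaleC scaleC_complex_def)
        also have "\<dots> = c *\<^sub>C (\<Sum>x\<in>B. \<phi> x a *\<^sub>C x)" by (simp only: complex_vector.scale_sum_right)
        finally show ?thesis unfolding that .
      qed
    qed
  next
    case (step y)
    have "(\<Sum>x\<in>B. \<phi> x y *\<^sub>C x) = (\<Sum>x\<in>B. if x = y then y else 0)"
      by (rule sum.cong) (auto simp: dual step scaleC_one)
    then show ?case using fin step by simp
  qed
  then show ?thesis using True by simp
next
  case False
  then have "\<phi> x d = 0" if "x \<in> B" for x using assms that by (auto simp: root_dual_bases_def)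
  then show ?thesis using False by simp
qed

text \<open>The value of \<Delta> on a word vector, free of the choice of bases. The colouring may
  depend on the factor, which allows two uses: integration variables coloured by \<open>c\<close>,
  and positions in the lists of an arbitrary sequence coloured by that sequence.\<close>

definition Delta_word :: "('n \<Rightarrow> nat \<Rightarrow> 'r) \<Rightarrow> ('r \<Rightarrow> nat) \<Rightarrow> ('n \<Rightarrow> nat list) \<Rightarrow> ('n, 'v) mtensor" where
  "Delta_word col k J = (\<Sum>j\<in>UNIV. \<Sum>S\<in>Pow (set (J j)).
     if count_list (map (col j) (filter (\<lambda>x. x \<in> S) (J j))) = k
     then nu_coeff j (col j) S (J j) *\<^sub>C total_act act (lie_word (map (col j) (filter (\<lambda>x. x \<in> S) (J j))))
       (f_vector f act v (\<lambda>i. map (col i) ((J(j := filter (\<lambda>x. x \<notin> S) (J j))) i)))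
     else 0)"

lemma Delta_plus_linear:
  assumes "root_dual_bases \<alpha> brk hh f k B \<phi>"
  shows "clinear (Delta_plus act \<nu> B \<phi>)"
  unfolding Delta_plus_def
  by (intro clinear_sumI clinear_compose[OF total_act_linear] clinear_compose[OF contract_linear nu_total_linear])
    (use assms in \<open>auto simp: root_dual_bases_def\<close>)

text \<open>Summing \<phi>_x(d) x over the basis projects d to the root space, so that among the
  subwords extracted by \<open>\<nu>\<close> exactly those of weight \<open>k\<close>
  survive.\<close>

lemma Delta_plus_word:
  assumes B: "root_dual_bases \<alpha> brk hh f k B \<phi>" and J: "\<And>j. distinct (J j)"
  shows "Delta_plus act \<nu> B \<phi> (f_vector f act v (\<lambda>i. map (col i) (J i))) = Delta_word col k J"
proof -
  let ?y = "\<lambda>i. vword i (map (col i) (J i))"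
  let ?d = "\<lambda>j S. lie_word (map (col j) (filter (\<lambda>x. x \<in> S) (J j)))"
  let ?w = "\<lambda>j S. ?y(j := vword j (map (col j) (filter (\<lambda>x. x \<notin> S) (J j))))"
  let ?s = "\<lambda>j S. nu_coeff j (col j) S (J j)"
  have lin: "clinear (\<phi> x)" if "x \<in> B" for x using B that by (auto simp: root_dual_bases_def)
  have 1: "contract (\<phi> x) (nu_total \<nu> (mtens ?y)) =
      (\<Sum>j\<in>UNIV. \<Sum>S\<in>Pow (set (J j)). (?s j S * \<phi> x (?d j S)) *\<^sub>C mtens (?w j S))" if "x \<in> B" for x
    unfolding nu_total_mtens nu_vword[OF J]
    by (simp add: clinear_sum[OF insert_tensor_linear] clinear_scale[OF insert_tensor_linear] insert_tensor_tens
        clinear_sum[OF contract_linear[OF lin[OF that]]] clinear_scale[OF contract_linear[OF lin[OF that]]]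
        contract_tens[OF lin[OF that]] scaleC_scaleC)
  have "Delta_plus act \<nu> B \<phi> (mtens ?y) =
     (\<Sum>x\<in>B. \<Sum>j\<in>UNIV. \<Sum>S\<in>Pow (set (J j)). ?s j S *\<^sub>C total_act act (\<phi> x (?d j S) *\<^sub>C x) (mtens (?w j S)))"
    unfolding Delta_plus_def
    by (intro sum.cong HOL.refl) (simp add: 1 clinear_sum[OF total_act_linear] clinear_scale[OF total_act_linear]
      clinear_scale[OF total_act_linear_left] scaleC_scaleC)
  also have "\<dots> = (\<Sum>j\<in>UNIV. \<Sum>S\<in>Pow (set (J j)). \<Sum>x\<in>B. ?s j S *\<^sub>C total_act act (\<phi> x (?d j S) *\<^sub>C x) (mtens (?w j S)))"
    by (subst sum.swap, rule sum.cong[OF HOL.refl], rule sum.swap)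
  also have "\<dots> = (\<Sum>j\<in>UNIV. \<Sum>S\<in>Pow (set (J j)).
      ?s j S *\<^sub>C total_act act (\<Sum>x\<in>B. \<phi> x (?d j S) *\<^sub>C x) (mtens (?w j S)))"
    by (simp add: clinear_sum[OF total_act_linear_left] complex_vector.scale_sum_right)
  also have "\<dots> = Delta_word col k J"
    unfolding Delta_word_def dual_bases_expand[OF B lie_word_root_space] f_vector_eq
    by (intro sum.cong HOL.refl) (auto simp: clinear_zero[OF total_act_linear_left] intro!: arg_cong[where f = mtens]
      arg_cong2[where f = "total_act act"] arg_cong2[where f = scaleC])
  finally show ?thesis by (simp add: f_vector_eq)
qed

text \<open>If the root space is zero, all brackets of this weight vanish. Sums over roots can
  therefore be extended to sums over weights.\<close>

lemma Delta_word_not_root: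
  assumes "\<not> pos_root \<alpha> brk hh f k" "k \<noteq> (\<lambda>_. 0)"
  shows "Delta_word col k J = 0"
proof -
  have "root_space \<alpha> brk hh f k = {0}" using assms by (simp add: pos_root_def)
  then have "lie_word w = 0" if "count_list w = k" for w
    using lie_word_root_space[of w] that by simp
  then show ?thesis
    unfolding Delta_word_def f_vector_eq by (auto intro!: sum.neutral simp: clinear_zero[OF total_act_linear_left])
qed

text \<open>The span of the words is stable under each f_i by construction, under \<hh> because
  words are eigenvectors, and under each e_i by moving e_i to the right until it kills the
  generating vector. These elements generate the Lie algebra and \<open>v j\<close> generates the
  module, so the span is everything.\<close>

lemma vword_spans: "x \<in> complex_vector.span (range (vword j))"
proof -
  let ?W = "complex_vector.span (range (vword j))"
  have closed: "act j g y \<in> ?W" if "\<And>w. act j g (vword j w) \<in> ?W" "y \<in> ?W" for g y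
    using that(2)
  proof (induction rule: complex_vector.span_induct)
    case base
    show ?case
      by (rule complex_vector.subspaceI)
        (simp_all add: clinear_zero[OF act_linear(1)] clinear_add[OF act_linear(1)] clinear_scale[OF act_linear(1)]
          complex_vector.span_zero complex_vector.span_add complex_vector.span_scale)
  qed (use that(1) in auto)
  have W: "vword j w \<in> ?W" for w by (rule complex_vector.span_base) simp
  have f: "act j (f i) y \<in> ?W" if "y \<in> ?W" for i y
    by (rule closed[OF _ that]) (metis W vword_simps(2))
  have h: "act j (hh h) y \<in> ?W" if "y \<in> ?W" for h y
    by (rule closed[OF _ that]) (simp add: act_h_vword W complex_vector.span_scale)
  have e_word: "act j (e i) (vword j w) \<in> ?W" for i w
  proof (induction w)
    case (Cons k w)
    have "act j (e i) (vword j (k # w)) =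
        act j (f k) (act j (e i) (vword j w)) + act j (brk (e i) (f k)) (vword j w)"
      unfolding vword_simps by (rule act_swap)
    moreover have "act j (brk (e i) (f k)) (vword j w) \<in> ?W"
      by (simp add: brk_e_f h[OF W] clinear_zero[OF act_linear(2)] complex_vector.span_zero)
    ultimately show ?case using f[OF Cons] by (simp add: complex_vector.span_add)
  qed (simp add: act_e_v complex_vector.span_zero)
  have g: "act j (lie_eval brk (case_km_gen hh e f) s) y \<in> ?W" if "y \<in> ?W" for s y
    using that
  proof (induction s arbitrary: y)
    case (LGen x)
    then show ?case using f h closed[OF e_word] by (cases x) auto
  qed (auto simp: clinear_zero[OF act_linear(2)] clinear_add[OF act_linear(2)] clinear_scale[OF act_linear(2)] act_brk
      intro: complex_vector.span_zero complex_vector.span_add complex_vector.span_scale complex_vector.span_diff)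
  have "surj (lie_eval brk (case_km_gen hh e f))"
    using km by (simp add: kac_moody_def lie_presented_def)
  then have act: "act j a y \<in> ?W" if "y \<in> ?W" for a y using g[OF that] by (metis surjD)
  have "mod_eval (act j) (v j) s \<in> ?W" for s
    using W[of "[]"] by (induction s)
      (auto simp: act intro: complex_vector.span_zero complex_vector.span_add complex_vector.span_scale)
  moreover have "surj (mod_eval (act j) (v j))" using vermas[of j] by (simp add: verma_def mod_presented_def)
  ultimately show ?thesis by (metis surjD)
qed

lemma f_vector_spans: "w \<in> complex_vector.span (range (f_vector f act v))"
proof -
  have "mtens y \<in> complex_vector.span (range (f_vector f act v))" for y
  proof -
    have "mtens y \<in> complex_vector.span (mtens ` {y. \<forall>j. y j \<in> range (vword j)})"
      by (intro mtens_in_span vword_spans)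
    moreover have "mtens ` {y. \<forall>j. y j \<in> range (vword j)} \<subseteq> range (f_vector f act v)"
    proof clarify
      fix y assume "\<forall>j. y j \<in> range (vword j)"
      then have "\<forall>j. \<exists>w. y j = vword j w" by auto
      then obtain I where "\<forall>j. y j = vword j (I j)" by metis
      then have "mtens y = f_vector f act v I" unfolding f_vector_eq by (metis ext)
      then show "mtens y \<in> range (f_vector f act v)" by auto
    qed
    ultimately show ?thesis using complex_vector.span_mono by blast
  qed
  then have "complex_vector.span (range mtens) \<subseteq> complex_vector.span (range (f_vector f act v))"
    by (intro complex_vector.span_minimal) auto
  then show ?thesis using mtensor_in_span by auto
qed

lemma weights_distinct:
  assumes "k \<noteq> k'"
  obtains h where "wt \<alpha> k h \<noteq> wt \<alpha> k' h"
proof -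
  have indep: "(\<forall>h. (\<Sum>i\<in>UNIV. a i * \<alpha> i h) = 0) \<longrightarrow> (\<forall>i. a i = 0)" for a
    using cartan by (simp add: cartan_datum_def)
  obtain i where "k i \<noteq> k' i" using assms by auto
  then have "of_nat (k i) - of_nat (k' i) \<noteq> (0 :: complex)" by simp
  with indep[of "\<lambda>i. of_nat (k i) - of_nat (k' i)"]
  obtain h where "(\<Sum>i\<in>UNIV. (of_nat (k i) - of_nat (k' i)) * \<alpha> i h) \<noteq> 0" by blast
  then have "wt \<alpha> k h \<noteq> wt \<alpha> k' h" by (auto simp: wt_def left_diff_distrib sum_subtractf)
  with that show thesis by blast
qed

text \<open>Some h separates two given weights. Applying h minus its eigenvalue on weight
  \<open>k0\<close> to the relation removes the term of \<open>k0\<close> and multiplies the other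
  terms by numbers, so the induction hypothesis applies to the rescaled vectors.\<close>

lemma weight_vectors_independent:
  assumes "finite N" "\<And>k. k \<in> N \<Longrightarrow> g k \<in> weight_space \<alpha> hh \<Lambda> act k" "(\<Sum>k\<in>N. g k) = 0" "k \<in> N"
  shows "g k = 0"
  using assms
proof (induction N arbitrary: g k rule: finite_induct)
  case (insert k0 N)
  have eig: "total_act act (hh h) (g k) = ((\<Sum>j\<in>UNIV. \<Lambda> j h) - wt \<alpha> k h) *\<^sub>C g k" if "k \<in> insert k0 N" for k h
    using insert(4)[OF that] by (simp add: weight_space_def)
  have zero: "g k = 0" if k: "k \<in> N" for k
  proof -
    have "k \<noteq> k0" using k insert by auto
    then obtain h where h: "wt \<alpha> k0 h \<noteq> wt \<alpha> k h" by (metis weights_distinct)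
    have "(\<Sum>k\<in>N. (wt \<alpha> k0 h - wt \<alpha> k h) *\<^sub>C g k) = (\<Sum>k\<in>insert k0 N. (wt \<alpha> k0 h - wt \<alpha> k h) *\<^sub>C g k)"
      using insert by simp
    also have "\<dots> = (\<Sum>k\<in>insert k0 N. total_act act (hh h) (g k) - ((\<Sum>j\<in>UNIV. \<Lambda> j h) - wt \<alpha> k0 h) *\<^sub>C g k)"
    proof (rule sum.cong[OF HOL.refl])
      fix k assume "k \<in> insert k0 N"
      then show "(wt \<alpha> k0 h - wt \<alpha> k h) *\<^sub>C g k =
          total_act act (hh h) (g k) - ((\<Sum>j\<in>UNIV. \<Lambda> j h) - wt \<alpha> k0 h) *\<^sub>C g k"
        unfolding eig[OF \<open>k \<in> insert k0 N\<close>] complex_vector.scale_left_diff_distrib[symmetric]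
        by (intro arg_cong2[where f = scaleC]) simp_all
    qed
    also have "\<dots> = total_act act (hh h) (\<Sum>k\<in>insert k0 N. g k)
        - ((\<Sum>j\<in>UNIV. \<Lambda> j h) - wt \<alpha> k0 h) *\<^sub>C (\<Sum>k\<in>insert k0 N. g k)"
      unfolding sum_subtractf clinear_sum[OF total_act_linear] complex_vector.scale_sum_right ..
    also have "\<dots> = 0" unfolding insert(5) by (simp add: clinear_zero[OF total_act_linear])
    finally have "(\<Sum>k\<in>N. (wt \<alpha> k0 h - wt \<alpha> k h) *\<^sub>C g k) = 0" .
    then have "(wt \<alpha> k0 h - wt \<alpha> k h) *\<^sub>C g k = 0"
      using insert.prems(1) k
      by (intro insert.IH[where g = "\<lambda>k. (wt \<alpha> k0 h - wt \<alpha> k h) *\<^sub>C g k"])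
        (auto intro: complex_vector.subspace_scale[OF subspace_weight_space])
    then show ?thesis using h by simp
  qed
  then have "g k0 = 0" using insert by simp
  with zero insert(6) show ?case by auto
qed simp

text \<open>The weight space is defined as a joint eigenspace, while \<Delta> is computed on word
  vectors; this connects the two descriptions.\<close>

lemma weight_space_span:
  assumes "w \<in> weight_space \<alpha> hh \<Lambda> act mm"
  shows "w \<in> complex_vector.span (f_vector f act v ` sequences mm)"
proof -
  let ?X = "\<lambda>k. complex_vector.span (f_vector f act v ` sequences k)"
  have "\<exists>N g. finite N \<and> (\<forall>k. g k \<in> ?X k) \<and> (\<forall>k. k \<notin> N \<longrightarrow> g k = 0) \<and> w = (\<Sum>k\<in>N. g k)"
    using f_vector_spans[of w]
  proof (induction rule: complex_vector.span_induct)
    case base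
    show ?case
    proof (rule complex_vector.subspaceI; unfold mem_Collect_eq)
      show "\<exists>N g. finite N \<and> (\<forall>k. g k \<in> ?X k) \<and> (\<forall>k. k \<notin> N \<longrightarrow> g k = 0) \<and> 0 = (\<Sum>k\<in>N. g k)"
        by (rule exI[of _ "{}"]) (auto intro: complex_vector.span_zero)
    next
      fix x y
      assume "\<exists>N g. finite N \<and> (\<forall>k. g k \<in> ?X k) \<and> (\<forall>k. k \<notin> N \<longrightarrow> g k = 0) \<and> x = (\<Sum>k\<in>N. g k)"
        "\<exists>N g. finite N \<and> (\<forall>k. g k \<in> ?X k) \<and> (\<forall>k. k \<notin> N \<longrightarrow> g k = 0) \<and> y = (\<Sum>k\<in>N. g k)"
      then obtain N g N' g' where
        g: "finite N" "\<And>k. g k \<in> ?X k" "\<And>k. k \<notin> N \<Longrightarrow> g k = 0" "x = (\<Sum>k\<in>N. g k)" and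
        g': "finite N'" "\<And>k. g' k \<in> ?X k" "\<And>k. k \<notin> N' \<Longrightarrow> g' k = 0" "y = (\<Sum>k\<in>N'. g' k)"
        by blast
      have "x = (\<Sum>k\<in>N \<union> N'. g k)" "y = (\<Sum>k\<in>N \<union> N'. g' k)"
        unfolding g(4) g'(4) using g g' by (auto intro!: sum.mono_neutral_left)
      then have "x + y = (\<Sum>k\<in>N \<union> N'. g k + g' k)" by (simp add: sum.distrib)
      then show "\<exists>N g. finite N \<and> (\<forall>k. g k \<in> ?X k) \<and> (\<forall>k. k \<notin> N \<longrightarrow> g k = 0) \<and> x + y = (\<Sum>k\<in>N. g k)"
        using g g' by (intro exI[of _ "N \<union> N'"] exI[of _ "\<lambda>k. g k + g' k"]) (auto intro: complex_vector.span_add)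
    next
      fix c x
      assume "\<exists>N g. finite N \<and> (\<forall>k. g k \<in> ?X k) \<and> (\<forall>k. k \<notin> N \<longrightarrow> g k = 0) \<and> x = (\<Sum>k\<in>N. g k)"
      then obtain N g where
        g: "finite N" "\<And>k. g k \<in> ?X k" "\<And>k. k \<notin> N \<Longrightarrow> g k = 0" "x = (\<Sum>k\<in>N. g k)" by blast
      then show "\<exists>N g. finite N \<and> (\<forall>k. g k \<in> ?X k) \<and> (\<forall>k. k \<notin> N \<longrightarrow> g k = 0) \<and> c *\<^sub>C x = (\<Sum>k\<in>N. g k)"
        by (intro exI[of _ N] exI[of _ "\<lambda>k. c *\<^sub>C g k"])
          (auto intro: complex_vector.span_scale simp: complex_vector.scale_sum_right)
    qed
  next
    case (step x)
    then obtain I where I: "x = f_vector f act v I" by auto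
    let ?k = "total_count I"
    have "I \<in> sequences ?k" by (simp add: sequences_eq)
    then show ?case
      by (intro exI[of _ "{?k}"] exI[of _ "\<lambda>k. if k = ?k then x else 0"])
        (auto simp: I intro: complex_vector.span_base complex_vector.span_zero)
  qed
  then obtain N g where g: "finite N" "\<And>k. g k \<in> ?X k" "\<And>k. k \<notin> N \<Longrightarrow> g k = 0" "w = (\<Sum>k\<in>N. g k)" by blast
  have sub: "?X k \<subseteq> weight_space \<alpha> hh \<Lambda> act k" for k
    by (rule complex_vector.span_minimal[OF _ subspace_weight_space]) (auto intro: f_vector_weight_space)
  \<comment> \<open>Subtracting \<open>w\<close> from the component of weight \<open>mm\<close>
    turns the decomposition of \<open>w\<close> into a relation between weight vectors of distinct
    weights.\<close>
  let ?N = "insert mm N" and ?g = "g(mm := g mm - w)"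
  have "w = (\<Sum>k\<in>?N. g k)" using g by (auto simp: sum.insert_if)
  also have "\<dots> = g mm + (\<Sum>k\<in>?N - {mm}. g k)" using g by (subst sum.remove[of _ mm]) auto
  finally have "(\<Sum>k\<in>?N. ?g k) = 0"
    using g by (subst sum.remove[of _ mm]) (auto simp: algebra_simps)
  moreover have "?g k \<in> weight_space \<alpha> hh \<Lambda> act k" for k
  proof -
    have "g k \<in> weight_space \<alpha> hh \<Lambda> act k" using g(2) sub by blast
    then show ?thesis using complex_vector.subspace_diff[OF subspace_weight_space _ assms] by (cases "k = mm") auto
  qed
  ultimately have "?g mm = 0"
    using g(1) by (intro weight_vectors_independent[of ?N ?g]) auto
  then have "w = g mm" by simp
  with g(2)[of mm] show ?thesis by simp
qed

text \<open>A nonzero contribution extracts a subword of weight \<open>k\<close> from a family of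
  words of total weight \<open>mm\<close>. This is what makes the set of relevant roots
  finite.\<close>

lemma Delta_plus_weight_bound:
  assumes B: "root_dual_bases \<alpha> brk hh f k B \<phi>" and w: "w \<in> weight_space \<alpha> hh \<Lambda> act mm"
    and nz: "Delta_plus act \<nu> B \<phi> w \<noteq> 0"
  shows "k i \<le> mm i"
proof (rule ccontr)
  assume not_le: "\<not> k i \<le> mm i"
  have "Delta_plus act \<nu> B \<phi> (f_vector f act v I) = 0" if I: "I \<in> sequences mm" for I
  proof -
    \<comment> \<open>The positions in each list serve as distinct letters; position l of list j has
      the colour \<open>I j ! l\<close>.\<close>
    let ?J = "\<lambda>j. [0..<length (I j)]"
    have I_eq: "I = (\<lambda>j. map ((!) (I j)) (?J j))" by (auto simp: map_nth)
    have filt: "count_list (map g (filter P xs)) i \<le> count_list (map g xs) i" for g P and xs :: "nat list"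
      by (induction xs) auto
    have "count_list (map ((!) (I j)) (filter P (?J j))) \<noteq> k" for j P
    proof -
      have "count_list (map ((!) (I j)) (filter P (?J j))) i \<le> count_list (I j) i"
        using filt[of "(!) (I j)" P "?J j"] by (simp add: map_nth)
      also have "\<dots> \<le> total_count I i" unfolding total_count_def by (rule member_le_sum) auto
      also have "total_count I i = mm i" using I by (simp add: sequences_eq)
      finally show ?thesis using not_le by auto
    qed
    then have "Delta_word (\<lambda>j. (!) (I j)) k ?J = 0" by (simp add: Delta_word_def)
    then show ?thesis using Delta_plus_word[OF B, of ?J "\<lambda>j. (!) (I j)"] I_eq by simp
  qed
  note f_vectors = this
  have "Delta_plus act \<nu> B \<phi> x = 0" if "x \<in> complex_vector.span (f_vector f act v ` sequences mm)" for x
    using that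
  proof (induction rule: complex_vector.span_induct)
    case base
    note lin = Delta_plus_linear[OF B]
    show ?case
      by (rule complex_vector.subspaceI) (auto simp: clinear_zero[OF lin] clinear_add[OF lin] clinear_scale[OF lin])
  qed (use f_vectors in auto)
  with weight_space_span[OF w] nz show False by blast
qed

lemma finite_bounded_weights: "finite {k :: 'r \<Rightarrow> nat. \<forall>i. k i \<le> mm i}"
proof -
  have "{k :: 'r \<Rightarrow> nat. \<forall>i. k i \<le> mm i} = Pi\<^sub>E UNIV (\<lambda>i. {..mm i})" by (auto simp: PiE_def)
  then show ?thesis by (simp add: finite_PiE)
qed

end

section \<open>Determinants of logarithmic forms\<close>

text \<open>A wedge product of m one-forms at a fixed point, as a determinant. Its rows will be
  indexed by the integration variables instead of the positions in the wedge product; the price is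
  the sign in \<open>form_det_permute\<close>.\<close>

definition form_det :: "nat \<Rightarrow> (nat \<Rightarrow> point \<Rightarrow> complex) \<Rightarrow> (nat \<Rightarrow> point) \<Rightarrow> complex" where
  "form_det m \<theta> V = (\<Sum>\<pi> | \<pi> permutes {..<m}. of_int (sign \<pi>) * (\<Prod>a<m. \<theta> a (V (\<pi> a))))"

definition coord :: "nat \<Rightarrow> point \<Rightarrow> complex" where
  "coord k w = w k"

lemma form_det_cong: "(\<And>a w. a < m \<Longrightarrow> \<theta> a w = \<theta>' a w) \<Longrightarrow> form_det m \<theta> V = form_det m \<theta>' V"
  unfolding form_det_def by (intro sum.cong HOL.refl arg_cong2[where f = "(*)"] prod.cong) auto

lemma wedge_eq_form_det: "wedge \<theta>s t V = form_det (length \<theta>s) (\<lambda>a. (\<theta>s ! a) t) V"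
  by (simp add: wedge_def form_det_def)

lemma form_det_permute:
  assumes \<sigma>: "\<sigma> permutes {..<m}"
  shows "form_det m (\<lambda>a. \<theta> (\<sigma> a)) V = of_int (sign \<sigma>) * form_det m \<theta> V"
proof -
  have perm: "permutation \<sigma>" using \<sigma> by (auto intro: permutes_imp_permutation)
  have "form_det m \<theta> V = (\<Sum>\<pi> | \<pi> permutes {..<m}. of_int (sign (\<pi> \<circ> inv \<sigma>)) * (\<Prod>a<m. \<theta> a (V ((\<pi> \<circ> inv \<sigma>) a))))"
    unfolding form_det_def by (rule sum_permutations_compose_right[OF permutes_inv[OF \<sigma>]])
  also have "\<dots> = (\<Sum>\<pi> | \<pi> permutes {..<m}. of_int (sign \<sigma>) * (of_int (sign \<pi>) * (\<Prod>a<m. \<theta> (\<sigma> a) (V (\<pi> a)))))"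
  proof (rule sum.cong[OF HOL.refl])
    fix \<pi> assume "\<pi> \<in> {\<pi>. \<pi> permutes {..<m}}"
    then have "permutation \<pi>" by (auto intro: permutes_imp_permutation)
    then have "sign (\<pi> \<circ> inv \<sigma>) = sign \<sigma> * sign \<pi>"
      using perm by (simp add: sign_compose permutation_inverse sign_inverse)
    moreover have "(\<Prod>a<m. \<theta> a (V ((\<pi> \<circ> inv \<sigma>) a))) = (\<Prod>a<m. \<theta> (\<sigma> a) (V (\<pi> a)))"
      using prod.permute[OF \<sigma>, of "\<lambda>a. \<theta> a (V ((\<pi> \<circ> inv \<sigma>) a))"] permutes_inverses(2)[OF \<sigma>]
      by (simp add: comp_def)
    ultimately show "of_int (sign (\<pi> \<circ> inv \<sigma>)) * (\<Prod>a<m. \<theta> a (V ((\<pi> \<circ> inv \<sigma>) a)))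
        = of_int (sign \<sigma>) * (of_int (sign \<pi>) * (\<Prod>a<m. \<theta> (\<sigma> a) (V (\<pi> a))))" by simp
  qed
  finally have "form_det m \<theta> V = of_int (sign \<sigma>) * form_det m (\<lambda>a. \<theta> (\<sigma> a)) V"
    by (simp add: form_det_def sum_distrib_left)
  moreover have "of_int (sign \<sigma>) * of_int (sign \<sigma>) = (1 :: complex)"
    by (simp add: sign_def)
  ultimately show ?thesis by (metis mult.assoc mult_1)
qed

lemma form_det_scale: "form_det m (\<lambda>a w. g a * \<theta> a w) V = (\<Prod>a<m. g a) * form_det m \<theta> V"
  unfolding form_det_def sum_distrib_left prod.distrib by (intro sum.cong) (auto simp: mult_ac)

lemma form_det_row_add:
  assumes "k < m"
  shows "form_det m (\<theta>(k := \<lambda>w. x w + c * y w)) V = form_det m (\<theta>(k := x)) V + c * form_det m (\<theta>(k := y)) V"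
proof -
  have P: "(\<Prod>a<m. (\<theta>(k := x)) a (V (\<pi> a))) = x (V (\<pi> k)) * (\<Prod>a\<in>{..<m} - {k}. \<theta> a (V (\<pi> a)))" for x \<pi>
    using assms by (subst prod.remove[of _ k]) auto
  show ?thesis
    unfolding form_det_def P sum_distrib_left sum.distrib[symmetric]
    by (intro sum.cong HOL.refl) (simp add: algebra_simps)
qed

lemma form_det_row_sum:
  assumes "k < m" "finite A"
  shows "form_det m (\<theta>(k := \<lambda>w. \<Sum>i\<in>A. c i * y i w)) V = (\<Sum>i\<in>A. c i * form_det m (\<theta>(k := y i)) V)"
  using assms(2)
proof (induction A rule: finite_induct)
  case empty
  show ?case using form_det_row_add[OF assms(1), of \<theta> "\<lambda>w. 0" "-1" "\<lambda>w. 0" V] by (simp add: fun_upd_def)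
next
  case (insert i A)
  have "(\<lambda>w. \<Sum>i\<in>insert i A. c i * y i w) = (\<lambda>w. (\<Sum>i\<in>A. c i * y i w) + c i * y i w)"
    using insert by (simp add: add.commute)
  then have "form_det m (\<theta>(k := \<lambda>w. \<Sum>i\<in>insert i A. c i * y i w)) V =
      form_det m (\<theta>(k := \<lambda>w. \<Sum>i\<in>A. c i * y i w)) V + c i * form_det m (\<theta>(k := y i)) V"
    by (simp only: form_det_row_add[OF assms(1)])
  then show ?case using insert by (simp only: insert.IH sum.insert[OF insert.hyps] add.commute)
qed

lemma form_det_equal_rows:
  assumes "k < m" "l < m" "k \<noteq> l" "\<theta> k = \<theta> l"
  shows "form_det m \<theta> V = 0"
proof -
  have tr: "Transposition.transpose k l permutes {..<m}" using assms by (intro permutes_swap_id) auto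
  have "(\<lambda>a. \<theta> (Transposition.transpose k l a)) = \<theta>" using assms(4) by (auto simp: Transposition.transpose_def fun_eq_iff)
  then have "form_det m \<theta> V = - form_det m \<theta> V"
    using form_det_permute[OF tr, of \<theta> V] assms(3) by (simp add: sign_swap_id)
  then show ?thesis by simp
qed

lemma form_det_row_op:
  assumes "k < m" "l < m" "k \<noteq> l"
  shows "form_det m (\<theta>(k := \<lambda>w. x w + c * \<theta> l w)) V = form_det m (\<theta>(k := x)) V"
proof -
  have "form_det m (\<theta>(k := \<theta> l)) V = 0"
    using assms by (intro form_det_equal_rows[of k m l]) auto
  then show ?thesis by (simp add: form_det_row_add[OF assms(1)])
qed

text \<open>Row operations along a chain \<open>k\<^sub>1, \<dots>, k\<^sub>s\<close> replace the rows \<open>dt\<^bsub>k\<^sub>q\<^esub> - dt\<^bsub>k\<^bsub>q+1\<^esub>\<^esub>\<close> by \<open>dt\<^bsub>k\<^sub>q\<^esub>\<close>.\<close>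

lemma form_det_chain:
  assumes "distinct w" "set w \<subseteq> {..<m}"
    "\<And>q. Suc q < length w \<Longrightarrow> \<theta> (w ! q) = (\<lambda>x. coord (w ! q) x - coord (w ! Suc q) x)"
    "w \<noteq> [] \<Longrightarrow> \<theta> (last w) = coord (last w)"
  shows "form_det m \<theta> V = form_det m (\<lambda>k. if k \<in> set w then coord k else \<theta> k) V"
  using assms
proof (induction w)
  case (Cons k w)
  have IH: "form_det m \<theta> V = form_det m (\<lambda>k. if k \<in> set w then coord k else \<theta> k) V"
  proof (rule Cons.IH)
    show "\<theta> (w ! q) = (\<lambda>x. coord (w ! q) x - coord (w ! Suc q) x)" if "Suc q < length w" for q
      using Cons.prems(3)[of "Suc q"] that by simp
  qed (use Cons.prems in auto)
  let ?\<theta> = "\<lambda>k. if k \<in> set w then coord k else \<theta> k"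
  show ?case
  proof (cases w)
    case Nil
    then have "(\<lambda>i. if i \<in> set (k # w) then coord i else \<theta> i) = \<theta>" using Cons.prems(4) by auto
    then show ?thesis by simp
  next
    case (Cons l w')
    have kl: "k < m" "l < m" "k \<noteq> l" "k \<notin> set w" using Cons.prems Cons by auto
    \<comment> \<open>Row \<open>l\<close> is already dt_l by the induction hypothesis, so one row
      operation leaves dt_k in row \<open>k\<close>.\<close>
    have "\<theta> k = (\<lambda>x. coord k x - coord l x)" using Cons.prems(3)[of 0] Cons by simp
    then have "?\<theta> = ?\<theta>(k := \<lambda>x. coord k x + (-1) * ?\<theta> l x)" using kl Cons by (auto simp: fun_eq_iff)
    then have "form_det m ?\<theta> V = form_det m (?\<theta>(k := coord k)) V"
      using form_det_row_op[OF kl(1-3), of ?\<theta> "coord k" "-1" V] by (rule HOL.trans[OF arg_cong[where f = "\<lambda>\<theta>. form_det m \<theta> V"]])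
    also have "?\<theta>(k := coord k) = (\<lambda>i. if i \<in> set (k # w) then coord i else \<theta> i)" by auto
    finally show ?thesis using IH by simp
  qed
qed simp

text \<open>
  A row \<open>\<zeta>\<close> at the end of a chain \<open>w\<close>, when all rows off the chain are \<open>dt\<^sub>i\<close>, contributes the value
  of \<open>\<zeta>\<close> at the vector \<open>\<Sum>\<^bsub>i \<in> w\<^esub> \<partial>/\<partial>t\<^sub>i\<close>.
\<close>

lemma form_det_chain_end:
  assumes w: "distinct w" "set w \<subseteq> {..<m}" "w \<noteq> []"
    and chain: "\<And>q. Suc q < length w \<Longrightarrow> \<theta> (w ! q) = (\<lambda>x. coord (w ! q) x - coord (w ! Suc q) x)"
    and last: "\<theta> (last w) = (\<lambda>x. \<Sum>i<m. \<zeta> i * coord i x)"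
    and off: "\<And>i. i < m \<Longrightarrow> i \<notin> set w \<Longrightarrow> \<theta> i = coord i"
  shows "form_det m \<theta> V = (\<Sum>i\<in>set w. \<zeta> i) * form_det m coord V"
proof -
  let ?k = "last w"
  let ?D = "\<lambda>i. form_det m (\<theta>(?k := coord i)) V"
  have k: "?k < m" using w by (metis last_in_set lessThan_iff subsetD)
  have kth: "w ! q \<noteq> ?k" if "Suc q < length w" for q
    using that w by (simp add: last_conv_nth nth_eq_iff_index_eq)
  have D_last: "?D ?k = form_det m coord V"
  proof -
    have "?D ?k = form_det m (\<lambda>i. if i \<in> set w then coord i else (\<theta>(?k := coord ?k)) i) V"
      using w chain kth by (intro form_det_chain) (auto simp: fun_upd_def)
    also have "\<dots> = form_det m coord V" using off w by (intro form_det_cong) auto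
    finally show ?thesis .
  qed
  have D_off: "?D i = 0" if "i < m" "i \<notin> set w" for i
    using that k off w by (intro form_det_equal_rows[of i m ?k]) auto
  \<comment> \<open>If the last row is replaced by a copy of row \<open>w ! q\<close>, two rows
    agree and the determinant is 0. As that row is a difference of two neighbouring coordinates, the
    determinants for these two coincide: \<open>?D\<close> is constant along the chain.\<close>
  have D_step: "?D (w ! q) = ?D (w ! Suc q)" if q: "Suc q < length w" for q
  proof -
    have "w ! q < m" using q w by (metis Suc_lessD lessThan_iff nth_mem subsetD)
    then have "form_det m (\<theta>(?k := \<theta> (w ! q))) V = 0"
      using k kth[OF q] by (intro form_det_equal_rows[of "w ! q" m ?k]) auto
    moreover have eq: "\<theta>(?k := \<theta> (w ! q)) = \<theta>(?k := \<lambda>x. coord (w ! q) x + (-1) * coord (w ! Suc q) x)"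
      using chain[OF q] by simp
    have "form_det m (\<theta>(?k := \<theta> (w ! q))) V = ?D (w ! q) + (-1) * ?D (w ! Suc q)"
      unfolding eq by (rule form_det_row_add[OF k])
    ultimately show ?thesis by simp
  qed
  have "?D (w ! q) = ?D ?k" if "q < length w" for q
  proof -
    have "q \<le> length w - 1" using that by simp
    then show ?thesis
    proof (induction q rule: inc_induct)
      case base
      then show ?case using w by (simp add: last_conv_nth)
    next
      case (step q)
      then have "?D (w ! q) = ?D (w ! Suc q)" by (intro D_step) simp
      with step show ?case by (simp only:)
    qed
  qed
  then have D_on: "?D i = form_det m coord V" if "i \<in> set w" for i
    using that D_last by (metis in_set_conv_nth)
  have "form_det m \<theta> V = form_det m (\<theta>(?k := \<lambda>x. \<Sum>i<m. \<zeta> i * coord i x)) V"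
    using last by (simp add: fun_upd_idem)
  also have "\<dots> = (\<Sum>i<m. \<zeta> i * ?D i)"
    using form_det_row_sum[OF k, of "{..<m}" \<theta> \<zeta> coord V] by simp
  also have "\<dots> = (\<Sum>i\<in>set w. \<zeta> i * ?D i)"
    using w D_off by (intro sum.mono_neutral_right) auto
  also have "\<dots> = (\<Sum>i\<in>set w. \<zeta> i) * form_det m coord V"
    by (simp add: D_on sum_distrib_right)
  finally show ?thesis .
qed

lemma distinct_list_permutation:
  assumes "distinct ks" "set ks = {..<m}"
  obtains \<sigma> where "\<sigma> permutes {..<m}" "ks = map \<sigma> [0..<m]"
proof
  let ?\<sigma> = "\<lambda>a. if a < m then ks ! a else a"
  have len: "length ks = m" using assms by (metis card_lessThan distinct_card)
  have "bij_betw ((!) ks) {..<m} {..<m}"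
    by (rule bij_betw_nth) (simp_all add: assms len)
  then have "bij_betw ?\<sigma> {..<m} {..<m}" by (subst bij_betw_cong[of _ _ "(!) ks"]) auto
  then show "?\<sigma> permutes {..<m}" by (rule bij_imp_permutes) auto
  show "ks = map ?\<sigma> [0..<m]" using len by (auto intro!: nth_equalityI)
qed

lemma wedge_map_letters:
  assumes "\<sigma> permutes {..<m}"
  shows "wedge (map \<theta> (map \<sigma> [0..<m])) t V = of_int (sign \<sigma>) * form_det m (\<lambda>k. \<theta> k t) V"
  unfolding wedge_eq_form_det
  by (subst form_det_permute[OF assms, symmetric]) (auto intro!: form_det_cong)

section \<open>Arrangements of the integration variables\<close>

text \<open>
  The pairs \<open>(I, \<sigma>)\<close> with \<open>\<sigma> \<in> \<Sigma>(I)\<close> correspond to the arrangements of the letters \<open>0, \<dots>, m - 1\<close> into lists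
  \<open>J\<^sub>j\<close>; the form \<open>(-1)\<^bsup>|\<sigma>|\<^esup> \<omega>\<^bsub>I,\<sigma>\<^esub>\<close> only depends on \<open>J\<close>.
\<close>

definition arrangements :: "nat set \<Rightarrow> ('n::finite \<Rightarrow> nat list) set" where
  "arrangements A = {J. (\<forall>j. distinct (J j)) \<and> (\<forall>i j. i \<noteq> j \<longrightarrow> set (J i) \<inter> set (J j) = {}) \<and> (\<Union>j. set (J j)) = A}"

definition rho_arr :: "complex^'n \<Rightarrow> point \<Rightarrow> ('n::finite \<Rightarrow> nat list) \<Rightarrow> complex" where
  "rho_arr z t J = (\<Prod>j\<in>UNIV. rho t (J j) (z $ j))"

text \<open>The factors of \<open>rho\<close>, and likewise the d log's of omega, indexed by
  letters: each letter is paired with its successor, the last one with z_j. Letters off the list get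
  the dummy value \<open>TZ k j\<close>.\<close>

fun chain_fun :: "nat list \<Rightarrow> 'n \<Rightarrow> nat \<Rightarrow> 'n diff_fun" where
  "chain_fun [] j k = TZ k j"
| "chain_fun (a # w) j k = (if k = a then (if w = [] then TZ a j else TT a (hd w)) else chain_fun w j k)"

definition row :: "('n::finite \<Rightarrow> nat list) \<Rightarrow> nat \<Rightarrow> 'n diff_fun" where
  "row J k = (let j = (THE j. k \<in> set (J j)) in chain_fun (J j) j k)"

lemma row_eq: "J \<in> arrangements A \<Longrightarrow> k \<in> set (J j) \<Longrightarrow> row J k = chain_fun (J j) j k"
proof -
  assume "J \<in> arrangements A" "k \<in> set (J j)"
  then have "(THE j. k \<in> set (J j)) = j" by (intro the_equality) (auto simp: arrangements_def)
  then show ?thesis by (simp add: row_def)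
qed

lemma omega_functions_eq: "distinct w \<Longrightarrow> master_function.omega_functions w j = map (chain_fun w j) w"
proof (induction w rule: induct_list012)
  case (3 a b w)
  have "map (chain_fun (a # b # w) j) (b # w) = map (chain_fun (b # w) j) (b # w)"
    using 3(3) by (intro map_cong) auto
  with 3 show ?case by (simp add: master_function.omega_functions.simps del: chain_fun.simps) simp
qed (simp_all add: master_function.omega_functions.simps)

lemma chain_fun_nth: "distinct w \<Longrightarrow> Suc q < length w \<Longrightarrow> chain_fun w j (w ! q) = TT (w ! q) (w ! Suc q)"
proof (induction w arbitrary: q)
  case (Cons a w)
  then show ?case by (cases q) (auto simp: hd_conv_nth in_set_conv_nth)
qed simp

lemma chain_fun_last: "distinct w \<Longrightarrow> w \<noteq> [] \<Longrightarrow> chain_fun w j (last w) = TZ (last w) j"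
proof (induction w)
  case (Cons a w)
  then show ?case by (cases "w = []") auto
qed simp

lemma chain_fun_butlast:
  assumes "distinct w" "k \<in> set w" "k \<noteq> last w"
  obtains l where "l \<in> set w" "l \<noteq> k" "chain_fun w j k = TT k l"
proof -
  obtain q where q: "q < length w" "k = w ! q" using assms(2) by (metis in_set_conv_nth)
  have "Suc q < length w"
    using q assms(3) by (metis Suc_lessI diff_Suc_1 last_conv_nth length_0_conv less_nat_zero_code)
  with q assms(1) chain_fun_nth[OF assms(1), of q j] show thesis
    by (intro that[of "w ! Suc q"]) (auto simp: nth_eq_iff_index_eq)
qed

lemma rho_eq_prod: "distinct w \<Longrightarrow> (\<Prod>k\<in>set w. 1 / dval z (chain_fun w j k) t) = rho t w (z $ j)"
proof (induction w)
  case (Cons a w)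
  have "(\<Prod>k\<in>set w. 1 / dval z (chain_fun (a # w) j k) t) = (\<Prod>k\<in>set w. 1 / dval z (chain_fun w j k) t)"
    using Cons(2) by (intro prod.cong) auto
  also have "\<dots> = rho t w (z $ j)" using Cons by simp
  finally have tail: "(\<Prod>k\<in>set w. 1 / dval z (chain_fun (a # w) j k) t) = rho t w (z $ j)" .
  have "(\<Prod>k\<in>set (a # w). 1 / dval z (chain_fun (a # w) j k) t)
      = 1 / dval z (chain_fun (a # w) j a) t * rho t w (z $ j)"
    using Cons(2) tail by (simp del: chain_fun.simps)
  then show ?case using rho_append[of w t "[a]" "z $ j"] by (cases "w = []") auto
qed simp

text \<open>Only the factor of the last letter involves \<open>j\<close>, and this factor is the one
  left out; hence \<open>j\<close> is arbitrary.\<close>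

lemma rho0_eq_prod:
  assumes "distinct w" "w \<noteq> []"
  shows "(\<Prod>k\<in>set w - {last w}. 1 / dval z (chain_fun w j k) t) = rho0 t w"
  using assms
proof (induction w)
  case (Cons a w)
  show ?case
  proof (cases "w = []")
    case True
    then show ?thesis by (simp add: rho0_def)
  next
    case False
    have "set (a # w) - {last (a # w)} = insert a (set w - {last w})"
      using False Cons(2) last_in_set[OF False] by auto
    moreover have "(\<Prod>k\<in>set w - {last w}. 1 / dval z (chain_fun (a # w) j k) t) =
        (\<Prod>k\<in>set w - {last w}. 1 / dval z (chain_fun w j k) t)"
      by (rule prod.cong[OF HOL.refl]) (use Cons(2) in auto)
    moreover have "\<dots> = rho0 t w" using Cons False by simp
    ultimately show ?thesis
      using False Cons(2) rho0_append[OF False, of t "[a]"] by (simp del: chain_fun.simps) simp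
  qed
qed simp

lemma dlog_eq: "dlog z H t = (\<lambda>w. 1 / dval z H t * ddiff H w)"
  by (simp add: dlog_def fun_eq_iff)

lemma ddiff_eq: "ddiff (TT k l) = (\<lambda>x. coord k x - coord l x)" "ddiff (TZ k j) = coord k"
  by (simp_all add: fun_eq_iff coord_def)

lemma arrangementsD:
  assumes "J \<in> arrangements A"
  shows "distinct (J j)" "set (J j) \<subseteq> A" "i \<noteq> j \<Longrightarrow> set (J i) \<inter> set (J j) = {}" "(\<Union>j. set (J j)) = A"
  using assms by (auto simp: arrangements_def)

lemma prod_arrangement:
  fixes J :: "'n::finite \<Rightarrow> nat list"
  assumes "J \<in> arrangements A"
  shows "(\<Prod>k\<in>A. g k) = (\<Prod>j\<in>UNIV. \<Prod>k\<in>set (J j). g k)"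
  using assms by (subst prod.UNION_disjoint[symmetric]) (auto simp: arrangements_def)

lemma rho_arr_eq_prod:
  assumes "J \<in> arrangements A"
  shows "(\<Prod>k\<in>A. 1 / dval z (row J k) t) = rho_arr z t J"
  unfolding prod_arrangement[OF assms] rho_arr_def
proof (rule prod.cong[OF HOL.refl])
  fix j
  have "(\<Prod>k\<in>set (J j). 1 / dval z (row J k) t) = (\<Prod>k\<in>set (J j). 1 / dval z (chain_fun (J j) j k) t)"
    by (rule prod.cong[OF HOL.refl]) (simp only: row_eq[OF assms, of _ j])
  then show "(\<Prod>k\<in>set (J j). 1 / dval z (row J k) t) = rho t (J j) (z $ j)"
    unfolding rho_eq_prod[OF arrangementsD(1)[OF assms]] .
qed

text \<open>The lists are treated one after the other, \<open>X\<close> being the set of those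
  already done. Rows outside \<open>A\<close> stay as they are, which leaves room for one further
  chain.\<close>

lemma form_det_arrangement:
  fixes J :: "'n::finite \<Rightarrow> nat list"
  assumes J: "J \<in> arrangements A" and A: "A \<subseteq> {..<m}"
    and \<theta>: "\<And>k. k \<in> A \<Longrightarrow> \<theta> k = ddiff (row J k)"
  shows "form_det m \<theta> V = form_det m (\<lambda>k. if k \<in> A then coord k else \<theta> k) V"
proof -
  have "form_det m \<theta> V = form_det m (\<lambda>k. if k \<in> (\<Union>j\<in>X. set (J j)) then coord k else \<theta> k) V" for X
    using finite[of X]
  proof (induction X rule: finite_induct)
    case (insert j X)
    let ?\<theta> = "\<lambda>k. if k \<in> (\<Union>j\<in>X. set (J j)) then coord k else \<theta> k"
    have notin: "k \<notin> (\<Union>j\<in>X. set (J j))" if "k \<in> set (J j)" for k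
    proof
      assume "k \<in> (\<Union>j\<in>X. set (J j))"
      then obtain i where "i \<in> X" "k \<in> set (J i)" by auto
      with that insert.hyps(2) arrangementsD(3)[OF J, of i j] show False by auto
    qed
    have row: "?\<theta> k = ddiff (chain_fun (J j) j k)" if "k \<in> set (J j)" for k
      using notin[OF that] \<theta>[of k] arrangementsD(2)[OF J, of j] that row_eq[OF J that] by auto
    have "form_det m ?\<theta> V = form_det m (\<lambda>k. if k \<in> set (J j) then coord k else ?\<theta> k) V"
    proof (rule form_det_chain)
      show "distinct (J j)" "set (J j) \<subseteq> {..<m}"
        by (rule arrangementsD(1)[OF J], rule subset_trans[OF arrangementsD(2)[OF J] A])
      show "?\<theta> (J j ! q) = (\<lambda>x. coord (J j ! q) x - coord (J j ! Suc q) x)" if "Suc q < length (J j)" for q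
        unfolding row[OF nth_mem[OF Suc_lessD[OF that]]] chain_fun_nth[OF arrangementsD(1)[OF J] that] by (rule ddiff_eq)
      show "?\<theta> (last (J j)) = coord (last (J j))" if "J j \<noteq> []"
        unfolding row[OF last_in_set[OF that]] chain_fun_last[OF arrangementsD(1)[OF J] that] by (rule ddiff_eq)
    qed
    also have "\<dots> = form_det m (\<lambda>k. if k \<in> (\<Union>j\<in>insert j X. set (J j)) then coord k else \<theta> k) V"
      by (rule arg_cong[where f = "\<lambda>\<theta>. form_det m \<theta> V"]) (auto simp: fun_eq_iff)
    finally show ?case using insert.IH by simp
  qed simp
  from this[of UNIV] show ?thesis using arrangementsD(4)[OF J] by simp
qed

lemma form_det_rows:
  assumes J: "J \<in> arrangements {..<m}"
  shows "form_det m (\<lambda>k. dlog z (row J k) t) V = rho_arr z t J * form_det m coord V"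
proof -
  have "form_det m (\<lambda>k. dlog z (row J k) t) V =
      (\<Prod>k<m. 1 / dval z (row J k) t) * form_det m (\<lambda>k. ddiff (row J k)) V"
    unfolding dlog_eq by (rule form_det_scale)
  also have "form_det m (\<lambda>k. ddiff (row J k)) V = form_det m coord V"
    by (subst form_det_arrangement[OF J]) (auto intro: form_det_cong)
  finally show ?thesis by (simp only: rho_arr_eq_prod[OF J])
qed

text \<open>The differences inside \<open>p\<close> and those of \<open>J\<close> leave the row of
  \<open>last p\<close> free, and \<open>\<zeta>\<close> takes it. What survives of
  \<open>\<zeta>\<close> is its value on the vector that moves all letters of \<open>p\<close> at
  the same speed. It will be applied to d log \<Phi>.\<close>

lemma form_det_rows_chain:
  assumes J: "J \<in> arrangements ({..<m} - set p)" and p: "distinct p" "p \<noteq> []" "set p \<subseteq> {..<m}"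
    and \<zeta>: "\<And>w. \<zeta> w = (\<Sum>i<m. b i * w i)"
  shows "form_det m (\<lambda>k. if k = last p then \<zeta> else if k \<in> set p then dlog z (chain_fun p j k) t else dlog z (row J k) t) V
    = (\<Sum>i\<in>set p. b i) * (rho0 t p * rho_arr z t J) * form_det m coord V"
proof -
  let ?g = "\<lambda>k. if k = last p then 1 else if k \<in> set p then 1 / dval z (chain_fun p j k) t else 1 / dval z (row J k) t"
  let ?\<theta> = "\<lambda>k. if k = last p then \<zeta> else if k \<in> set p then ddiff (chain_fun p j k) else ddiff (row J k)"
  let ?A = "{..<m} - set p"
  let ?\<theta>' = "\<lambda>k. if k \<in> ?A then coord k else ?\<theta> k"
  have last: "last p \<in> set p" "last p < m" using p by (auto intro: last_in_set dest!: subsetD)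
  have "form_det m (\<lambda>k. if k = last p then \<zeta> else if k \<in> set p then dlog z (chain_fun p j k) t else dlog z (row J k) t) V
      = form_det m (\<lambda>k w. ?g k * ?\<theta> k w) V"
    by (rule form_det_cong) (auto simp: dlog_eq)
  also have "\<dots> = (\<Prod>k<m. ?g k) * form_det m ?\<theta> V" by (rule form_det_scale)
  also have "(\<Prod>k<m. ?g k) = (\<Prod>k\<in>set p. ?g k) * (\<Prod>k\<in>?A. ?g k)"
  proof -
    have "{..<m} = set p \<union> ?A" using p by auto
    then show ?thesis by (metis (no_types, lifting) Diff_disjoint finite_Diff finite_lessThan finite_set prod.union_disjoint)
  qed
  also have "(\<Prod>k\<in>set p. ?g k) = (\<Prod>k\<in>set p - {last p}. 1 / dval z (chain_fun p j k) t)"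
    using last by (subst prod.remove[of _ "last p"]) auto
  also have "\<dots> = rho0 t p" by (rule rho0_eq_prod[OF p(1,2)])
  also have "(\<Prod>k\<in>?A. ?g k) = (\<Prod>k\<in>?A. 1 / dval z (row J k) t)" using last by (intro prod.cong[OF HOL.refl]) auto
  also have "\<dots> = rho_arr z t J" by (rule rho_arr_eq_prod[OF J])
  also have "form_det m ?\<theta> V = form_det m ?\<theta>' V"
    using last by (intro form_det_arrangement[OF J]) auto
  also have "\<dots> = (\<Sum>i\<in>set p. b i) * form_det m coord V"
  proof (rule form_det_chain_end[OF p(1,3,2)])
    fix q assume q: "Suc q < length p"
    have "p ! q \<noteq> last p"
      using q p by (simp add: last_conv_nth nth_eq_iff_index_eq)
    moreover have "p ! q \<in> set p" using q by simp
    ultimately show "?\<theta>' (p ! q) = (\<lambda>x. coord (p ! q) x - coord (p ! Suc q) x)"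
      by (simp add: chain_fun_nth[OF p(1) q] ddiff_eq)
  qed (use last in \<open>auto simp: \<zeta> fun_eq_iff coord_def\<close>)
  finally show ?thesis by (simp add: mult_ac)
qed

section \<open>Arrangements as pairs of a sequence and a permutation\<close>

lemma concat_intervals:
  assumes "\<And>us x vs. xs = us @ x # vs \<Longrightarrow> g x = (\<Sum>y\<leftarrow>us. n y)"
  shows "concat (map (\<lambda>x. [g x..<g x + n x]) xs) = [0..<(\<Sum>y\<leftarrow>xs. n y)]"
  using assms
proof (induction xs rule: rev_induct)
  case (snoc x xs)
  have "concat (map (\<lambda>x. [g x..<g x + n x]) xs) = [0..<(\<Sum>y\<leftarrow>xs. n y)]"
    using snoc.prems by (intro snoc.IH) (metis append.assoc append_Cons)
  moreover have "g x = (\<Sum>y\<leftarrow>xs. n y)" using snoc.prems[of xs x "[]"] by simp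
  ultimately show ?case using upt_add_eq_append[of 0 "\<Sum>y\<leftarrow>xs. n y" "n x"] by simp
qed simp

abbreviation all_indices :: "'n::{finite,linorder} list" where
  "all_indices \<equiv> sorted_list_of_set UNIV"

definition block_start :: "('n::{finite,linorder} \<Rightarrow> nat) \<Rightarrow> 'n \<Rightarrow> nat" where
  "block_start n j = (\<Sum>i\<in>{..<j}. n i)"

lemma block_start_prefix:
  fixes n :: "'n::{finite,linorder} \<Rightarrow> nat"
  assumes "all_indices = us @ j # vs"
  shows "block_start n j = (\<Sum>i\<leftarrow>us. n i)"
proof -
  have srt: "sorted (us @ j # vs)" "distinct (us @ j # vs)" "set (us @ j # vs) = UNIV"
    unfolding assms[symmetric] by simp_all
  have "set us = {..<j}"
  proof
    show "set us \<subseteq> {..<j}" using srt by (auto simp: sorted_append order.order_iff_strict)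
    show "{..<j} \<subseteq> set us"
    proof
      fix i assume "i \<in> {..<j}"
      moreover have "i \<in> set us \<or> i = j \<or> i \<in> set vs" using srt(3) by auto
      ultimately show "i \<in> set us" using srt(1) by (auto simp: sorted_append)
    qed
  qed
  then show ?thesis using srt(2) unfolding block_start_def
    by (metis distinct_append sum_list_distinct_conv_sum_set)
qed

lemma sum_list_all_indices: "(\<Sum>i\<leftarrow>(all_indices :: 'n::{finite,linorder} list). g i) = (\<Sum>i\<in>UNIV. g i)"
  by (simp add: sum_list_distinct_conv_sum_set)

definition blocks :: "('n::{finite,linorder} \<Rightarrow> nat) \<Rightarrow> (nat \<Rightarrow> nat) \<Rightarrow> 'n \<Rightarrow> nat list" where
  "blocks n \<sigma> j = map \<sigma> [block_start n j..<block_start n j + n j]"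

lemma offset_eq: "master_function.offset I = block_start (\<lambda>j. length (I j))"
  by (simp add: fun_eq_iff block_start_def master_function.offset_def)

lemma concat_blocks:
  "concat (map (blocks n \<sigma>) all_indices) = map \<sigma> [0..<(\<Sum>j\<in>UNIV. n j)]"
proof -
  have "concat (map (blocks n \<sigma>) all_indices) =
      map \<sigma> (concat (map (\<lambda>j. [block_start n j..<block_start n j + n j]) all_indices))"
    by (simp add: map_concat blocks_def[abs_def] comp_def)
  also have "\<dots> = map \<sigma> [0..<(\<Sum>i\<leftarrow>all_indices. n i)]"
    by (subst concat_intervals[where n = n]) (simp_all add: block_start_prefix)
  finally show ?thesis by (simp only: sum_list_all_indices)
qed

text \<open>Read in the order of the indices, the lists enumerate the letters without repetition;
  for the letters \<open>{..<m}\<close> such an enumeration is a permutation.\<close>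

lemma arrangement_concat:
  fixes J :: "'n::{finite,linorder} \<Rightarrow> nat list"
  shows "J \<in> arrangements A \<longleftrightarrow> distinct (concat (map J all_indices)) \<and> set (concat (map J all_indices)) = A"
proof -
  have d: "distinct (concat (map J all_indices)) \<longleftrightarrow>
      (\<forall>j. distinct (J j)) \<and> (\<forall>i j. i \<noteq> j \<longrightarrow> set (J i) \<inter> set (J j) = {})"
  proof -
    have "distinct (concat (map J xs)) \<longleftrightarrow>
      (\<forall>j\<in>set xs. distinct (J j)) \<and> (\<forall>i\<in>set xs. \<forall>j\<in>set xs. i \<noteq> j \<longrightarrow> set (J i) \<inter> set (J j) = {})"
      if "distinct xs" for xs
      using that
    proof (induction xs)
      case (Cons a xs)
      then have IH: "distinct (concat (map J xs)) \<longleftrightarrow>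
        (\<forall>j\<in>set xs. distinct (J j)) \<and> (\<forall>i\<in>set xs. \<forall>j\<in>set xs. i \<noteq> j \<longrightarrow> set (J i) \<inter> set (J j) = {})"
        and a: "a \<notin> set xs" by simp_all
      have dc: "distinct (concat (map J (a # xs))) \<longleftrightarrow>
        distinct (J a) \<and> distinct (concat (map J xs)) \<and> (\<forall>j\<in>set xs. set (J a) \<inter> set (J j) = {})" by auto
      have gen: "(P a \<and> ((\<forall>j\<in>S. P j) \<and> (\<forall>i\<in>S. \<forall>j\<in>S. i \<noteq> j \<longrightarrow> d i j)) \<and> (\<forall>j\<in>S. d a j)) \<longleftrightarrow>
        (\<forall>j\<in>insert a S. P j) \<and> (\<forall>i\<in>insert a S. \<forall>j\<in>insert a S. i \<noteq> j \<longrightarrow> d i j)"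
        if "a \<notin> S" "\<And>i j. d i j = d j i" for P d and S :: "'n set"
        using that by (smt (verit) insert_iff)
      show ?case unfolding list.set
        by (rule HOL.trans[OF dc[unfolded IH] gen]) (use a in auto)
    qed simp
    from this[of all_indices] show ?thesis by simp
  qed
  show ?thesis unfolding d arrangements_def by auto
qed

lemma block_of_concat:
  fixes J :: "'n::{finite,linorder} \<Rightarrow> nat list"
  assumes "concat (map J all_indices) = map \<sigma> [0..<m]"
  shows "blocks (\<lambda>j. length (J j)) \<sigma> = J"
proof
  fix j :: 'n
  have "j \<in> set all_indices" by simp
  then obtain us vs where uv: "all_indices = us @ j # vs" by (meson split_list)
  have off: "block_start (\<lambda>j. length (J j)) j = length (concat (map J us))"
    unfolding block_start_prefix[OF uv] by (simp add: length_concat comp_def)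
  have len: "length (concat (map J all_indices)) = m" using assms by simp
  have "take (length (J j)) (drop (length (concat (map J us))) (concat (map J all_indices))) = J j"
    by (simp add: uv)
  then have "J j = take (length (J j)) (drop (length (concat (map J us))) (map \<sigma> [0..<m]))" using assms by simp
  also have "\<dots> = blocks (\<lambda>j. length (J j)) \<sigma> j"
    using len by (simp add: blocks_def off take_map drop_map uv)
  finally show "blocks (\<lambda>j. length (J j)) \<sigma> j = J j" by simp
qed

text \<open>Sorting the d log's by their variables costs the sign of \<sigma>, and the sign in the
  definition of u_I cancels it. What remains depends on the arrangement alone: the function
  \<open>rho_arr\<close> times the standard form dt_0 ... dt_(m-1), whose value is the determinant
  of \<open>coord\<close>.\<close>

lemma omega_eq_rho:
  fixes I :: "'n::{finite,linorder} \<Rightarrow> 'r::{finite,linorder} list"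
  assumes "\<sigma> permutes {..<m}" "(\<Sum>j\<in>UNIV. length (I j)) = m"
  shows "blocks (\<lambda>j. length (I j)) \<sigma> \<in> arrangements {..<m}"
    and "of_int (sign \<sigma>) * master_function.omega z I \<sigma> t V = rho_arr z t (blocks (\<lambda>j. length (I j)) \<sigma>) * form_det m coord V"
proof -
  have ks: "concat (map (blocks (\<lambda>j. length (I j)) \<sigma>) all_indices) = map \<sigma> [0..<m]" using concat_blocks[of "\<lambda>j. length (I j)" \<sigma>] assms(2) by simp
  show J: "blocks (\<lambda>j. length (I j)) \<sigma> \<in> arrangements {..<m}"
    unfolding arrangement_concat ks using permutes_image[OF assms(1)] permutes_inj_on[OF assms(1)]
    by (auto simp: distinct_map atLeast0LessThan)
  let ?J = "blocks (\<lambda>j. length (I j)) \<sigma>"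
  have "concat (map (\<lambda>j. master_function.omega_functions (blocks (\<lambda>j. length (I j)) \<sigma> j) j) xs) = map (row (blocks (\<lambda>j. length (I j)) \<sigma>)) (concat (map (blocks (\<lambda>j. length (I j)) \<sigma>) xs))" for xs
  proof (induction xs)
    case (Cons j xs)
    have "map (chain_fun (?J j) j) (?J j) = map (row ?J) (?J j)"
      by (intro map_cong HOL.refl) (simp add: row_eq[OF J, of _ j])
    with Cons show ?case by (simp add: omega_functions_eq[OF arrangementsD(1)[OF J]])
  qed simp
  note rows = this[of all_indices]
  have "master_function.omega z I \<sigma> = wedge (map (dlog z) (concat (map (\<lambda>j. master_function.omega_functions (?J j) j) all_indices)))"
    by (simp add: master_function.omega_def offset_eq blocks_def)
  also have "\<dots> = wedge (map (\<lambda>k. dlog z (row ?J k)) (map \<sigma> [0..<m]))"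
    unfolding rows ks by (simp add: comp_def)
  finally have omega: "master_function.omega z I \<sigma> = wedge (map (\<lambda>k. dlog z (row ?J k)) (map \<sigma> [0..<m]))" .
  have "master_function.omega z I \<sigma> t V = of_int (sign \<sigma>) * (rho_arr z t (blocks (\<lambda>j. length (I j)) \<sigma>) * form_det m coord V)"
    unfolding omega wedge_map_letters[OF assms(1)] form_det_rows[OF J] ..
  then show "of_int (sign \<sigma>) * master_function.omega z I \<sigma> t V = rho_arr z t (blocks (\<lambda>j. length (I j)) \<sigma>) * form_det m coord V"
    by (simp add: sign_def)
qed

lemma sum_length_sequences:
  fixes I :: "'n::finite \<Rightarrow> 'r::finite list"
  assumes "I \<in> sequences mm"
  shows "(\<Sum>j\<in>UNIV. length (I j)) = sum mm UNIV"
proof -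
  have "(\<Sum>j\<in>UNIV. length (I j)) = (\<Sum>j\<in>UNIV. \<Sum>i\<in>UNIV. count_list (I j) i)"
    by (simp add: sum_count_set)
  also have "\<dots> = (\<Sum>i\<in>UNIV. \<Sum>j\<in>UNIV. count_list (I j) i)" by (rule sum.swap)
  finally show ?thesis using assms by (simp add: sequences_def)
qed

lemma finite_sequences: "finite (sequences mm :: ('n::finite \<Rightarrow> 'r::finite list) set)"
proof (rule finite_subset)
  show "sequences mm \<subseteq> Pi\<^sub>E UNIV (\<lambda>j :: 'n. {w :: 'r list. set w \<subseteq> UNIV \<and> length w \<le> sum mm UNIV})"
  proof
    fix I :: "'n \<Rightarrow> 'r list" assume I: "I \<in> sequences mm"
    have "length (I j) \<le> sum mm UNIV" for j
      unfolding sum_length_sequences[OF I, symmetric] by (rule member_le_sum) auto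
    then show "I \<in> Pi\<^sub>E UNIV (\<lambda>j :: 'n. {w :: 'r list. set w \<subseteq> UNIV \<and> length w \<le> sum mm UNIV})" by auto
  qed
  show "finite (Pi\<^sub>E UNIV (\<lambda>j :: 'n. {w :: 'r list. set w \<subseteq> UNIV \<and> length w \<le> sum mm UNIV}))"
    by (intro finite_PiE finite_lists_length_le) auto
qed

text \<open>An arrangement determines the sequence by colouring its letters and the permutation by
  concatenating its lists. The sequence has the right multiplicities because each variable occurs
  exactly once and \<open>c\<close> takes the value i exactly m_i times.\<close>

lemma sum_sequences_permutations:
  fixes G :: "('n::{finite,linorder} \<Rightarrow> nat list) \<Rightarrow> 'a::comm_monoid_add"
  assumes c: "is_coloring (mm :: 'r::{finite,linorder} \<Rightarrow> nat) c" and m: "m = sum mm UNIV"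
  shows "(\<Sum>I\<in>sequences mm. \<Sum>\<sigma>\<in>master_function.Sigma_perms m c I. G (blocks (\<lambda>j. length (I j)) \<sigma>)) = (\<Sum>J\<in>arrangements {..<m}. G J)"
proof -
  have fin: "finite (master_function.Sigma_perms m c I)" for I :: "'n \<Rightarrow> 'r list"
    by (rule finite_subset[OF _ finite_permutations[of "{..<m}"]]) (auto simp: master_function.Sigma_perms_def)
  have col: "map c (blocks (\<lambda>j. length (I j)) \<sigma> j) = I j" if "\<sigma> \<in> master_function.Sigma_perms m c I" for I :: "'n \<Rightarrow> 'r list" and \<sigma> j
  proof (rule nth_equalityI)
    show "length (map c (blocks (\<lambda>j. length (I j)) \<sigma> j)) = length (I j)" by (simp add: blocks_def)
    fix l assume "l < length (map c (blocks (\<lambda>j. length (I j)) \<sigma> j))"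
    then have l: "l < length (I j)" by (simp add: blocks_def)
    then have "c (\<sigma> (master_function.offset I j + l)) = I j ! l"
      using that by (simp add: master_function.Sigma_perms_def)
    then show "map c (blocks (\<lambda>j. length (I j)) \<sigma> j) ! l = I j ! l"
      unfolding offset_eq using l by (simp add: blocks_def)
  qed
  have "(\<Sum>I\<in>sequences mm. \<Sum>\<sigma>\<in>master_function.Sigma_perms m c I. G (blocks (\<lambda>j. length (I j)) \<sigma>)) =
      (\<Sum>(I, \<sigma>)\<in>Sigma (sequences mm :: ('n \<Rightarrow> 'r list) set) (master_function.Sigma_perms m c). G (blocks (\<lambda>j. length (I j)) \<sigma>))"
    by (rule sum.Sigma) (auto simp: fin finite_sequences)
  also have "\<dots> = (\<Sum>J\<in>arrangements {..<m}. G J)"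
  proof -
    let ?D = "Sigma (sequences mm :: ('n \<Rightarrow> 'r list) set) (master_function.Sigma_perms m c)"
    have bij: "bij_betw (\<lambda>(I, \<sigma>). blocks (\<lambda>j. length (I j)) \<sigma>) ?D (arrangements {..<m})"
    proof (rule bij_betwI')
      fix x y assume xy: "x \<in> ?D" "y \<in> ?D"
      obtain I \<sigma> I' \<sigma>' where x: "x = (I, \<sigma>)" and y: "y = (I', \<sigma>')" by (metis prod.exhaust)
      have *: "I \<in> sequences mm" "\<sigma> permutes {..<m}" "\<sigma> \<in> master_function.Sigma_perms m c I"
        "I' \<in> sequences mm" "\<sigma>' permutes {..<m}" "\<sigma>' \<in> master_function.Sigma_perms m c I'"
        using xy by (auto simp: x y master_function.Sigma_perms_def)
      show "((case x of (I, \<sigma>) \<Rightarrow> blocks (\<lambda>j. length (I j)) \<sigma>) = (case y of (I, \<sigma>) \<Rightarrow> blocks (\<lambda>j. length (I j)) \<sigma>)) = (x = y)"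
      proof
        assume eq: "(case x of (I, \<sigma>) \<Rightarrow> blocks (\<lambda>j. length (I j)) \<sigma>) = (case y of (I, \<sigma>) \<Rightarrow> blocks (\<lambda>j. length (I j)) \<sigma>)"
        have "I = I'"
        proof
          fix j show "I j = I' j" using col[OF *(3), of j] col[OF *(6), of j] eq by (simp add: x y)
        qed
        have "blocks (\<lambda>j. length (I j)) \<sigma> = blocks (\<lambda>j. length (I' j)) \<sigma>'" using eq by (simp add: x y)
        then have "map \<sigma> [0..<\<Sum>j\<in>UNIV. length (I j)] = map \<sigma>' [0..<\<Sum>j\<in>UNIV. length (I' j)]"
          by (metis concat_blocks)
        then have "map \<sigma> [0..<m] = map \<sigma>' [0..<m]"
          unfolding sum_length_sequences[OF *(1)] sum_length_sequences[OF *(4)] m .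
        then have "\<sigma> a = \<sigma>' a" if "a < m" for a using that by simp
        moreover have "\<sigma> a = \<sigma>' a" if "\<not> a < m" for a
          using *(2,5) that by (simp add: permutes_not_in)
        ultimately have "\<sigma> = \<sigma>'" by blast
        with \<open>I = I'\<close> show "x = y" by (simp add: x y)
      qed simp
    next
      fix x assume "x \<in> ?D"
      then show "(case x of (I, \<sigma>) \<Rightarrow> blocks (\<lambda>j. length (I j)) \<sigma>) \<in> arrangements {..<m}"
        by (auto simp: master_function.Sigma_perms_def m sum_length_sequences intro!: omega_eq_rho(1))
    next
      fix J :: "'n \<Rightarrow> nat list" assume J: "J \<in> arrangements {..<m}"
      let ?I = "\<lambda>j. map c (J j)"
      from J obtain \<sigma> where \<sigma>: "\<sigma> permutes {..<m}" "concat (map J all_indices) = map \<sigma> [0..<m]"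
        unfolding arrangement_concat by (metis distinct_list_permutation)
      have B: "blocks (\<lambda>j. length (?I j)) \<sigma> = J" using block_of_concat[OF \<sigma>(2)] by simp
      have cnt: "count_list (map c w) i = card {k \<in> set w. c k = i}" if "distinct w" for w i
        using that
      proof (induction w)
        case (Cons k w)
        have "{l \<in> set (k # w). c l = i} = (if c k = i then insert k {l \<in> set w. c l = i} else {l \<in> set w. c l = i})" by auto
        then show ?case using Cons by auto
      qed simp
      have "?I \<in> sequences mm"
        unfolding sequences_def
      proof (clarify)
        fix i
        have "(\<Sum>j\<in>UNIV. count_list (?I j) i) = (\<Sum>j\<in>UNIV. card {k \<in> set (J j). c k = i})"
          using cnt arrangementsD(1)[OF J] by simp
        also have "\<dots> = card (\<Union>j. {k \<in> set (J j). c k = i})"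
          using J by (intro card_UN_disjoint[symmetric]) (auto simp: arrangements_def)
        also have "(\<Union>j. {k \<in> set (J j). c k = i}) = {k. k < sum mm UNIV \<and> c k = i}"
          using arrangementsD(4)[OF J] m by auto
        also have "card \<dots> = mm i" using c by (simp add: is_coloring_def)
        finally show "(\<Sum>j\<in>UNIV. count_list (?I j) i) = mm i" .
      qed
      moreover have "\<sigma> \<in> master_function.Sigma_perms m c ?I"
      proof -
        have "c (\<sigma> (master_function.offset ?I j + l)) = ?I j ! l" if "l < length (?I j)" for j l
        proof -
          have "?I j ! l = c (blocks (\<lambda>j. length (?I j)) \<sigma> j ! l)" using that B by simp
          also have "\<dots> = c (\<sigma> (master_function.offset ?I j + l))" using that by (simp add: blocks_def offset_eq)
          finally show ?thesis by simp
        qed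
        then show ?thesis using \<sigma>(1) by (auto simp: master_function.Sigma_perms_def)
      qed
      ultimately show "\<exists>x\<in>?D. J = (case x of (I, \<sigma>) \<Rightarrow> blocks (\<lambda>j. length (I j)) \<sigma>)"
        using B by (intro bexI[of _ "(?I, \<sigma>)"]) auto
    qed
    show ?thesis
      using sum.reindex_bij_betw[OF bij, of G] by (simp add: case_prod_unfold)
  qed
  finally show ?thesis .
qed

section \<open>Stokes' theorem for compact twisted cycles\<close>

text \<open>Points of the cube are functions on all natural numbers with the fixed value
  \<open>undefined\<close> from m on. Written as a product over all indices, with singletons from m
  on, the cube is compact by Tychonoff's theorem.\<close>

lemma cube_eq_PiE_UNIV: "cube m = Pi\<^sub>E UNIV (\<lambda>i. if i < m then {0..1} else {undefined})"
proof (intro set_eqI iffI)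
  fix s assume s: "s \<in> cube m"
  have "s i \<in> (if i < m then {0..1} else {undefined})" for i
    using s by (cases "i < m") (simp_all add: cube_def PiE_iff extensional_def)
  then show "s \<in> Pi\<^sub>E UNIV (\<lambda>i. if i < m then {0..1} else {undefined})" by blast
next
  fix s :: "nat \<Rightarrow> real" assume s: "s \<in> Pi\<^sub>E UNIV (\<lambda>i. if i < m then {0..1} else {undefined})"
  have i: "s i \<in> (if i < m then {0..1} else {undefined})" for i
    by (rule PiE_mem[OF s]) simp
  have "s i \<in> {0..1}" if "i < m" for i using i[of i] that by simp
  moreover have "s i = undefined" if "\<not> i < m" for i using i[of i] that by simp
  ultimately show "s \<in> cube m" by (simp add: cube_def PiE_iff extensional_def)
qed

lemma compact_cube: "compact (cube m)"
proof -
  have "compactin (product_topology (\<lambda>i. euclidean) UNIV) (Pi\<^sub>E UNIV (\<lambda>i. if i < m then {0..1::real} else {undefined}))"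
    unfolding compactin_PiE compactin_euclidean_iff
  proof (intro disjI2 ballI)
    fix i show "compact (if i < m then {0..1::real} else {undefined})" by (cases "i < m") simp_all
  qed
  then show ?thesis unfolding cube_eq_PiE_UNIV euclidean_product_topology compactin_euclidean_iff .
qed

lemma open_cube_subset: "open_cube m \<subseteq> cube m"
  unfolding open_cube_def cube_def by (rule PiE_mono) auto

lemma cube_upd: "s \<in> cube m \<Longrightarrow> l < m \<Longrightarrow> x \<in> {0..1} \<Longrightarrow> s(l := x) \<in> cube m"
  unfolding cube_def PiE_iff extensional_def by simp

lemma cubeD: "s \<in> cube m \<Longrightarrow> l < m \<Longrightarrow> s l \<in> {0..1}"
  unfolding cube_def by (rule PiE_mem[where S = "{..<m}"]) simp_all

lemma continuous_on_fun_upd: "continuous_on UNIV (\<lambda>x :: real. (s :: nat \<Rightarrow> real)(l := x))"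
proof (rule continuous_on_coordinatewise_then_product)
  fix i show "continuous_on UNIV (\<lambda>x :: real. (s(l := x)) i)" by (cases "i = l") simp_all
qed

lemma continuous_on_cube_line:
  assumes "continuous_on (cube m) F" "s \<in> cube m" "l < m"
  shows "continuous_on {0..1} (\<lambda>x. F (s(l := x)))"
  using assms by (intro continuous_on_compose2[OF assms(1) continuous_on_subset[OF continuous_on_fun_upd]])
    (auto intro: cube_upd)

lemma continuous_on_cube_plane:
  assumes "continuous_on (cube m) F" "s \<in> cube m" "l < m" "l' < m"
  shows "continuous_on ({0..1} \<times> {0..1}) (\<lambda>(x, y). F (s(l := x, l' := y)))"
proof -
  have "continuous_on UNIV (\<lambda>p. s(l := fst p, l' := snd p))"
  proof (rule continuous_on_coordinatewise_then_product)
    fix i show "continuous_on UNIV (\<lambda>p. (s(l := fst p, l' := snd p)) i)"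
      by (cases "i = l'"; cases "i = l") (simp_all add: continuous_on_fst continuous_on_snd continuous_on_id)
  qed
  then show ?thesis unfolding case_prod_unfold using assms
    by (intro continuous_on_compose2[OF assms(1) continuous_on_subset[where t = "{0..1} \<times> {0..1}"]])
      (auto intro!: cube_upd)
qed

lemma measurable_open_cube: "open_cube m \<in> sets (Pi\<^sub>M {..<m} (\<lambda>_. lborel))"
  unfolding open_cube_def by (intro sets_PiM_I_finite) auto

lemma emeasure_open_cube: "emeasure (Pi\<^sub>M {..<m} (\<lambda>_. lborel)) (open_cube m) = 1"
proof -
  interpret product_sigma_finite "\<lambda>_ :: nat. lborel :: real measure"
    by unfold_locales
  show ?thesis unfolding open_cube_def by (subst emeasure_PiM) auto
qed

text \<open>Continuity on the cube refers to the product topology on functions of all natural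
  numbers, integration to a product of m copies of Lebesgue measure. This inclusion carries Borel
  measurability from the first setting to the second.\<close>

lemma measurable_PiM_borel: "(\<lambda>s. s) \<in> measurable (Pi\<^sub>M {..<m} (\<lambda>_. lborel)) (borel :: (nat \<Rightarrow> real) measure)"
proof -
  have "(\<lambda>s. s) \<in> measurable (Pi\<^sub>M {..<m} (\<lambda>_. lborel)) (Pi\<^sub>M UNIV (\<lambda>_. borel :: real measure))"
  proof (rule measurable_PiM_single')
    fix i :: nat
    show "(\<lambda>s. s i) \<in> measurable (Pi\<^sub>M {..<m} (\<lambda>_. lborel)) (borel :: real measure)"
    proof (cases "i < m")
      case True
      then have "(\<lambda>s. s i) \<in> measurable (Pi\<^sub>M {..<m} (\<lambda>_. lborel :: real measure)) lborel"
        by (intro measurable_component_singleton) auto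
      then show ?thesis by simp
    next
      case False
      then have "(\<lambda>s. s i) \<in> measurable (Pi\<^sub>M {..<m} (\<lambda>_. lborel)) (borel :: real measure) \<longleftrightarrow>
          (\<lambda>s. undefined) \<in> measurable (Pi\<^sub>M {..<m} (\<lambda>_. lborel :: real measure)) (borel :: real measure)"
        using False by (intro measurable_cong) (simp add: space_PiM PiE_iff extensional_def)
      then show ?thesis by simp
    qed
  qed auto
  then show ?thesis using measurable_cong_sets[OF HOL.refl sets_PiM_equal_borel] by blast
qed

text \<open>Nothing is known about \<open>F\<close> off the closed cube, so measurability is
  obtained for its extension by 0; integrability then follows from boundedness and finite
  measure.\<close>

lemma set_integrable_continuous_cube:
  fixes F :: "(nat \<Rightarrow> real) \<Rightarrow> complex"
  assumes "continuous_on (cube m) F"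
  shows "set_integrable (Pi\<^sub>M {..<m} (\<lambda>_. lborel)) (open_cube m) F"
proof -
  let ?M = "Pi\<^sub>M {..<m} (\<lambda>_. lborel :: real measure)"
  let ?F = "\<lambda>s. indicator (cube m) s *\<^sub>R F s"
  have closed: "closed (cube m)" by (rule compact_imp_closed[OF compact_cube])
  have "?F \<in> borel_measurable borel"
    by (rule borel_measurable_continuous_on_indicator[OF borel_closed[OF closed] assms])
  from measurable_compose[OF measurable_PiM_borel this]
  have meas: "?F \<in> borel_measurable ?M" .
  have "bounded (F ` cube m)" by (intro compact_imp_bounded compact_continuous_image assms compact_cube)
  then obtain b where b: "\<And>s. s \<in> cube m \<Longrightarrow> norm (F s) \<le> b" by (auto simp: bounded_iff)
  have "integrable ?M (\<lambda>s. indicator (open_cube m) s *\<^sub>R ?F s)"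
  proof (rule integrableI_bounded_set_indicator[OF measurable_open_cube meas])
    show "emeasure ?M (open_cube m) < \<infinity>" by (simp add: emeasure_open_cube)
    show "AE s in ?M. s \<in> open_cube m \<longrightarrow> norm (?F s) \<le> b"
      using b open_cube_subset[of m] by (intro AE_I2) (auto simp: indicator_def)
  qed
  moreover have "(\<lambda>s. indicator (open_cube m) s *\<^sub>R ?F s) = (\<lambda>s. indicator (open_cube m) s *\<^sub>R F s)"
  proof
    fix s show "indicator (open_cube m) s *\<^sub>R ?F s = indicator (open_cube m) s *\<^sub>R F s"
      using open_cube_subset[of m] by (cases "s \<in> open_cube m") (auto simp: indicator_def)
  qed
  ultimately show ?thesis by (simp add: set_integrable_def)
qed

text \<open>The map \<open>face\<close> with an arbitrary inserted value in place of 0 or 1: it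
  slices the cube in direction \<open>l\<close>.\<close>

definition insert_coord :: "nat \<Rightarrow> nat \<Rightarrow> real \<Rightarrow> (nat \<Rightarrow> real) \<Rightarrow> nat \<Rightarrow> real" where
  "insert_coord m l x s = (\<lambda>i\<in>{..<m}. if i < l then s i else if i = l then x else s (i - 1))"

lemma face_eq_insert_coord: "face m l \<epsilon> = insert_coord m l (real \<epsilon>)"
  by (simp add: fun_eq_iff face_def insert_coord_def)

lemma insert_coord_simps:
  "i < l \<Longrightarrow> i < m \<Longrightarrow> insert_coord m l x s i = s i"
  "l < m \<Longrightarrow> insert_coord m l x s l = x"
  "l \<le> i \<Longrightarrow> Suc i < m \<Longrightarrow> insert_coord m l x s (Suc i) = s i"
  "\<not> i < m \<Longrightarrow> insert_coord m l x s i = undefined"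
  by (simp_all add: insert_coord_def)

lemma insert_coord_cases:
  fixes i l :: nat
  obtains "i < l" | "i = l" | j where "i = Suc j" "l \<le> j"
  by (cases i l rule: linorder_cases) (auto simp: less_eq_Suc_le dest: Suc_le_D)

lemma insert_coord_upd:
  assumes "l < m"
  shows "(insert_coord m l x s)(l := y) = insert_coord m l y s"
proof
  fix i show "((insert_coord m l x s)(l := y)) i = insert_coord m l y s i"
    using assms by (simp add: insert_coord_def)
qed

lemma insert_coord_mem_PiE_iff:
  assumes l: "l < Suc n" and s: "s \<in> extensional {..<n}"
  shows "insert_coord (Suc n) l x s \<in> Pi\<^sub>E {..<Suc n} A \<longleftrightarrow>
    s \<in> Pi\<^sub>E {..<n} (\<lambda>i. A (if i < l then i else Suc i)) \<and> x \<in> A l"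
proof
  assume L: "insert_coord (Suc n) l x s \<in> Pi\<^sub>E {..<Suc n} A"
  have *: "insert_coord (Suc n) l x s i \<in> A i" if "i < Suc n" for i
    by (rule PiE_mem[OF L]) (simp add: that)
  have "s i \<in> A (if i < l then i else Suc i)" if "i < n" for i
    using *[of i] *[of "Suc i"] that by (cases "i < l") (simp_all add: insert_coord_simps)
  moreover have "x \<in> A l" using *[OF l] l by (simp add: insert_coord_simps)
  ultimately show "s \<in> Pi\<^sub>E {..<n} (\<lambda>i. A (if i < l then i else Suc i)) \<and> x \<in> A l"
    using s by (simp add: PiE_iff)
next
  assume R: "s \<in> Pi\<^sub>E {..<n} (\<lambda>i. A (if i < l then i else Suc i)) \<and> x \<in> A l"
  have *: "s i \<in> A (if i < l then i else Suc i)" if "i < n" for i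
    using R that PiE_mem[of s "{..<n}" "\<lambda>i. A (if i < l then i else Suc i)" i] by simp
  have "insert_coord (Suc n) l x s i \<in> A i" if i: "i < Suc n" for i
  proof (cases i l rule: insert_coord_cases)
    case 1
    then show ?thesis using *[of i] l i by (simp add: insert_coord_simps)
  next
    case 2
    then show ?thesis using R i by (simp add: insert_coord_simps)
  next
    case (3 j)
    then show ?thesis using *[of j] i by (simp add: insert_coord_simps)
  qed
  moreover have "insert_coord (Suc n) l x s \<in> extensional {..<Suc n}"
    by (simp add: insert_coord_def)
  ultimately show "insert_coord (Suc n) l x s \<in> Pi\<^sub>E {..<Suc n} A"
    by (simp add: PiE_iff)
qed

lemma cube_extensional: "s \<in> cube n \<Longrightarrow> s \<in> extensional {..<n}"
  by (simp add: cube_def PiE_iff)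

lemma insert_coord_cube: "s \<in> cube n \<Longrightarrow> x \<in> {0..1} \<Longrightarrow> l < Suc n \<Longrightarrow> insert_coord (Suc n) l x s \<in> cube (Suc n)"
  using insert_coord_mem_PiE_iff[OF _ cube_extensional, of l n s x "\<lambda>_. {0..1}"] by (simp add: cube_def)

lemma insert_coord_open_cube:
  assumes "s \<in> extensional {..<n}" "l < Suc n"
  shows "insert_coord (Suc n) l x s \<in> open_cube (Suc n) \<longleftrightarrow> s \<in> open_cube n \<and> x \<in> {0<..<1}"
  using insert_coord_mem_PiE_iff[OF assms(2,1), of x "\<lambda>_. {0<..<1}"] by (simp add: open_cube_def)

lemma measurable_insert_coord:
  assumes "l < Suc n"
  shows "(\<lambda>(s, x). insert_coord (Suc n) l x s) \<in>
    measurable (Pi\<^sub>M {..<n} (\<lambda>_. lborel) \<Otimes>\<^sub>M lborel) (Pi\<^sub>M {..<Suc n} (\<lambda>_. lborel))"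
proof (rule measurable_PiM_single')
  let ?N = "Pi\<^sub>M {..<n} (\<lambda>_. lborel :: real measure) \<Otimes>\<^sub>M (lborel :: real measure)"
  fix i assume i: "i \<in> {..<Suc n}"
  have comp: "(\<lambda>p. fst p j) \<in> measurable ?N lborel" if "j < n" for j
    by (rule measurable_compose[OF measurable_fst measurable_component_singleton]) (use that in auto)
  have "(\<lambda>p. (case p of (s, x) \<Rightarrow> insert_coord (Suc n) l x s) i) =
      (if i < l then (\<lambda>p. fst p i) else if i = l then snd else (\<lambda>p. fst p (i - 1)))"
    using i by (auto simp: fun_eq_iff insert_coord_def)
  then show "(\<lambda>p. (case p of (s, x) \<Rightarrow> insert_coord (Suc n) l x s) i) \<in> measurable ?N lborel"
    using i assms comp[of i] comp[of "i - 1"] by auto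
qed (auto simp: insert_coord_def space_pair_measure space_PiM)

text \<open>Both measures agree on boxes. This is the form of Fubini's theorem in which an arbitrary
  coordinate \<open>l\<close> can be integrated first.\<close>

lemma PiM_insert_coord:
  assumes l: "l < Suc n"
  shows "distr (Pi\<^sub>M {..<n} (\<lambda>_. lborel) \<Otimes>\<^sub>M lborel) (Pi\<^sub>M {..<Suc n} (\<lambda>_. lborel)) (\<lambda>(s, x). insert_coord (Suc n) l x s)
    = Pi\<^sub>M {..<Suc n} (\<lambda>_. lborel :: real measure)"
proof -
  interpret P: product_sigma_finite "\<lambda>_ :: nat. lborel :: real measure" by unfold_locales
  let ?N = "Pi\<^sub>M {..<n} (\<lambda>_. lborel :: real measure) \<Otimes>\<^sub>M (lborel :: real measure)"
  interpret F: finite_product_sigma_finite "\<lambda>_ :: nat. lborel :: real measure" "{..<n}" by unfold_locales auto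
  interpret pair_sigma_finite "Pi\<^sub>M {..<n} (\<lambda>_. lborel :: real measure)" "lborel :: real measure" by unfold_locales
  show ?thesis
  proof (rule P.PiM_eqI)
    fix A :: "nat \<Rightarrow> real set" assume A: "\<And>i. i \<in> {..<Suc n} \<Longrightarrow> A i \<in> sets lborel"
    let ?k = "\<lambda>i. if i < l then i else Suc i"
    have "emeasure (distr ?N (Pi\<^sub>M {..<Suc n} (\<lambda>_. lborel)) (\<lambda>(s, x). insert_coord (Suc n) l x s)) (Pi\<^sub>E {..<Suc n} A) =
        emeasure ?N ((\<lambda>(s, x). insert_coord (Suc n) l x s) -` Pi\<^sub>E {..<Suc n} A \<inter> space ?N)"
      using A by (intro emeasure_distr measurable_insert_coord l sets_PiM_I_finite) auto
    also have "(\<lambda>(s, x). insert_coord (Suc n) l x s) -` Pi\<^sub>E {..<Suc n} A \<inter> space ?N =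
        Pi\<^sub>E {..<n} (\<lambda>i. A (?k i)) \<times> A l"
    proof (rule set_eqI)
      fix p :: "(nat \<Rightarrow> real) \<times> real"
      obtain s x where sx: "p = (s, x)" by (rule prod.exhaust)
      show "p \<in> (\<lambda>(s, x). insert_coord (Suc n) l x s) -` Pi\<^sub>E {..<Suc n} A \<inter> space ?N \<longleftrightarrow>
          p \<in> Pi\<^sub>E {..<n} (\<lambda>i. A (?k i)) \<times> A l"
      proof (cases "s \<in> extensional {..<n}")
        case True
        then have "p \<in> space ?N" by (simp add: sx space_pair_measure space_PiM PiE_iff)
        with insert_coord_mem_PiE_iff[OF l True, of x A] show ?thesis by (simp add: sx)
      next
        case False
        then show ?thesis by (simp add: sx space_pair_measure space_PiM PiE_iff)
      qed
    qed
    also have "emeasure ?N (Pi\<^sub>E {..<n} (\<lambda>i. A (?k i)) \<times> A l) = (\<Prod>i<n. emeasure lborel (A (?k i))) * emeasure lborel (A l)"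
    proof -
      have k: "A (?k i) \<in> sets lborel" if "i \<in> {..<n}" for i using A[of "?k i"] that by simp
      have "emeasure ?N (Pi\<^sub>E {..<n} (\<lambda>i. A (?k i)) \<times> A l) =
          emeasure (Pi\<^sub>M {..<n} (\<lambda>_. lborel)) (Pi\<^sub>E {..<n} (\<lambda>i. A (?k i))) * emeasure lborel (A l)"
        using k A l by (intro lborel.emeasure_pair_measure_Times sets_PiM_I_finite) simp_all
      also have "emeasure (Pi\<^sub>M {..<n} (\<lambda>_. lborel)) (Pi\<^sub>E {..<n} (\<lambda>i. A (?k i))) = (\<Prod>i<n. emeasure lborel (A (?k i)))"
        by (rule P.emeasure_PiM[OF finite_lessThan k])
      finally show ?thesis .
    qed
    also have "(\<Prod>i<n. emeasure lborel (A (?k i))) = (\<Prod>i\<in>{..<Suc n} - {l}. emeasure lborel (A i))"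
    proof (rule prod.reindex_bij_witness[where i = "\<lambda>i. if i < l then i else i - 1" and j = ?k])
    qed (use l in auto)
    also have "\<dots> * emeasure lborel (A l) = (\<Prod>i<Suc n. emeasure lborel (A i))"
      using l by (subst (2) prod.remove[of _ l]) (auto simp: mult.commute)
    finally show "emeasure (distr ?N (Pi\<^sub>M {..<Suc n} (\<lambda>_. lborel)) (\<lambda>(s, x). insert_coord (Suc n) l x s)) (Pi\<^sub>E {..<Suc n} A)
        = (\<Prod>i\<in>{..<Suc n}. emeasure lborel (A i))" .
  qed auto
qed

lemma integral_partial_cube:
  fixes F G :: "(nat \<Rightarrow> real) \<Rightarrow> complex"
  assumes l: "l < Suc n" and F: "continuous_on (cube (Suc n)) F" and G: "continuous_on (cube (Suc n)) G"
    and deriv: "\<And>s. s \<in> cube (Suc n) \<Longrightarrow> ((\<lambda>x. F (s(l := x))) has_vector_derivative G s) (at (s l) within {0..1})"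
  shows "(LINT s:open_cube (Suc n)|Pi\<^sub>M {..<Suc n} (\<lambda>_. lborel). G s) =
    (LINT s:open_cube n|Pi\<^sub>M {..<n} (\<lambda>_. lborel). F (face (Suc n) l 1 s) - F (face (Suc n) l 0 s))"
proof -
  let ?M = "Pi\<^sub>M {..<Suc n} (\<lambda>_. lborel :: real measure)" and ?M' = "Pi\<^sub>M {..<n} (\<lambda>_. lborel :: real measure)"
  let ?I = "insert_coord (Suc n) l"
  let ?G = "\<lambda>s. indicator (open_cube (Suc n)) s *\<^sub>R G s"
  interpret P: product_sigma_finite "\<lambda>_ :: nat. lborel :: real measure" by unfold_locales
  interpret Fp: finite_product_sigma_finite "\<lambda>_ :: nat. lborel :: real measure" "{..<n}" by unfold_locales auto
  interpret pair_sigma_finite ?M' "lborel :: real measure" by unfold_locales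
  have int: "integrable ?M ?G" using set_integrable_continuous_cube[OF G] by (simp add: set_integrable_def)
  have int': "integrable (?M' \<Otimes>\<^sub>M lborel) (\<lambda>p. ?G (case p of (s, x) \<Rightarrow> ?I x s))"
    by (rule integrable_distr[OF measurable_insert_coord[OF l]]) (unfold PiM_insert_coord[OF l], rule int)
  have "(LINT s|?M. ?G s) = (LINT p|(?M' \<Otimes>\<^sub>M lborel). ?G (case p of (s, x) \<Rightarrow> ?I x s))"
    using integral_distr[OF measurable_insert_coord[OF l] borel_measurable_integrable[OF int]]
    unfolding PiM_insert_coord[OF l] .
  also have "\<dots> = (LINT p|(?M' \<Otimes>\<^sub>M lborel). (case p of (s, x) \<Rightarrow> ?G (?I x s)))"
    by (simp add: case_prod_unfold)
  also have "\<dots> = (LINT s|?M'. LINT x|lborel. ?G (?I x s))"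
    using int' by (intro integral_fst[symmetric]) (simp add: case_prod_unfold)
  also have "\<dots> = (LINT s|?M'. indicator (open_cube n) s *\<^sub>R (F (face (Suc n) l 1 s) - F (face (Suc n) l 0 s)))"
  proof (rule Bochner_Integration.integral_cong[OF HOL.refl])
    fix s assume "s \<in> space ?M'"
    then have ext: "s \<in> extensional {..<n}" by (auto simp: space_PiM PiE_iff)
    show "(LINT x|lborel. ?G (?I x s)) = indicator (open_cube n) s *\<^sub>R (F (face (Suc n) l 1 s) - F (face (Suc n) l 0 s))"
    proof (cases "s \<in> open_cube n")
      case False
      then have "(\<lambda>x. ?G (?I x s)) = (\<lambda>x. 0)"
        using insert_coord_open_cube[OF ext l] by (simp add: fun_eq_iff indicator_def)
      then have "(LINT x|lborel. ?G (?I x s)) = 0" by (simp only: Bochner_Integration.integral_zero)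
      with False show ?thesis by simp
    next
      case True
      then have sc: "s \<in> cube n" using open_cube_subset by auto
      have I: "?I x s \<in> cube (Suc n)" if "x \<in> {0..1}" for x using insert_coord_cube[OF sc that l] .
      have "(LINT x|lborel. ?G (?I x s)) = (LINT x|lborel. indicator {0<..<1} x *\<^sub>R G (?I x s))"
        using True insert_coord_open_cube[OF ext l] by (intro Bochner_Integration.integral_cong) (auto simp: indicator_def)
      \<comment> \<open>The endpoints form a null set; the fundamental theorem of calculus is
        applied on the closed interval.\<close>
      also have "\<dots> = (LINT x|lborel. indicator {0..1} x *\<^sub>R G (?I x s))"
      proof (rule integral_cong_AE)
        have line: "continuous_on {0..1} (\<lambda>x. G (?I x s))"
          using continuous_on_cube_line[OF G I[of 0] l] by (simp add: insert_coord_upd[OF l])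
        have m1: "(\<lambda>x. indicator {0..1} x *\<^sub>R G (?I x s)) \<in> borel_measurable borel"
          by (intro borel_measurable_continuous_on_indicator line) auto
        then show "(\<lambda>x. indicator {0..1} x *\<^sub>R G (?I x s)) \<in> borel_measurable lborel" by simp
        have "(\<lambda>x. indicator {0<..<1} x *\<^sub>R G (?I x s)) = (\<lambda>x. indicator {0<..<1::real} x *\<^sub>R (indicator {0..1} x *\<^sub>R G (?I x s)))"
          by (auto simp: fun_eq_iff indicator_def)
        also have "\<dots> \<in> borel_measurable lborel"
          unfolding measurable_lborel2 by (rule borel_measurable_scaleR[OF borel_measurable_indicator m1]) simp
        finally show "(\<lambda>x. indicator {0<..<1} x *\<^sub>R G (?I x s)) \<in> borel_measurable lborel" .
        show "AE x in lborel. indicator {0<..<1} x *\<^sub>R G (?I x s) = indicator {0..1} x *\<^sub>R G (?I x s)"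
          using AE_lborel_singleton[of "0 :: real"] AE_lborel_singleton[of "1 :: real"]
          by eventually_elim (auto simp: indicator_def)
      qed
      also have "\<dots> = F (?I 1 s) - F (?I 0 s)"
      proof (rule integral_FTC_Icc)
        show "continuous_on {0..1} (\<lambda>x. G (?I x s))"
          using continuous_on_cube_line[OF G I[of 0] l] by (simp add: insert_coord_upd[OF l])
        fix x :: real assume "0 \<le> x" "x \<le> 1"
        then have "((\<lambda>y. F ((?I x s)(l := y))) has_vector_derivative G (?I x s)) (at (?I x s l) within {0..1})"
          by (intro deriv I) auto
        then show "((\<lambda>x. F (?I x s)) has_vector_derivative G (?I x s)) (at x within {0..1})"
          using l by (simp add: insert_coord_upd[OF l]) (simp add: insert_coord_def)
      qed simp
      finally show ?thesis using True by (simp add: face_eq_insert_coord)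
    qed
  qed
  finally show ?thesis by (simp add: set_lebesgue_integral_def)
qed

text \<open>
  The second order derivatives commute: differentiate \<open>f(x, y) = f(0, y) + \<integral>\<^bsub>0\<^esub>\<^bsup>x\<^esup> \<partial>\<^sub>xf\<close> first in \<open>y\<close>
  under the integral sign, then in \<open>x\<close>.
\<close>

lemma mixed_derivatives_commute:
  fixes f A B C D :: "real \<Rightarrow> real \<Rightarrow> complex"
  assumes A: "\<And>x y. x \<in> {0..1} \<Longrightarrow> y \<in> {0..1} \<Longrightarrow> ((\<lambda>x. f x y) has_vector_derivative A x y) (at x within {0..1})"
    and B: "\<And>x y. x \<in> {0..1} \<Longrightarrow> y \<in> {0..1} \<Longrightarrow> ((\<lambda>y. f x y) has_vector_derivative B x y) (at y within {0..1})"
    and C: "\<And>x y. x \<in> {0..1} \<Longrightarrow> y \<in> {0..1} \<Longrightarrow> ((\<lambda>y. A x y) has_vector_derivative C x y) (at y within {0..1})"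
    and D: "\<And>x y. x \<in> {0..1} \<Longrightarrow> y \<in> {0..1} \<Longrightarrow> ((\<lambda>x. B x y) has_vector_derivative D x y) (at x within {0..1})"
    and contA: "continuous_on ({0..1} \<times> {0..1}) (\<lambda>(x, y). A x y)"
    and contC: "continuous_on ({0..1} \<times> {0..1}) (\<lambda>(x, y). C x y)"
    and xy: "x \<in> {0..1}" "y \<in> {0..1}"
  shows "C x y = D x y"
proof -
  have unique: "d = d'"
    if "(g has_vector_derivative d) (at x within {0..1})" "(g has_vector_derivative d') (at x within {0..1})"
      "x \<in> {0..1}" for g :: "real \<Rightarrow> complex" and d d' x
    using vector_derivative_unique_within_closed_interval[of 0 1 x g d d'] that by simp
  have contA': "continuous_on {0..1} (\<lambda>x. A x y)" if y: "y \<in> {0..1}" for y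
  proof -
    have "continuous_on {0..1} (\<lambda>x. (\<lambda>(x, y). A x y) (x, y))"
      by (rule continuous_on_compose2[OF contA]) (use y in \<open>auto intro!: continuous_intros\<close>)
    then show ?thesis by simp
  qed
  have contC': "continuous_on {0..1} (\<lambda>x. C x y)"
  proof -
    have "continuous_on {0..1} (\<lambda>x. (\<lambda>(x, y). C x y) (x, y))"
      by (rule continuous_on_compose2[OF contC]) (use xy in \<open>auto intro!: continuous_intros\<close>)
    then show ?thesis by simp
  qed
  have fA: "integral {0..a} (\<lambda>x. A x y) = f a y - f 0 y" if a: "a \<in> {0..1}" and y: "y \<in> {0..1}" for a y
  proof (rule integral_unique, rule fundamental_theorem_of_calculus)
    show "((\<lambda>x. f x y) has_vector_derivative A x y) (at x within {0..a})" if "x \<in> {0..a}" for x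
      by (rule has_vector_derivative_within_subset[OF A[OF _ y]]) (use a that in auto)
    show "0 \<le> a" using a by simp
  qed
  have BC: "B a y - B 0 y = integral {0..a} (\<lambda>x. C x y)" if a: "a \<in> {0..1}" for a
  proof -
    have "((\<lambda>y. integral (cbox 0 a) (\<lambda>x. A x y)) has_vector_derivative integral (cbox 0 a) (\<lambda>x. C x y)) (at y within {0..1})"
    proof (rule leibniz_rule_vector_derivative)
      show "((\<lambda>y. A x y) has_vector_derivative C x y) (at y within {0..1})" if "y \<in> {0..1}" "x \<in> cbox 0 a" for x y
        by (rule C) (use a that in auto)
      show "(\<lambda>x. A x y) integrable_on cbox 0 a" if "y \<in> {0..1}" for y
        by (rule integrable_continuous, rule continuous_on_subset[OF contA'[OF that]]) (use a in auto)
      have "continuous_on ({0..1} \<times> cbox 0 a) (\<lambda>p. (\<lambda>(x, y). C x y) (snd p, fst p))"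
        by (rule continuous_on_compose2[OF contC]) (use a in \<open>auto intro!: continuous_intros\<close>)
      then show "continuous_on ({0..1} \<times> cbox 0 a) (\<lambda>(y, x). C x y)" by (simp add: case_prod_unfold)
    qed (use xy in auto)
    then have "((\<lambda>y. f a y - f 0 y) has_vector_derivative integral (cbox 0 a) (\<lambda>x. C x y)) (at y within {0..1})"
      by (rule has_vector_derivative_transform[OF xy(2), rotated]) (simp add: fA[OF a])
    moreover have "((\<lambda>y. f a y - f 0 y) has_vector_derivative B a y - B 0 y) (at y within {0..1})"
      by (rule has_vector_derivative_diff[OF B B]) (use a xy in auto)
    ultimately show ?thesis using unique[OF _ _ xy(2)] by (metis box_real(2))
  qed
  have "((\<lambda>a. integral {0..a} (\<lambda>x. C x y)) has_vector_derivative C x y) (at x within {0..1})"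
    by (rule integral_has_vector_derivative[OF contC' xy(1)])
  then have "((\<lambda>a. B a y - B 0 y) has_vector_derivative C x y) (at x within {0..1})"
    by (rule has_vector_derivative_transform[OF xy(1), rotated]) (simp add: BC)
  moreover have "((\<lambda>a. B a y - B 0 y) has_vector_derivative D x y) (at x within {0..1})"
    using has_vector_derivative_diff[OF D[OF xy] has_vector_derivative_const] by simp
  ultimately show ?thesis by (rule unique[OF _ _ xy(1)])
qed

text \<open>Near \<open>x0\<close> a continuous logarithm equals L(x0) + Ln(g/g(x0)): by continuity
  L moves there by less than pi, so that Ln inverts exp on the difference. The derivative is then
  that of the principal branch at 1.\<close>

lemma has_vector_derivative_log:
  fixes L g :: "real \<Rightarrow> complex"
  assumes L: "continuous_on {0..1} L" and exp: "\<And>x. x \<in> {0..1} \<Longrightarrow> exp (L x) = g x"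
    and g: "(g has_vector_derivative g') (at x0 within {0..1})" and x0: "x0 \<in> {0..1}"
  shows "(L has_vector_derivative g' / g x0) (at x0 within {0..1})"
proof -
  have nz: "g x0 \<noteq> 0" using exp[OF x0] by (metis exp_not_eq_zero)
  obtain d where d: "d > 0" "\<And>x. x \<in> {0..1} \<Longrightarrow> dist x x0 < d \<Longrightarrow> dist (L x) (L x0) < pi"
    using L x0 pi_gt_zero unfolding continuous_on_iff by metis
  have "((\<lambda>x. g x / g x0) has_vector_derivative g' / g x0) (at x0 within {0..1})"
    using has_vector_derivative_mult_left[OF g, of "1 / g x0"] by simp
  moreover have "(Ln has_field_derivative 1) (at (g x0 / g x0) within (\<lambda>x. g x / g x0) ` {0..1})"
    using nz has_field_derivative_Ln[of 1] by (auto intro: has_field_derivative_at_within)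
  ultimately have "(Ln \<circ> (\<lambda>x. g x / g x0) has_vector_derivative g' / g x0 * 1) (at x0 within {0..1})"
    by (rule field_vector_diff_chain_within)
  then have "((\<lambda>x. L x0 + Ln (g x / g x0)) has_vector_derivative g' / g x0) (at x0 within {0..1})"
    using has_vector_derivative_add[OF has_vector_derivative_const] by (force simp: comp_def)
  then show ?thesis
  proof (rule has_vector_derivative_transform_within[OF _ d(1) x0])
    fix x :: real assume x: "x \<in> {0..1}" "dist x x0 < d"
    then have "\<bar>Im (L x - L x0)\<bar> < pi" using d(2)[OF x] abs_Im_le_cmod[of "L x - L x0"] by (simp add: dist_norm)
    then have "Ln (exp (L x - L x0)) = L x - L x0" by (intro Ln_exp) auto
    then show "L x0 + Ln (g x / g x0) = L x" using exp[OF x(1)] exp[OF x0] by (simp add: exp_diff)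
  qed
qed

lemma has_vector_derivative_prod:
  fixes f :: "'i \<Rightarrow> real \<Rightarrow> complex"
  assumes "finite A" "\<And>a. a \<in> A \<Longrightarrow> (f a has_vector_derivative f' a) (at x within X)"
  shows "((\<lambda>x. \<Prod>a\<in>A. f a x) has_vector_derivative (\<Sum>b\<in>A. f' b * (\<Prod>a\<in>A - {b}. f a x))) (at x within X)"
  using assms
proof (induction A rule: finite_induct)
  case (insert c A)
  have "((\<lambda>x. f c x * (\<Prod>a\<in>A. f a x)) has_vector_derivative
      f c x * (\<Sum>b\<in>A. f' b * (\<Prod>a\<in>A - {b}. f a x)) + f' c * (\<Prod>a\<in>A. f a x)) (at x within X)"
    by (rule has_vector_derivative_mult) (use insert in auto)
  moreover have "f c x * (\<Sum>b\<in>A. f' b * (\<Prod>a\<in>A - {b}. f a x)) = (\<Sum>b\<in>A. f' b * (\<Prod>a\<in>insert c A - {b}. f a x))"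
    unfolding sum_distrib_left
  proof (rule sum.cong[OF HOL.refl])
    fix b assume b: "b \<in> A"
    then have "insert c A - {b} = insert c (A - {b})" using insert.hyps by auto
    then show "f c x * (f' b * (\<Prod>a\<in>A - {b}. f a x)) = f' b * (\<Prod>a\<in>insert c A - {b}. f a x)"
      using insert.hyps by simp
  qed
  moreover have "insert c A - {c} = A" using insert.hyps by auto
  ultimately show ?case using insert.hyps by (simp add: add.commute)
qed simp

lemma set_integral_sum_mult:
  fixes f :: "'i \<Rightarrow> 'a \<Rightarrow> complex"
  assumes "finite I" "\<And>i. i \<in> I \<Longrightarrow> set_integrable M A (f i)"
  shows "set_integrable M A (\<lambda>x. \<Sum>i\<in>I. c i * f i x)"
    and "(LINT x:A|M. (\<Sum>i\<in>I. c i * f i x)) = (\<Sum>i\<in>I. c i * (LINT x:A|M. f i x))"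
proof -
  have eq: "(\<lambda>x. indicator A x *\<^sub>R (\<Sum>i\<in>I. c i * f i x)) = (\<lambda>x. \<Sum>i\<in>I. c i * (indicator A x *\<^sub>R f i x))"
    by (simp add: fun_eq_iff scaleR_sum_right)
  have int: "integrable M (\<lambda>x. indicator A x *\<^sub>R f i x)" if "i \<in> I" for i
    using assms(2)[OF that] by (simp add: set_integrable_def)
  show "set_integrable M A (\<lambda>x. \<Sum>i\<in>I. c i * f i x)"
    unfolding set_integrable_def eq
    by (rule Bochner_Integration.integrable_sum, rule integrable_mult_right, rule int)
  have "(LINT x|M. (\<Sum>i\<in>I. c i * (indicator A x *\<^sub>R f i x))) = (\<Sum>i\<in>I. (LINT x|M. c i * (indicator A x *\<^sub>R f i x)))"
    by (rule Bochner_Integration.integral_sum, rule integrable_mult_right, rule int)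
  then show "(LINT x:A|M. (\<Sum>i\<in>I. c i * f i x)) = (\<Sum>i\<in>I. c i * (LINT x:A|M. f i x))"
    unfolding set_lebesgue_integral_def eq by (simp only: integral_mult_right_zero)
qed

lemma continuous_on_insert_coord:
  assumes l: "l < Suc n" and x: "x \<in> {0..1}" and F: "continuous_on (cube (Suc n)) F"
  shows "continuous_on (cube n) (\<lambda>s. F (insert_coord (Suc n) l x s))"
proof (rule continuous_on_compose2[OF F])
  show "continuous_on (cube n) (insert_coord (Suc n) l x)"
  proof (rule continuous_on_coordinatewise_then_product)
    fix i
    have proj: "continuous_on (cube n) (\<lambda>s :: nat \<Rightarrow> real. s k)" for k
      by (rule continuous_on_subset[OF continuous_on_product_coordinates]) simp
    show "continuous_on (cube n) (\<lambda>s. insert_coord (Suc n) l x s i)"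
    proof (cases "i < Suc n")
      case True
      then show ?thesis by (cases i l rule: linorder_cases) (simp_all add: insert_coord_def proj)
    qed (simp add: insert_coord_def)
  qed
qed (use insert_coord_cube[OF _ x l] in blast)

text \<open>The cycle that takes 0 to l and shifts 1, ..., l down by one. Its sign (-1)^l becomes
  the sign with which the faces in direction l enter the boundary.\<close>

primrec cycle_perm :: "nat \<Rightarrow> nat \<Rightarrow> nat" where
  "cycle_perm 0 = id"
| "cycle_perm (Suc l) = Transposition.transpose l (Suc l) \<circ> cycle_perm l"

lemma cycle_perm_simps: "cycle_perm l 0 = l" "cycle_perm l (Suc a) = (if a < l then a else Suc a)"
  by (induction l) (auto simp: Transposition.transpose_def)

lemma cycle_perm_permutes: "l < m \<Longrightarrow> cycle_perm l permutes {..<m}"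
proof (induction l)
  case (Suc l)
  have "cycle_perm l permutes {..<m}" using Suc by simp
  then show ?case unfolding cycle_perm.simps
    by (rule permutes_compose) (use Suc(2) in \<open>auto intro!: permutes_swap_id\<close>)
qed (simp add: permutes_id)

lemma sign_cycle_perm: "sign (cycle_perm l) = (-1) ^ l"
proof (induction l)
  case (Suc l)
  have "permutation (cycle_perm l)"
    using permutes_imp_permutation[OF _ cycle_perm_permutes[of l "Suc l"]] by simp
  then show ?case
    by (simp only: cycle_perm.simps sign_compose[OF permutation_swap_id] sign_swap_id Suc) simp
qed simp

text \<open>Laplace expansion: \<pi> factors uniquely into a permutation fixing 0 followed by
  \<open>cycle_perm (\<pi> 0)\<close>. The condition \<open>0 < m\<close> in the index set makes
  both sides empty sums when m = 0.\<close>

lemma sum_permutations_first: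
  fixes G :: "(nat \<Rightarrow> nat) \<Rightarrow> complex"
  shows "(\<Sum>\<pi> | \<pi> permutes {..<m} \<and> 0 < m. of_int (sign \<pi>) * G \<pi>) =
    (\<Sum>l<m. (-1) ^ l * (\<Sum>\<rho> | \<rho> permutes {..<m} \<and> \<rho> 0 = 0. of_int (sign \<rho>) * G (cycle_perm l \<circ> \<rho>)))"
proof (cases "0 < m")
  case True
  let ?R = "{\<rho>. \<rho> permutes {..<m} \<and> \<rho> 0 = 0}"
  have "(\<Sum>l<m. (-1) ^ l * (\<Sum>\<rho>\<in>?R. of_int (sign \<rho>) * G (cycle_perm l \<circ> \<rho>))) =
      (\<Sum>(l, \<rho>)\<in>{..<m} \<times> ?R. (-1) ^ l * (of_int (sign \<rho>) * G (cycle_perm l \<circ> \<rho>)))"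
    by (simp add: sum.cartesian_product sum_distrib_left)
  also have "\<dots> = (\<Sum>\<pi> | \<pi> permutes {..<m}. of_int (sign \<pi>) * G \<pi>)"
  proof (rule sum.reindex_bij_witness[where j = "\<lambda>(l, \<rho>). cycle_perm l \<circ> \<rho>" and i = "\<lambda>\<pi>. (\<pi> 0, inv (cycle_perm (\<pi> 0)) \<circ> \<pi>)"])
    fix x assume x: "x \<in> {..<m} \<times> ?R"
    obtain l \<rho> where lr: "x = (l, \<rho>)" "l < m" "\<rho> permutes {..<m}" "\<rho> 0 = 0" using x by auto
    note perm = cycle_perm_permutes[OF lr(2)]
    show "(case x of (l, \<rho>) \<Rightarrow> cycle_perm l \<circ> \<rho>) \<in> {\<pi>. \<pi> permutes {..<m}}"
      using permutes_compose[OF lr(3) perm] by (simp add: lr)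
    show "(\<lambda>\<pi>. (\<pi> 0, inv (cycle_perm (\<pi> 0)) \<circ> \<pi>)) (case x of (l, \<rho>) \<Rightarrow> cycle_perm l \<circ> \<rho>) = x"
      using permutes_inv_o(2)[OF perm] by (simp add: lr cycle_perm_simps o_assoc)
    have "sign (cycle_perm l \<circ> \<rho>) = (-1) ^ l * sign \<rho>"
      using permutes_imp_permutation[OF _ lr(3)] permutes_imp_permutation[OF _ perm]
      by (simp add: sign_compose sign_cycle_perm)
    then show "of_int (sign (case x of (l, \<rho>) \<Rightarrow> cycle_perm l \<circ> \<rho>)) * G (case x of (l, \<rho>) \<Rightarrow> cycle_perm l \<circ> \<rho>) =
        (case x of (l, \<rho>) \<Rightarrow> (-1) ^ l * (of_int (sign \<rho>) * G (cycle_perm l \<circ> \<rho>)))"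
      by (simp add: lr)
  next
    fix \<pi> assume "\<pi> \<in> {\<pi>. \<pi> permutes {..<m}}"
    then have \<pi>: "\<pi> permutes {..<m}" by simp
    have l: "\<pi> 0 < m" using permutes_in_image[OF \<pi>, of 0] True by simp
    note perm = cycle_perm_permutes[OF l]
    show "(case (\<pi> 0, inv (cycle_perm (\<pi> 0)) \<circ> \<pi>) of (l, \<rho>) \<Rightarrow> cycle_perm l \<circ> \<rho>) = \<pi>"
      using permutes_inv_o(1)[OF perm] by (simp add: o_assoc)
    have "inv (cycle_perm (\<pi> 0)) (\<pi> 0) = 0"
      using permutes_inverses(2)[OF perm, of 0] by (simp add: cycle_perm_simps)
    then show "(\<pi> 0, inv (cycle_perm (\<pi> 0)) \<circ> \<pi>) \<in> {..<m} \<times> ?R"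
      using l permutes_compose[OF \<pi> permutes_inv[OF perm]] by simp
  qed
  finally show ?thesis using True by simp
qed simp

section \<open>Calculus along a twisted cell\<close>

context master_function
begin

definition tangent :: "'n cell \<Rightarrow> nat \<Rightarrow> (nat \<Rightarrow> real) \<Rightarrow> point" where
  "tangent C l s = (\<lambda>k. if k < m then partial l (\<lambda>s. pos C s k) s else 0)"

definition second_partial :: "'n cell \<Rightarrow> nat \<Rightarrow> nat \<Rightarrow> (nat \<Rightarrow> real) \<Rightarrow> point" where
  "second_partial C l l' s = (\<lambda>k. partial l' (partial l (\<lambda>s. pos C s k)) s)"

lemma pullback_eq: "pullback m C \<omega> s = \<omega> (pos C s) (\<lambda>l. tangent C l s)"
  by (simp add: pullback_def tangent_def)

definition below_m :: "'n diff_fun \<Rightarrow> bool" where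
  "below_m H \<longleftrightarrow> (case H of TT k l \<Rightarrow> k < m \<and> l < m | TZ k j \<Rightarrow> k < m | ZZ i j \<Rightarrow> True)"

lemma below_m_simps [simp]: "below_m (TT k l) \<longleftrightarrow> k < m \<and> l < m" "below_m (TZ k j) \<longleftrightarrow> k < m" "below_m (ZZ i j)"
  by (simp_all add: below_m_def)

lemma below_m_functions: "H \<in> t_functions \<Longrightarrow> below_m H" "H \<in> log_functions \<Longrightarrow> below_m H"
  by (auto simp: t_functions_def log_functions_def)

text \<open>The wedge product of \<open>Hs\<close>, of degree m - 1, pulled back to a face
  \<open>\<tau>\<close>. Its permutations are written as permutations of \<open>{..<m}\<close> that
  fix 0, the way they come out of the Laplace expansion; hence the shift by one in the direction.
  The form depends on \<open>\<tau>\<close> alone, not on the cell of which \<open>\<tau>\<close> is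
  a face.\<close>

definition face_form :: "(complex, 'n) vec \<Rightarrow> 'n diff_fun list \<Rightarrow> ((nat \<Rightarrow> real) \<Rightarrow> point) \<Rightarrow> (nat \<Rightarrow> real) \<Rightarrow> complex" where
  "face_form z Hs \<tau> s = (\<Sum>\<rho> | \<rho> permutes {..<m} \<and> \<rho> 0 = 0. of_int (sign \<rho>) *
     (\<Prod>a<length Hs. dlog z (Hs ! a) (\<tau> s) (\<lambda>k. if k < m then partial (\<rho> (Suc a) - 1) (\<lambda>s. \<tau> s k) s else 0)))"

context
  fixes C :: "'n cell" and z :: "(complex, 'n) vec"
  assumes C: "twisted_cell 2 (cube m) z C"
begin

lemma pos_C2:
  assumes k: "k < m"
  shows "continuous_on (cube m) (\<lambda>s. pos C s k)"
    and "l < m \<Longrightarrow> continuous_on (cube m) (\<lambda>s. tangent C l s k)"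
    and "l < m \<Longrightarrow> l' < m \<Longrightarrow> continuous_on (cube m) (\<lambda>s. second_partial C l l' s k)"
    and "l < m \<Longrightarrow> s \<in> cube m \<Longrightarrow> ((\<lambda>x. pos C (s(l := x)) k) has_vector_derivative tangent C l s k) (at (s l) within {0..1})"
    and "l < m \<Longrightarrow> l' < m \<Longrightarrow> s \<in> cube m \<Longrightarrow>
      ((\<lambda>x. tangent C l (s(l' := x)) k) has_vector_derivative second_partial C l l' s k) (at (s l') within {0..1})"
proof -
  have "C_k m (cube m) (Suc (Suc 0)) (\<lambda>s. pos C s k)"
    using C k unfolding twisted_cell_def numeral_2_eq_2 by blast
  note * = this[unfolded C_k.simps]
  show "continuous_on (cube m) (\<lambda>s. pos C s k)" using * by blast
  show "continuous_on (cube m) (\<lambda>s. tangent C l s k)" if "l < m" using * that k by (simp add: tangent_def)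
  show "continuous_on (cube m) (\<lambda>s. second_partial C l l' s k)" if "l < m" "l' < m"
    using * that by (simp add: second_partial_def)
  show "((\<lambda>x. pos C (s(l := x)) k) has_vector_derivative tangent C l s k) (at (s l) within {0..1})"
    if "l < m" "s \<in> cube m"
  proof -
    have "(\<lambda>x. pos C (s(l := x)) k) differentiable (at (s l) within {0..1})" using * that by blast
    then show ?thesis unfolding vector_derivative_works using k by (simp add: tangent_def partial_def)
  qed
  show "((\<lambda>x. tangent C l (s(l' := x)) k) has_vector_derivative second_partial C l l' s k) (at (s l') within {0..1})"
    if "l < m" "l' < m" "s \<in> cube m"
  proof -
    have "(\<lambda>x. partial l (\<lambda>s. pos C s k) (s(l' := x))) differentiable (at (s l') within {0..1})" using * that by blast
    then show ?thesis unfolding vector_derivative_works using k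
      by (simp add: tangent_def second_partial_def partial_def[of l'])
  qed
qed

lemma second_partial_commute:
  assumes k: "k < m" and l: "l < m" "l' < m" and s: "s \<in> cube m"
  shows "second_partial C l l' s k = second_partial C l' l s k"
proof (cases "l = l'")
  case False
  let ?s = "\<lambda>x y. s(l := x, l' := y)"
  have cube: "?s x y \<in> cube m" if "x \<in> {0..1}" "y \<in> {0..1}" for x y
    using cube_upd[OF cube_upd[OF s l(1) that(1)] l(2) that(2)] .
  have upd: "(?s x y)(l := x') = ?s x' y" "(?s x y)(l' := y') = ?s x y'" "?s x y l = x" "?s x y l' = y" for x y x' y'
    using False by (auto simp: fun_upd_twist)
  have "second_partial C l l' (?s (s l) (s l')) k = second_partial C l' l (?s (s l) (s l')) k"
  proof (rule mixed_derivatives_commute[where f = "\<lambda>x y. pos C (?s x y) k" and A = "\<lambda>x y. tangent C l (?s x y) k"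
        and B = "\<lambda>x y. tangent C l' (?s x y) k" and C = "\<lambda>x y. second_partial C l l' (?s x y) k"
        and D = "\<lambda>x y. second_partial C l' l (?s x y) k"])
    fix x y :: real assume xy: "x \<in> {0..1}" "y \<in> {0..1}"
    note c = cube[OF xy]
    show "((\<lambda>x. pos C (?s x y) k) has_vector_derivative tangent C l (?s x y) k) (at x within {0..1})"
      using pos_C2(4)[OF k l(1) c] unfolding upd .
    show "((\<lambda>y. pos C (?s x y) k) has_vector_derivative tangent C l' (?s x y) k) (at y within {0..1})"
      using pos_C2(4)[OF k l(2) c] unfolding upd .
    show "((\<lambda>y. tangent C l (?s x y) k) has_vector_derivative second_partial C l l' (?s x y) k) (at y within {0..1})"
      using pos_C2(5)[OF k l(1,2) c] unfolding upd .
    show "((\<lambda>x. tangent C l' (?s x y) k) has_vector_derivative second_partial C l' l (?s x y) k) (at x within {0..1})"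
      using pos_C2(5)[OF k l(2,1) c] unfolding upd .
  next
    show "continuous_on ({0..1} \<times> {0..1}) (\<lambda>(x, y). tangent C l (?s x y) k)"
      by (rule continuous_on_cube_plane[OF pos_C2(2)[OF k l(1)] s l])
    show "continuous_on ({0..1} \<times> {0..1}) (\<lambda>(x, y). second_partial C l l' (?s x y) k)"
      by (rule continuous_on_cube_plane[OF pos_C2(3)[OF k l] s l])
  qed (rule cubeD[OF s l(1)], rule cubeD[OF s l(2)])
  then show ?thesis by simp
qed simp

lemma dval_derivative:
  assumes H: "below_m H" and l: "l < m" and s: "s \<in> cube m"
  shows "((\<lambda>x. dval z H (pos C (s(l := x)))) has_vector_derivative ddiff H (tangent C l s)) (at (s l) within {0..1})"
proof (cases H)
  case (TT k k')
  then show ?thesis using H pos_C2(4)[OF _ l s] by (simp add: has_vector_derivative_diff)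
next
  case (TZ k j)
  then show ?thesis using H has_vector_derivative_diff[OF pos_C2(4)[OF _ l s] has_vector_derivative_const, of k] by simp
qed simp

lemma ddiff_derivative:
  assumes H: "below_m H" and l: "l < m" "l' < m" and s: "s \<in> cube m"
  shows "((\<lambda>x. ddiff H (tangent C l (s(l' := x)))) has_vector_derivative ddiff H (second_partial C l l' s)) (at (s l') within {0..1})"
proof (cases H)
  case (TT k k')
  then show ?thesis using H pos_C2(5)[OF _ l s] by (simp add: has_vector_derivative_diff)
next
  case (TZ k j)
  then show ?thesis using H pos_C2(5)[OF _ l s] by simp
qed simp

lemma dval_continuous: "below_m H \<Longrightarrow> continuous_on (cube m) (\<lambda>s. dval z H (pos C s))"
  using pos_C2(1) by (cases H) (auto intro!: continuous_on_diff continuous_on_const)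

lemma ddiff_continuous: "below_m H \<Longrightarrow> l < m \<Longrightarrow> continuous_on (cube m) (\<lambda>s. ddiff H (tangent C l s))"
  using pos_C2(2) by (cases H) (auto intro!: continuous_on_diff continuous_on_const)

lemma dval_nonzero: "H \<in> t_functions \<Longrightarrow> s \<in> cube m \<Longrightarrow> dval z H (pos C s) \<noteq> 0"
  using C unfolding twisted_cell_def complement_def by blast

definition dlog_partial :: "'n diff_fun \<Rightarrow> nat \<Rightarrow> nat \<Rightarrow> (nat \<Rightarrow> real) \<Rightarrow> complex" where
  "dlog_partial H l l' s = (ddiff H (second_partial C l l' s) * dval z H (pos C s) -
     ddiff H (tangent C l s) * ddiff H (tangent C l' s)) / (dval z H (pos C s))\<^sup>2"

text \<open>Closedness of d log: the part with second derivatives is symmetric because mixed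
  derivatives commute, the other part by inspection.\<close>

lemma dlog_partial_commute:
  assumes "below_m H" "l < m" "l' < m" "s \<in> cube m"
  shows "dlog_partial H l l' s = dlog_partial H l' l s"
proof -
  have "ddiff H (second_partial C l l' s) = ddiff H (second_partial C l' l s)"
    using assms second_partial_commute[OF _ assms(2-4)] by (cases H) auto
  then show ?thesis by (simp add: dlog_partial_def mult.commute)
qed

lemma dlog_derivative:
  assumes H: "H \<in> t_functions" and l: "l < m" "l' < m" and s: "s \<in> cube m"
  shows "((\<lambda>x. dlog z H (pos C (s(l' := x))) (tangent C l (s(l' := x)))) has_vector_derivative dlog_partial H l l' s)
    (at (s l') within {0..1})"
proof -
  note b = below_m_functions(1)[OF H]
  have nz: "dval z H (pos C (s(l' := s l'))) \<noteq> 0" using dval_nonzero[OF H s] by simp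
  have inv: "((\<lambda>x. inverse (dval z H (pos C (s(l' := x))))) has_vector_derivative
      ddiff H (tangent C l' s) * (- (inverse (dval z H (pos C s)) ^ 2))) (at (s l') within {0..1})"
  proof -
    have "(inverse has_field_derivative - (inverse (dval z H (pos C s)) ^ 2))
        (at (dval z H (pos C (s(l' := s l')))) within (\<lambda>x. dval z H (pos C (s(l' := x)))) ` {0..1})"
      using DERIV_inverse[OF nz] by (simp add: has_field_derivative_at_within numeral_2_eq_2)
    from field_vector_diff_chain_within[OF dval_derivative[OF b l(2) s] this]
    show ?thesis by (simp add: comp_def)
  qed
  have "((\<lambda>x. ddiff H (tangent C l (s(l' := x))) * inverse (dval z H (pos C (s(l' := x))))) has_vector_derivative
      ddiff H (tangent C l s) * (ddiff H (tangent C l' s) * (- (inverse (dval z H (pos C s)) ^ 2))) +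
      ddiff H (second_partial C l l' s) * inverse (dval z H (pos C s))) (at (s l') within {0..1})"
    using has_vector_derivative_mult[OF ddiff_derivative[OF b l s] inv] by simp
  moreover have "ddiff H (tangent C l s) * (ddiff H (tangent C l' s) * (- (inverse (dval z H (pos C s)) ^ 2))) +
      ddiff H (second_partial C l l' s) * inverse (dval z H (pos C s)) = dlog_partial H l l' s"
    using dval_nonzero[OF H s] by (simp add: dlog_partial_def field_simps power2_eq_square)
  ultimately show ?thesis by (simp add: dlog_def divide_inverse)
qed

lemma dlog_continuous:
  assumes "H \<in> t_functions" "l < m"
  shows "continuous_on (cube m) (\<lambda>s. dlog z H (pos C s) (tangent C l s))"
  unfolding dlog_def
  by (rule continuous_on_divide[OF ddiff_continuous dval_continuous])
    (use assms below_m_functions dval_nonzero in auto)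

lemma dlog_partial_continuous:
  assumes "H \<in> t_functions" "l < m" "l' < m"
  shows "continuous_on (cube m) (\<lambda>s. dlog_partial H l l' s)"
proof -
  note b = below_m_functions(1)[OF assms(1)]
  have "continuous_on (cube m) (\<lambda>s. ddiff H (second_partial C l l' s))"
    using pos_C2(3)[OF _ assms(2,3)] b by (cases H) (auto intro!: continuous_on_diff continuous_on_const)
  then show ?thesis unfolding dlog_partial_def
    using dval_nonzero[OF assms(1)]
    by (intro continuous_on_divide continuous_on_diff continuous_on_mult continuous_on_power
        ddiff_continuous dval_continuous b assms) auto
qed

lemma log_derivative:
  assumes H: "H \<in> log_functions" and l: "l < m" and s: "s \<in> cube m"
  shows "((\<lambda>x. logb C H (s(l := x))) has_vector_derivative dlog z H (pos C s) (tangent C l s)) (at (s l) within {0..1})"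
proof -
  have L: "continuous_on (cube m) (logb C H)" "\<And>s. s \<in> cube m \<Longrightarrow> exp (logb C H s) = dval z H (pos C s)"
    using C H unfolding twisted_cell_def by blast+
  have "((\<lambda>x. logb C H (s(l := x))) has_vector_derivative ddiff H (tangent C l s) / dval z H (pos C (s(l := s l)))) (at (s l) within {0..1})"
    using has_vector_derivative_log[OF continuous_on_cube_line[OF L(1) s l] _ dval_derivative[OF below_m_functions(2)[OF H] l s] cubeD[OF s l]]
      L(2)[OF cube_upd[OF s l]] by blast
  then show ?thesis by (simp add: dlog_def)
qed

lemma log_Phi_derivative:
  assumes l: "l < m" and s: "s \<in> cube m"
  shows "((\<lambda>x. log_Phi z \<mu> (pos C (s(l := x))) (\<lambda>H. logb C H (s(l := x)))) has_vector_derivative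
    dlog_Phi z \<mu> (pos C s) (tangent C l s)) (at (s l) within {0..1})"
proof -
  \<comment> \<open>The points z_j do not move along a cell, so the logarithms of z_i - z_j have
    derivative 0.\<close>
  have zz: "((\<lambda>x. logb C (ZZ i j) (s(l := x))) has_vector_derivative 0) (at (s l) within {0..1})" if "i < j" for i j
    using log_derivative[of "ZZ i j", OF _ l s] that by (simp add: log_functions_def dlog_def)
  have fin: "finite {(k, k'). k < k' \<and> k' < m}"
    by (rule finite_subset[of _ "{..<m} \<times> {..<m}"]) auto
  have "((\<lambda>x. log_Phi z \<mu> (pos C (s(l := x))) (\<lambda>H. logb C H (s(l := x)))) has_vector_derivative
     - (\<Sum>k<m. \<alpha> (c k) \<mu> * tangent C l s k) + 0
     + (\<Sum>(i, j) | i < j. dual_form form (\<Lambda> i) (\<Lambda> j) * 0)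
     - (\<Sum>k<m. \<Sum>j\<in>UNIV. dual_form form (\<alpha> (c k)) (\<Lambda> j) * dlog z (TZ k j) (pos C s) (tangent C l s))
     + (\<Sum>(k, k') | k < k' \<and> k' < m. dual_form form (\<alpha> (c k)) (\<alpha> (c k')) * dlog z (TT k k') (pos C s) (tangent C l s)))
     (at (s l) within {0..1})"
    unfolding log_Phi_def case_prod_unfold
    by (intro has_vector_derivative_add has_vector_derivative_diff has_vector_derivative_minus has_vector_derivative_sum
        has_vector_derivative_mult_right has_vector_derivative_const)
      (use l s in \<open>auto intro!: pos_C2(4) log_derivative zz simp: log_functions_def\<close>)
  then show ?thesis by (simp add: dlog_Phi_def case_prod_unfold)
qed

lemma branch_derivative:
  assumes l: "l < m" and s: "s \<in> cube m"
  shows "((\<lambda>x. branch z \<mu> C (s(l := x))) has_vector_derivative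
    branch z \<mu> C s * (dlog_Phi z \<mu> (pos C s) (tangent C l s) / \<kappa>)) (at (s l) within {0..1})"
proof -
  have "((\<lambda>x. log_Phi z \<mu> (pos C (s(l := x))) (\<lambda>H. logb C H (s(l := x))) / \<kappa>) has_vector_derivative
      dlog_Phi z \<mu> (pos C s) (tangent C l s) / \<kappa>) (at (s l) within {0..1})"
    by (rule has_vector_derivative_divide[OF log_Phi_derivative[OF l s]])
  from field_vector_diff_chain_within[OF this has_field_derivative_at_within[OF DERIV_exp]]
  show ?thesis by (simp add: comp_def branch_def mult.commute)
qed

lemma log_Phi_continuous: "continuous_on (cube m) (\<lambda>s. log_Phi z \<mu> (pos C s) (\<lambda>H. logb C H s))"
proof -
  have L: "continuous_on (cube m) (logb C H)" if "H \<in> log_functions" for H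
    using C that unfolding twisted_cell_def by blast
  show ?thesis
    unfolding log_Phi_def case_prod_unfold
    by (intro continuous_on_add continuous_on_diff continuous_on_minus continuous_on_sum continuous_on_mult
        continuous_on_const) (auto intro!: pos_C2(1) L simp: log_functions_def)
qed

lemma branch_continuous: "continuous_on (cube m) (branch z \<mu> C)"
proof -
  have "continuous_on (cube m) (\<lambda>s. exp (log_Phi z \<mu> (pos C s) (\<lambda>H. logb C H s) * inverse \<kappa>))"
    by (intro continuous_on_exp continuous_on_mult log_Phi_continuous continuous_on_const)
  then show ?thesis by (simp add: branch_def[abs_def] divide_inverse)
qed

lemma dlog_Phi_continuous: "l < m \<Longrightarrow> continuous_on (cube m) (\<lambda>s. dlog_Phi z \<mu> (pos C s) (tangent C l s))"
  unfolding dlog_Phi_def case_prod_unfold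
  by (intro continuous_on_add continuous_on_diff continuous_on_minus continuous_on_sum continuous_on_mult
      continuous_on_const) (auto intro!: pos_C2(2) dlog_continuous simp: t_functions_def)

lemma pullback_wedge_continuous:
  assumes "length Hs = m" "set Hs \<subseteq> t_functions"
  shows "continuous_on (cube m) (pullback m C (wedge (map (dlog z) Hs)))"
proof -
  have "continuous_on (cube m) (\<lambda>s. dlog z (Hs ! a) (pos C s) (tangent C (\<pi> a) s))"
    if "\<pi> permutes {..<m}" "a < m" for \<pi> a
    using assms that permutes_in_image[OF that(1), of a] by (intro dlog_continuous) (auto dest: nth_mem)
  then show ?thesis
    unfolding pullback_eq[abs_def] wedge_def using assms(1)
    by (auto intro!: continuous_on_sum continuous_on_mult continuous_on_prod continuous_on_const)
qed

text \<open>The part of the form \<Phi>\<eta> of degree m - 1 belonging to \<pi>. It is evaluated on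
  all directions except \<open>\<pi> 0\<close>, the one in which it is going to be differentiated
  and then integrated.\<close>

definition face_term :: "complex^'d \<Rightarrow> 'n diff_fun list \<Rightarrow> (nat \<Rightarrow> nat) \<Rightarrow> (nat \<Rightarrow> real) \<Rightarrow> complex" where
  "face_term \<mu> Hs \<pi> s = branch z \<mu> C s * (\<Prod>a<length Hs. dlog z (Hs ! a) (pos C s) (tangent C (\<pi> (Suc a)) s))"

lemma permutes_lt: "\<pi> permutes {..<m} \<Longrightarrow> a < m \<Longrightarrow> \<pi> a < m"
  using permutes_in_image[of \<pi> "{..<m}" a] by simp

lemma face_term_continuous:
  assumes "Suc (length Hs) = m" "set Hs \<subseteq> t_functions" "\<pi> permutes {..<m}"
  shows "continuous_on (cube m) (face_term \<mu> Hs \<pi>)"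
  unfolding face_term_def[abs_def]
proof (intro continuous_on_mult branch_continuous continuous_on_prod)
  fix a assume "a \<in> {..<length Hs}"
  then show "continuous_on (cube m) (\<lambda>s. dlog z (Hs ! a) (pos C s) (tangent C (\<pi> (Suc a)) s))"
    using assms permutes_lt[OF assms(3), of "Suc a"] by (intro dlog_continuous) (auto dest: nth_mem)
qed

text \<open>Product rule in direction \<open>\<pi> 0\<close>: the sum over \<open>b\<close> collects
  the derivatives of the d log's, the last summand comes from the branch.\<close>

definition face_term_deriv :: "complex^'d \<Rightarrow> 'n diff_fun list \<Rightarrow> (nat \<Rightarrow> nat) \<Rightarrow> (nat \<Rightarrow> real) \<Rightarrow> complex" where
  "face_term_deriv \<mu> Hs \<pi> s =
    branch z \<mu> C s * (\<Sum>b<length Hs. dlog_partial (Hs ! b) (\<pi> (Suc b)) (\<pi> 0) s *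
        (\<Prod>a\<in>{..<length Hs} - {b}. dlog z (Hs ! a) (pos C s) (tangent C (\<pi> (Suc a)) s))) +
    branch z \<mu> C s * (dlog_Phi z \<mu> (pos C s) (tangent C (\<pi> 0) s) / \<kappa>) *
      (\<Prod>a<length Hs. dlog z (Hs ! a) (pos C s) (tangent C (\<pi> (Suc a)) s))"

lemma face_term_derivative:
  assumes Hs: "Suc (length Hs) = m" "set Hs \<subseteq> t_functions" and \<pi>: "\<pi> permutes {..<m}" and s: "s \<in> cube m"
  shows "((\<lambda>x. face_term \<mu> Hs \<pi> (s(\<pi> 0 := x))) has_vector_derivative face_term_deriv \<mu> Hs \<pi> s) (at (s (\<pi> 0)) within {0..1})"
proof -
  have l: "\<pi> 0 < m" "\<And>a. a < length Hs \<Longrightarrow> \<pi> (Suc a) < m" using permutes_lt[OF \<pi>] Hs by auto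
  have "((\<lambda>x. \<Prod>a<length Hs. dlog z (Hs ! a) (pos C (s(\<pi> 0 := x))) (tangent C (\<pi> (Suc a)) (s(\<pi> 0 := x)))) has_vector_derivative
      (\<Sum>b<length Hs. dlog_partial (Hs ! b) (\<pi> (Suc b)) (\<pi> 0) s *
        (\<Prod>a\<in>{..<length Hs} - {b}. dlog z (Hs ! a) (pos C (s(\<pi> 0 := s (\<pi> 0)))) (tangent C (\<pi> (Suc a)) (s(\<pi> 0 := s (\<pi> 0)))))))
      (at (s (\<pi> 0)) within {0..1})"
  proof (rule has_vector_derivative_prod)
    fix a assume "a \<in> {..<length Hs}"
    then show "((\<lambda>x. dlog z (Hs ! a) (pos C (s(\<pi> 0 := x))) (tangent C (\<pi> (Suc a)) (s(\<pi> 0 := x)))) has_vector_derivative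
        dlog_partial (Hs ! a) (\<pi> (Suc a)) (\<pi> 0) s) (at (s (\<pi> 0)) within {0..1})"
      using Hs(2) l by (intro dlog_derivative s) (auto dest: nth_mem)
  qed simp
  from has_vector_derivative_mult[OF branch_derivative[OF l(1) s] this]
  show ?thesis by (simp add: face_term_def face_term_deriv_def)
qed

lemma face_term_deriv_continuous:
  assumes Hs: "Suc (length Hs) = m" "set Hs \<subseteq> t_functions" and \<pi>: "\<pi> permutes {..<m}"
  shows "continuous_on (cube m) (face_term_deriv \<mu> Hs \<pi>)"
proof -
  have l: "\<pi> 0 < m" "\<And>a. a < length Hs \<Longrightarrow> \<pi> (Suc a) < m" using permutes_lt[OF \<pi>] Hs by auto
  have H: "a < length Hs \<Longrightarrow> Hs ! a \<in> t_functions" for a using Hs by auto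
  show ?thesis unfolding face_term_deriv_def[abs_def] divide_inverse
    by (intro continuous_on_add continuous_on_mult branch_continuous continuous_on_sum continuous_on_prod
        dlog_continuous dlog_partial_continuous dlog_Phi_continuous continuous_on_const) (use l H in auto)
qed

text \<open>The terms with second derivatives cancel in pairs: they are symmetric under the transposition of \<open>0\<close> and \<open>b + 1\<close>.\<close>

lemma sum_face_term_deriv:
  assumes Hs: "Suc (length Hs) = m" "set Hs \<subseteq> t_functions" and s: "s \<in> cube m"
  shows "(\<Sum>\<pi> | \<pi> permutes {..<m}. of_int (sign \<pi>) * face_term_deriv \<mu> Hs \<pi> s) =
    branch z \<mu> C s * pullback m C (wedge ((\<lambda>t w. dlog_Phi z \<mu> t w / \<kappa>) # map (dlog z) Hs)) s"
proof -
  let ?g = "\<lambda>a l. dlog z (Hs ! a) (pos C s) (tangent C l s)"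
  let ?E = "\<lambda>b \<pi>. dlog_partial (Hs ! b) (\<pi> (Suc b)) (\<pi> 0) s * (\<Prod>a\<in>{..<length Hs} - {b}. ?g a (\<pi> (Suc a)))"
  let ?P = "{\<pi>. \<pi> permutes {..<m}}"
  have E0: "(\<Sum>\<pi>\<in>?P. of_int (sign \<pi>) * ?E b \<pi>) = 0" if b: "b < length Hs" for b
  proof -
    let ?t = "Transposition.transpose 0 (Suc b)"
    have t: "?t permutes {..<m}" using b Hs by (intro permutes_swap_id) auto
    have "(\<Sum>\<pi>\<in>?P. of_int (sign \<pi>) * ?E b \<pi>) = (\<Sum>\<pi>\<in>?P. of_int (sign (\<pi> \<circ> ?t)) * ?E b (\<pi> \<circ> ?t))"
      by (rule sum_permutations_compose_right[OF t])
    also have "\<dots> = (\<Sum>\<pi>\<in>?P. - (of_int (sign \<pi>) * ?E b \<pi>))"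
    proof (rule sum.cong[OF HOL.refl])
      fix \<pi> assume "\<pi> \<in> ?P"
      then have \<pi>: "\<pi> permutes {..<m}" by simp
      have "sign (\<pi> \<circ> ?t) = - sign \<pi>"
        using permutes_imp_permutation[OF _ \<pi>] by (simp add: sign_compose permutation_swap_id sign_swap_id)
      moreover have "dlog_partial (Hs ! b) (\<pi> 0) (\<pi> (Suc b)) s = dlog_partial (Hs ! b) (\<pi> (Suc b)) (\<pi> 0) s"
      proof (rule dlog_partial_commute[OF _ _ _ s])
        show "below_m (Hs ! b)" using b Hs(2) by (intro below_m_functions(1)) (auto dest: nth_mem)
        show "\<pi> 0 < m" "\<pi> (Suc b) < m" by (rule permutes_lt[OF \<pi>], use b Hs(1) in simp)+
      qed
      moreover have "(\<Prod>a\<in>{..<length Hs} - {b}. ?g a (\<pi> (?t (Suc a)))) = (\<Prod>a\<in>{..<length Hs} - {b}. ?g a (\<pi> (Suc a)))"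
        by (rule prod.cong) (auto simp: Transposition.transpose_def)
      ultimately show "of_int (sign (\<pi> \<circ> ?t)) * ?E b (\<pi> \<circ> ?t) = - (of_int (sign \<pi>) * ?E b \<pi>)" by simp
    qed
    finally show ?thesis by (simp add: sum_negf)
  qed
  let ?Z = "\<lambda>\<pi>. dlog_Phi z \<mu> (pos C s) (tangent C (\<pi> 0) s) / \<kappa> * (\<Prod>a<length Hs. ?g a (\<pi> (Suc a)))"
  have "(\<Sum>\<pi>\<in>?P. of_int (sign \<pi>) * face_term_deriv \<mu> Hs \<pi> s) =
      (\<Sum>\<pi>\<in>?P. branch z \<mu> C s * (\<Sum>b<length Hs. of_int (sign \<pi>) * ?E b \<pi>) + branch z \<mu> C s * (of_int (sign \<pi>) * ?Z \<pi>))"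
  proof (rule sum.cong[OF HOL.refl])
    fix \<pi>
    show "of_int (sign \<pi>) * face_term_deriv \<mu> Hs \<pi> s =
        branch z \<mu> C s * (\<Sum>b<length Hs. of_int (sign \<pi>) * ?E b \<pi>) + branch z \<mu> C s * (of_int (sign \<pi>) * ?Z \<pi>)"
      unfolding sum_distrib_left[symmetric] face_term_deriv_def by (simp only: distrib_left mult_ac)
  qed
  also have "\<dots> = branch z \<mu> C s * (\<Sum>\<pi>\<in>?P. \<Sum>b<length Hs. of_int (sign \<pi>) * ?E b \<pi>) +
      branch z \<mu> C s * (\<Sum>\<pi>\<in>?P. of_int (sign \<pi>) * ?Z \<pi>)"
    by (simp only: sum.distrib sum_distrib_left)
  also have "(\<Sum>\<pi>\<in>?P. \<Sum>b<length Hs. of_int (sign \<pi>) * ?E b \<pi>) = (\<Sum>b<length Hs. \<Sum>\<pi>\<in>?P. of_int (sign \<pi>) * ?E b \<pi>)"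
    by (rule sum.swap)
  also have "(\<Sum>b<length Hs. \<Sum>\<pi>\<in>?P. of_int (sign \<pi>) * ?E b \<pi>) = 0" by (rule sum.neutral) (use E0 in auto)
  also have "(\<Sum>\<pi>\<in>?P. of_int (sign \<pi>) * ?Z \<pi>) = pullback m C (wedge ((\<lambda>t w. dlog_Phi z \<mu> t w / \<kappa>) # map (dlog z) Hs)) s"
  proof -
    have len: "length ((\<lambda>t w. dlog_Phi z \<mu> t w / \<kappa>) # map (dlog z) Hs) = m" using Hs by simp
    have pm: "(\<Prod>a<m. F a) = F 0 * (\<Prod>a<length Hs. F (Suc a))" for F :: "nat \<Rightarrow> complex"
      unfolding Hs(1)[symmetric] by (rule prod.lessThan_Suc_shift)
    show ?thesis
      unfolding pullback_eq wedge_def len pm nth_Cons_0 nth_Cons_Suc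
      by (intro sum.cong HOL.refl arg_cong2[where f = "(*)"] prod.cong) simp
  qed
  finally show ?thesis by simp
qed

text \<open>The exterior derivative is a signed sum of partial derivatives, and each of them is
  integrated by the fundamental theorem of calculus in its own direction
  \<open>\<pi> 0\<close>.\<close>

lemma cell_stokes:
  assumes Hs: "Suc (length Hs) = m" "set Hs \<subseteq> t_functions"
  shows "(LINT s:open_cube m|cube_measure. branch z \<mu> C s * pullback m C (wedge ((\<lambda>t w. dlog_Phi z \<mu> t w / \<kappa>) # map (dlog z) Hs)) s)
    = (LINT s:open_cube (m - 1)|Pi\<^sub>M {..<m - 1} (\<lambda>_. lborel). \<Sum>\<pi> | \<pi> permutes {..<m}. of_int (sign \<pi>) *
        (face_term \<mu> Hs \<pi> (face m (\<pi> 0) 1 s) - face_term \<mu> Hs \<pi> (face m (\<pi> 0) 0 s)))"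
    and "set_integrable (Pi\<^sub>M {..<m - 1} (\<lambda>_. lborel)) (open_cube (m - 1)) (\<lambda>s. \<Sum>\<pi> | \<pi> permutes {..<m}. of_int (sign \<pi>) *
        (face_term \<mu> Hs \<pi> (face m (\<pi> 0) 1 s) - face_term \<mu> Hs \<pi> (face m (\<pi> 0) 0 s)))"
proof -
  let ?n = "m - 1"
  have m: "m = Suc ?n" using Hs by simp
  let ?P = "{\<pi>. \<pi> permutes {..<m}}"
  have fin: "finite ?P" by (rule finite_permutations) simp
  have lt: "\<pi> 0 < m" if "\<pi> \<in> ?P" for \<pi> using permutes_lt[of \<pi> 0] that m by simp
  have int: "set_integrable (Pi\<^sub>M {..<?n} (\<lambda>_. lborel)) (open_cube ?n)
      (\<lambda>s. face_term \<mu> Hs \<pi> (face m (\<pi> 0) 1 s) - face_term \<mu> Hs \<pi> (face m (\<pi> 0) 0 s))" if "\<pi> \<in> ?P" for \<pi>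
  proof -
    have "continuous_on (cube (Suc ?n)) (face_term \<mu> Hs \<pi>)"
      using face_term_continuous[OF Hs, of \<pi>] that m by simp
    note cont = continuous_on_insert_coord[OF _ _ this, of "\<pi> 0"]
    show ?thesis
      unfolding face_eq_insert_coord
      by (intro set_integrable_continuous_cube continuous_on_diff)
        (use cont[of 1] cont[of 0] lt[OF that] m in auto)
  qed
  show "set_integrable (Pi\<^sub>M {..<m - 1} (\<lambda>_. lborel)) (open_cube (m - 1)) (\<lambda>s. \<Sum>\<pi>\<in>?P. of_int (sign \<pi>) *
        (face_term \<mu> Hs \<pi> (face m (\<pi> 0) 1 s) - face_term \<mu> Hs \<pi> (face m (\<pi> 0) 0 s)))"
    by (rule set_integral_sum_mult(1)[OF fin int])
  have dint: "set_integrable cube_measure (open_cube m) (face_term_deriv \<mu> Hs \<pi>)" if "\<pi> \<in> ?P" for \<pi>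
    using face_term_deriv_continuous[OF Hs, of \<pi>] that by (intro set_integrable_continuous_cube) simp
  have "(LINT s:open_cube m|cube_measure. branch z \<mu> C s * pullback m C (wedge ((\<lambda>t w. dlog_Phi z \<mu> t w / \<kappa>) # map (dlog z) Hs)) s)
      = (LINT s:open_cube m|cube_measure. \<Sum>\<pi>\<in>?P. of_int (sign \<pi>) * face_term_deriv \<mu> Hs \<pi> s)"
  proof (rule set_lebesgue_integral_cong[OF measurable_open_cube], intro allI impI)
    fix s assume "s \<in> open_cube m"
    then have "s \<in> cube m" using open_cube_subset by blast
    then show "branch z \<mu> C s * pullback m C (wedge ((\<lambda>t w. dlog_Phi z \<mu> t w / \<kappa>) # map (dlog z) Hs)) s =
        (\<Sum>\<pi>\<in>?P. of_int (sign \<pi>) * face_term_deriv \<mu> Hs \<pi> s)"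
      by (rule sum_face_term_deriv[OF Hs, symmetric])
  qed
  also have "\<dots> = (\<Sum>\<pi>\<in>?P. of_int (sign \<pi>) * (LINT s:open_cube m|cube_measure. face_term_deriv \<mu> Hs \<pi> s))"
    by (rule set_integral_sum_mult(2)[OF fin dint])
  also have "\<dots> = (\<Sum>\<pi>\<in>?P. of_int (sign \<pi>) * (LINT s:open_cube ?n|Pi\<^sub>M {..<?n} (\<lambda>_. lborel).
      face_term \<mu> Hs \<pi> (face m (\<pi> 0) 1 s) - face_term \<mu> Hs \<pi> (face m (\<pi> 0) 0 s)))"
  proof (rule sum.cong[OF HOL.refl])
    fix \<pi> assume p: "\<pi> \<in> ?P"
    note ipc = integral_partial_cube[of "\<pi> 0" ?n "face_term \<mu> Hs \<pi>" "face_term_deriv \<mu> Hs \<pi>", folded m]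
    have "(LINT s:open_cube m|cube_measure. face_term_deriv \<mu> Hs \<pi> s) =
      (LINT s:open_cube ?n|Pi\<^sub>M {..<?n} (\<lambda>_. lborel). face_term \<mu> Hs \<pi> (face m (\<pi> 0) 1 s) - face_term \<mu> Hs \<pi> (face m (\<pi> 0) 0 s))"
      by (rule ipc[OF lt[OF p] face_term_continuous[OF Hs] face_term_deriv_continuous[OF Hs] face_term_derivative[OF Hs]])
        (use p in simp_all)
    then show "of_int (sign \<pi>) * (LINT s:open_cube m|cube_measure. face_term_deriv \<mu> Hs \<pi> s) =
      of_int (sign \<pi>) * (LINT s:open_cube ?n|Pi\<^sub>M {..<?n} (\<lambda>_. lborel).
        face_term \<mu> Hs \<pi> (face m (\<pi> 0) 1 s) - face_term \<mu> Hs \<pi> (face m (\<pi> 0) 0 s))"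
      by (simp only:)
  qed
  also have "\<dots> = (LINT s:open_cube ?n|Pi\<^sub>M {..<?n} (\<lambda>_. lborel). \<Sum>\<pi>\<in>?P. of_int (sign \<pi>) *
      (face_term \<mu> Hs \<pi> (face m (\<pi> 0) 1 s) - face_term \<mu> Hs \<pi> (face m (\<pi> 0) 0 s)))"
    by (rule set_integral_sum_mult(2)[OF fin int, symmetric])
  finally show "(LINT s:open_cube m|cube_measure. branch z \<mu> C s * pullback m C (wedge ((\<lambda>t w. dlog_Phi z \<mu> t w / \<kappa>) # map (dlog z) Hs)) s)
    = (LINT s:open_cube (m - 1)|Pi\<^sub>M {..<m - 1} (\<lambda>_. lborel). \<Sum>\<pi>\<in>?P. of_int (sign \<pi>) *
        (face_term \<mu> Hs \<pi> (face m (\<pi> 0) 1 s) - face_term \<mu> Hs \<pi> (face m (\<pi> 0) 0 s)))" .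
qed

lemma tangent_face:
  assumes "l < m" "Suc a < m"
  shows "tangent C (cycle_perm l (Suc a)) (face m l \<epsilon> s) =
    (\<lambda>k. if k < m then partial a (\<lambda>s. pos C (face m l \<epsilon> s) k) s else 0)"
proof -
  have "face m l \<epsilon> (s(a := x)) = (face m l \<epsilon> s)(cycle_perm l (Suc a) := x)" for x
    using assms by (auto simp: face_def cycle_perm_simps fun_eq_iff)
  moreover have "face m l \<epsilon> s (cycle_perm l (Suc a)) = s a"
    using assms by (auto simp: face_def cycle_perm_simps)
  ultimately have "partial (cycle_perm l (Suc a)) (\<lambda>s. pos C s k) (face m l \<epsilon> s) = partial a (\<lambda>s. pos C (face m l \<epsilon> s) k) s" for k
    by (simp add: partial_def)
  then show ?thesis by (auto simp: tangent_def fun_eq_iff)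
qed

text \<open>Grouping the permutations by l = \<open>\<pi> 0\<close> collects the two faces in
  direction l with the factor (-1)^l. As the face \<epsilon> = 1 counts positively, the signs are
  opposite to the (-1)^(l+\<epsilon>) of \<open>boundary_zero\<close>; hence the minus in
  front.\<close>

lemma sum_face_terms:
  assumes Hs: "Suc (length Hs) = m"
  shows "(\<Sum>\<pi> | \<pi> permutes {..<m}. of_int (sign \<pi>) *
      (face_term \<mu> Hs \<pi> (face m (\<pi> 0) 1 s) - face_term \<mu> Hs \<pi> (face m (\<pi> 0) 0 s))) =
    - (\<Sum>l<m. \<Sum>\<epsilon><2. (-1) ^ (l + \<epsilon>) * (branch z \<mu> C (face m l \<epsilon> s) * face_form z Hs (\<lambda>s. pos C (face m l \<epsilon> s)) s))"
proof -
  let ?R = "{\<rho>. \<rho> permutes {..<m} \<and> \<rho> 0 = 0}"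
  let ?X = "\<lambda>l \<epsilon>. branch z \<mu> C (face m l \<epsilon> s) * face_form z Hs (\<lambda>s. pos C (face m l \<epsilon> s)) s"
  have X: "(\<Sum>\<rho>\<in>?R. of_int (sign \<rho>) * face_term \<mu> Hs (cycle_perm l \<circ> \<rho>) (face m l \<epsilon> s)) = ?X l \<epsilon>" if l: "l < m" for l \<epsilon>
    unfolding face_form_def sum_distrib_left
  proof (rule sum.cong[OF HOL.refl])
    fix \<rho> assume \<rho>: "\<rho> \<in> ?R"
    have "(\<Prod>a<length Hs. dlog z (Hs ! a) (pos C (face m l \<epsilon> s)) (tangent C ((cycle_perm l \<circ> \<rho>) (Suc a)) (face m l \<epsilon> s))) =
      (\<Prod>a<length Hs. dlog z (Hs ! a) (pos C (face m l \<epsilon> s))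
        (\<lambda>k. if k < m then partial (\<rho> (Suc a) - 1) (\<lambda>s. pos C (face m l \<epsilon> s) k) s else 0))"
    proof (rule prod.cong[OF HOL.refl])
      fix a assume a: "a \<in> {..<length Hs}"
      have \<rho>p: "\<rho> permutes {..<m}" "\<rho> 0 = 0" using \<rho> by simp_all
      have lt: "\<rho> (Suc a) < m" by (rule permutes_lt[OF \<rho>p(1)]) (use a Hs in simp)
      have inj: "inj \<rho>" by (rule permutes_inj[OF \<rho>p(1)])
      have "\<rho> (Suc a) \<noteq> \<rho> 0" unfolding inj_eq[OF inj] by simp
      then have "\<rho> (Suc a) \<noteq> 0" unfolding \<rho>p(2) .
      then obtain b where rb: "\<rho> (Suc a) = Suc b" by (meson not0_implies_Suc)
      show "dlog z (Hs ! a) (pos C (face m l \<epsilon> s)) (tangent C ((cycle_perm l \<circ> \<rho>) (Suc a)) (face m l \<epsilon> s)) =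
        dlog z (Hs ! a) (pos C (face m l \<epsilon> s))
          (\<lambda>k. if k < m then partial (\<rho> (Suc a) - 1) (\<lambda>s. pos C (face m l \<epsilon> s) k) s else 0)"
        unfolding comp_apply rb diff_Suc_1 tangent_face[OF l lt[unfolded rb]] ..
    qed
    then show "of_int (sign \<rho>) * face_term \<mu> Hs (cycle_perm l \<circ> \<rho>) (face m l \<epsilon> s) =
      branch z \<mu> C (face m l \<epsilon> s) * (of_int (sign \<rho>) * (\<Prod>a<length Hs. dlog z (Hs ! a) (pos C (face m l \<epsilon> s))
        (\<lambda>k. if k < m then partial (\<rho> (Suc a) - 1) (\<lambda>s. pos C (face m l \<epsilon> s) k) s else 0)))"
      unfolding face_term_def by (simp only: mult_ac)
  qed
  have "(\<Sum>\<pi> | \<pi> permutes {..<m}. of_int (sign \<pi>) *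
      (face_term \<mu> Hs \<pi> (face m (\<pi> 0) 1 s) - face_term \<mu> Hs \<pi> (face m (\<pi> 0) 0 s))) =
    (\<Sum>l<m. (-1) ^ l * (\<Sum>\<rho>\<in>?R. of_int (sign \<rho>) *
      (face_term \<mu> Hs (cycle_perm l \<circ> \<rho>) (face m ((cycle_perm l \<circ> \<rho>) 0) 1 s) -
       face_term \<mu> Hs (cycle_perm l \<circ> \<rho>) (face m ((cycle_perm l \<circ> \<rho>) 0) 0 s))))"
  proof -
    have P: "{\<pi>. \<pi> permutes {..<m}} = {\<pi>. \<pi> permutes {..<m} \<and> 0 < m}" using Hs by auto
    show ?thesis unfolding P by (rule sum_permutations_first)
  qed
  also have "\<dots> = (\<Sum>l<m. (-1) ^ l * (?X l 1 - ?X l 0))"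
  proof (rule sum.cong[OF HOL.refl])
    fix l assume "l \<in> {..<m}"
    then have l: "l < m" by simp
    have "(\<Sum>\<rho>\<in>?R. of_int (sign \<rho>) *
      (face_term \<mu> Hs (cycle_perm l \<circ> \<rho>) (face m ((cycle_perm l \<circ> \<rho>) 0) 1 s) -
       face_term \<mu> Hs (cycle_perm l \<circ> \<rho>) (face m ((cycle_perm l \<circ> \<rho>) 0) 0 s))) =
      (\<Sum>\<rho>\<in>?R. of_int (sign \<rho>) * face_term \<mu> Hs (cycle_perm l \<circ> \<rho>) (face m l 1 s) -
        of_int (sign \<rho>) * face_term \<mu> Hs (cycle_perm l \<circ> \<rho>) (face m l 0 s))"
      by (rule sum.cong) (auto simp: cycle_perm_simps right_diff_distrib)
    also have "\<dots> = ?X l 1 - ?X l 0" unfolding sum_subtractf X[OF l] ..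
    finally show "(-1) ^ l * (\<Sum>\<rho>\<in>?R. of_int (sign \<rho>) *
      (face_term \<mu> Hs (cycle_perm l \<circ> \<rho>) (face m ((cycle_perm l \<circ> \<rho>) 0) 1 s) -
       face_term \<mu> Hs (cycle_perm l \<circ> \<rho>) (face m ((cycle_perm l \<circ> \<rho>) 0) 0 s))) = (-1) ^ l * (?X l 1 - ?X l 0)"
      by (simp only:)
  qed
  also have "\<dots> = - (\<Sum>l<m. \<Sum>\<epsilon><2. (-1) ^ (l + \<epsilon>) * ?X l \<epsilon>)"
    unfolding sum_negf[symmetric] by (rule sum.cong) (simp_all add: numeral_2_eq_2 algebra_simps)
  finally show ?thesis .
qed

end

section \<open>Cancellation of the faces of a compact cycle\<close>

lemma partial_cong:
  assumes "\<And>x. x \<in> {0..1} \<Longrightarrow> F (s(l := x)) = G (s(l := x))" "s l \<in> {0..1}"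
  shows "partial l F s = partial l G s"
proof -
  have "((\<lambda>x. F (s(l := x))) has_vector_derivative d) (at (s l) within {0..1}) \<longleftrightarrow>
      ((\<lambda>x. G (s(l := x))) has_vector_derivative d) (at (s l) within {0..1})" for d
  proof
    assume "((\<lambda>x. F (s(l := x))) has_vector_derivative d) (at (s l) within {0..1})"
    then show "((\<lambda>x. G (s(l := x))) has_vector_derivative d) (at (s l) within {0..1})"
      by (rule has_vector_derivative_transform[OF assms(2), rotated]) (simp add: assms(1))
  next
    assume "((\<lambda>x. G (s(l := x))) has_vector_derivative d) (at (s l) within {0..1})"
    then show "((\<lambda>x. F (s(l := x))) has_vector_derivative d) (at (s l) within {0..1})"
      by (rule has_vector_derivative_transform[OF assms(2), rotated]) (simp add: assms(1))
  qed
  then show ?thesis by (simp add: partial_def vector_derivative_def)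
qed

text \<open>Only values on the cube enter, even into the derivatives, which are taken within [0,1].
  So faces that agree on the cube carry the same form.\<close>

lemma face_form_cong:
  assumes \<tau>: "\<And>s k. s \<in> cube (m - 1) \<Longrightarrow> k < m \<Longrightarrow> \<tau> s k = \<tau>' s k" and s: "s \<in> cube (m - 1)"
    and Hs: "Suc (length Hs) = m" "set Hs \<subseteq> t_functions"
  shows "face_form z Hs \<tau> s = face_form z Hs \<tau>' s"
  unfolding face_form_def
proof (intro sum.cong HOL.refl arg_cong2[where f = "(*)"] prod.cong)
  fix \<rho> a assume \<rho>: "\<rho> \<in> {\<rho>. \<rho> permutes {..<m} \<and> \<rho> 0 = 0}" and a: "a \<in> {..<length Hs}"
  have \<rho>p: "\<rho> permutes {..<m}" "\<rho> 0 = 0" using \<rho> by simp_all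
  have lt: "\<rho> (Suc a) < m" using permutes_in_image[OF \<rho>p(1), of "Suc a"] a Hs(1) by simp
  have inj: "inj \<rho>" by (rule permutes_inj[OF \<rho>p(1)])
  have "\<rho> (Suc a) \<noteq> \<rho> 0" unfolding inj_eq[OF inj] by simp
  then have b: "\<rho> (Suc a) - 1 < m - 1" using lt unfolding \<rho>p(2) by simp
  have P: "partial (\<rho> (Suc a) - 1) (\<lambda>s. \<tau> s k) s = partial (\<rho> (Suc a) - 1) (\<lambda>s. \<tau>' s k) s" if "k < m" for k
    by (rule partial_cong) (use \<tau>[OF cube_upd[OF s b] that] cubeD[OF s b] in auto)
  have "(\<lambda>k. if k < m then partial (\<rho> (Suc a) - 1) (\<lambda>s. \<tau> s k) s else 0) =
      (\<lambda>k. if k < m then partial (\<rho> (Suc a) - 1) (\<lambda>s. \<tau>' s k) s else 0)" using P by auto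
  moreover have "dval z (Hs ! a) (\<tau> s) = dval z (Hs ! a) (\<tau>' s)"
  proof -
    have "below_m (Hs ! a)" using a Hs by (intro below_m_functions(1)) (auto dest: nth_mem)
    then show ?thesis using \<tau>[OF s] by (cases "Hs ! a") auto
  qed
  ultimately show "dlog z (Hs ! a) (\<tau> s) (\<lambda>k. if k < m then partial (\<rho> (Suc a) - 1) (\<lambda>s. \<tau> s k) s else 0) =
      dlog z (Hs ! a) (\<tau>' s) (\<lambda>k. if k < m then partial (\<rho> (Suc a) - 1) (\<lambda>s. \<tau>' s k) s else 0)"
    by (simp add: dlog_def)
qed

text \<open>Along one direction the face is constant, and every permutation assigns this direction
  to some factor of the product, which then vanishes.\<close>

lemma face_form_degenerate:
  assumes \<tau>: "degenerate m \<tau>" and s: "s \<in> cube (m - 1)" and Hs: "Suc (length Hs) = m"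
  shows "face_form z Hs \<tau> s = 0"
  unfolding face_form_def
proof (rule sum.neutral, rule ballI)
  fix \<rho> assume \<rho>: "\<rho> \<in> {\<rho>. \<rho> permutes {..<m} \<and> \<rho> 0 = 0}"
  obtain l where l: "l < m - 1" "\<And>s x k. s \<in> cube (m - 1) \<Longrightarrow> x \<in> {0..1} \<Longrightarrow> k < m \<Longrightarrow> \<tau> (s(l := x)) k = \<tau> s k"
    using \<tau> unfolding degenerate_def by blast
  have P0: "partial l (\<lambda>s. \<tau> s k) s = 0" if "k < m" for k
  proof -
    have "partial l (\<lambda>s. \<tau> s k) s = partial l (\<lambda>_. \<tau> s k) s"
      by (rule partial_cong) (use l(2)[OF s _ that] cubeD[OF s l(1)] in auto)
    also have "\<dots> = 0"
      unfolding partial_def using cubeD[OF s l(1)]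
      by (intro vector_derivative_within_cbox[of 0 1, unfolded box_real]) auto
    finally show ?thesis .
  qed
  have \<rho>p: "\<rho> permutes {..<m}" "\<rho> 0 = 0" using \<rho> by simp_all
  obtain b where b: "\<rho> b = Suc l" using surjD[OF permutes_surj[OF \<rho>p(1)], of "Suc l"] by force
  have "b \<noteq> 0" using b \<rho>p(2) by (metis nat.distinct(1))
  then obtain a where a: "b = Suc a" by (meson not0_implies_Suc)
  have "b < m"
  proof (rule ccontr)
    assume "\<not> b < m"
    then have "\<rho> b = b" using permutes_not_in[OF \<rho>p(1), of b] by simp
    then show False using b l(1) \<open>\<not> b < m\<close> by simp
  qed
  then have "a < length Hs" using a Hs by simp
  moreover have "dlog z (Hs ! a) (\<tau> s) (\<lambda>k. if k < m then partial (\<rho> (Suc a) - 1) (\<lambda>s. \<tau> s k) s else 0) = 0"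
  proof -
    have "(\<lambda>k. if k < m then partial (\<rho> (Suc a) - 1) (\<lambda>s. \<tau> s k) s else 0) = (\<lambda>k. 0)"
      using b a P0 by auto
    moreover have "ddiff H (\<lambda>k. 0) = 0" for H :: "'n diff_fun" by (cases H) auto
    ultimately show ?thesis by (simp add: dlog_def)
  qed
  ultimately show "of_int (sign \<rho>) * (\<Prod>a<length Hs. dlog z (Hs ! a) (\<tau> s)
      (\<lambda>k. if k < m then partial (\<rho> (Suc a) - 1) (\<lambda>s. \<tau> s k) s else 0)) = 0"
    by (auto intro!: bexI[of _ a])
qed

text \<open>To be used with the face as \<open>key\<close>, the form on it as
  \<open>\<Theta>\<close> and the signed branch as \<open>h\<close>: the form is common to all
  members of a class and factors out.\<close>

lemma sum_grouped_zero:
  fixes h \<Theta> :: "'i \<Rightarrow> complex"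
  assumes "finite F" "\<And>x y. x \<in> F \<Longrightarrow> y \<in> F \<Longrightarrow> key y = key x \<Longrightarrow> \<Theta> y = \<Theta> x"
    and "\<And>x. x \<in> F \<Longrightarrow> \<Theta> x = 0 \<or> (\<Sum>y\<in>{y \<in> F. key y = key x}. h y) = 0"
  shows "(\<Sum>x\<in>F. h x * \<Theta> x) = 0"
proof -
  have "(\<Sum>x\<in>F. h x * \<Theta> x) = (\<Sum>y\<in>key ` F. \<Sum>x\<in>{x \<in> F. key x = y}. h x * \<Theta> x)"
    by (rule sum.image_gen[OF assms(1)])
  also have "\<dots> = 0"
  proof (rule sum.neutral, rule ballI)
    fix y assume "y \<in> key ` F"
    then obtain x where x: "x \<in> F" "y = key x" by auto
    have "(\<Sum>x\<in>{x \<in> F. key x = y}. h x * \<Theta> x) = (\<Sum>x'\<in>{x' \<in> F. key x' = key x}. h x' * \<Theta> x)"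
      using assms(2)[OF x(1)] x(2) by (intro sum.cong) auto
    also have "\<dots> = (\<Sum>x'\<in>{x' \<in> F. key x' = key x}. h x') * \<Theta> x" by (rule sum_distrib_right[symmetric])
    also have "\<dots> = 0" using assms(3)[OF x(1)] by auto
    finally show "(\<Sum>x\<in>{x \<in> F. key x = y}. h x * \<Theta> x) = 0" .
  qed
  finally show ?thesis .
qed

text \<open>The boundary terms of all cells are integrals over one and the same cube, and their sum
  vanishes already pointwise: on a degenerate face the form is zero, and over each class of equal
  nondegenerate faces the branches add up to zero.\<close>

lemma compact_cycle_stokes:
  assumes \<Gamma>: "compact_cycle z \<mu> \<Gamma>" and Hs: "Suc (length Hs) = m" "set Hs \<subseteq> t_functions"
  shows "chain_integral \<Gamma> (branch z \<mu>) (wedge ((\<lambda>t w. dlog_Phi z \<mu> t w / \<kappa>) # map (dlog z) Hs)) = 0"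
proof -
  let ?A = "chain_index \<Gamma>" and ?C = "chain_cell \<Gamma>" and ?n = "m - 1"
  let ?M = "Pi\<^sub>M {..<?n} (\<lambda>_. lborel :: real measure)"
  let ?d = "wedge ((\<lambda>t w. dlog_Phi z \<mu> t w / \<kappa>) # map (dlog z) Hs)"
  have A: "finite ?A" and cells: "\<And>a. a \<in> ?A \<Longrightarrow> twisted_cell 2 (cube m) z (?C a)" and bd: "boundary_zero z \<mu> \<Gamma>"
    using \<Gamma> by (auto simp: compact_cycle_def)
  let ?f = "\<lambda>a s. \<Sum>\<pi> | \<pi> permutes {..<m}. of_int (sign \<pi>) *
        (face_term (?C a) z \<mu> Hs \<pi> (face m (\<pi> 0) 1 s) - face_term (?C a) z \<mu> Hs \<pi> (face m (\<pi> 0) 0 s))"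
  have zero: "(\<Sum>a\<in>?A. coef (?C a) * ?f a s) = 0" if "s \<in> open_cube ?n" for s
  proof -
    have s: "s \<in> cube ?n" using that open_cube_subset by blast
    let ?F = "?A \<times> {..<m} \<times> {..<2::nat}"
    let ?\<tau> = "\<lambda>(a, l, \<epsilon>) s. pos (?C a) (face m l \<epsilon> s)"
    let ?h = "\<lambda>(a, l, \<epsilon>). (-1) ^ (l + \<epsilon>) * coef (?C a) * branch z \<mu> (?C a) (face m l \<epsilon> s)"
    let ?\<Theta> = "\<lambda>x. face_form z Hs (?\<tau> x) s"
    \<comment> \<open>Values off the cube and coordinates from m on are normalised to 0, so that
      equality of keys is precisely the agreement that \<open>boundary_zero\<close> speaks
      of.\<close>
    let ?key = "\<lambda>x s k. if s \<in> cube ?n \<and> k < m then ?\<tau> x s k else 0"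
    have key: "?key y = ?key x \<longleftrightarrow> (\<forall>s\<in>cube ?n. \<forall>k<m. ?\<tau> y s k = ?\<tau> x s k)" for x y
    proof
      assume L: "?key y = ?key x"
      show "\<forall>s\<in>cube ?n. \<forall>k<m. ?\<tau> y s k = ?\<tau> x s k"
      proof (intro ballI allI impI)
        fix s k assume "s \<in> cube ?n" "k < m"
        then show "?\<tau> y s k = ?\<tau> x s k" using fun_cong[OF fun_cong[OF L, of s], of k] by simp
      qed
    qed (auto simp: fun_eq_iff)
    have "(\<Sum>x\<in>?F. ?h x * ?\<Theta> x) = 0"
    proof (rule sum_grouped_zero[where key = ?key])
      show "finite ?F" using A by simp
      fix x assume x: "x \<in> ?F"
      show "?\<Theta> y = ?\<Theta> x" if "y \<in> ?F" "?key y = ?key x" for y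
        using that(2) unfolding key by (intro face_form_cong[OF _ s Hs]) blast
      show "?\<Theta> x = 0 \<or> (\<Sum>y\<in>{y \<in> ?F. ?key y = ?key x}. ?h y) = 0"
      proof (cases "degenerate m (?\<tau> x)")
        case True
        then show ?thesis using face_form_degenerate[OF _ s Hs(1)] by blast
      next
        case False
        have "{y \<in> ?F. ?key y = ?key x} = {(a, l, \<epsilon>). a \<in> ?A \<and> l < m \<and> \<epsilon> < 2 \<and>
            (\<forall>s'\<in>cube ?n. \<forall>k<m. pos (?C a) (face m l \<epsilon> s') k = ?\<tau> x s' k)}"
          unfolding key by auto
        moreover have "(\<Sum>(a, l, \<epsilon>) | a \<in> ?A \<and> l < m \<and> \<epsilon> < 2 \<and>
            (\<forall>s'\<in>cube ?n. \<forall>k<m. pos (?C a) (face m l \<epsilon> s') k = ?\<tau> x s' k).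
            (-1) ^ (l + \<epsilon>) * coef (?C a) * branch z \<mu> (?C a) (face m l \<epsilon> s)) = 0"
          using bd False s unfolding boundary_zero_def by blast
        ultimately show ?thesis by (simp only:) blast
      qed
    qed
    moreover have "(\<Sum>a\<in>?A. coef (?C a) * ?f a s) = - (\<Sum>x\<in>?F. ?h x * ?\<Theta> x)"
    proof -
      have "(\<Sum>a\<in>?A. coef (?C a) * ?f a s) = (\<Sum>a\<in>?A. - (\<Sum>l<m. \<Sum>\<epsilon><2. ?h (a, l, \<epsilon>) * ?\<Theta> (a, l, \<epsilon>)))"
      proof (rule sum.cong[OF HOL.refl])
        fix a assume "a \<in> ?A"
        show "coef (?C a) * ?f a s = - (\<Sum>l<m. \<Sum>\<epsilon><2. ?h (a, l, \<epsilon>) * ?\<Theta> (a, l, \<epsilon>))"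
          unfolding sum_face_terms[OF cells[OF \<open>a \<in> ?A\<close>] Hs(1)] mult_minus_right sum_distrib_left prod.case
          by (simp only: mult_ac)
      qed
      then show ?thesis by (simp add: sum_negf sum.cartesian_product case_prod_unfold)
    qed
    ultimately show ?thesis by simp
  qed
  have "chain_integral \<Gamma> (branch z \<mu>) ?d = (\<Sum>a\<in>?A. coef (?C a) * (LINT s:open_cube ?n|?M. ?f a s))"
    unfolding chain_integral_def cell_integral_def infsum_finite[OF A]
    by (rule sum.cong[OF HOL.refl]) (simp only: cell_stokes(1)[OF cells Hs])
  also have "\<dots> = (LINT s:open_cube ?n|?M. (\<Sum>a\<in>?A. coef (?C a) * ?f a s))"
    by (rule set_integral_sum_mult(2)[OF A cell_stokes(2)[OF cells Hs], symmetric])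
  also have "\<dots> = (LINT s:open_cube ?n|?M. 0)"
    by (rule set_lebesgue_integral_cong[OF measurable_open_cube]) (use zero in blast)
  also have "\<dots> = 0" by (simp add: set_lebesgue_integral_def)
  finally show ?thesis .
qed

lemma compact_chain_converges:
  assumes A: "finite (chain_index \<Gamma>)"
    and "\<And>a. a \<in> chain_index \<Gamma> \<Longrightarrow> continuous_on (cube m) (\<lambda>s. \<Psi> (chain_cell \<Gamma> a) s * pullback m (chain_cell \<Gamma> a) \<omega> s)"
  shows "chain_converges \<Gamma> \<Psi> \<omega>"
  unfolding chain_converges_def using assms by (auto intro!: set_integrable_continuous_cube summable_on_finite)

lemma compact_cycle_converges:
  assumes \<Gamma>: "compact_cycle z \<mu> \<Gamma>"
  shows "length Hs = m \<Longrightarrow> set Hs \<subseteq> t_functions \<Longrightarrow> chain_converges \<Gamma> (branch z \<mu>) (wedge (map (dlog z) Hs))"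
    and "Suc (length Hs) = m \<Longrightarrow> set Hs \<subseteq> t_functions \<Longrightarrow>
      chain_converges \<Gamma> (branch z \<mu>) (wedge ((\<lambda>t w. dlog_Phi z \<mu> t w / \<kappa>) # map (dlog z) Hs))"
proof -
  have A: "finite (chain_index \<Gamma>)" and cells: "\<And>a. a \<in> chain_index \<Gamma> \<Longrightarrow> twisted_cell 2 (cube m) z (chain_cell \<Gamma> a)"
    using \<Gamma> by (auto simp: compact_cycle_def)
  show "chain_converges \<Gamma> (branch z \<mu>) (wedge (map (dlog z) Hs))" if "length Hs = m" "set Hs \<subseteq> t_functions"
    by (rule compact_chain_converges[OF A], rule continuous_on_mult[OF branch_continuous pullback_wedge_continuous])
      (use cells that in auto)
  show "chain_converges \<Gamma> (branch z \<mu>) (wedge ((\<lambda>t w. dlog_Phi z \<mu> t w / \<kappa>) # map (dlog z) Hs))"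
    if Hs: "Suc (length Hs) = m" "set Hs \<subseteq> t_functions"
  proof (rule compact_chain_converges[OF A])
    fix a assume a: "a \<in> chain_index \<Gamma>"
    note C = cells[OF a]
    have "continuous_on (cube m) (\<lambda>s. \<Sum>\<pi> | \<pi> permutes {..<m}. of_int (sign \<pi>) * face_term_deriv (chain_cell \<Gamma> a) z \<mu> Hs \<pi> s)"
      by (intro continuous_on_sum continuous_on_mult continuous_on_const face_term_deriv_continuous[OF C Hs]) simp
    then show "continuous_on (cube m) (\<lambda>s. branch z \<mu> (chain_cell \<Gamma> a) s *
        pullback m (chain_cell \<Gamma> a) (wedge ((\<lambda>t w. dlog_Phi z \<mu> t w / \<kappa>) # map (dlog z) Hs)) s)"
      by (rule continuous_on_cong[THEN iffD1, rotated 2]) (simp_all add: sum_face_term_deriv[OF C Hs])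
  qed
qed

end

section \<open>Differentiation under the integral sign\<close>

lemma eventually_line_in_open:
  fixes z :: "(complex, 'n::finite) vec" and \<mu> \<mu>' :: "(complex, 'd::finite) vec"
  assumes "open U" "(z, \<mu>) \<in> U"
  shows "eventually (\<lambda>a :: complex. (z, \<mu> + a *s \<mu>') \<in> U) (nhds 0)"
proof -
  have "continuous_on UNIV (\<lambda>a :: complex. (z, \<mu> + a *s \<mu>'))"
    by (intro continuous_on_Pair continuous_on_const continuous_on_add)
      (auto simp: vector_scalar_mult_def intro!: continuous_on_vec_lambda continuous_intros)
  then have "open ((\<lambda>a :: complex. (z, \<mu> + a *s \<mu>')) -` U)" using assms(1) by (simp add: continuous_on_open_vimage)
  then show ?thesis using assms(2) by (auto simp: eventually_nhds)
qed

lemma norm_set_integral_open_cube_le: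
  fixes g :: "(nat \<Rightarrow> real) \<Rightarrow> complex"
  assumes g: "continuous_on (cube m) g" and K: "\<And>s. s \<in> cube m \<Longrightarrow> norm (g s) \<le> K"
  shows "norm (LINT s:open_cube m|Pi\<^sub>M {..<m} (\<lambda>_. lborel). g s) \<le> K"
proof -
  let ?M = "Pi\<^sub>M {..<m} (\<lambda>_. lborel :: real measure)"
  have int: "integrable ?M (\<lambda>s. indicator (open_cube m) s *\<^sub>R g s)"
    using set_integrable_continuous_cube[OF g] by (simp add: set_integrable_def)
  have intK: "integrable ?M (\<lambda>s. indicator (open_cube m) s * K)"
    using measurable_open_cube[of m] by (intro integrable_mult_left integrable_real_indicator) (auto simp: emeasure_open_cube)
  have "norm (LINT s|?M. indicator (open_cube m) s *\<^sub>R g s) \<le> (LINT s|?M. norm (indicator (open_cube m) s *\<^sub>R g s))"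
    by (rule integral_norm_bound)
  also have "\<dots> \<le> (LINT s|?M. indicator (open_cube m) s * K)"
  proof (rule integral_mono[OF integrable_norm[OF int] intK])
    fix s show "norm (indicator (open_cube m) s *\<^sub>R g s) \<le> indicator (open_cube m) s * K"
      using K[of s] open_cube_subset[of m] by (cases "s \<in> open_cube m") auto
  qed
  also have "\<dots> = measure ?M (open_cube m) * K"
    using measurable_open_cube[of m] by (simp add: emeasure_open_cube)
  also have "\<dots> = K" by (simp add: measure_def emeasure_open_cube)
  finally show ?thesis by (simp add: set_lebesgue_integral_def)
qed

lemma bounded_on_cube:
  fixes g :: "(nat \<Rightarrow> real) \<Rightarrow> complex"
  assumes "continuous_on (cube m) g"
  obtains K where "K \<ge> 0" "\<And>s. s \<in> cube m \<Longrightarrow> norm (g s) \<le> K"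
proof -
  have "bounded (g ` cube m)" by (intro compact_imp_bounded compact_continuous_image assms compact_cube)
  then obtain b where b: "\<And>s. s \<in> cube m \<Longrightarrow> norm (g s) \<le> b" by (auto simp: bounded_iff)
  show thesis by (rule that[of "max 0 b"]) (use b in \<open>auto intro: max.coboundedI2\<close>)
qed

text \<open>The parameter enters through an exponential with bounded exponent, so the second order
  Taylor remainder is at most a constant times |h|^2, uniformly on the cube, and so is its
  integral.\<close>

lemma DERIV_integral_exp:
  fixes q B :: "(nat \<Rightarrow> real) \<Rightarrow> complex"
  assumes q: "continuous_on (cube m) q" and B: "continuous_on (cube m) B"
  shows "((\<lambda>h. LINT s:open_cube m|Pi\<^sub>M {..<m} (\<lambda>_. lborel). q s * exp (h * B s)) has_field_derivative
    (LINT s:open_cube m|Pi\<^sub>M {..<m} (\<lambda>_. lborel). q s * B s)) (at 0)"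
proof -
  let ?M = "Pi\<^sub>M {..<m} (\<lambda>_. lborel :: real measure)"
  let ?f = "\<lambda>h. LINT s:open_cube m|?M. q s * exp (h * B s)" and ?D = "LINT s:open_cube m|?M. q s * B s"
  obtain Q where Q: "Q \<ge> 0" "\<And>s. s \<in> cube m \<Longrightarrow> norm (q s) \<le> Q" using bounded_on_cube[OF q] by blast
  obtain b where b: "b \<ge> 0" "\<And>s. s \<in> cube m \<Longrightarrow> norm (B s) \<le> b" using bounded_on_cube[OF B] by blast
  \<comment> \<open>From |exp w - 1 - w| \<le> exp|w| |w|^2 with w = h B, where |w| \<le> |h| b and
    |h| \<le> 1.\<close>
  let ?K = "Q * (exp b * b ^ 2)"
  have exp_cont: "continuous_on (cube m) (\<lambda>s. q s * exp (h * B s))" for h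
    by (intro continuous_on_mult q continuous_on_exp continuous_on_const B)
  have qB: "continuous_on (cube m) (\<lambda>s. q s * B s)" by (intro continuous_on_mult q B)
  have bound: "norm ((?f h - ?f 0) / h - ?D) \<le> ?K * norm h" if h: "norm h \<le> 1" "h \<noteq> 0" for h
  proof -
    let ?g = "\<lambda>s. q s * (exp (h * B s) - 1 - h * B s)"
    \<comment> \<open>The three terms of the remainder, written as one linear combination indexed by
      0, 1, 2.\<close>
    have "(LINT s:open_cube m|?M. (\<Sum>i<3. (if i = 0 then 1 else if i = Suc 0 then -1 else - h) *
        (if i = 0 then q s * exp (h * B s) else if i = Suc 0 then q s * exp (0 * B s) else q s * B s))) =
      (\<Sum>i<3. (if i = 0 then 1 else if i = Suc 0 then -1 else - h) *
        (LINT s:open_cube m|?M. (if i = 0 then q s * exp (h * B s) else if i = Suc 0 then q s * exp (0 * B s) else q s * B s)))"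
    proof (rule set_integral_sum_mult(2))
      fix i :: nat
      show "set_integrable ?M (open_cube m)
        (\<lambda>s. if i = 0 then q s * exp (h * B s) else if i = Suc 0 then q s * exp (0 * B s) else q s * B s)"
        using exp_cont[of h] exp_cont[of 0] qB by (intro set_integrable_continuous_cube) (cases "i = 0"; cases "i = Suc 0"; simp)
    qed simp
    then have "(LINT s:open_cube m|?M. ?g s) = ?f h - ?f 0 - h * ?D"
      by (simp add: numeral_3_eq_3 algebra_simps)
    moreover have "norm (LINT s:open_cube m|?M. ?g s) \<le> ?K * (norm h)\<^sup>2"
    proof (rule norm_set_integral_open_cube_le)
      show "continuous_on (cube m) ?g"
        by (intro continuous_on_mult q continuous_on_diff continuous_on_exp continuous_on_const B)
      fix s assume s: "s \<in> cube m"
      have "norm (exp (h * B s) - (\<Sum>i\<le>1. (h * B s) ^ i / fact i)) \<le> exp (norm (h * B s)) * (norm (h * B s) ^ Suc 1) / fact 1"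
        by (rule Taylor_exp_field)
      then have "norm (exp (h * B s) - 1 - h * B s) \<le> exp (norm (h * B s)) * (norm (h * B s))\<^sup>2"
        by (simp add: diff_diff_eq power2_eq_square)
      also have "\<dots> \<le> exp b * (norm h * b)\<^sup>2"
      proof (intro mult_mono power_mono)
        have hb: "norm (h * B s) \<le> norm h * b" unfolding norm_mult by (intro mult_left_mono b s) simp
        also have "\<dots> \<le> 1 * b" by (intro mult_right_mono h b)
        finally show "exp (norm (h * B s)) \<le> exp b" by simp
        show "norm (h * B s) \<le> norm h * b" by (rule hb)
      qed simp_all
      finally have "norm (exp (h * B s) - 1 - h * B s) \<le> exp b * (norm h * b)\<^sup>2" .
      then have "norm (?g s) \<le> Q * (exp b * (norm h * b)\<^sup>2)"
        unfolding norm_mult[of "q s"] by (intro mult_mono Q s) simp_all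
      then show "norm (?g s) \<le> ?K * (norm h)\<^sup>2" by (simp add: power_mult_distrib mult_ac)
    qed
    ultimately have le: "norm (?f h - ?f 0 - h * ?D) \<le> ?K * (norm h)\<^sup>2" by simp
    have "(?f h - ?f 0) / h - ?D = (?f h - ?f 0 - h * ?D) / h" using h(2) by (simp add: diff_divide_distrib)
    then have "norm ((?f h - ?f 0) / h - ?D) = norm (?f h - ?f 0 - h * ?D) / norm h" by (simp only: norm_divide)
    also have "\<dots> \<le> ?K * (norm h)\<^sup>2 / norm h" by (rule divide_right_mono[OF le]) simp
    also have "\<dots> = ?K * norm h" using h(2) by (simp add: power2_eq_square)
    finally show ?thesis .
  qed
  have "((\<lambda>h. (?f h - ?f 0) / h - ?D) \<longlongrightarrow> 0) (at 0)"
  proof (rule Lim_null_comparison)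
    have "eventually (\<lambda>h :: complex. norm h < 1) (at 0)"
      by (rule eventually_at_ball'[of 1 0 UNIV, THEN eventually_mono]) (auto simp: dist_norm)
    moreover have "eventually (\<lambda>h :: complex. h \<noteq> 0) (at 0)" by (rule eventually_neq_at_within)
    ultimately show "eventually (\<lambda>h. norm ((?f h - ?f 0) / h - ?D) \<le> ?K * norm h) (at 0)"
      by eventually_elim (rule bound, auto)
    show "((\<lambda>h. ?K * norm h) \<longlongrightarrow> 0) (at (0 :: complex))"
      by (rule tendsto_mult_right_zero, rule tendsto_norm_zero, rule tendsto_ident_at)
  qed
  then show ?thesis unfolding DERIV_def by (subst (asm) LIM_zero_iff) simp
qed

section \<open>Dependence of \<Phi>_\<mu> on \<mu>, and horizontal families\<close>

context master_function
begin

text \<open>log \<Phi>_\<mu> is affine in \<mu>, and this is its slope in direction \<mu>'. For this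
  reason \<open>branch_shift\<close> is exact for all \<open>a\<close>, not merely to first
  order.\<close>

definition log_dir :: "(complex, 'n) vec \<Rightarrow> complex^'d \<Rightarrow> point \<Rightarrow> complex" where
  "log_dir z \<mu>' t = - (\<Sum>k<m. \<alpha> (c k) \<mu>' * t k) + (\<Sum>j\<in>UNIV. \<Lambda> j \<mu>' * z $ j)"

context
  assumes fun_\<alpha>: "\<And>i. functional (\<alpha> i)" and fun_\<Lambda>: "\<And>j. functional (\<Lambda> j)"
begin

lemma branch_shift:
  "branch z (\<mu> + a *s \<mu>') C s = branch z \<mu> C s * exp (a * (log_dir z \<mu>' (pos C s) / \<kappa>))"
proof -
  have "log_Phi z (\<mu> + a *s \<mu>') t L = log_Phi z \<mu> t L + a * log_dir z \<mu>' t" for t L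
    unfolding log_Phi_def log_dir_def functional_add[OF fun_\<alpha>] functional_add[OF fun_\<Lambda>]
      functional_scale[OF fun_\<alpha>] functional_scale[OF fun_\<Lambda>]
    by (simp add: sum.distrib sum_distrib_left algebra_simps)
  then show ?thesis by (simp add: branch_def add_divide_distrib exp_add)
qed

lemma branch_deriv_eq: "branch_deriv z \<mu> \<mu>' C s = branch z \<mu> C s * (log_dir z \<mu>' (pos C s) / \<kappa>)"
proof -
  have "((\<lambda>a. X * exp (a * w)) has_field_derivative X * w) (at 0)" for X w :: complex
    by (auto intro!: derivative_eq_intros)
  from this[of "branch z \<mu> C s" "log_dir z \<mu>' (pos C s) / \<kappa>"]
  have "((\<lambda>a. branch z (\<mu> + a *s \<mu>') C s) has_field_derivative branch z \<mu> C s * (log_dir z \<mu>' (pos C s) / \<kappa>)) (at 0)"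
    unfolding branch_shift .
  then show ?thesis unfolding branch_deriv_def by (rule DERIV_imp_deriv)
qed

text \<open>Near a given parameter, cells and logarithms stay the same along the line in direction
  \<mu>', so only the exponential in \<open>branch_shift\<close> varies, and
  \<open>DERIV_integral_exp\<close> applies to each of the finitely many cells.\<close>

lemma compact_derivative_under_integral:
  assumes D: "open D" "\<And>z \<mu>. (z, \<mu>) \<in> D \<Longrightarrow> compact_cycle z \<mu> (\<gamma> z \<mu>)"
    and const: "locally_constant (cube m) D \<gamma>"
  shows "derivative_under_integral D \<gamma>"
proof -
  have "chain_converges (\<gamma> z \<mu>) (branch_deriv z \<mu> \<mu>') (wedge (map (dlog z) Hs)) \<and>
      ((\<lambda>x. chain_integral (\<gamma> z (\<mu> + x *s \<mu>')) (branch z (\<mu> + x *s \<mu>')) (wedge (map (dlog z) Hs))) has_field_derivative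
        chain_integral (\<gamma> z \<mu>) (branch_deriv z \<mu> \<mu>') (wedge (map (dlog z) Hs))) (at 0)"
    if zD: "(z, \<mu>) \<in> D" and Hs: "length Hs = m" "set Hs \<subseteq> t_functions"
    for z \<mu> \<mu>' and Hs :: "'n diff_fun list"
  proof -
    let ?\<omega> = "wedge (map (dlog z) Hs)" and ?\<Gamma> = "\<gamma> z \<mu>"
    let ?C = "chain_cell ?\<Gamma>"
    from D(2)[OF zD] have A: "finite (chain_index ?\<Gamma>)"
      and cells: "\<And>a. a \<in> chain_index ?\<Gamma> \<Longrightarrow> twisted_cell 2 (cube m) z (?C a)"
      by (auto simp: compact_cycle_def)
    have dir: "continuous_on (cube m) (\<lambda>s. log_dir z \<mu>' (pos (?C a) s) / \<kappa>)" if "a \<in> chain_index ?\<Gamma>" for a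
      unfolding log_dir_def divide_inverse
      by (intro continuous_on_mult continuous_on_add continuous_on_minus continuous_on_sum continuous_on_const
          pos_C2(1)[OF cells[OF that]]) simp
    have q: "continuous_on (cube m) (\<lambda>s. branch z \<mu> (?C a) s * pullback m (?C a) ?\<omega> s)" if "a \<in> chain_index ?\<Gamma>" for a
      by (intro continuous_on_mult branch_continuous[OF cells[OF that]] pullback_wedge_continuous[OF cells[OF that] Hs])
    have bd: "branch_deriv z \<mu> \<mu>' (?C a) s * pullback m (?C a) ?\<omega> s =
        branch z \<mu> (?C a) s * pullback m (?C a) ?\<omega> s * (log_dir z \<mu>' (pos (?C a) s) / \<kappa>)" for a s
      by (simp add: branch_deriv_eq)
    have conv: "chain_converges ?\<Gamma> (branch_deriv z \<mu> \<mu>') ?\<omega>"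
    proof (rule compact_chain_converges[OF A])
      fix a assume a: "a \<in> chain_index ?\<Gamma>"
      show "continuous_on (cube m) (\<lambda>s. branch_deriv z \<mu> \<mu>' (?C a) s * pullback m (?C a) ?\<omega> s)"
        using continuous_on_mult[OF q[OF a] dir[OF a]] by (simp only: bd)
    qed
    obtain U B co ps lb where U: "open U" "(z, \<mu>) \<in> U" "U \<subseteq> D" and
      cell': "\<forall>(z, \<mu>)\<in>U. chain_index (\<gamma> z \<mu>) = B \<and>
        (\<forall>a\<in>B. chain_cell (\<gamma> z \<mu>) a = \<lparr>coef = co a, pos = ps a z, logb = lb a z\<rparr>)"
      using bspec[OF const[unfolded locally_constant_def] zD] by (elim exE conjE) (rule that)
    have cell: "chain_index (\<gamma> z' \<nu>) = B \<and>
        (\<forall>a\<in>B. chain_cell (\<gamma> z' \<nu>) a = \<lparr>coef = co a, pos = ps a z', logb = lb a z'\<rparr>)" if "(z', \<nu>) \<in> U" for z' \<nu>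
      using bspec[OF cell' that] unfolding prod.case .
    have same: "chain_integral (\<gamma> z \<nu>) (branch z \<nu>) ?\<omega> = (\<Sum>a\<in>chain_index ?\<Gamma>. cell_integral (?C a) (branch z \<nu>) ?\<omega>)"
      if "(z, \<nu>) \<in> U" for \<nu>
    proof -
      have idx: "chain_index (\<gamma> z \<nu>) = chain_index ?\<Gamma>" using cell[OF that] cell[OF U(2)] by simp
      have "chain_cell (\<gamma> z \<nu>) a = ?C a" if "a \<in> chain_index ?\<Gamma>" for a
        using cell[OF \<open>(z, \<nu>) \<in> U\<close>] cell[OF U(2)] that by simp
      then show ?thesis unfolding chain_integral_def idx infsum_finite[OF A] by (intro sum.cong) auto
    qed
    have near: "eventually (\<lambda>a. (z, \<mu> + a *s \<mu>') \<in> U) (nhds 0)"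
      by (rule eventually_line_in_open[OF U(1,2)])
    let ?I = "\<lambda>a x. LINT s:open_cube m|cube_measure. (branch z \<mu> (?C a) s * pullback m (?C a) ?\<omega> s) * exp (x * (log_dir z \<mu>' (pos (?C a) s) / \<kappa>))"
    have "((\<lambda>x. \<Sum>a\<in>chain_index ?\<Gamma>. coef (?C a) * ?I a x) has_field_derivative
        (\<Sum>a\<in>chain_index ?\<Gamma>. coef (?C a) * (LINT s:open_cube m|cube_measure.
          (branch z \<mu> (?C a) s * pullback m (?C a) ?\<omega> s) * (log_dir z \<mu>' (pos (?C a) s) / \<kappa>)))) (at 0)"
      by (rule DERIV_sum, rule DERIV_cmult, rule DERIV_integral_exp[OF q dir])
    moreover have "(\<Sum>a\<in>chain_index ?\<Gamma>. coef (?C a) * (LINT s:open_cube m|cube_measure.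
          (branch z \<mu> (?C a) s * pullback m (?C a) ?\<omega> s) * (log_dir z \<mu>' (pos (?C a) s) / \<kappa>))) =
        chain_integral ?\<Gamma> (branch_deriv z \<mu> \<mu>') ?\<omega>"
      unfolding chain_integral_def infsum_finite[OF A] cell_integral_def bd ..
    moreover have "eventually (\<lambda>x. (\<Sum>a\<in>chain_index ?\<Gamma>. coef (?C a) * ?I a x) =
        chain_integral (\<gamma> z (\<mu> + x *s \<mu>')) (branch z (\<mu> + x *s \<mu>')) ?\<omega>) (nhds 0)"
      using near
    proof eventually_elim
      case (elim x)
      show ?case unfolding same[OF elim] cell_integral_def branch_shift
        by (intro sum.cong HOL.refl) (simp only: mult_ac)
    qed
    ultimately have "((\<lambda>x. chain_integral (\<gamma> z (\<mu> + x *s \<mu>')) (branch z (\<mu> + x *s \<mu>')) ?\<omega>) has_field_derivative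
        chain_integral ?\<Gamma> (branch_deriv z \<mu> \<mu>') ?\<omega>) (at 0)"
      by (subst DERIV_cong_ev[OF HOL.refl _ HOL.refl]) (auto elim: eventually_mono)
    with conv show ?thesis by blast
  qed
  then show ?thesis unfolding derivative_under_integral_def Let_def by blast
qed

text \<open>The interface between the analysis of cycles and the rest: compact and noncompact cycles
  provide the same five facts, where convergence, differentiation and Stokes' relation are proved in
  the first case and assumed in the second.\<close>

lemma horizontal_familyD:
  assumes "horizontal_family D \<gamma>"
  shows "open D" and "derivative_under_integral D \<gamma>"
    and "(z, \<mu>) \<in> D \<Longrightarrow> length Hs = m \<Longrightarrow> set Hs \<subseteq> t_functions \<Longrightarrow>
      chain_converges (\<gamma> z \<mu>) (branch z \<mu>) (wedge (map (dlog z) Hs))"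
    and "(z, \<mu>) \<in> D \<Longrightarrow> Suc (length Hs) = m \<Longrightarrow> set Hs \<subseteq> t_functions \<Longrightarrow>
      chain_converges (\<gamma> z \<mu>) (branch z \<mu>) (wedge ((\<lambda>t w. dlog_Phi z \<mu> t w / \<kappa>) # map (dlog z) Hs)) \<and>
      chain_integral (\<gamma> z \<mu>) (branch z \<mu>) (wedge ((\<lambda>t w. dlog_Phi z \<mu> t w / \<kappa>) # map (dlog z) Hs)) = 0"
    and "(z, \<mu>) \<in> D \<Longrightarrow> a \<in> chain_index (\<gamma> z \<mu>) \<Longrightarrow> s \<in> open_cube m \<Longrightarrow> pos (chain_cell (\<gamma> z \<mu>) a) s \<in> complement z"
proof -
  show "open D" using assms by (simp add: horizontal_family_def)
  consider (compact) "\<And>z \<mu>. (z, \<mu>) \<in> D \<Longrightarrow> compact_cycle z \<mu> (\<gamma> z \<mu>)" "locally_constant (cube m) D \<gamma>"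
    | (noncompact) "\<And>z \<mu>. (z, \<mu>) \<in> D \<Longrightarrow> noncompact_cycle z \<mu> (\<gamma> z \<mu>)" "derivative_under_integral D \<gamma>"
    using assms unfolding horizontal_family_def by blast
  note cases = this
  show "derivative_under_integral D \<gamma>"
    using cases
  proof cases
    case compact
    show ?thesis by (rule compact_derivative_under_integral[OF \<open>open D\<close> compact])
  qed
  show "chain_converges (\<gamma> z \<mu>) (branch z \<mu>) (wedge (map (dlog z) Hs))"
    if "(z, \<mu>) \<in> D" "length Hs = m" "set Hs \<subseteq> t_functions"
    using cases
  proof cases
    case compact
    show ?thesis by (rule compact_cycle_converges(1)[OF compact(1)[OF that(1)] that(2,3)])
  next
    case noncompact
    show ?thesis using noncompact(1)[OF that(1)] that(2,3) unfolding noncompact_cycle_def by blast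
  qed
  show "chain_converges (\<gamma> z \<mu>) (branch z \<mu>) (wedge ((\<lambda>t w. dlog_Phi z \<mu> t w / \<kappa>) # map (dlog z) Hs)) \<and>
      chain_integral (\<gamma> z \<mu>) (branch z \<mu>) (wedge ((\<lambda>t w. dlog_Phi z \<mu> t w / \<kappa>) # map (dlog z) Hs)) = 0"
    if "(z, \<mu>) \<in> D" "Suc (length Hs) = m" "set Hs \<subseteq> t_functions"
    using cases
  proof cases
    case compact
    show ?thesis
      using compact_cycle_converges(2)[OF compact(1)[OF that(1)] that(2,3)]
        compact_cycle_stokes[OF compact(1)[OF that(1)] that(2,3)] by blast
  next
    case noncompact
    show ?thesis using noncompact(1)[OF that(1)] that(2,3) unfolding noncompact_cycle_def Let_def by blast
  qed
  show "pos (chain_cell (\<gamma> z \<mu>) a) s \<in> complement z"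
    if "(z, \<mu>) \<in> D" "a \<in> chain_index (\<gamma> z \<mu>)" "s \<in> open_cube m"
    using cases
  proof cases
    case compact
    have "twisted_cell 2 (cube m) z (chain_cell (\<gamma> z \<mu>) a)"
      using compact(1)[OF that(1)] that(2) by (simp add: compact_cycle_def)
    moreover have "s \<in> cube m" using that(3) open_cube_subset by blast
    ultimately show ?thesis unfolding twisted_cell_def by blast
  next
    case noncompact
    have "twisted_cell 1 (open_cube m) z (chain_cell (\<gamma> z \<mu>) a)"
      using noncompact(1)[OF that(1)] that(2) by (simp add: noncompact_cycle_def)
    then show ?thesis using that(3) unfolding twisted_cell_def by blast
  qed
qed

end

section \<open>Congruence and linearity of chain integrals\<close>

lemma chain_cong:
  assumes "\<And>a s. a \<in> chain_index \<Gamma> \<Longrightarrow> s \<in> open_cube m \<Longrightarrow>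
    \<Psi> (chain_cell \<Gamma> a) s * pullback m (chain_cell \<Gamma> a) \<omega> s = \<Psi>' (chain_cell \<Gamma> a) s * pullback m (chain_cell \<Gamma> a) \<omega>' s"
  shows "chain_converges \<Gamma> \<Psi> \<omega> \<longleftrightarrow> chain_converges \<Gamma> \<Psi>' \<omega>'" "chain_integral \<Gamma> \<Psi> \<omega> = chain_integral \<Gamma> \<Psi>' \<omega>'"
proof -
  have cell: "cell_integral (chain_cell \<Gamma> a) \<Psi> \<omega> = cell_integral (chain_cell \<Gamma> a) \<Psi>' \<omega>'" if "a \<in> chain_index \<Gamma>" for a
    unfolding cell_integral_def using assms[OF that]
    by (intro arg_cong2[where f = "(*)"] HOL.refl set_lebesgue_integral_cong measurable_open_cube) blast
  have "set_integrable cube_measure (open_cube m) (\<lambda>s. \<Psi> (chain_cell \<Gamma> a) s * pullback m (chain_cell \<Gamma> a) \<omega> s) \<longleftrightarrow>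
      set_integrable cube_measure (open_cube m) (\<lambda>s. \<Psi>' (chain_cell \<Gamma> a) s * pullback m (chain_cell \<Gamma> a) \<omega>' s)"
    if "a \<in> chain_index \<Gamma>" for a
  proof -
    have "(\<lambda>s. indicator (open_cube m) s *\<^sub>R (\<Psi> (chain_cell \<Gamma> a) s * pullback m (chain_cell \<Gamma> a) \<omega> s)) =
        (\<lambda>s. indicator (open_cube m) s *\<^sub>R (\<Psi>' (chain_cell \<Gamma> a) s * pullback m (chain_cell \<Gamma> a) \<omega>' s))"
    proof
      fix s
      show "indicator (open_cube m) s *\<^sub>R (\<Psi> (chain_cell \<Gamma> a) s * pullback m (chain_cell \<Gamma> a) \<omega> s) =
          indicator (open_cube m) s *\<^sub>R (\<Psi>' (chain_cell \<Gamma> a) s * pullback m (chain_cell \<Gamma> a) \<omega>' s)"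
        by (cases "s \<in> open_cube m") (simp_all add: assms[OF that])
    qed
    then show ?thesis by (simp add: set_integrable_def)
  qed
  moreover have "(\<lambda>a. cell_integral (chain_cell \<Gamma> a) \<Psi> \<omega>) summable_on chain_index \<Gamma> \<longleftrightarrow>
      (\<lambda>a. cell_integral (chain_cell \<Gamma> a) \<Psi>' \<omega>') summable_on chain_index \<Gamma>"
    by (rule summable_on_cong) (rule cell)
  ultimately show "chain_converges \<Gamma> \<Psi> \<omega> \<longleftrightarrow> chain_converges \<Gamma> \<Psi>' \<omega>'" by (simp add: chain_converges_def)
  show "chain_integral \<Gamma> \<Psi> \<omega> = chain_integral \<Gamma> \<Psi>' \<omega>'"
    unfolding chain_integral_def by (rule infsum_cong) (rule cell)
qed

lemma chain_linear_combination:
  assumes I: "finite I" and conv: "\<And>i. i \<in> I \<Longrightarrow> chain_converges \<Gamma> \<Psi> (\<omega> i)"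
  shows "chain_converges \<Gamma> \<Psi> (\<lambda>t V. \<Sum>i\<in>I. b i * \<omega> i t V)"
    and "chain_integral \<Gamma> \<Psi> (\<lambda>t V. \<Sum>i\<in>I. b i * \<omega> i t V) = (\<Sum>i\<in>I. b i * chain_integral \<Gamma> \<Psi> (\<omega> i))"
proof -
  let ?C = "chain_cell \<Gamma>"
  have pb: "\<Psi> (?C a) s * pullback m (?C a) (\<lambda>t V. \<Sum>i\<in>I. b i * \<omega> i t V) s =
      (\<Sum>i\<in>I. b i * (\<Psi> (?C a) s * pullback m (?C a) (\<omega> i) s))" for a s
    by (simp add: pullback_def sum_distrib_left mult_ac)
  have int: "set_integrable cube_measure (open_cube m) (\<lambda>s. \<Psi> (?C a) s * pullback m (?C a) (\<omega> i) s)"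
    if "a \<in> chain_index \<Gamma>" "i \<in> I" for a i
    using conv[OF that(2)] that(1) by (simp add: chain_converges_def)
  have sm: "(\<lambda>a. cell_integral (?C a) \<Psi> (\<omega> i)) summable_on chain_index \<Gamma>" if "i \<in> I" for i
    using conv[OF that] by (simp add: chain_converges_def)
  have cell: "cell_integral (?C a) \<Psi> (\<lambda>t V. \<Sum>i\<in>I. b i * \<omega> i t V) = (\<Sum>i\<in>I. b i * cell_integral (?C a) \<Psi> (\<omega> i))"
    if "a \<in> chain_index \<Gamma>" for a
  proof -
    have "(LINT s:open_cube m|cube_measure. (\<Sum>i\<in>I. b i * (\<Psi> (?C a) s * pullback m (?C a) (\<omega> i) s))) =
        (\<Sum>i\<in>I. b i * (LINT s:open_cube m|cube_measure. \<Psi> (?C a) s * pullback m (?C a) (\<omega> i) s))"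
      by (rule set_integral_sum_mult(2)[OF I]) (rule int[OF that])
    then show ?thesis unfolding cell_integral_def pb by (simp add: sum_distrib_left mult_ac)
  qed
  have *: "(\<lambda>a. \<Sum>i\<in>I. b i * cell_integral (?C a) \<Psi> (\<omega> i)) summable_on chain_index \<Gamma> \<and>
      infsum (\<lambda>a. \<Sum>i\<in>I. b i * cell_integral (?C a) \<Psi> (\<omega> i)) (chain_index \<Gamma>) =
      (\<Sum>i\<in>I. b i * infsum (\<lambda>a. cell_integral (?C a) \<Psi> (\<omega> i)) (chain_index \<Gamma>))"
    using I sm
  proof (induction I rule: finite_induct)
    case (insert i I)
    have 1: "(\<lambda>a. b i * cell_integral (?C a) \<Psi> (\<omega> i)) summable_on chain_index \<Gamma>"
      by (rule summable_on_cmult_right) (use insert in simp)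
    have 2: "(\<lambda>a. \<Sum>i\<in>I. b i * cell_integral (?C a) \<Psi> (\<omega> i)) summable_on chain_index \<Gamma>" using insert by simp
    have "infsum (\<lambda>a. b i * cell_integral (?C a) \<Psi> (\<omega> i)) (chain_index \<Gamma>) =
        b i * infsum (\<lambda>a. cell_integral (?C a) \<Psi> (\<omega> i)) (chain_index \<Gamma>)"
      by (rule infsum_cmult_right) (use insert in simp)
    then show ?case using summable_on_add[OF 1 2] infsum_add[OF 1 2] insert by simp
  qed simp
  have "(\<lambda>a. cell_integral (?C a) \<Psi> (\<lambda>t V. \<Sum>i\<in>I. b i * \<omega> i t V)) summable_on chain_index \<Gamma>"
    by (rule iffD2[OF summable_on_cong *[THEN conjunct1]]) (rule cell)
  moreover have "set_integrable cube_measure (open_cube m) (\<lambda>s. \<Psi> (?C a) s * pullback m (?C a) (\<lambda>t V. \<Sum>i\<in>I. b i * \<omega> i t V) s)"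
    if "a \<in> chain_index \<Gamma>" for a
    unfolding pb by (rule set_integral_sum_mult(1)[OF I]) (rule int[OF that])
  ultimately show "chain_converges \<Gamma> \<Psi> (\<lambda>t V. \<Sum>i\<in>I. b i * \<omega> i t V)"
    unfolding chain_converges_def by blast
  have "chain_integral \<Gamma> \<Psi> (\<lambda>t V. \<Sum>i\<in>I. b i * \<omega> i t V) =
      infsum (\<lambda>a. \<Sum>i\<in>I. b i * cell_integral (?C a) \<Psi> (\<omega> i)) (chain_index \<Gamma>)"
    unfolding chain_integral_def by (rule infsum_cong) (rule cell)
  then show "chain_integral \<Gamma> \<Psi> (\<lambda>t V. \<Sum>i\<in>I. b i * \<omega> i t V) = (\<Sum>i\<in>I. b i * chain_integral \<Gamma> \<Psi> (\<omega> i))"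
    unfolding chain_integral_def *[THEN conjunct2, symmetric] .
qed

end

section \<open>The pointwise identity\<close>

lemma finite_arrangements: "finite A \<Longrightarrow> finite (arrangements A :: ('n::finite \<Rightarrow> nat list) set)"
proof -
  assume A: "finite A"
  have "arrangements A \<subseteq> (PiE UNIV (\<lambda>_. {w. set w \<subseteq> A \<and> distinct w}) :: ('n \<Rightarrow> nat list) set)"
    using arrangementsD(1,2) by (fastforce simp: PiE_def Pi_def extensional_def)
  moreover have "finite (PiE UNIV (\<lambda>_. {w. set w \<subseteq> A \<and> distinct w}) :: ('n \<Rightarrow> nat list) set)"
    by (intro finite_PiE finite_subset_distinct A) simp
  ultimately show ?thesis by (rule finite_subset)
qed

lemma arrangement_insert:
  assumes "L \<in> arrangements (A - S)" "S \<subseteq> A" "distinct w" "set w = S \<union> set (L j)"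
  shows "L(j := w) \<in> arrangements A"
proof -
  have S: "set (L i) \<inter> S = {}" for i using arrangementsD(2)[OF assms(1), of i] by auto
  have "(\<Union>i. set ((L(j := w)) i)) = (\<Union>i. set (L i)) \<union> S"
    using assms(4) by (auto split: if_splits)
  then have "(\<Union>i. set ((L(j := w)) i)) = A" using arrangementsD(4)[OF assms(1)] assms(2) by auto
  moreover have "set ((L(j := w)) i) \<inter> set ((L(j := w)) i') = {}" if "i \<noteq> i'" for i i'
    using arrangementsD(3)[OF assms(1) that] S[of i] S[of i'] assms(4) that by auto
  moreover have "distinct ((L(j := w)) i)" for i using arrangementsD(1)[OF assms(1)] assms(3) by simp
  ultimately show ?thesis by (simp only: arrangements_def mem_Collect_eq) blast
qed

lemma arrangement_remove:
  assumes "J \<in> arrangements A" "S \<subseteq> set (J j)" "distinct y" "set y = set (J j) - S"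
  shows "J(j := y) \<in> arrangements (A - S)"
proof -
  have S: "set (J i) \<inter> S = {}" if "i \<noteq> j" for i using arrangementsD(3)[OF assms(1) that] assms(2) by auto
  have "(\<Union>i. set ((J(j := y)) i)) = (\<Union>i. set (J i)) - S"
  proof (intro set_eqI iffI)
    fix l assume "l \<in> (\<Union>i. set ((J(j := y)) i))"
    then obtain i where i: "l \<in> set ((J(j := y)) i)" by blast
    show "l \<in> (\<Union>i. set (J i)) - S"
      using i S[of i] assms(4) by (cases "i = j") auto
  next
    fix l assume l: "l \<in> (\<Union>i. set (J i)) - S"
    then obtain i where i: "l \<in> set (J i)" "l \<notin> S" by blast
    then have "l \<in> set ((J(j := y)) i)" using assms(4) by (cases "i = j") auto
    then show "l \<in> (\<Union>i. set ((J(j := y)) i))" by blast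
  qed
  then have "(\<Union>i. set ((J(j := y)) i)) = A - S" using arrangementsD(4)[OF assms(1)] by simp
  moreover have "set ((J(j := y)) i) \<inter> set ((J(j := y)) i') = {}" if "i \<noteq> i'" for i i'
    using arrangementsD(3)[OF assms(1) that] assms(4) that by auto
  moreover have "distinct ((J(j := y)) i)" for i using arrangementsD(1)[OF assms(1)] assms(3) by simp
  ultimately show ?thesis by (simp only: arrangements_def mem_Collect_eq) blast
qed

text \<open>Cutting a nonempty initial segment off the list \<open>j\<close> and prepending an
  ordering of its set of letters are inverse to each other.\<close>

lemma sum_arrangements_prefix:
  fixes H :: "('n::finite \<Rightarrow> nat list) \<Rightarrow> nat list \<Rightarrow> 'a::comm_monoid_add"
  assumes A: "finite A"
  shows "(\<Sum>J\<in>arrangements A. \<Sum>n\<in>{1..length (J j)}. H (J(j := drop n (J j))) (take n (J j))) =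
    (\<Sum>S\<in>Pow A - {{}}. \<Sum>L\<in>arrangements (A - S). \<Sum>p\<in>permutations_of_set S. H L p)"
proof -
  have "(\<Sum>J\<in>arrangements A. \<Sum>n\<in>{1..length (J j)}. H (J(j := drop n (J j))) (take n (J j))) =
      (\<Sum>(J, n)\<in>Sigma (arrangements A) (\<lambda>J. {1..length (J j)}). H (J(j := drop n (J j))) (take n (J j)))"
    by (rule sum.Sigma) (simp_all add: finite_arrangements A)
  also have "\<dots> = (\<Sum>(S, L, p)\<in>Sigma (Pow A - {{}}) (\<lambda>S. arrangements (A - S) \<times> permutations_of_set S). H L p)"
  proof (rule sum.reindex_bij_witness[where
        j = "\<lambda>(J, n). (set (take n (J j)), J(j := drop n (J j)), take n (J j))" and
        i = "\<lambda>(S, L, p). (L(j := p @ L j), length p)"])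
    fix x :: "('n \<Rightarrow> nat list) \<times> nat" assume x: "x \<in> Sigma (arrangements A) (\<lambda>J. {1..length (J j)})"
    obtain J n where [simp]: "x = (J, n)" by (cases x)
    have J: "J \<in> arrangements A" and n: "1 \<le> n" "n \<le> length (J j)" using x by auto
    show "(case (case x of (J, n) \<Rightarrow> (set (take n (J j)), J(j := drop n (J j)), take n (J j))) of
        (S, L, p) \<Rightarrow> (L(j := p @ L j), length p)) = x"
      using n by simp
    have d: "distinct (take n (J j) @ drop n (J j))" using arrangementsD(1)[OF J] by simp
    have s: "set (J j) = set (take n (J j)) \<union> set (drop n (J j))" by (metis append_take_drop_id set_append)
    have "J(j := drop n (J j)) \<in> arrangements (A - set (take n (J j)))"
      by (rule arrangement_remove[OF J set_take_subset]) (use d s in \<open>auto simp del: append_take_drop_id\<close>)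
    moreover have "set (take n (J j)) \<subseteq> A" using set_take_subset[of n "J j"] arrangementsD(2)[OF J, of j] by blast
    moreover have "take n (J j) \<noteq> []" using n by (cases "J j") auto
    ultimately show "(case x of (J, n) \<Rightarrow> (set (take n (J j)), J(j := drop n (J j)), take n (J j))) \<in>
        Sigma (Pow A - {{}}) (\<lambda>S. arrangements (A - S) \<times> permutations_of_set S)"
      using arrangementsD(1)[OF J, of j] by (simp add: permutations_of_set_def distinct_take)
    show "(case (case x of (J, n) \<Rightarrow> (set (take n (J j)), J(j := drop n (J j)), take n (J j))) of (S, L, p) \<Rightarrow> H L p) =
        (case x of (J, n) \<Rightarrow> H (J(j := drop n (J j))) (take n (J j)))"
      by simp
  next
    fix x :: "nat set \<times> ('n \<Rightarrow> nat list) \<times> nat list"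
    assume x: "x \<in> Sigma (Pow A - {{}}) (\<lambda>S. arrangements (A - S) \<times> permutations_of_set S)"
    obtain S L p where [simp]: "x = (S, L, p)" by (cases x)
    have S: "S \<subseteq> A" "S \<noteq> {}" and L: "L \<in> arrangements (A - S)" and p: "set p = S" "distinct p"
      using x by (auto simp: permutations_of_set_def)
    show "(case (case x of (S, L, p) \<Rightarrow> (L(j := p @ L j), length p)) of
        (J, n) \<Rightarrow> (set (take n (J j)), J(j := drop n (J j)), take n (J j))) = x"
      using p by simp
    have "L(j := p @ L j) \<in> arrangements A"
      by (rule arrangement_insert[OF L S(1)])
        (use p arrangementsD(1)[OF L, of j] arrangementsD(2)[OF L, of j] in auto)
    moreover have "length p \<ge> 1" using p(1) S(2) by (cases p) auto
    ultimately show "(case x of (S, L, p) \<Rightarrow> (L(j := p @ L j), length p)) \<in> Sigma (arrangements A) (\<lambda>J. {1..length (J j)})"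
      by simp
  qed
  also have "\<dots> = (\<Sum>S\<in>Pow A - {{}}. \<Sum>(L, p)\<in>arrangements (A - S) \<times> permutations_of_set S. H L p)"
    by (rule sum.Sigma[symmetric]) (use A in \<open>auto intro!: finite_cartesian_product finite_arrangements finite_subset[OF _ A]\<close>)
  finally show ?thesis by (simp only: sum.cartesian_product)
qed

text \<open>An arrangement with \<open>S\<close> inside the list \<open>j\<close> is an arrangement
  of the other letters together with a shuffle of an ordering of \<open>S\<close> into that list.
  The outer sums are those of \<open>sum_arrangements_prefix\<close>, which is why extraction by
  \<open>\<nu>\<close> can be compared with cutting off segments.\<close>

lemma sum_arrangements_shuffles:
  fixes H :: "('n::finite \<Rightarrow> nat list) \<Rightarrow> 'a::comm_monoid_add"
  assumes A: "finite A" and S: "S \<subseteq> A"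
  shows "(\<Sum>J\<in>{J \<in> arrangements A. S \<subseteq> set (J j)}. H J) =
    (\<Sum>L\<in>arrangements (A - S). \<Sum>p\<in>permutations_of_set S. \<Sum>w\<in>shuffles p (L j). H (L(j := w)))"
proof -
  let ?X = "Sigma (arrangements (A - S) \<times> permutations_of_set S) (\<lambda>(L, p). shuffles p (L j))"
  have "(\<Sum>J\<in>{J \<in> arrangements A. S \<subseteq> set (J j)}. H J) = (\<Sum>((L, p), w)\<in>?X. H (L(j := w)))"
  proof (rule sum.reindex_bij_witness[where
        j = "\<lambda>J. ((J(j := filter (\<lambda>l. l \<notin> S) (J j)), filter (\<lambda>l. l \<in> S) (J j)), J j)" and
        i = "\<lambda>((L, p), w). L(j := w)"])
    fix J assume "J \<in> {J \<in> arrangements A. S \<subseteq> set (J j)}"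
    then have J: "J \<in> arrangements A" "S \<subseteq> set (J j)" by auto
    have p: "set (filter (\<lambda>l. l \<in> S) (J j)) = S" using J(2) by auto
    have "J(j := filter (\<lambda>l. l \<notin> S) (J j)) \<in> arrangements (A - S)"
      by (rule arrangement_remove[OF J]) (use arrangementsD(1)[OF J(1)] in auto)
    moreover have "filter (\<lambda>l. l \<in> S) (J j) \<in> permutations_of_set S"
      using p arrangementsD(1)[OF J(1)] by (simp add: permutations_of_set_def)
    moreover have "J j \<in> shuffles (filter (\<lambda>l. l \<in> S) (J j)) (filter (\<lambda>l. l \<notin> S) (J j))"
      by (subst shuffles_eq_filter) (auto simp: p intro!: filter_cong)
    ultimately show "((J(j := filter (\<lambda>l. l \<notin> S) (J j)), filter (\<lambda>l. l \<in> S) (J j)), J j) \<in> ?X" by simp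
  next
    fix x assume x: "x \<in> ?X"
    obtain L p w where [simp]: "x = ((L, p), w)" by (cases x) auto
    have L: "L \<in> arrangements (A - S)" and p: "set p = S" "distinct p" and w: "w \<in> shuffles p (L j)"
      using x by (auto simp: permutations_of_set_def)
    have disj: "set p \<inter> set (L j) = {}" using arrangementsD(2)[OF L, of j] p by auto
    have f: "filter (\<lambda>l. l \<in> S) w = p" "filter (\<lambda>l. l \<notin> S) w = L j"
      using w unfolding shuffles_eq_filter[OF disj] p(1) by auto
    have "L(j := w) \<in> arrangements A"
      by (rule arrangement_insert[OF L S distinct_disjoint_shuffles[OF p(2) arrangementsD(1)[OF L] disj w]])
        (use set_shuffles[OF w] p in simp)
    then show "((\<lambda>((L, p), w). L(j := w)) x) \<in> {J \<in> arrangements A. S \<subseteq> set (J j)}"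
      using set_shuffles[OF w] p by simp
    show "(((((\<lambda>((L, p), w). L(j := w)) x))(j := filter (\<lambda>l. l \<notin> S) (((\<lambda>((L, p), w). L(j := w)) x) j)),
        filter (\<lambda>l. l \<in> S) (((\<lambda>((L, p), w). L(j := w)) x) j)), ((\<lambda>((L, p), w). L(j := w)) x) j) = x"
      by (simp add: f)
  qed simp_all
  also have "\<dots> = (\<Sum>(L, p)\<in>arrangements (A - S) \<times> permutations_of_set S. \<Sum>w\<in>shuffles p (L j). H (L(j := w)))"
  proof -
    have "finite (arrangements (A - S) \<times> permutations_of_set S)"
      by (rule finite_cartesian_product) (simp_all add: finite_arrangements A)
    then have "(\<Sum>x\<in>arrangements (A - S) \<times> permutations_of_set S. \<Sum>w\<in>(\<lambda>(L, p). shuffles p (L j)) x. H ((fst x)(j := w))) =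
        (\<Sum>(x, w)\<in>?X. H ((fst x)(j := w)))"
      by (intro sum.Sigma) (auto simp: case_prod_unfold)
    then show ?thesis by (simp only: case_prod_unfold)
  qed
  finally show ?thesis by (simp only: sum.cartesian_product)
qed

lemma sum_permutations_last:
  assumes "finite S" "S \<noteq> {}"
  shows "(\<Sum>p\<in>permutations_of_set S. X p) = (\<Sum>k\<in>S. \<Sum>w\<in>permutations_of_set (S - {k}). X (w @ [k]))"
proof -
  have "(\<Sum>p\<in>permutations_of_set S. X p) = (\<Sum>(k, w)\<in>Sigma S (\<lambda>k. permutations_of_set (S - {k})). X (w @ [k]))"
  proof (rule sum.reindex_bij_witness[where j = "\<lambda>p. (last p, butlast p)" and i = "\<lambda>(k, w). w @ [k]"])
    fix p assume "p \<in> permutations_of_set S"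
    then have p: "set p = S" "distinct p" "p \<noteq> []" using assms(2) by (auto simp: permutations_of_set_def)
    have w: "butlast p @ [last p] = p" using p(3) by (rule append_butlast_last_id)
    have "distinct (butlast p @ [last p])" "set (butlast p @ [last p]) = S" unfolding w using p by blast+
    then have "last p \<in> S" "butlast p \<in> permutations_of_set (S - {last p})"
      by (auto intro!: permutations_of_setI)
    then show "(last p, butlast p) \<in> Sigma S (\<lambda>k. permutations_of_set (S - {k}))" by blast
    show "(case (last p, butlast p) of (k, w) \<Rightarrow> w @ [k]) = p" using w by (simp only: prod.case)
    show "(case (last p, butlast p) of (k, w) \<Rightarrow> X (w @ [k])) = X p" using w by (simp only: prod.case)
  next
    fix x assume x: "x \<in> Sigma S (\<lambda>k. permutations_of_set (S - {k}))"
    obtain k w where kw: "x = (k, w)" by (cases x)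
    have k: "k \<in> S" and w: "set w = S - {k}" "distinct w" using x unfolding kw by (auto simp: permutations_of_set_def)
    have "set (w @ [k]) = S" "distinct (w @ [k])" using k w(2) unfolding set_append w(1) distinct_append by auto
    then show "(\<lambda>(k, w). w @ [k]) x \<in> permutations_of_set S"
      unfolding kw prod.case by (rule permutations_of_setI)
    show "(last ((\<lambda>(k, w). w @ [k]) x), butlast ((\<lambda>(k, w). w @ [k]) x)) = x"
      unfolding kw prod.case by simp
  qed
  also have "\<dots> = (\<Sum>k\<in>S. \<Sum>w\<in>permutations_of_set (S - {k}). X (w @ [k]))"
    by (rule sum.Sigma[symmetric]) (use assms(1) in auto)
  finally show ?thesis .
qed

lemma rho_arr_update: "rho_arr z t (L(j := w)) = rho t w (z $ j) * (\<Prod>i\<in>UNIV - {j}. rho t (L i) (z $ i))"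
proof -
  have "rho_arr z t (L(j := w)) = rho t ((L(j := w)) j) (z $ j) * (\<Prod>i\<in>UNIV - {j}. rho t ((L(j := w)) i) (z $ i))"
    unfolding rho_arr_def by (rule prod.remove) simp_all
  also have "(\<Prod>i\<in>UNIV - {j}. rho t ((L(j := w)) i) (z $ i)) = (\<Prod>i\<in>UNIV - {j}. rho t (L i) (z $ i))"
    by (rule prod.cong) auto
  finally show ?thesis by (simp only: fun_upd_same)
qed

lemma rho_arr_remove: "rho_arr z t L = rho t (L j) (z $ j) * (\<Prod>i\<in>UNIV - {j}. rho t (L i) (z $ i))"
  using rho_arr_update[of z t L j "L j"] by simp

lemma ad_word_map: "ad_word F (map c w) y = ad_word (\<lambda>n. F (c n)) w y"
  by (induction w arbitrary: y rule: induct_list012) auto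

lemma clinear_sum_scale: "clinear T \<Longrightarrow> T (\<Sum>a\<in>A. g a *\<^sub>C x a) = (\<Sum>a\<in>A. g a *\<^sub>C T (x a))"
  by (simp add: clinear_sum clinear_scale)

definition letter_weight :: "(nat \<Rightarrow> 'r) \<Rightarrow> nat set \<Rightarrow> 'r \<Rightarrow> nat" where
  "letter_weight c S i = card {l \<in> S. c l = i}"

lemma count_list_map_distinct:
  assumes "distinct p"
  shows "count_list (map c p) = letter_weight c (set p)"
proof
  fix i
  have "count_list (map c p) i = length (filter (\<lambda>l. c l = i) p)"
    by (simp add: count_list_eq_length_filter filter_map comp_def)(rule arg_cong[where f = length], rule filter_cong, auto)
  then show "count_list (map c p) i = letter_weight c (set p) i"
    using assms by (simp add: letter_weight_def distinct_length_filter Int_def conj_commute)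
qed

lemma wt_letter_weight: "finite S \<Longrightarrow> wt \<alpha> (letter_weight c S) h = (\<Sum>k\<in>S. \<alpha> (c k) h)"
proof -
  assume S: "finite S"
  have "(\<Sum>k\<in>S. \<alpha> (c k) h) = (\<Sum>i\<in>UNIV. \<Sum>k\<in>{k \<in> S. c k = i}. \<alpha> (c k) h)"
    by (rule sum.group[symmetric]) (use S in auto)
  also have "\<dots> = (\<Sum>i\<in>UNIV. of_nat (letter_weight c S i) * \<alpha> i h)"
    by (rule sum.cong) (auto simp: letter_weight_def)
  finally show ?thesis by (simp add: wt_def)
qed

section \<open>Poles of d log \<Phi> against extraction of letters, pointwise in t\<close>

context kz_data
begin

definition fvec :: "(nat \<Rightarrow> 'r) \<Rightarrow> ('n \<Rightarrow> nat list) \<Rightarrow> ('n, 'v) mtensor" where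
  "fvec c J = f_vector f act v (\<lambda>j. map c (J j))"

definition subset_action :: "(nat \<Rightarrow> 'r) \<Rightarrow> 'n \<Rightarrow> nat set \<Rightarrow> ('n \<Rightarrow> nat list) \<Rightarrow> ('n, 'v) mtensor" where
  "subset_action c j S J = nu_coeff j c S (J j) *\<^sub>C total_act act (lie_word (map c (filter (\<lambda>x. x \<in> S) (J j))))
     (fvec c (J(j := filter (\<lambda>x. x \<notin> S) (J j))))"

definition Delta_subset :: "(nat \<Rightarrow> 'r) \<Rightarrow> nat set \<Rightarrow> ('n \<Rightarrow> nat list) \<Rightarrow> ('n, 'v) mtensor" where
  "Delta_subset c S J = (\<Sum>j\<in>UNIV. if S \<subseteq> set (J j) then subset_action c j S J else 0)"

text \<open>The vector T_S of the overview: the letters of \<open>S\<close> form a chain that has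
  lost its link to the right, placed in front of any one of the lists.\<close>

definition chain_vector :: "(nat \<Rightarrow> 'r) \<Rightarrow> nat set \<Rightarrow> (complex, 'n) vec \<Rightarrow> point \<Rightarrow> nat set \<Rightarrow> ('n, 'v) mtensor" where
  "chain_vector c A z t S = (\<Sum>L\<in>arrangements (A - S). \<Sum>j\<in>UNIV. \<Sum>p\<in>permutations_of_set S.
     (rho0 t p * rho_arr z t L) *\<^sub>C fvec c (L(j := p @ L j)))"

text \<open>Minus the polar part of the derivative of log \<Phi> in t_k, with the letters of
  \<open>A\<close> as the other variables. If \<open>k\<close> lies in \<open>A\<close>, its own
  term is a division by zero and counts as 0.\<close>

definition letter_charge :: "(nat \<Rightarrow> 'r) \<Rightarrow> nat set \<Rightarrow> (complex, 'n) vec \<Rightarrow> point \<Rightarrow> nat \<Rightarrow> complex" where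
  "letter_charge c A z t k = (\<Sum>j\<in>UNIV. dual_form form (\<alpha> (c k)) (\<Lambda> j) / (t k - z $ j)) -
     (\<Sum>l\<in>A. dual_form form (\<alpha> (c k)) (\<alpha> (c l)) / (t k - t l))"

lemma Delta_word_eq_subsets:
  assumes A: "finite A" and J: "J \<in> arrangements A"
  shows "Delta_word (\<lambda>_. c) k J = (\<Sum>S\<in>Pow A. if letter_weight c S = k then Delta_subset c S J else 0)"
proof -
  have "Delta_word (\<lambda>_. c) k J = (\<Sum>j\<in>UNIV. \<Sum>S\<in>Pow (set (J j)). if letter_weight c S = k then subset_action c j S J else 0)"
    unfolding Delta_word_def
  proof (rule sum.cong[OF HOL.refl], rule sum.cong[OF HOL.refl])
    fix j S assume "S \<in> Pow (set (J j))"
    then have "set (filter (\<lambda>x. x \<in> S) (J j)) = S" by auto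
    then have "count_list (map c (filter (\<lambda>x. x \<in> S) (J j))) = letter_weight c S"
      using count_list_map_distinct[of "filter (\<lambda>x. x \<in> S) (J j)" c] arrangementsD(1)[OF J] by simp
    then show "(if count_list (map c (filter (\<lambda>x. x \<in> S) (J j))) = k
        then nu_coeff j c S (J j) *\<^sub>C total_act act (lie_word (map c (filter (\<lambda>x. x \<in> S) (J j))))
          (f_vector f act v (\<lambda>i. map c ((J(j := filter (\<lambda>x. x \<notin> S) (J j))) i)))
        else 0) = (if letter_weight c S = k then subset_action c j S J else 0)"
      by (simp only: subset_action_def fvec_def)
  qed
  also have "\<dots> = (\<Sum>j\<in>UNIV. \<Sum>S\<in>Pow A. if letter_weight c S = k then (if S \<subseteq> set (J j) then subset_action c j S J else 0) else 0)"
    by (rule sum.cong[OF HOL.refl], rule sum.mono_neutral_cong_left) (use A arrangementsD(2)[OF J] in auto)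
  also have "\<dots> = (\<Sum>S\<in>Pow A. \<Sum>j\<in>UNIV. if letter_weight c S = k then (if S \<subseteq> set (J j) then subset_action c j S J else 0) else 0)"
    by (rule sum.swap)
  also have "\<dots> = (\<Sum>S\<in>Pow A. if letter_weight c S = k then Delta_subset c S J else 0)"
    by (rule sum.cong[OF HOL.refl]) (auto simp: Delta_subset_def)
  finally show ?thesis .
qed

text \<open>The standard action adds up the actions in the single factors, and in each factor
  \<open>sum_rho0_ad_word\<close> turns the commutators into words. The result no longer depends on
  the letter \<open>k\<close>.\<close>

lemma sum_lie_word_action:
  assumes S: "finite S" "k \<in> S" and t: "inj_on t S"
  shows "(\<Sum>w\<in>permutations_of_set (S - {k}). rho t w (t k) *\<^sub>C total_act act (lie_word (map c (w @ [k]))) (fvec c L)) =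
    (\<Sum>j\<in>UNIV. \<Sum>p\<in>permutations_of_set S. rho0 t p *\<^sub>C fvec c (L(j := p @ L j)))"
proof -
  define y where "y i = vword i (map c (L i))" for i
  define F where "F i n = act i (f (c n))" for i n
  have L: "fvec c L = mtens y" by (simp add: fvec_def f_vector_eq y_def[abs_def])
  have tot: "total_act act (lie_word (map c w)) (fvec c L) = (\<Sum>i\<in>UNIV. mtens (y(i := ad_word (F i) w (y i))))" for w
    unfolding L total_act_mtens act_lie_word ad_word_map F_def ..
  have upd: "mtens (y(i := foldr (F i) p (y i))) = fvec c (L(i := p @ L i))" for i p
  proof -
    have "foldr (F i) p (y i) = vword i (map c (p @ L i))"
      by (induction p) (simp_all add: F_def y_def)
    then have "y(i := foldr (F i) p (y i)) = (\<lambda>j. vword j (map c ((L(i := p @ L i)) j)))"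
      by (auto simp: y_def fun_eq_iff)
    then show ?thesis by (simp only: fvec_def f_vector_eq)
  qed
  have "(\<Sum>w\<in>permutations_of_set (S - {k}). rho t w (t k) *\<^sub>C total_act act (lie_word (map c (w @ [k]))) (fvec c L)) =
      (\<Sum>i\<in>UNIV. \<Sum>w\<in>permutations_of_set (S - {k}). rho t w (t k) *\<^sub>C mtens (y(i := ad_word (F i) (w @ [k]) (y i))))"
    unfolding tot complex_vector.scale_sum_right by (rule sum.swap)
  also have "\<dots> = (\<Sum>i\<in>UNIV. mtens (y(i := (\<Sum>w\<in>permutations_of_set (S - {k}). rho t w (t k) *\<^sub>C ad_word (F i) (w @ [k]) (y i)))))"
    by (subst clinear_sum_scale[OF clinear_mtens]) (rule HOL.refl)
  also have "\<dots> = (\<Sum>i\<in>UNIV. mtens (y(i := (\<Sum>p\<in>permutations_of_set S. rho0 t p *\<^sub>C foldr (F i) p (y i)))))"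
  proof (rule sum.cong[OF HOL.refl])
    fix i
    have "(\<Sum>w\<in>permutations_of_set (S - {k}). rho t w (t k) *\<^sub>C ad_word (F i) (w @ [k]) (y i)) =
        (\<Sum>p\<in>permutations_of_set (insert k (S - {k})). rho0 t p *\<^sub>C foldr (F i) p (y i))"
      by (rule sum_rho0_ad_word) (use S t in \<open>simp_all add: F_def act_linear insert_absorb\<close>)
    then show "mtens (y(i := (\<Sum>w\<in>permutations_of_set (S - {k}). rho t w (t k) *\<^sub>C ad_word (F i) (w @ [k]) (y i)))) =
        mtens (y(i := (\<Sum>p\<in>permutations_of_set S. rho0 t p *\<^sub>C foldr (F i) p (y i))))"
      using S(2) by (simp add: insert_absorb)
  qed
  also have "\<dots> = (\<Sum>j\<in>UNIV. \<Sum>p\<in>permutations_of_set S. rho0 t p *\<^sub>C fvec c (L(j := p @ L j)))"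
    by (subst clinear_sum_scale[OF clinear_mtens]) (simp only: upd)
  finally show ?thesis .
qed

text \<open>The extracted word and the vector left over are the same for all shuffles; only the
  coefficients differ. These are summed by the weighted shuffle identity, with \<open>b\<close> and
  \<open>a l\<close> the pairings of the root of \<open>last p\<close> with \<Lambda>_j and with the
  root of l.\<close>

lemma sum_shuffles_subset_action:
  assumes L: "L \<in> arrangements (A - S)" and S: "S \<subseteq> A" "S \<noteq> {}" and p: "p \<in> permutations_of_set S"
    and t: "inj_on t A" "\<And>k. k \<in> A \<Longrightarrow> t k \<noteq> z $ j"
  shows "(\<Sum>w\<in>shuffles p (L j). rho_arr z t (L(j := w)) *\<^sub>C subset_action c j S (L(j := w))) =
    (rho0 t p * rho_arr z t L * (dual_form form (\<alpha> (c (last p))) (\<Lambda> j) / (t (last p) - z $ j) -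
      (\<Sum>l\<in>set (L j). dual_form form (\<alpha> (c (last p))) (\<alpha> (c l)) / (t (last p) - t l)))) *\<^sub>C
    total_act act (lie_word (map c p)) (fvec c L)"
proof -
  have p': "set p = S" "distinct p" "p \<noteq> []" using p S(2) by (auto simp: permutations_of_set_def)
  have sub: "set (L j) \<subseteq> A - S" by (rule arrangementsD(2)[OF L])
  have disj: "set p \<inter> set (L j) = {}" using sub p' by auto
  let ?R = "\<Prod>i\<in>UNIV - {j}. rho t (L i) (z $ i)" and ?h = "dual_vec form (\<alpha> (c (last p)))"
  let ?T = "total_act act (lie_word (map c p)) (fvec c L)"
  have "rho_arr z t (L(j := w)) *\<^sub>C subset_action c j S (L(j := w)) =
      (rho t w (z $ j) * (\<Lambda> j ?h - (\<Sum>l\<leftarrow>letters_after (set p) w. \<alpha> (c l) ?h)) * ?R) *\<^sub>C ?T"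
    if w: "w \<in> shuffles p (L j)" for w
  proof -
    have f: "filter (\<lambda>l. l \<in> S) w = p" "filter (\<lambda>l. l \<notin> S) w = L j"
      using w unfolding shuffles_eq_filter[OF disj] p'(1) by auto
    have "subset_action c j S (L(j := w)) = (\<Lambda> j ?h - (\<Sum>l\<leftarrow>letters_after (set p) w. \<alpha> (c l) ?h)) *\<^sub>C ?T"
      by (simp add: subset_action_def nu_coeff_def Let_def f p'(1))
    then show ?thesis by (simp add: rho_arr_update scaleC_scaleC mult_ac)
  qed
  then have "(\<Sum>w\<in>shuffles p (L j). rho_arr z t (L(j := w)) *\<^sub>C subset_action c j S (L(j := w))) =
      ((\<Sum>w\<in>shuffles p (L j). rho t w (z $ j) * (\<Lambda> j ?h - (\<Sum>l\<leftarrow>letters_after (set p) w. \<alpha> (c l) ?h))) * ?R) *\<^sub>C ?T"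
    by (simp add: sum_distrib_right complex_vector.scale_sum_left)
  also have "(\<Sum>w\<in>shuffles p (L j). rho t w (z $ j) * (\<Lambda> j ?h - (\<Sum>l\<leftarrow>letters_after (set p) w. \<alpha> (c l) ?h))) =
      rho0 t p * rho t (L j) (z $ j) * (\<Lambda> j ?h / (t (last p) - z $ j) - (\<Sum>l\<in>set (L j). \<alpha> (c l) ?h / (t (last p) - t l)))"
  proof (rule rho_shuffles_weighted[OF p'(2,3) arrangementsD(1)[OF L] disj])
    have sub': "set p \<union> set (L j) \<subseteq> A" using p'(1) S(1) sub by auto
    then show "inj_on t (set p \<union> set (L j))" by (rule inj_on_subset[OF t(1)])
    show "z $ j \<notin> t ` (set p \<union> set (L j))"
    proof
      assume "z $ j \<in> t ` (set p \<union> set (L j))"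
      then obtain k where "k \<in> set p \<union> set (L j)" "t k = z $ j" by (elim imageE) (rule that, assumption, rule HOL.sym)
      then show False using t(2)[OF subsetD[OF sub']] by blast
    qed
  qed
  finally have "(\<Sum>w\<in>shuffles p (L j). rho_arr z t (L(j := w)) *\<^sub>C subset_action c j S (L(j := w))) =
      (rho0 t p * rho t (L j) (z $ j) * (\<Lambda> j ?h / (t (last p) - z $ j) - (\<Sum>l\<in>set (L j). \<alpha> (c l) ?h / (t (last p) - t l))) * ?R) *\<^sub>C ?T" .
  moreover have "a * b * x * r = a * (b * r) * x" for a b x r :: complex by simp
  ultimately show ?thesis
    unfolding dual_form_eq(1)[OF cartan fun_alpha fun_Lambda] dual_form_eq(1)[OF cartan fun_alpha fun_alpha]
      rho_arr_remove[of z t L j] by (rule HOL.trans[OF _ arg_cong[where f = "\<lambda>b. b *\<^sub>C ?T"]])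
qed

text \<open>For a fixed last letter k of \<open>S\<close>, the poles found in the single lists add
  up over j to the charge of k, however the other letters are arranged. The remaining sum over
  orderings ending in k gives the same vector for every k, so the charges factor out.\<close>

lemma sum_Delta_subset:
  assumes A: "finite A" and S: "S \<subseteq> A" "S \<noteq> {}"
    and t: "inj_on t A" "\<And>k j. k \<in> A \<Longrightarrow> t k \<noteq> z $ j"
  shows "(\<Sum>J\<in>arrangements A. rho_arr z t J *\<^sub>C Delta_subset c S J) =
    (\<Sum>k\<in>S. letter_charge c (A - S) z t k) *\<^sub>C chain_vector c A z t S"
proof -
  have fS: "finite S" using A S(1) by (rule finite_subset[rotated])
  let ?q = "\<lambda>L j k. dual_form form (\<alpha> (c k)) (\<Lambda> j) / (t k - z $ j) -
      (\<Sum>l\<in>set (L j). dual_form form (\<alpha> (c k)) (\<alpha> (c l)) / (t k - t l))"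
  let ?T = "\<lambda>L p. total_act act (lie_word (map c p)) (fvec c L)"
  let ?Q = "letter_charge c (A - S) z t"
  have q: "(\<Sum>j\<in>UNIV. ?q L j k) = ?Q k" if "L \<in> arrangements (A - S)" for L k
  proof -
    have "(\<Sum>l\<in>A - S. dual_form form (\<alpha> (c k)) (\<alpha> (c l)) / (t k - t l)) =
        (\<Sum>j\<in>UNIV. \<Sum>l\<in>set (L j). dual_form form (\<alpha> (c k)) (\<alpha> (c l)) / (t k - t l))"
      unfolding arrangementsD(4)[OF that, symmetric]
      by (rule sum.UNION_disjoint) (use arrangementsD(3)[OF that] in auto)
    then show ?thesis by (simp add: letter_charge_def sum_subtractf)
  qed
  have "(\<Sum>J\<in>arrangements A. rho_arr z t J *\<^sub>C Delta_subset c S J) =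
      (\<Sum>j\<in>UNIV. \<Sum>J\<in>arrangements A. if S \<subseteq> set (J j) then rho_arr z t J *\<^sub>C subset_action c j S J else 0)"
  proof -
    have "rho_arr z t J *\<^sub>C Delta_subset c S J =
        (\<Sum>j\<in>UNIV. if S \<subseteq> set (J j) then rho_arr z t J *\<^sub>C subset_action c j S J else 0)" for J
      unfolding Delta_subset_def complex_vector.scale_sum_right by (rule sum.cong) auto
    then show ?thesis by (simp only:) (rule sum.swap)
  qed
  also have "\<dots> = (\<Sum>j\<in>UNIV. \<Sum>J\<in>{J \<in> arrangements A. S \<subseteq> set (J j)}. rho_arr z t J *\<^sub>C subset_action c j S J)"
    by (simp add: sum.inter_filter finite_arrangements A)
  also have "\<dots> = (\<Sum>j\<in>UNIV. \<Sum>L\<in>arrangements (A - S). \<Sum>p\<in>permutations_of_set S.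
      (rho0 t p * rho_arr z t L * ?q L j (last p)) *\<^sub>C ?T L p)"
    unfolding sum_arrangements_shuffles[OF A S(1)]
    by (rule sum.cong[OF HOL.refl], rule sum.cong[OF HOL.refl], rule sum.cong[OF HOL.refl],
        rule sum_shuffles_subset_action[OF _ S _ t])
  also have "\<dots> = (\<Sum>L\<in>arrangements (A - S). \<Sum>j\<in>UNIV. \<Sum>p\<in>permutations_of_set S.
      (rho0 t p * rho_arr z t L * ?q L j (last p)) *\<^sub>C ?T L p)"
    by (rule sum.swap)
  also have "\<dots> = (\<Sum>L\<in>arrangements (A - S). \<Sum>p\<in>permutations_of_set S. \<Sum>j\<in>UNIV.
      (rho0 t p * rho_arr z t L * ?q L j (last p)) *\<^sub>C ?T L p)"
    by (rule sum.cong[OF HOL.refl], rule sum.swap)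
  also have "\<dots> = (\<Sum>L\<in>arrangements (A - S). \<Sum>p\<in>permutations_of_set S.
      (rho0 t p * rho_arr z t L * ?Q (last p)) *\<^sub>C ?T L p)"
    by (rule sum.cong[OF HOL.refl], rule sum.cong[OF HOL.refl])
      (simp only: complex_vector.scale_sum_left[symmetric] sum_distrib_left[symmetric] q)
  also have "\<dots> = (\<Sum>L\<in>arrangements (A - S). (\<Sum>k\<in>S. ?Q k) *\<^sub>C
      (\<Sum>j\<in>UNIV. \<Sum>p\<in>permutations_of_set S. (rho0 t p * rho_arr z t L) *\<^sub>C fvec c (L(j := p @ L j))))"
  proof (rule sum.cong[OF HOL.refl])
    fix L :: "'n \<Rightarrow> nat list"
    let ?Y = "\<Sum>j\<in>UNIV. \<Sum>p\<in>permutations_of_set S. rho0 t p *\<^sub>C fvec c (L(j := p @ L j))"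
    have "(\<Sum>p\<in>permutations_of_set S. (rho0 t p * rho_arr z t L * ?Q (last p)) *\<^sub>C ?T L p) =
        (\<Sum>k\<in>S. \<Sum>w\<in>permutations_of_set (S - {k}). (rho0 t (w @ [k]) * rho_arr z t L * ?Q (last (w @ [k]))) *\<^sub>C ?T L (w @ [k]))"
      by (rule sum_permutations_last[OF fS S(2)])
    also have "\<dots> = (\<Sum>k\<in>S. (rho_arr z t L * ?Q k) *\<^sub>C ?Y)"
    proof (rule sum.cong[OF HOL.refl])
      fix k assume k: "k \<in> S"
      have "(\<Sum>w\<in>permutations_of_set (S - {k}). (rho0 t (w @ [k]) * rho_arr z t L * ?Q (last (w @ [k]))) *\<^sub>C ?T L (w @ [k])) =
          (rho_arr z t L * ?Q k) *\<^sub>C (\<Sum>w\<in>permutations_of_set (S - {k}). rho t w (t k) *\<^sub>C ?T L (w @ [k]))"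
        by (simp only: complex_vector.scale_sum_right scaleC_scaleC rho0_snoc last_snoc mult_ac)
      also have "(\<Sum>w\<in>permutations_of_set (S - {k}). rho t w (t k) *\<^sub>C ?T L (w @ [k])) = ?Y"
        by (rule sum_lie_word_action[OF fS k inj_on_subset[OF t(1) S(1)]])
      finally show "(\<Sum>w\<in>permutations_of_set (S - {k}). (rho0 t (w @ [k]) * rho_arr z t L * ?Q (last (w @ [k]))) *\<^sub>C ?T L (w @ [k])) =
          (rho_arr z t L * ?Q k) *\<^sub>C ?Y" .
    qed
    also have "\<dots> = (\<Sum>k\<in>S. ?Q k) *\<^sub>C rho_arr z t L *\<^sub>C ?Y"
      unfolding complex_vector.scale_sum_left unfolding scaleC_scaleC by (simp only: mult.commute)
    also have "rho_arr z t L *\<^sub>C ?Y = (\<Sum>j\<in>UNIV. \<Sum>p\<in>permutations_of_set S. (rho0 t p * rho_arr z t L) *\<^sub>C fvec c (L(j := p @ L j)))"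
      by (simp only: complex_vector.scale_sum_right scaleC_scaleC mult_ac)
    finally show "(\<Sum>p\<in>permutations_of_set S. (rho0 t p * rho_arr z t L * ?Q (last p)) *\<^sub>C ?T L p) = (\<Sum>k\<in>S. ?Q k) *\<^sub>C
        (\<Sum>j\<in>UNIV. \<Sum>p\<in>permutations_of_set S. (rho0 t p * rho_arr z t L) *\<^sub>C fvec c (L(j := p @ L j)))" .
  qed
  also have "\<dots> = (\<Sum>k\<in>S. ?Q k) *\<^sub>C chain_vector c A z t S"
    by (simp only: chain_vector_def complex_vector.scale_sum_right)
  finally show ?thesis .
qed

end

section \<open>Integrals of logarithmic forms with values in a vector space\<close>

text \<open>Coordinates with respect to a basis of the whole space. In this way equations between
  vector-valued integrals and limits are reduced to scalars.\<close>

lemma clinear_functionals_separate: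
  fixes x y :: "'w::complex_vector"
  assumes "\<And>\<psi> :: 'w \<Rightarrow> complex. clinear \<psi> \<Longrightarrow> \<psi> x = \<psi> y"
  shows "x = y"
proof -
  define B :: "'w set" where "B = complex_vector.extend_basis {}"
  have ind: "complex_vector.independent B" and span: "w \<in> complex_vector.span B" for w
    unfolding B_def by (rule complex_vector.independent_extend_basis[OF complex_vector.independent_empty],
        simp only: complex_vector.span_extend_basis[OF complex_vector.independent_empty] UNIV_I)
  have lin: "clinear (\<lambda>w. complex_vector.representation B w b)" for b
  proof (rule clinearI)
    fix v w and r
    show "complex_vector.representation B (v + w) b = complex_vector.representation B v b + complex_vector.representation B w b"
      by (subst complex_vector.representation_add[OF ind span span]) (rule HOL.refl)
    show "complex_vector.representation B (r *\<^sub>C v) b = r *\<^sub>C complex_vector.representation B v b"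
      unfolding scaleC_complex_def by (subst complex_vector.representation_scale[OF ind span]) (rule HOL.refl)
  qed
  have eq: "complex_vector.representation B x = complex_vector.representation B y"
    by (rule ext) (rule assms[OF lin])
  show ?thesis
    using complex_vector.sum_nonzero_representation_eq[OF ind span, of x]
    unfolding eq complex_vector.sum_nonzero_representation_eq[OF ind span, of y] by (rule HOL.sym)
qed

lemma sum_ordered_pairs:
  fixes x :: "nat \<Rightarrow> nat \<Rightarrow> complex"
  shows "(\<Sum>i<m. \<Sum>l<m. x i l) = (\<Sum>(k, l) | k < l \<and> l < m. x k l + x l k) + (\<Sum>i<m. x i i)"
proof -
  have "(\<Sum>(k, l) | k < l \<and> l < m. f k l) = (\<Sum>l<m. \<Sum>k<l. f k l)" for f :: "nat \<Rightarrow> nat \<Rightarrow> complex"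
  proof -
    have "(\<Sum>(k, l) | k < l \<and> l < m. f k l) = (\<Sum>(l, k)\<in>Sigma {..<m} (\<lambda>l. {..<l}). f k l)"
      by (rule sum.reindex_bij_witness[where i = prod.swap and j = prod.swap]) auto
    then show ?thesis by (simp add: sum.Sigma)
  qed
  note pairs = this
  have "(\<Sum>i<m. \<Sum>l<m. x i l) = (\<Sum>l<m. \<Sum>k<l. x k l + x l k) + (\<Sum>i<m. x i i)"
    by (induction m) (simp_all add: sum.distrib)
  then show ?thesis by (simp only: pairs)
qed

text \<open>With k the last letter, t_l - x = (t_l - t_k) + (t_k - x) for every letter l. The second
  part cancels the factor next to \<open>x\<close> and cuts off the whole word, the summand with the
  largest \<open>n\<close>; the first part is the induction hypothesis with t_k in place of
  \<open>x\<close>.\<close>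

lemma rho_times_linear:
  assumes "distinct w" "inj_on t (set w)" "x \<notin> t ` set w"
  shows "rho t w x * (\<Sum>k\<leftarrow>w. a k * (t k - x)) =
    (\<Sum>n\<in>{1..length w}. (\<Sum>k\<leftarrow>take n w. a k) * (rho0 t (take n w) * rho t (drop n w) x))"
  using assms
proof (induction w arbitrary: x rule: rev_induct)
  case (snoc k w)
  let ?A = "\<lambda>n. \<Sum>l\<leftarrow>take n w. a l"
  have k: "t k - x \<noteq> 0" using snoc.prems(3) by auto
  have IH: "rho t w (t k) * (\<Sum>l\<leftarrow>w. a l * (t l - t k)) = (\<Sum>n\<in>{1..length w}. ?A n * (rho0 t (take n w) * rho t (drop n w) (t k)))"
    by (rule snoc.IH) (use snoc.prems in \<open>auto simp: inj_on_def\<close>)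
  have "(\<Sum>l\<leftarrow>w @ [k]. a l * (t l - x)) = (\<Sum>l\<leftarrow>w. a l * (t l - t k)) + (\<Sum>l\<leftarrow>w @ [k]. a l) * (t k - x)"
    by (induction w) (simp_all add: algebra_simps)
  then have "rho t (w @ [k]) x * (\<Sum>l\<leftarrow>w @ [k]. a l * (t l - x)) =
      rho t w (t k) * (\<Sum>l\<leftarrow>w. a l * (t l - t k)) / (t k - x) + (\<Sum>l\<leftarrow>w @ [k]. a l) * rho t w (t k)"
    using k by (simp only: rho_snoc) (simp add: field_simps)
  also have "\<dots> = (\<Sum>n\<in>{1..length w}. ?A n * (rho0 t (take n w) * rho t (drop n w @ [k]) x)) + (\<Sum>l\<leftarrow>w @ [k]. a l) * rho t w (t k)"
    unfolding IH by (simp add: sum_divide_distrib)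
  also have "\<dots> = (\<Sum>n\<in>{1..length (w @ [k])}. (\<Sum>l\<leftarrow>take n (w @ [k]). a l) * (rho0 t (take n (w @ [k])) * rho t (drop n (w @ [k])) x))"
  proof -
    have "(\<Sum>n\<in>{1..length w}. ?A n * (rho0 t (take n w) * rho t (drop n w @ [k]) x)) =
        (\<Sum>n\<in>{1..length w}. (\<Sum>l\<leftarrow>take n (w @ [k]). a l) * (rho0 t (take n (w @ [k])) * rho t (drop n (w @ [k])) x))"
      by (rule sum.cong) auto
    then show ?thesis by simp
  qed
  finally show ?case .
qed simp

section \<open>Integrals against dt_0 ... dt_(m-1), with scalar and vector values\<close>

context master_function
begin

text \<open>The determinant of \<open>coord\<close> is the form dt_0 ... dt_(m-1). All forms of
  degree m that occur reduce to functions times this one.\<close>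

definition letter_converges :: "'n chain \<Rightarrow> ('n cell \<Rightarrow> (nat \<Rightarrow> real) \<Rightarrow> complex) \<Rightarrow> (point \<Rightarrow> complex) \<Rightarrow> bool" where
  "letter_converges \<Gamma> \<Psi> g \<longleftrightarrow> chain_converges \<Gamma> \<Psi> (\<lambda>t V. g t * form_det m coord V)"

definition letter_integral :: "'n chain \<Rightarrow> ('n cell \<Rightarrow> (nat \<Rightarrow> real) \<Rightarrow> complex) \<Rightarrow> (point \<Rightarrow> complex) \<Rightarrow> complex" where
  "letter_integral \<Gamma> \<Psi> g = chain_integral \<Gamma> \<Psi> (\<lambda>t V. g t * form_det m coord V)"

lemma letter_sum:
  assumes "finite I" "\<And>i. i \<in> I \<Longrightarrow> letter_converges \<Gamma> \<Psi> (g i)"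
  shows "letter_converges \<Gamma> \<Psi> (\<lambda>t. \<Sum>i\<in>I. b i * g i t)"
    "letter_integral \<Gamma> \<Psi> (\<lambda>t. \<Sum>i\<in>I. b i * g i t) = (\<Sum>i\<in>I. b i * letter_integral \<Gamma> \<Psi> (g i))"
proof -
  have eq: "(\<lambda>t V. (\<Sum>i\<in>I. b i * g i t) * form_det m coord V) = (\<lambda>t V. \<Sum>i\<in>I. b i * (g i t * form_det m coord V))"
    by (simp add: sum_distrib_right mult.assoc)
  note conv = assms(2)[unfolded letter_converges_def]
  show "letter_converges \<Gamma> \<Psi> (\<lambda>t. \<Sum>i\<in>I. b i * g i t)"
    unfolding letter_converges_def eq by (rule chain_linear_combination(1)[OF assms(1) conv])
  show "letter_integral \<Gamma> \<Psi> (\<lambda>t. \<Sum>i\<in>I. b i * g i t) = (\<Sum>i\<in>I. b i * letter_integral \<Gamma> \<Psi> (g i))"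
    unfolding letter_integral_def eq by (rule chain_linear_combination(2)[OF assms(1) conv])
qed

lemma letter_scale:
  assumes "letter_converges \<Gamma> \<Psi> g"
  shows "letter_converges \<Gamma> \<Psi> (\<lambda>t. b * g t)" "letter_integral \<Gamma> \<Psi> (\<lambda>t. b * g t) = b * letter_integral \<Gamma> \<Psi> g"
  using letter_sum[of "{()}" \<Gamma> \<Psi> "\<lambda>_. g" "\<lambda>_. b"] assms by simp_all

lemma letter_cong:
  assumes "\<And>a s. a \<in> chain_index \<Gamma> \<Longrightarrow> s \<in> open_cube m \<Longrightarrow> pos (chain_cell \<Gamma> a) s \<in> X"
    and "\<And>t. t \<in> X \<Longrightarrow> g t = g' t"
  shows "letter_converges \<Gamma> \<Psi> g \<longleftrightarrow> letter_converges \<Gamma> \<Psi> g'" "letter_integral \<Gamma> \<Psi> g = letter_integral \<Gamma> \<Psi> g'"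
proof -
  have eq: "\<Psi> (chain_cell \<Gamma> a) s * pullback m (chain_cell \<Gamma> a) (\<lambda>t V. g t * form_det m coord V) s =
      \<Psi> (chain_cell \<Gamma> a) s * pullback m (chain_cell \<Gamma> a) (\<lambda>t V. g' t * form_det m coord V) s"
    if "a \<in> chain_index \<Gamma>" "s \<in> open_cube m" for a s
    unfolding pullback_def assms(2)[OF assms(1)[OF that]] ..
  show "letter_converges \<Gamma> \<Psi> g \<longleftrightarrow> letter_converges \<Gamma> \<Psi> g'" "letter_integral \<Gamma> \<Psi> g = letter_integral \<Gamma> \<Psi> g'"
    unfolding letter_converges_def letter_integral_def by (rule chain_cong, rule eq, assumption, assumption)+
qed

text \<open>Since the target carries no topology, the integral of a vector-valued function is defined weakly.\<close>

definition has_vint ::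
    "'n chain \<Rightarrow> ('n cell \<Rightarrow> (nat \<Rightarrow> real) \<Rightarrow> complex) \<Rightarrow> (point \<Rightarrow> 'w::complex_vector) \<Rightarrow> 'w \<Rightarrow> bool" where
  "has_vint \<Gamma> \<Psi> F x \<longleftrightarrow> (\<forall>\<psi> :: 'w \<Rightarrow> complex. clinear \<psi> \<longrightarrow>
     letter_converges \<Gamma> \<Psi> (\<lambda>t. \<psi> (F t)) \<and> letter_integral \<Gamma> \<Psi> (\<lambda>t. \<psi> (F t)) = \<psi> x)"

lemma has_vint_single:
  assumes "letter_converges \<Gamma> \<Psi> g"
  shows "has_vint \<Gamma> \<Psi> (\<lambda>t. g t *\<^sub>C w) (letter_integral \<Gamma> \<Psi> g *\<^sub>C w)"
  unfolding has_vint_def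
proof (intro allI impI)
  fix \<psi> :: "'a \<Rightarrow> complex" assume \<psi>: "clinear \<psi>"
  have "\<psi> (b *\<^sub>C w) = \<psi> w * b" for b by (simp add: clinear_scale[OF \<psi>] scaleC_complex_def)
  then show "letter_converges \<Gamma> \<Psi> (\<lambda>t. \<psi> (g t *\<^sub>C w)) \<and>
      letter_integral \<Gamma> \<Psi> (\<lambda>t. \<psi> (g t *\<^sub>C w)) = \<psi> (letter_integral \<Gamma> \<Psi> g *\<^sub>C w)"
    using letter_scale[OF assms, of "\<psi> w"] by simp
qed

lemma has_vint_sum:
  assumes "finite I" "\<And>i. i \<in> I \<Longrightarrow> has_vint \<Gamma> \<Psi> (F i) (x i)"
  shows "has_vint \<Gamma> \<Psi> (\<lambda>t. \<Sum>i\<in>I. F i t) (\<Sum>i\<in>I. x i)"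
  unfolding has_vint_def
proof (intro allI impI)
  fix \<psi> :: "'b \<Rightarrow> complex" assume \<psi>: "clinear \<psi>"
  have conv: "letter_converges \<Gamma> \<Psi> (\<lambda>t. \<psi> (F i t))" and int: "letter_integral \<Gamma> \<Psi> (\<lambda>t. \<psi> (F i t)) = \<psi> (x i)" if "i \<in> I" for i
    using assms(2)[OF that] \<psi> by (auto simp: has_vint_def)
  show "letter_converges \<Gamma> \<Psi> (\<lambda>t. \<psi> (\<Sum>i\<in>I. F i t)) \<and>
      letter_integral \<Gamma> \<Psi> (\<lambda>t. \<psi> (\<Sum>i\<in>I. F i t)) = \<psi> (\<Sum>i\<in>I. x i)"
    using letter_sum[OF assms(1) conv, where b = "\<lambda>_. 1"] int by (simp add: clinear_sum[OF \<psi>])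
qed

lemma has_vint_zero: "has_vint \<Gamma> \<Psi> (\<lambda>t. 0) 0"
  using has_vint_sum[of "{}" \<Gamma> \<Psi>] by simp

lemma has_vint_linear:
  assumes "clinear T" "has_vint \<Gamma> \<Psi> F x"
  shows "has_vint \<Gamma> \<Psi> (\<lambda>t. T (F t)) (T x)"
  unfolding has_vint_def
proof (intro allI impI)
  fix \<psi> :: "'b \<Rightarrow> complex" assume "clinear \<psi>"
  from assms(2)[unfolded has_vint_def, rule_format, OF clinear_compose[OF this assms(1)]]
  show "letter_converges \<Gamma> \<Psi> (\<lambda>t. \<psi> (T (F t))) \<and> letter_integral \<Gamma> \<Psi> (\<lambda>t. \<psi> (T (F t))) = \<psi> (T x)" .
qed

lemma clinear_scaleC: "clinear (\<lambda>x. b *\<^sub>C x)"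
  by (rule clinearI) (simp_all add: scaleC_add_right scaleC_scaleC mult.commute)

lemma has_vint_scale: "has_vint \<Gamma> \<Psi> F x \<Longrightarrow> has_vint \<Gamma> \<Psi> (\<lambda>t. b *\<^sub>C F t) (b *\<^sub>C x)"
  by (rule has_vint_linear[OF clinear_scaleC])

lemma has_vint_add:
  assumes "has_vint \<Gamma> \<Psi> F x" "has_vint \<Gamma> \<Psi> G y"
  shows "has_vint \<Gamma> \<Psi> (\<lambda>t. F t + G t) (x + y)"
proof -
  have "has_vint \<Gamma> \<Psi> (\<lambda>t. \<Sum>i\<in>{True, False}. (if i then F else G) t) (\<Sum>i\<in>{True, False}. if i then x else y)"
    by (rule has_vint_sum) (use assms in auto)
  then show ?thesis by simp
qed

lemma has_vint_cong:
  assumes "has_vint \<Gamma> \<Psi> F x"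
    and "\<And>a s. a \<in> chain_index \<Gamma> \<Longrightarrow> s \<in> open_cube m \<Longrightarrow> pos (chain_cell \<Gamma> a) s \<in> X"
    and "\<And>t. t \<in> X \<Longrightarrow> F t = G t"
  shows "has_vint \<Gamma> \<Psi> G x"
  unfolding has_vint_def
proof (intro allI impI)
  fix \<psi> :: "'a \<Rightarrow> complex" assume \<psi>: "clinear \<psi>"
  have eq: "\<psi> (F t) = \<psi> (G t)" if "t \<in> X" for t using assms(3)[OF that] by simp
  have "letter_converges \<Gamma> \<Psi> (\<lambda>t. \<psi> (F t)) \<and> letter_integral \<Gamma> \<Psi> (\<lambda>t. \<psi> (F t)) = \<psi> x"
    using assms(1) \<psi> by (simp add: has_vint_def)
  moreover have "letter_converges \<Gamma> \<Psi> (\<lambda>t. \<psi> (F t)) \<longleftrightarrow> letter_converges \<Gamma> \<Psi> (\<lambda>t. \<psi> (G t))"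
    by (rule letter_cong(1)[OF assms(2) eq])
  moreover have "letter_integral \<Gamma> \<Psi> (\<lambda>t. \<psi> (F t)) = letter_integral \<Gamma> \<Psi> (\<lambda>t. \<psi> (G t))"
    by (rule letter_cong(2)[OF assms(2) eq])
  ultimately show "letter_converges \<Gamma> \<Psi> (\<lambda>t. \<psi> (G t)) \<and> letter_integral \<Gamma> \<Psi> (\<lambda>t. \<psi> (G t)) = \<psi> x"
    by simp
qed

text \<open>The differential equation will result from two evaluations of the integral of one and
  the same function.\<close>

lemma has_vint_unique:
  assumes "has_vint \<Gamma> \<Psi> F x" "has_vint \<Gamma> \<Psi> F y"
  shows "x = y"
  by (rule clinear_functionals_separate) (use assms in \<open>auto simp: has_vint_def\<close>)

lemma chain_fun_t_functions:
  assumes "distinct w" "k \<in> set w" "set w \<subseteq> {..<m}"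
  shows "chain_fun w j k \<in> t_functions"
proof (cases "k = last w")
  case True
  then have "chain_fun w j k = TZ k j" using chain_fun_last[OF assms(1)] assms(2) by (cases w) auto
  then show ?thesis using assms(2,3) by (auto simp: t_functions_def)
next
  case False
  from chain_fun_butlast[OF assms(1,2) this] obtain l where "l \<in> set w" "l \<noteq> k" "chain_fun w j k = TT k l" by metis
  then show ?thesis using assms(2,3) by (auto simp: t_functions_def)
qed

lemma row_t_functions:
  assumes "J \<in> arrangements A" "A \<subseteq> {..<m}" "k \<in> A"
  shows "row J k \<in> t_functions"
proof -
  obtain j where j: "k \<in> set (J j)" using assms(3) arrangementsD(4)[OF assms(1)] by blast
  have "set (J j) \<subseteq> {..<m}" using arrangementsD(2)[OF assms(1), of j] assms(2) by blast
  then show ?thesis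
    unfolding row_eq[OF assms(1) j] by (intro chain_fun_t_functions arrangementsD(1)[OF assms(1)] j)
qed

text \<open>This makes the properties of cycles that are known for products of d log's available for
  the functions \<open>rho_arr\<close>.\<close>

lemma wedge_rows:
  assumes "J \<in> arrangements {..<m}"
  shows "wedge (map (dlog z) (map (row J) [0..<m])) = (\<lambda>t V. rho_arr z t J * form_det m coord V)"
proof (intro ext)
  fix t V
  have "wedge (map (\<lambda>k. dlog z (row J k)) (map id [0..<m])) t V = of_int (sign (id :: nat \<Rightarrow> nat)) * form_det m (\<lambda>k. dlog z (row J k) t) V"
    using wedge_map_letters[OF permutes_id, where \<theta> = "\<lambda>k. dlog z (row J k)"] .
  then show "wedge (map (dlog z) (map (row J) [0..<m])) t V = rho_arr z t J * form_det m coord V"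
    by (simp add: form_det_rows[OF assms] sign_id comp_def)
qed

text \<open>\<open>Hs\<close> contains one d log for each letter except \<open>last p\<close>, whose
  row is left to \<open>\<Theta>\<close>; \<open>\<epsilon>\<close> is the sign of the order that
  lists \<open>last p\<close> first. The quantification over \<open>\<Theta>\<close>,
  \<open>b\<close> and \<open>t\<close> lets one \<open>Hs\<close> serve at all points, as the
  coefficients of d log \<Phi> vary with t.\<close>

lemma wedge_chain:
  assumes L: "L \<in> arrangements ({..<m} - S)" and S: "S \<subseteq> {..<m}" "S \<noteq> {}" and p: "p \<in> permutations_of_set S"
  obtains Hs \<epsilon> where "\<epsilon> \<noteq> 0" "Suc (length Hs) = m" "set Hs \<subseteq> t_functions"
    "\<forall>\<Theta> b t V. (\<forall>w. \<Theta> t w = (\<Sum>i<m. b i * w i)) \<longrightarrow>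
      wedge (\<Theta> # map (dlog z) Hs) t V = (\<epsilon> * ((\<Sum>i\<in>S. b i) * (rho0 t p * rho_arr z t L))) * form_det m coord V"
proof -
  have p': "distinct p" "p \<noteq> []" "set p = S" using p S(2) by (auto simp: permutations_of_set_def)
  have L': "L \<in> arrangements ({..<m} - set p)" using L p'(3) by simp
  have sub: "set p \<subseteq> {..<m}" using S(1) p'(3) by simp
  have last: "last p \<in> set p" "last p < m" using last_in_set[OF p'(2)] sub by auto
  \<comment> \<open>The link to z_j occurs only in the row of \<open>last p\<close>, which is
    replaced, so any index will do.\<close>
  define j :: 'n where "j = undefined"
  define h where "h k = (if k \<in> set p then chain_fun p j k else row L k)" for k
  define ks where "ks = last p # filter (\<lambda>k. k \<noteq> last p) [0..<m]"
  have ks: "distinct ks" "set ks = {..<m}" using last(2) by (auto simp: ks_def)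
  obtain \<sigma> where \<sigma>: "\<sigma> permutes {..<m}" "ks = map \<sigma> [0..<m]" by (rule distinct_list_permutation[OF ks])
  let ?Hs = "map h (tl ks)"
  show thesis
  proof (rule that[of "of_int (sign \<sigma>)" ?Hs])
    show "of_int (sign \<sigma>) \<noteq> (0 :: complex)" by (simp add: sign_def)
    show "Suc (length ?Hs) = m" using arg_cong[OF \<sigma>(2), of length] by (simp add: ks_def)
    show "set ?Hs \<subseteq> t_functions"
      using chain_fun_t_functions[OF p'(1) _ sub] row_t_functions[OF L'] by (auto simp: ks_def h_def)
    show "\<forall>\<Theta> b t V. (\<forall>w. \<Theta> t w = (\<Sum>i<m. b i * w i)) \<longrightarrow>
      wedge (\<Theta> # map (dlog z) ?Hs) t V = (of_int (sign \<sigma>) * ((\<Sum>i\<in>S. b i) * (rho0 t p * rho_arr z t L))) * form_det m coord V"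
    proof (intro allI impI)
      fix \<Theta> :: one_form and b t V
      assume "\<forall>w. \<Theta> t w = (\<Sum>i<m. b i * w i)"
      then have \<Theta>: "\<Theta> t w = (\<Sum>i<m. b i * w i)" for w by blast
      let ?\<theta> = "\<lambda>k. if k = last p then \<Theta> else dlog z (h k)"
      have "map ?\<theta> (map \<sigma> [0..<m]) = \<Theta> # map (dlog z) ?Hs"
        unfolding \<sigma>(2)[symmetric] by (simp add: ks_def)
      then have "wedge (\<Theta> # map (dlog z) ?Hs) t V = of_int (sign \<sigma>) * form_det m (\<lambda>k. ?\<theta> k t) V"
        using wedge_map_letters[OF \<sigma>(1), of ?\<theta> t V] by simp
      also have "form_det m (\<lambda>k. ?\<theta> k t) V = form_det m (\<lambda>k. if k = last p then \<Theta> t else if k \<in> set p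
          then dlog z (chain_fun p j k) t else dlog z (row L k) t) V"
        by (rule form_det_cong) (simp add: h_def)
      also have "\<dots> = (\<Sum>i\<in>set p. b i) * (rho0 t p * rho_arr z t L) * form_det m coord V"
        by (rule form_det_rows_chain[OF L' p'(1,2) sub \<Theta>])
      finally show "wedge (\<Theta> # map (dlog z) ?Hs) t V =
          (of_int (sign \<sigma>) * ((\<Sum>i\<in>S. b i) * (rho0 t p * rho_arr z t L))) * form_det m coord V"
        by (simp add: p'(3) mult.assoc)
    qed
  qed
qed

lemma complementD:
  assumes "t \<in> complement z"
  shows "inj_on t {..<m}" "k < m \<Longrightarrow> t k \<noteq> z $ j"
proof -
  show "inj_on t {..<m}"
  proof (rule inj_onI, rule ccontr)
    fix k l assume "k \<in> {..<m}" "l \<in> {..<m}" "t k = t l" "k \<noteq> l"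
    then have "TT k l \<in> t_functions" "dval z (TT k l) t = 0" by (auto simp: t_functions_def)
    then show False using assms by (auto simp: complement_def)
  qed
  assume "k < m"
  then have "TZ k j \<in> t_functions" by (auto simp: t_functions_def)
  then have "dval z (TZ k j) t \<noteq> 0" using assms unfolding complement_def by blast
  then show "t k \<noteq> z $ j" by simp
qed

end

section \<open>The dynamical differential equations\<close>

locale kz_integral = kz_data form \<alpha> brk hh e f \<Lambda> act v \<nu> + master_function form \<alpha> \<Lambda> \<kappa> m c
  for form :: "complex^'d \<Rightarrow> complex^'d \<Rightarrow> complex"
    and \<alpha> :: "'r::{finite,linorder} \<Rightarrow> complex^'d \<Rightarrow> complex"
    and brk :: "'g::complex_vector \<Rightarrow> 'g \<Rightarrow> 'g"
    and hh :: "complex^'d \<Rightarrow> 'g" and e f :: "'r \<Rightarrow> 'g"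
    and \<Lambda> :: "'n::{finite,linorder} \<Rightarrow> complex^'d \<Rightarrow> complex"
    and act :: "'n \<Rightarrow> 'g \<Rightarrow> 'v::complex_vector \<Rightarrow> 'v" and v :: "'n \<Rightarrow> 'v"
    and \<nu> :: "'n \<Rightarrow> 'v \<Rightarrow> ('g, 'v) tensor"
    and \<kappa> :: complex and m :: nat and c :: "nat \<Rightarrow> 'r" +
  fixes mm :: "'r \<Rightarrow> nat"
    and D :: "((complex, 'n) vec \<times> (complex, 'd) vec) set"
    and \<gamma> :: "(complex, 'n) vec \<Rightarrow> complex^'d \<Rightarrow> 'n chain"
  assumes kappa: "\<kappa> \<noteq> 0"
    and coloring: "is_coloring mm c"
    and m_eq: "m = sum mm UNIV"
    and horizontal: "horizontal_family D \<gamma>"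
begin

lemmas horizontalD = horizontal_familyD[OF fun_alpha fun_Lambda horizontal]

definition weight_sum :: "nat set \<Rightarrow> complex^'d \<Rightarrow> complex" where
  "weight_sum S h = (\<Sum>k\<in>S. \<alpha> (c k) h)"

definition coeff :: "(complex, 'n) vec \<Rightarrow> complex^'d \<Rightarrow> ('n \<Rightarrow> nat list) \<Rightarrow> complex" where
  "coeff z \<mu> J = letter_integral (\<gamma> z \<mu>) (branch z \<mu>) (\<lambda>t. rho_arr z t J)"

definition coeff_deriv :: "(complex, 'n) vec \<Rightarrow> complex^'d \<Rightarrow> complex^'d \<Rightarrow> ('n \<Rightarrow> nat list) \<Rightarrow> complex" where
  "coeff_deriv z \<mu> \<mu>' J = letter_integral (\<gamma> z \<mu>) (branch z \<mu>) (\<lambda>t. rho_arr z t J * (log_dir z \<mu>' t / \<kappa>))"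

definition solution :: "(complex, 'n) vec \<Rightarrow> complex^'d \<Rightarrow> ('n, 'v) mtensor" where
  "solution z \<mu> = (\<Sum>J\<in>arrangements {..<m}. coeff z \<mu> J *\<^sub>C fvec c J)"

lemma rho_arr_converges:
  assumes "(z, \<mu>) \<in> D" "J \<in> arrangements {..<m}"
  shows "letter_converges (\<gamma> z \<mu>) (branch z \<mu>) (\<lambda>t. rho_arr z t J)"
  unfolding letter_converges_def wedge_rows[OF assms(2), symmetric]
  by (rule horizontalD(3)[OF assms(1)]) (use row_t_functions[OF assms(2) subset_refl] in auto)

text \<open>Differentiation under the integral sign is formulated with \<open>branch_deriv\<close>;
  its extra factor \<open>log_dir\<close> over \<kappa> is moved from the branch into the function
  that is integrated.\<close>

lemma coeff_has_derivative:
  assumes zD: "(z, \<mu>) \<in> D" and J: "J \<in> arrangements {..<m}"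
  shows "letter_converges (\<gamma> z \<mu>) (branch z \<mu>) (\<lambda>t. rho_arr z t J * (log_dir z \<mu>' t / \<kappa>))"
    and "((\<lambda>a. coeff z (\<mu> + a *s \<mu>') J) has_field_derivative coeff_deriv z \<mu> \<mu>' J) (at 0)"
proof -
  let ?\<omega> = "\<lambda>t V. rho_arr z t J * form_det m coord V"
  have Hs: "length (map (row J) [0..<m]) = m \<and> set (map (row J) [0..<m]) \<subseteq> t_functions"
    using row_t_functions[OF J subset_refl] by auto
  have *: "chain_converges (\<gamma> z \<mu>) (branch_deriv z \<mu> \<mu>') ?\<omega> \<and>
      ((\<lambda>a. chain_integral (\<gamma> z (\<mu> + a *s \<mu>')) (branch z (\<mu> + a *s \<mu>')) ?\<omega>)
        has_field_derivative chain_integral (\<gamma> z \<mu>) (branch_deriv z \<mu> \<mu>') ?\<omega>) (at 0)"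
    using bspec[OF horizontalD(2)[unfolded derivative_under_integral_def] zD, unfolded prod.case,
        THEN spec[of _ \<mu>'], THEN spec[of _ "map (row J) [0..<m]"], THEN mp, OF Hs]
    unfolding Let_def wedge_rows[OF J] .
  have eq: "branch_deriv z \<mu> \<mu>' C s * pullback m C ?\<omega> s =
      branch z \<mu> C s * pullback m C (\<lambda>t V. rho_arr z t J * (log_dir z \<mu>' t / \<kappa>) * form_det m coord V) s" for C s
    unfolding branch_deriv_eq[OF fun_alpha fun_Lambda] pullback_def by (simp only: mult_ac)
  show "letter_converges (\<gamma> z \<mu>) (branch z \<mu>) (\<lambda>t. rho_arr z t J * (log_dir z \<mu>' t / \<kappa>))"
    unfolding letter_converges_def using conjunct1[OF *] by (rule iffD1[OF chain_cong(1), rotated]) (rule eq)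
  have "chain_integral (\<gamma> z \<mu>) (branch_deriv z \<mu> \<mu>') ?\<omega> = coeff_deriv z \<mu> \<mu>' J"
    unfolding coeff_deriv_def letter_integral_def by (rule chain_cong(2)) (rule eq)
  then show "((\<lambda>a. coeff z (\<mu> + a *s \<mu>') J) has_field_derivative coeff_deriv z \<mu> \<mu>' J) (at 0)"
    using conjunct2[OF *] by (simp add: coeff_def letter_integral_def)
qed

lemma has_vint_solution:
  assumes "(z, \<mu>) \<in> D"
  shows "has_vint (\<gamma> z \<mu>) (branch z \<mu>) (\<lambda>t. \<Sum>J\<in>arrangements {..<m}. rho_arr z t J *\<^sub>C w J)
    (\<Sum>J\<in>arrangements {..<m}. coeff z \<mu> J *\<^sub>C w J)"
  unfolding coeff_def
  by (rule has_vint_sum) (simp_all add: finite_arrangements has_vint_single rho_arr_converges assms)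

text \<open>By symmetry of the form, the sum over pairs k < l spreads evenly over both variables of
  each pair. The diagonal terms that come in with \<open>letter_charge\<close> are divisions by
  zero, hence 0.\<close>

lemma dlog_Phi_eq:
  "dlog_Phi z \<mu> t w = (\<Sum>i<m. (- \<alpha> (c i) \<mu> - letter_charge c {..<m} z t i) * w i)"
proof -
  let ?a = "\<lambda>k l. dual_form form (\<alpha> (c k)) (\<alpha> (c l))"
  have "(\<Sum>i<m. \<Sum>l<m. ?a i l / (t i - t l) * w i) =
      (\<Sum>(k, l) | k < l \<and> l < m. ?a k l / (t k - t l) * w k + ?a l k / (t l - t k) * w l)"
    by (subst sum_ordered_pairs) simp
  also have "\<dots> = (\<Sum>(k, l) | k < l \<and> l < m. ?a k l * dlog z (TT k l) t w)"
  proof (rule sum.cong[OF HOL.refl], clarsimp)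
    fix k l :: nat
    have "?a l k / (t l - t k) = - (?a k l / (t k - t l))"
      unfolding dual_form_eq(2)[OF cartan fun_alpha fun_alpha, of "c l" "c k"]
      by (metis minus_diff_eq minus_divide_right)
    then show "?a k l * w k / (t k - t l) + ?a l k * w l / (t l - t k) = ?a k l * dlog z (TT k l) t w"
      by (simp add: dlog_def diff_divide_distrib right_diff_distrib)
        (metis times_divide_eq_left mult_minus_left)
  qed
  finally have pairs: "(\<Sum>(k, l) | k < l \<and> l < m. ?a k l * dlog z (TT k l) t w) =
      (\<Sum>i<m. (\<Sum>l<m. ?a i l / (t i - t l)) * w i)" by (simp only: sum_distrib_right)
  have points: "(\<Sum>k<m. \<Sum>j\<in>UNIV. dual_form form (\<alpha> (c k)) (\<Lambda> j) * dlog z (TZ k j) t w) =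
      (\<Sum>i<m. (\<Sum>j\<in>UNIV. dual_form form (\<alpha> (c i)) (\<Lambda> j) / (t i - z $ j)) * w i)"
    by (simp add: dlog_def sum_distrib_right)
  show ?thesis
    unfolding dlog_Phi_def pairs points letter_charge_def
    by (simp add: left_diff_distrib sum_subtractf sum_negf)
qed

text \<open>The poles between two letters of \<open>S\<close> are antisymmetric and cancel in the
  sum over \<open>S\<close>.\<close>

lemma sum_letter_charge:
  assumes "S \<subseteq> {..<m}"
  shows "(\<Sum>k\<in>S. letter_charge c {..<m} z t k) = (\<Sum>k\<in>S. letter_charge c ({..<m} - S) z t k)"
proof -
  let ?a = "\<lambda>k l. dual_form form (\<alpha> (c k)) (\<alpha> (c l)) / (t k - t l)"
  have fS: "finite S" using assms finite_subset by auto
  have skew: "?a k l = - ?a l k" for k l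
    unfolding dual_form_eq(2)[OF cartan fun_alpha fun_alpha, of "c l" "c k"]
    by (metis minus_diff_eq minus_divide_right)
  have "(\<Sum>k\<in>S. \<Sum>l\<in>S. ?a k l) = (\<Sum>k\<in>S. \<Sum>l\<in>S. - ?a l k)"
    by (rule sum.cong[OF HOL.refl], rule sum.cong[OF HOL.refl], rule skew)
  also have "\<dots> = - (\<Sum>k\<in>S. \<Sum>l\<in>S. ?a l k)" by (simp only: sum_negf)
  also have "(\<Sum>k\<in>S. \<Sum>l\<in>S. ?a l k) = (\<Sum>k\<in>S. \<Sum>l\<in>S. ?a k l)" by (rule sum.swap)
  finally have zero: "(\<Sum>k\<in>S. \<Sum>l\<in>S. ?a k l) = 0" by simp
  have "(\<Sum>l<m. ?a k l) = (\<Sum>l\<in>{..<m} - S. ?a k l) + (\<Sum>l\<in>S. ?a k l)" for k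
    by (rule sum.subset_diff[OF assms]) simp
  then have "letter_charge c {..<m} z t k = letter_charge c ({..<m} - S) z t k - (\<Sum>l\<in>S. ?a k l)" for k
    unfolding letter_charge_def by simp
  then show ?thesis using zero by (simp add: sum_subtractf)
qed

text \<open>Stokes' relation for the d log's of \<open>wedge_chain\<close>, with d log
  \<Phi>/\<kappa> in the free row. The nonzero factor \<epsilon>/\<kappa> is divided out.\<close>

lemma stokes_chain:
  assumes zD: "(z, \<mu>) \<in> D" and L: "L \<in> arrangements ({..<m} - S)" and S: "S \<subseteq> {..<m}" "S \<noteq> {}"
    and p: "p \<in> permutations_of_set S"
  defines "g \<equiv> \<lambda>t. (- weight_sum S \<mu> - (\<Sum>k\<in>S. letter_charge c ({..<m} - S) z t k)) * (rho0 t p * rho_arr z t L)"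
  shows "letter_converges (\<gamma> z \<mu>) (branch z \<mu>) g" "letter_integral (\<gamma> z \<mu>) (branch z \<mu>) g = 0"
proof -
  obtain Hs \<epsilon> where \<epsilon>: "\<epsilon> \<noteq> 0" and Hs: "Suc (length Hs) = m" "set Hs \<subseteq> t_functions" and
    wedge: "\<forall>\<Theta> b t V. (\<forall>w. \<Theta> t w = (\<Sum>i<m. b i * w i)) \<longrightarrow>
      wedge (\<Theta> # map (dlog z) Hs) t V = (\<epsilon> * ((\<Sum>i\<in>S. b i) * (rho0 t p * rho_arr z t L))) * form_det m coord V"
    by (rule wedge_chain[OF L S p, of z])
  have eq: "wedge ((\<lambda>t w. dlog_Phi z \<mu> t w / \<kappa>) # map (dlog z) Hs) = (\<lambda>t V. \<epsilon> / \<kappa> * g t * form_det m coord V)"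
  proof (intro ext)
    fix t V
    have "wedge ((\<lambda>t w. dlog_Phi z \<mu> t w / \<kappa>) # map (dlog z) Hs) t V =
        (\<epsilon> * ((\<Sum>i\<in>S. (- \<alpha> (c i) \<mu> - letter_charge c {..<m} z t i) / \<kappa>) * (rho0 t p * rho_arr z t L))) * form_det m coord V"
      by (rule wedge[rule_format]) (simp only: dlog_Phi_eq sum_divide_distrib times_divide_eq_left)
    also have "(\<Sum>i\<in>S. (- \<alpha> (c i) \<mu> - letter_charge c {..<m} z t i) / \<kappa>) =
        (- weight_sum S \<mu> - (\<Sum>k\<in>S. letter_charge c ({..<m} - S) z t k)) / \<kappa>"
      unfolding sum_letter_charge[OF S(1), symmetric]
      by (simp only: weight_sum_def sum_divide_distrib[symmetric] sum_subtractf sum_negf)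
    finally show "wedge ((\<lambda>t w. dlog_Phi z \<mu> t w / \<kappa>) # map (dlog z) Hs) t V = \<epsilon> / \<kappa> * g t * form_det m coord V"
      by (simp add: g_def)
  qed
  have "letter_converges (\<gamma> z \<mu>) (branch z \<mu>) (\<lambda>t. \<epsilon> / \<kappa> * g t) \<and> letter_integral (\<gamma> z \<mu>) (branch z \<mu>) (\<lambda>t. \<epsilon> / \<kappa> * g t) = 0"
    using horizontalD(4)[OF zD Hs] unfolding eq letter_converges_def letter_integral_def .
  then show "letter_converges (\<gamma> z \<mu>) (branch z \<mu>) g" "letter_integral (\<gamma> z \<mu>) (branch z \<mu>) g = 0"
    using letter_scale[where g = "\<lambda>t. \<epsilon> / \<kappa> * g t" and b = "\<kappa> / \<epsilon>", of "\<gamma> z \<mu>" "branch z \<mu>"] \<epsilon> kappa by simp_all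
qed

text \<open>With q the charge of \<open>S\<close>, write -\<langle>\<alpha>_S, \<mu>\<rangle> as
  (-\<langle>\<alpha>_S, \<mu>\<rangle> - q) + q. The first part integrates to 0 by Stokes' theorem;
  the second is evaluated by the pointwise identity, valid on the complement of the hyperplanes,
  where all cells lie.\<close>

lemma has_vint_chain_vector:
  assumes zD: "(z, \<mu>) \<in> D" and S: "S \<subseteq> {..<m}" "S \<noteq> {}"
  shows "has_vint (\<gamma> z \<mu>) (branch z \<mu>) (\<lambda>t. - weight_sum S \<mu> *\<^sub>C chain_vector c {..<m} z t S)
    (\<Sum>J\<in>arrangements {..<m}. coeff z \<mu> J *\<^sub>C Delta_subset c S J)"
proof -
  let ?q = "\<lambda>t. \<Sum>k\<in>S. letter_charge c ({..<m} - S) z t k" and ?V = "has_vint (\<gamma> z \<mu>) (branch z \<mu>)"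
  have fS: "finite ({..<m} - S)" by simp
  let ?r = "\<lambda>L p t. (- weight_sum S \<mu> - ?q t) * (rho0 t p * rho_arr z t L)"
  have single: "?V (\<lambda>t. ?r L p t *\<^sub>C w) 0"
    if "L \<in> arrangements ({..<m} - S)" "p \<in> permutations_of_set S" for L p and w :: "('n, 'v) mtensor"
    using has_vint_single[OF stokes_chain(1)[OF zD that(1) S that(2)], of w]
    unfolding stokes_chain(2)[OF zD that(1) S that(2)] complex_vector.scale_zero_left .
  have "?V (\<lambda>t. \<Sum>L\<in>arrangements ({..<m} - S). \<Sum>j\<in>UNIV. \<Sum>p\<in>permutations_of_set S.
      ?r L p t *\<^sub>C fvec c (L(j := p @ L j)))
      (\<Sum>L\<in>(arrangements ({..<m} - S) :: ('n \<Rightarrow> nat list) set). \<Sum>j\<in>(UNIV :: 'n set). \<Sum>p\<in>permutations_of_set S. 0)"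
    by (rule has_vint_sum[OF finite_arrangements[OF fS]], rule has_vint_sum[OF finite], rule has_vint_sum)
      (simp_all add: single)
  then have "?V (\<lambda>t. (- weight_sum S \<mu> - ?q t) *\<^sub>C chain_vector c {..<m} z t S) 0"
    unfolding chain_vector_def complex_vector.scale_sum_right scaleC_scaleC by simp
  moreover have "?V (\<lambda>t. ?q t *\<^sub>C chain_vector c {..<m} z t S) (\<Sum>J\<in>arrangements {..<m}. coeff z \<mu> J *\<^sub>C Delta_subset c S J)"
  proof (rule has_vint_cong[OF has_vint_solution[OF zD], where X = "complement z"])
    show "pos (chain_cell (\<gamma> z \<mu>) a) s \<in> complement z" if "a \<in> chain_index (\<gamma> z \<mu>)" "s \<in> open_cube m" for a s
      by (rule horizontalD(5)[OF zD that])
    show "(\<Sum>J\<in>arrangements {..<m}. rho_arr z t J *\<^sub>C Delta_subset c S J) = ?q t *\<^sub>C chain_vector c {..<m} z t S"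
      if "t \<in> complement z" for t
      by (rule sum_Delta_subset[OF _ S complementD(1)[OF that]]) (use complementD(2)[OF that] in auto)
  qed
  ultimately have "?V (\<lambda>t. (- weight_sum S \<mu> - ?q t) *\<^sub>C chain_vector c {..<m} z t S + ?q t *\<^sub>C chain_vector c {..<m} z t S)
      (0 + (\<Sum>J\<in>arrangements {..<m}. coeff z \<mu> J *\<^sub>C Delta_subset c S J))"
    by (rule has_vint_add)
  moreover have "(- weight_sum S \<mu> - b) *\<^sub>C w + b *\<^sub>C w = - weight_sum S \<mu> *\<^sub>C w" for b and w :: "('n, 'v) mtensor"
    by (simp add: scaleC_add_left[symmetric])
  ultimately show ?thesis by simp
qed

lemma rho_arr_log_dir:
  assumes t: "t \<in> complement z" and J: "J \<in> arrangements {..<m}"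
  shows "rho_arr z t J * log_dir z h t = (\<Sum>j\<in>UNIV. rho_arr z t J * (z $ j * (\<Lambda> j h - (\<Sum>k\<leftarrow>map c (J j). \<alpha> k h)))) -
    (\<Sum>j\<in>UNIV. \<Sum>n\<in>{1..length (J j)}. weight_sum (set (take n (J j))) h *
      (rho0 t (take n (J j)) * rho_arr z t (J(j := drop n (J j)))))"
proof -
  let ?a = "\<lambda>k. \<alpha> (c k) h"
  have dist: "distinct (J j)" for j by (rule arrangementsD(1)[OF J])
  have "(\<Sum>k<m. ?a k * t k) = (\<Sum>j\<in>UNIV. \<Sum>k\<in>set (J j). ?a k * t k)"
    unfolding arrangementsD(4)[OF J, symmetric]
    by (rule sum.UNION_disjoint) (use arrangementsD(3)[OF J] in auto)
  also have "\<dots> = (\<Sum>j\<in>UNIV. \<Sum>k\<leftarrow>J j. ?a k * t k)"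
    by (simp only: sum_list_distinct_conv_sum_set[OF dist])
  finally have "log_dir z h t = (\<Sum>j\<in>UNIV. \<Lambda> j h * z $ j - (\<Sum>k\<leftarrow>J j. ?a k * t k))"
    by (simp add: log_dir_def sum_subtractf)
  \<comment> \<open>For the letters of list j, t_k = z_j + (t_k - z_j). The parts z_j combine with
    \<Lambda>_j to the weight of the word in factor j.\<close>
  also have "\<dots> = (\<Sum>j\<in>UNIV. z $ j * (\<Lambda> j h - (\<Sum>k\<leftarrow>map c (J j). \<alpha> k h)) - (\<Sum>k\<leftarrow>J j. ?a k * (t k - z $ j)))"
  proof (rule sum.cong[OF HOL.refl])
    fix j
    have "(\<Sum>k\<leftarrow>w. ?a k * (t k - x)) = (\<Sum>k\<leftarrow>w. ?a k * t k) - x * (\<Sum>k\<leftarrow>map c w. \<alpha> k h)" for w x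
      by (induction w) (simp_all add: algebra_simps)
    then show "\<Lambda> j h * z $ j - (\<Sum>k\<leftarrow>J j. ?a k * t k) =
        z $ j * (\<Lambda> j h - (\<Sum>k\<leftarrow>map c (J j). \<alpha> k h)) - (\<Sum>k\<leftarrow>J j. ?a k * (t k - z $ j))"
      by (simp add: algebra_simps)
  qed
  finally have log: "log_dir z h t = (\<Sum>j\<in>UNIV. z $ j * (\<Lambda> j h - (\<Sum>k\<leftarrow>map c (J j). \<alpha> k h))) - (\<Sum>j\<in>UNIV. \<Sum>k\<leftarrow>J j. ?a k * (t k - z $ j))"
    by (simp only: sum_subtractf)
  have "rho_arr z t J * (\<Sum>k\<leftarrow>J j. ?a k * (t k - z $ j)) =
      (\<Sum>n\<in>{1..length (J j)}. weight_sum (set (take n (J j))) h * (rho0 t (take n (J j)) * rho_arr z t (J(j := drop n (J j)))))" for j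
  proof -
    let ?R = "\<Prod>i\<in>UNIV - {j}. rho t (J i) (z $ i)"
    have sub: "set (J j) \<subseteq> {..<m}" by (rule arrangementsD(2)[OF J])
    have word: "rho t (J j) (z $ j) * (\<Sum>k\<leftarrow>J j. ?a k * (t k - z $ j)) =
        (\<Sum>n\<in>{1..length (J j)}. (\<Sum>k\<leftarrow>take n (J j). ?a k) * (rho0 t (take n (J j)) * rho t (drop n (J j)) (z $ j)))"
    proof (rule rho_times_linear[OF dist inj_on_subset[OF complementD(1)[OF t] sub]])
      show "z $ j \<notin> t ` set (J j)"
      proof
        assume "z $ j \<in> t ` set (J j)"
        then obtain k where "k \<in> set (J j)" "t k = z $ j" by (elim imageE) (rule that, assumption, rule HOL.sym)
        then show False using complementD(2)[OF t, of k j] subsetD[OF sub, of k] by simp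
      qed
    qed
    have "rho_arr z t J * (\<Sum>k\<leftarrow>J j. ?a k * (t k - z $ j)) = rho t (J j) (z $ j) * (\<Sum>k\<leftarrow>J j. ?a k * (t k - z $ j)) * ?R"
      unfolding rho_arr_remove[of z t J j] by (simp only: mult.assoc mult.commute[of ?R])
    also have "\<dots> = (\<Sum>n\<in>{1..length (J j)}. (\<Sum>k\<leftarrow>take n (J j). ?a k) * (rho0 t (take n (J j)) * rho t (drop n (J j)) (z $ j))) * ?R"
      by (simp only: word)
    also have "\<dots> = (\<Sum>n\<in>{1..length (J j)}. weight_sum (set (take n (J j))) h * (rho0 t (take n (J j)) * rho_arr z t (J(j := drop n (J j)))))"
    proof -
      have "weight_sum (set (take n (J j))) h = (\<Sum>k\<leftarrow>take n (J j). ?a k)" for n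
        by (simp only: weight_sum_def sum_list_distinct_conv_sum_set[OF distinct_take[OF dist]])
      then show ?thesis unfolding sum_distrib_right rho_arr_update by (simp only: mult.assoc)
    qed
    finally show ?thesis .
  qed
  then show ?thesis unfolding log right_diff_distrib sum_distrib_left[of "rho_arr z t J"] by simp
qed

text \<open>The weights in front of the z_j are the eigenvalues of \<open>hh h\<close> in the single
  factors, and the segments cut off are regrouped by their sets of letters.\<close>

lemma sum_rho_arr_log_dir:
  assumes t: "t \<in> complement z"
  shows "(\<Sum>J\<in>arrangements {..<m}. (rho_arr z t J * log_dir z h t) *\<^sub>C fvec c J) =
    (\<Sum>j\<in>UNIV. z $ j *\<^sub>C factor_act act j (hh h) (\<Sum>J\<in>arrangements {..<m}. rho_arr z t J *\<^sub>C fvec c J)) +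
    (\<Sum>S\<in>Pow {..<m} - {{}}. - weight_sum S h *\<^sub>C chain_vector c {..<m} z t S)"
proof -
  let ?A = "{..<m}"
  have fin: "finite ?A" by simp
  let ?X = "\<lambda>J j. rho_arr z t J * (z $ j * (\<Lambda> j h - (\<Sum>k\<leftarrow>map c (J j). \<alpha> k h)))"
  define H where "H j L p = (weight_sum (set p) h * (rho0 t p * rho_arr z t L)) *\<^sub>C fvec c (L(j := p @ L j))"
    for j and L :: "'n \<Rightarrow> nat list" and p
  have 1: "(\<Sum>J\<in>arrangements ?A. \<Sum>j\<in>UNIV. ?X J j *\<^sub>C fvec c J) =
      (\<Sum>j\<in>UNIV. z $ j *\<^sub>C factor_act act j (hh h) (\<Sum>J\<in>arrangements ?A. rho_arr z t J *\<^sub>C fvec c J))"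
  proof -
    have "?X J j *\<^sub>C fvec c J = z $ j *\<^sub>C rho_arr z t J *\<^sub>C factor_act act j (hh h) (fvec c J)" for J j
      unfolding fvec_def factor_act_h_f_vector scaleC_scaleC by (simp only: mult_ac)
    then have "(\<Sum>J\<in>arrangements ?A. \<Sum>j\<in>UNIV. ?X J j *\<^sub>C fvec c J) =
        (\<Sum>J\<in>arrangements ?A. \<Sum>j\<in>UNIV. z $ j *\<^sub>C rho_arr z t J *\<^sub>C factor_act act j (hh h) (fvec c J))"
      by (simp only:)
    also have "\<dots> = (\<Sum>j\<in>UNIV. \<Sum>J\<in>arrangements ?A. z $ j *\<^sub>C rho_arr z t J *\<^sub>C factor_act act j (hh h) (fvec c J))"
      by (rule sum.swap)
    finally show ?thesis
      unfolding clinear_sum_scale[OF factor_act_linear] complex_vector.scale_sum_right .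
  qed
  have "(\<Sum>J\<in>arrangements ?A. \<Sum>j\<in>UNIV. \<Sum>n\<in>{1..length (J j)}. (weight_sum (set (take n (J j))) h *
      (rho0 t (take n (J j)) * rho_arr z t (J(j := drop n (J j))))) *\<^sub>C fvec c J) =
      (\<Sum>J\<in>arrangements ?A. \<Sum>j\<in>UNIV. \<Sum>n\<in>{1..length (J j)}. H j (J(j := drop n (J j))) (take n (J j)))"
    unfolding H_def by simp
  also have "\<dots> = (\<Sum>j\<in>UNIV. \<Sum>J\<in>arrangements ?A. \<Sum>n\<in>{1..length (J j)}. H j (J(j := drop n (J j))) (take n (J j)))"
    by (rule sum.swap)
  also have "\<dots> = (\<Sum>j\<in>UNIV. \<Sum>S\<in>Pow ?A - {{}}. \<Sum>L\<in>arrangements (?A - S). \<Sum>p\<in>permutations_of_set S. H j L p)"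
    unfolding sum_arrangements_prefix[OF fin] ..
  also have "\<dots> = (\<Sum>S\<in>Pow ?A - {{}}. \<Sum>j\<in>UNIV. \<Sum>L\<in>arrangements (?A - S). \<Sum>p\<in>permutations_of_set S. H j L p)"
    by (rule sum.swap)
  also have "\<dots> = (\<Sum>S\<in>Pow ?A - {{}}. weight_sum S h *\<^sub>C chain_vector c ?A z t S)"
  proof (rule sum.cong[OF HOL.refl])
    fix S assume "S \<in> Pow ?A - {{}}"
    have "(\<Sum>j\<in>UNIV. \<Sum>L\<in>arrangements (?A - S). \<Sum>p\<in>permutations_of_set S. H j L p) =
        (\<Sum>L\<in>arrangements (?A - S). \<Sum>j\<in>UNIV. \<Sum>p\<in>permutations_of_set S. H j L p)" by (rule sum.swap)
    also have "\<dots> = weight_sum S h *\<^sub>C chain_vector c ?A z t S"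
      unfolding chain_vector_def complex_vector.scale_sum_right scaleC_scaleC
      by (rule sum.cong[OF HOL.refl], rule sum.cong[OF HOL.refl], rule sum.cong[OF HOL.refl])
        (simp add: H_def permutations_of_set_def)
    finally show "(\<Sum>j\<in>UNIV. \<Sum>L\<in>arrangements (?A - S). \<Sum>p\<in>permutations_of_set S. H j L p) = weight_sum S h *\<^sub>C chain_vector c ?A z t S" .
  qed
  finally have 2: "(\<Sum>J\<in>arrangements ?A. \<Sum>j\<in>UNIV. \<Sum>n\<in>{1..length (J j)}. (weight_sum (set (take n (J j))) h *
      (rho0 t (take n (J j)) * rho_arr z t (J(j := drop n (J j))))) *\<^sub>C fvec c J) =
      (\<Sum>S\<in>Pow ?A - {{}}. weight_sum S h *\<^sub>C chain_vector c ?A z t S)" .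
  have "(\<Sum>J\<in>arrangements ?A. (rho_arr z t J * log_dir z h t) *\<^sub>C fvec c J) =
      (\<Sum>J\<in>arrangements ?A. \<Sum>j\<in>UNIV. ?X J j *\<^sub>C fvec c J) -
      (\<Sum>J\<in>arrangements ?A. \<Sum>j\<in>UNIV. \<Sum>n\<in>{1..length (J j)}. (weight_sum (set (take n (J j))) h *
        (rho0 t (take n (J j)) * rho_arr z t (J(j := drop n (J j))))) *\<^sub>C fvec c J)"
    unfolding sum_subtractf[of _ _ "arrangements ?A", symmetric]
    by (rule sum.cong[OF HOL.refl])
      (simp only: rho_arr_log_dir[OF t] complex_vector.scale_left_diff_distrib complex_vector.scale_sum_left)
  then show ?thesis
    unfolding 1 2 by (simp add: complex_vector.scale_minus_left sum_negf)
qed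

text \<open>If \<langle>\<alpha>_S, \<mu>'\<rangle> = 0, the term of S vanishes in the integrand as
  well as in the result; otherwise Stokes' relation is divided by \<langle>\<alpha>_S,
  \<mu>\<rangle>. Both sides are then integrals of the same function.\<close>

lemma solution_derivative:
  assumes zD: "(z, \<mu>) \<in> D"
    and good: "\<And>S. S \<subseteq> {..<m} \<Longrightarrow> S \<noteq> {} \<Longrightarrow> weight_sum S \<mu>' = 0 \<or> weight_sum S \<mu> \<noteq> 0"
  shows "\<kappa> *\<^sub>C (\<Sum>J\<in>arrangements {..<m}. coeff_deriv z \<mu> \<mu>' J *\<^sub>C fvec c J) =
    (\<Sum>i\<in>UNIV. z $ i *\<^sub>C factor_act act i (hh \<mu>') (solution z \<mu>)) +
    (\<Sum>S\<in>Pow {..<m} - {{}}. (weight_sum S \<mu>' / weight_sum S \<mu>) *\<^sub>C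
      (\<Sum>J\<in>arrangements {..<m}. coeff z \<mu> J *\<^sub>C Delta_subset c S J))"
proof -
  let ?V = "has_vint (\<gamma> z \<mu>) (branch z \<mu>)" and ?A = "{..<m}"
  let ?X = "\<lambda>S. \<Sum>J\<in>arrangements ?A. coeff z \<mu> J *\<^sub>C Delta_subset c S J"
  have S: "?V (\<lambda>t. - weight_sum S \<mu>' *\<^sub>C chain_vector c ?A z t S) ((weight_sum S \<mu>' / weight_sum S \<mu>) *\<^sub>C ?X S)"
    if "S \<in> Pow ?A - {{}}" for S
  proof (cases "weight_sum S \<mu>' = 0")
    case True
    then show ?thesis by (simp add: has_vint_zero)
  next
    case False
    have S: "S \<subseteq> ?A" "S \<noteq> {}" using that by auto
    have nz: "weight_sum S \<mu> \<noteq> 0" using good[OF S] False by simp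
    have "?V (\<lambda>t. (weight_sum S \<mu>' / weight_sum S \<mu>) *\<^sub>C - weight_sum S \<mu> *\<^sub>C chain_vector c ?A z t S)
        ((weight_sum S \<mu>' / weight_sum S \<mu>) *\<^sub>C ?X S)"
      by (rule has_vint_scale[OF has_vint_chain_vector[OF zD S]])
    then show ?thesis using nz by (simp add: scaleC_scaleC)
  qed
  have "?V (\<lambda>t. z $ j *\<^sub>C factor_act act j (hh \<mu>') (\<Sum>J\<in>arrangements ?A. rho_arr z t J *\<^sub>C fvec c J))
      (z $ j *\<^sub>C factor_act act j (hh \<mu>') (solution z \<mu>))" for j
    unfolding solution_def by (rule has_vint_scale[OF has_vint_linear[OF factor_act_linear has_vint_solution[OF zD]]])
  then have 1: "?V (\<lambda>t. \<Sum>j\<in>UNIV. z $ j *\<^sub>C factor_act act j (hh \<mu>') (\<Sum>J\<in>arrangements ?A. rho_arr z t J *\<^sub>C fvec c J))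
      (\<Sum>i\<in>UNIV. z $ i *\<^sub>C factor_act act i (hh \<mu>') (solution z \<mu>))"
    by (rule has_vint_sum[OF finite])
  have 2: "?V (\<lambda>t. \<Sum>S\<in>Pow ?A - {{}}. - weight_sum S \<mu>' *\<^sub>C chain_vector c ?A z t S)
      (\<Sum>S\<in>Pow ?A - {{}}. (weight_sum S \<mu>' / weight_sum S \<mu>) *\<^sub>C ?X S)"
    by (rule has_vint_sum[OF _ S]) simp_all
  from has_vint_add[OF 1 2]
have rhs: "?V (\<lambda>t. \<Sum>J\<in>arrangements ?A. (rho_arr z t J * log_dir z \<mu>' t) *\<^sub>C fvec c J)
      ((\<Sum>i\<in>UNIV. z $ i *\<^sub>C factor_act act i (hh \<mu>') (solution z \<mu>)) +
      (\<Sum>S\<in>Pow ?A - {{}}. (weight_sum S \<mu>' / weight_sum S \<mu>) *\<^sub>C ?X S))"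
    by (rule has_vint_cong[where X = "complement z"]) (rule horizontalD(5)[OF zD], assumption+, rule sum_rho_arr_log_dir[symmetric])
  have "?V (\<lambda>t. \<kappa> *\<^sub>C (\<Sum>J\<in>arrangements ?A. (rho_arr z t J * (log_dir z \<mu>' t / \<kappa>)) *\<^sub>C fvec c J))
      (\<kappa> *\<^sub>C (\<Sum>J\<in>arrangements ?A. coeff_deriv z \<mu> \<mu>' J *\<^sub>C fvec c J))"
    unfolding coeff_deriv_def
    by (rule has_vint_scale, rule has_vint_sum[OF finite_arrangements[OF finite_lessThan]], rule has_vint_single,
        rule coeff_has_derivative(1)[OF zD])
  then have lhs: "?V (\<lambda>t. \<Sum>J\<in>arrangements ?A. (rho_arr z t J * log_dir z \<mu>' t) *\<^sub>C fvec c J)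
      (\<kappa> *\<^sub>C (\<Sum>J\<in>arrangements ?A. coeff_deriv z \<mu> \<mu>' J *\<^sub>C fvec c J))"
    unfolding complex_vector.scale_sum_right scaleC_scaleC using kappa by simp
  show ?thesis by (rule has_vint_unique[OF lhs rhs])
qed

end

text \<open>Mean value inequality for F - l id on the segment from 0 to h, with continuity at 0
  supplied by the derivative there: the difference quotients at 0 converge to l, and also to
  d.\<close>

lemma DERIV_eq_limit:
  fixes F g :: "complex \<Rightarrow> complex"
  assumes F: "eventually (\<lambda>a. (F has_field_derivative g a) (at a)) (at 0)"
    and g: "(g \<longlongrightarrow> l) (at 0)" and F0: "(F has_field_derivative d) (at 0)"
  shows "d = l"
proof -
  have "((\<lambda>h. (F h - F 0) / h) \<longlongrightarrow> l) (at 0)"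
  proof (rule tendstoI)
    fix \<epsilon> :: real assume \<epsilon>: "\<epsilon> > 0"
    have "eventually (\<lambda>a. dist (g a) l < \<epsilon> / 2) (at 0)" using g \<epsilon> by (intro tendstoD) auto
    with F have "eventually (\<lambda>a. (F has_field_derivative g a) (at a) \<and> dist (g a) l < \<epsilon> / 2) (at 0)"
      by (rule eventually_conj)
    then obtain \<delta> where \<delta>: "\<delta> > 0" and near: "\<And>a. a \<noteq> 0 \<Longrightarrow> norm a < \<delta> \<Longrightarrow>
        (F has_field_derivative g a) (at a) \<and> dist (g a) l < \<epsilon> / 2"
      unfolding eventually_at by (auto simp: dist_norm)
    have "dist ((F h - F 0) / h) l < \<epsilon>" if h: "h \<noteq> 0" "norm h < \<delta>" for h
    proof -
      \<comment> \<open>The function F - l id restricted to the segment from 0 to h, parametrised by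
        [0,1]; its derivative is at most |h| \<epsilon>/2 in the interior.\<close>
      define \<phi> where "\<phi> x = F (of_real x * h) - l * (of_real x * h)" for x :: real
      have small: "norm (of_real x * h) < \<delta>" if "0 \<le> x" "x \<le> 1" for x
        using that h(2) mult_right_mono[of x 1 "norm h"] by (simp add: norm_mult)
      have cont: "continuous_on {0..1} \<phi>"
      proof -
        have "isCont F (of_real x * h)" if "0 \<le> x" "x \<le> 1" for x
        proof (cases "x = 0")
          case True
          then show ?thesis using DERIV_isCont[OF F0] by simp
        next
          case False
          then show ?thesis using near[OF _ small[OF that]] h(1) by (auto intro: DERIV_isCont)
        qed
        then have "continuous_on ((\<lambda>x. of_real x * h) ` {0..1}) F"
          by (intro continuous_at_imp_continuous_on) auto
        then have "continuous_on {0..1} (\<lambda>x. F (of_real x * h))"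
          by (rule continuous_on_compose2) (auto intro!: continuous_intros)
        then show ?thesis unfolding \<phi>_def by (intro continuous_intros)
      qed
      have deriv: "(\<phi> has_derivative (\<lambda>y. y *\<^sub>R ((g (of_real x * h) - l) * h))) (at x)" if "0 < x" "x < 1" for x
      proof -
        have "(F has_field_derivative g (of_real x * h)) (at (of_real x * h))"
          using near[OF _ small[of x]] that h(1) by simp
        then have "((\<lambda>w. F (w * h) - l * (w * h)) has_field_derivative (g (of_real x * h) - l) * h) (at (of_real x))"
          by (auto intro!: derivative_eq_intros DERIV_chain'[where g = F] simp: algebra_simps)
        from has_vector_derivative_real_field[OF this] show ?thesis
          unfolding \<phi>_def has_vector_derivative_def .
      qed
      obtain x where x: "0 < x" "x < 1" and "norm (\<phi> 1 - \<phi> 0) \<le> norm ((1 - 0) *\<^sub>R ((g (of_real x * h) - l) * h))"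
        using mvt_general[OF zero_less_one cont deriv] by auto
      moreover have "\<phi> 1 - \<phi> 0 = F h - F 0 - l * h" by (simp add: \<phi>_def)
      ultimately have "norm (F h - F 0 - l * h) \<le> norm (g (of_real x * h) - l) * norm h"
        by (simp only: norm_mult diff_zero scaleR_one)
      moreover have "norm (g (of_real x * h) - l) < \<epsilon> / 2"
        using near[OF _ small[of x]] x h(1) by (simp add: dist_norm)
      ultimately have "norm (F h - F 0 - l * h) \<le> \<epsilon> / 2 * norm h"
        by (meson less_imp_le mult_right_mono norm_ge_zero order_trans)
      moreover have "(F h - F 0) / h - l = (F h - F 0 - l * h) / h" using h(1) by (simp add: diff_divide_distrib)
      ultimately have "dist ((F h - F 0) / h) l \<le> \<epsilon> / 2" using h(1) by (simp add: dist_norm norm_divide field_simps)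
      then show ?thesis using \<epsilon> by simp
    qed
    then show "eventually (\<lambda>h. dist ((F h - F 0) / h) l < \<epsilon>) (at 0)"
      unfolding eventually_at using \<delta> by (auto simp: dist_norm)
  qed
  moreover have "((\<lambda>h. (F h - F 0) / h) \<longlongrightarrow> d) (at 0)" using F0 by (simp add: DERIV_def)
  ultimately show ?thesis by (intro tendsto_unique[OF _ _ \<open>((\<lambda>h. (F h - F 0) / h) \<longlongrightarrow> l) (at 0)\<close>]) auto
qed

section \<open>From arrangements to sequences, and from sets of letters to weights\<close>

context kz_integral
begin

lemma hyp_coeff_eq:
  assumes zD: "(z, \<mu>) \<in> D" and I: "I \<in> sequences mm"
  shows "hyp_coeff \<gamma> z \<mu> I = (\<Sum>\<sigma>\<in>Sigma_perms I. coeff z \<mu> (blocks (\<lambda>j. length (I j)) \<sigma>))"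
proof -
  let ?J = "blocks (\<lambda>j. length (I j))"
  have len: "(\<Sum>j\<in>UNIV. length (I j)) = m" using sum_length_sequences[OF I] m_eq by simp
  have fin: "finite (Sigma_perms I)"
    by (rule finite_subset[OF _ finite_permutations[OF finite_lessThan[of m]]]) (auto simp: Sigma_perms_def)
  have perm: "\<sigma> permutes {..<m}" if "\<sigma> \<in> Sigma_perms I" for \<sigma> using that by (simp add: Sigma_perms_def)
  have eq: "(\<lambda>t V. \<Sum>\<sigma>\<in>Sigma_perms I. of_int (sign \<sigma>) * omega z I \<sigma> t V) =
      (\<lambda>t V. \<Sum>\<sigma>\<in>Sigma_perms I. 1 * (rho_arr z t (?J \<sigma>) * form_det m coord V))"
    by (intro ext, rule sum.cong[OF HOL.refl]) (simp only: omega_eq_rho(2)[OF perm len] mult_1)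
  have conv: "chain_converges (\<gamma> z \<mu>) (branch z \<mu>) (\<lambda>t V. rho_arr z t (?J \<sigma>) * form_det m coord V)"
    if "\<sigma> \<in> Sigma_perms I" for \<sigma>
    using rho_arr_converges[OF zD omega_eq_rho(1)[OF perm[OF that] len]] by (simp only: letter_converges_def)
  show ?thesis
    unfolding hyp_coeff_def eq coeff_def letter_integral_def
    by (subst chain_linear_combination(2)[OF fin conv]) simp_all
qed

lemma solution_eq:
  assumes "(z, \<mu>) \<in> D"
  shows "(\<Sum>I\<in>sequences mm. hyp_coeff \<gamma> z \<mu> I *\<^sub>C f_vector f act v I) = solution z \<mu>"
proof -
  have "(\<Sum>I\<in>sequences mm. hyp_coeff \<gamma> z \<mu> I *\<^sub>C f_vector f act v I) =
      (\<Sum>I\<in>sequences mm. \<Sum>\<sigma>\<in>Sigma_perms I. coeff z \<mu> (blocks (\<lambda>j. length (I j)) \<sigma>) *\<^sub>C fvec c (blocks (\<lambda>j. length (I j)) \<sigma>))"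
  proof (rule sum.cong[OF HOL.refl])
    fix I :: "'n \<Rightarrow> 'r list" assume I: "I \<in> sequences mm"
    have "fvec c (blocks (\<lambda>j. length (I j)) \<sigma>) = f_vector f act v I" if \<sigma>: "\<sigma> \<in> Sigma_perms I" for \<sigma>
    proof -
      have "map c (blocks (\<lambda>j. length (I j)) \<sigma> j) = I j" for j
        using \<sigma> by (intro nth_equalityI) (auto simp: blocks_def Sigma_perms_def offset_eq)
      then show ?thesis by (simp add: fvec_def)
    qed
    then show "hyp_coeff \<gamma> z \<mu> I *\<^sub>C f_vector f act v I =
        (\<Sum>\<sigma>\<in>Sigma_perms I. coeff z \<mu> (blocks (\<lambda>j. length (I j)) \<sigma>) *\<^sub>C fvec c (blocks (\<lambda>j. length (I j)) \<sigma>))"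
      unfolding hyp_coeff_eq[OF assms I] complex_vector.scale_sum_left by (intro sum.cong) auto
  qed
  also have "\<dots> = solution z \<mu>"
    unfolding solution_def by (rule sum_sequences_permutations[OF coloring m_eq])
  finally show ?thesis .
qed

lemma solution_in_weight_space:
  assumes "(z, \<mu>) \<in> D"
  shows "solution z \<mu> \<in> weight_space \<alpha> hh \<Lambda> act mm"
  unfolding solution_eq[OF assms, symmetric]
  by (intro complex_vector.subspace_sum complex_vector.subspace_scale subspace_weight_space f_vector_weight_space)

text \<open>A finite index set that contains the weights of all nonempty sets of letters as well as
  all relevant roots.\<close>

definition bounded_weights :: "('r \<Rightarrow> nat) set" where
  "bounded_weights = {k. k \<noteq> (\<lambda>_. 0) \<and> (\<forall>i. k i \<le> mm i)}"

lemma finite_weights: "finite bounded_weights"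
  by (rule finite_subset[OF _ finite_bounded_weights[of mm]]) (auto simp: bounded_weights_def)

lemma letter_weight_bounded:
  assumes "S \<subseteq> {..<m}" "S \<noteq> {}"
  shows "letter_weight c S \<in> bounded_weights"
proof -
  have fin: "finite S" using assms(1) finite_subset by auto
  obtain k where k: "k \<in> S" using assms(2) by blast
  have "letter_weight c S (c k) \<noteq> 0" using fin k by (auto simp: letter_weight_def)
  then have "letter_weight c S \<noteq> (\<lambda>_. 0)" by auto
  moreover have "letter_weight c S i \<le> mm i" for i
  proof -
    have "letter_weight c S i \<le> card {k. k < m \<and> c k = i}"
      unfolding letter_weight_def by (rule card_mono) (use assms(1) in auto)
    then show ?thesis using coloring by (simp add: is_coloring_def m_eq)
  qed
  ultimately show ?thesis by (simp add: bounded_weights_def)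
qed

text \<open>\<alpha>_S, and with it the quotient, depends only on how often each colour occurs in
  \<open>S\<close>; grouping by these multiplicities assembles the operators of the single sets of
  letters.\<close>

lemma sum_subsets_by_weight:
  "(\<Sum>S\<in>Pow {..<m} - {{}}. (weight_sum S \<mu>' / weight_sum S \<mu>) *\<^sub>C (\<Sum>J\<in>arrangements {..<m}. x J *\<^sub>C Delta_subset c S J)) =
    (\<Sum>k\<in>bounded_weights. (wt \<alpha> k \<mu>' / wt \<alpha> k \<mu>) *\<^sub>C (\<Sum>J\<in>arrangements {..<m}. x J *\<^sub>C Delta_word (\<lambda>_. c) k J))"
proof -
  let ?X = "\<lambda>S. \<Sum>J\<in>arrangements {..<m}. x J *\<^sub>C Delta_subset c S J"
  let ?P = "Pow {..<m} - {{}} :: nat set set" and ?r = "\<lambda>k. wt \<alpha> k \<mu>' / wt \<alpha> k \<mu>"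
  have word: "(\<Sum>J\<in>arrangements {..<m}. x J *\<^sub>C Delta_word (\<lambda>_. c) k J) = (\<Sum>S\<in>{S \<in> ?P. letter_weight c S = k}. ?X S)"
    if k: "k \<in> bounded_weights" for k
  proof -
    have "(\<Sum>J\<in>arrangements {..<m}. x J *\<^sub>C Delta_word (\<lambda>_. c) k J) =
        (\<Sum>J\<in>arrangements {..<m}. \<Sum>S\<in>Pow {..<m}. if letter_weight c S = k then x J *\<^sub>C Delta_subset c S J else 0)"
    proof (rule sum.cong[OF HOL.refl])
      fix J :: "'n \<Rightarrow> nat list" assume "J \<in> arrangements {..<m}"
      then show "x J *\<^sub>C Delta_word (\<lambda>_. c) k J = (\<Sum>S\<in>Pow {..<m}. if letter_weight c S = k then x J *\<^sub>C Delta_subset c S J else 0)"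
        unfolding Delta_word_eq_subsets[OF finite_lessThan \<open>J \<in> arrangements {..<m}\<close>] complex_vector.scale_sum_right
        by (intro sum.cong) auto
    qed
    also have "\<dots> = (\<Sum>S\<in>Pow {..<m}. \<Sum>J\<in>arrangements {..<m}. if letter_weight c S = k then x J *\<^sub>C Delta_subset c S J else 0)"
      by (rule sum.swap)
    also have "\<dots> = (\<Sum>S\<in>Pow {..<m}. if letter_weight c S = k then ?X S else 0)"
      by (rule sum.cong) auto
    also have "\<dots> = (\<Sum>S\<in>{S \<in> Pow {..<m}. letter_weight c S = k}. ?X S)"
      by (rule sum.inter_filter[symmetric]) simp
    also have "{S \<in> Pow {..<m}. letter_weight c S = k} = {S \<in> ?P. letter_weight c S = k}"
      using k by (auto simp: bounded_weights_def letter_weight_def)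
    finally show ?thesis .
  qed
  have "(\<Sum>S\<in>?P. (weight_sum S \<mu>' / weight_sum S \<mu>) *\<^sub>C ?X S) = (\<Sum>S\<in>?P. ?r (letter_weight c S) *\<^sub>C ?X S)"
  proof (rule sum.cong[OF HOL.refl])
    fix S assume "S \<in> ?P"
    then have "finite S" using finite_subset[of S "{..<m}"] by auto
    then show "(weight_sum S \<mu>' / weight_sum S \<mu>) *\<^sub>C ?X S = ?r (letter_weight c S) *\<^sub>C ?X S"
      by (simp only: weight_sum_def wt_letter_weight)
  qed
  also have "\<dots> = (\<Sum>k\<in>bounded_weights. \<Sum>S\<in>{S \<in> ?P. letter_weight c S = k}. ?r (letter_weight c S) *\<^sub>C ?X S)"
    by (rule sum.group[symmetric]) (use finite_weights letter_weight_bounded in auto)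
  also have "\<dots> = (\<Sum>k\<in>bounded_weights. ?r k *\<^sub>C (\<Sum>J\<in>arrangements {..<m}. x J *\<^sub>C Delta_word (\<lambda>_. c) k J))"
  proof (rule sum.cong[OF HOL.refl])
    fix k assume k: "k \<in> bounded_weights"
    show "(\<Sum>S\<in>{S \<in> ?P. letter_weight c S = k}. ?r (letter_weight c S) *\<^sub>C ?X S) =
        ?r k *\<^sub>C (\<Sum>J\<in>arrangements {..<m}. x J *\<^sub>C Delta_word (\<lambda>_. c) k J)"
      unfolding word[OF k] complex_vector.scale_sum_right[of _ _ "{S \<in> ?P. letter_weight c S = k}"]
      by (rule sum.cong) auto
  qed
  finally show ?thesis .
qed

end

locale kz_roots = kz_integral form \<alpha> brk hh e f \<Lambda> act v \<nu> \<kappa> m c mm D \<gamma>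
  for form :: "complex^'d \<Rightarrow> complex^'d \<Rightarrow> complex"
    and \<alpha> :: "'r::{finite,linorder} \<Rightarrow> complex^'d \<Rightarrow> complex"
    and brk :: "'g::complex_vector \<Rightarrow> 'g \<Rightarrow> 'g"
    and hh :: "complex^'d \<Rightarrow> 'g" and e f :: "'r \<Rightarrow> 'g"
    and \<Lambda> :: "'n::{finite,linorder} \<Rightarrow> complex^'d \<Rightarrow> complex"
    and act :: "'n \<Rightarrow> 'g \<Rightarrow> 'v::complex_vector \<Rightarrow> 'v" and v :: "'n \<Rightarrow> 'v"
    and \<nu> :: "'n \<Rightarrow> 'v \<Rightarrow> ('g, 'v) tensor"
    and \<kappa> :: complex and m :: nat and c :: "nat \<Rightarrow> 'r"
    and mm :: "'r \<Rightarrow> nat"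
    and D :: "((complex, 'n) vec \<times> (complex, 'd) vec) set"
    and \<gamma> :: "(complex, 'n) vec \<Rightarrow> complex^'d \<Rightarrow> 'n chain" +
  fixes B :: "('r \<Rightarrow> nat) \<Rightarrow> 'g set" and \<phi> :: "('r \<Rightarrow> nat) \<Rightarrow> 'g \<Rightarrow> 'g \<Rightarrow> complex"
  assumes bases: "\<And>k. pos_root \<alpha> brk hh f k \<Longrightarrow> root_dual_bases \<alpha> brk hh f k (B k) (\<phi> k)"
begin

abbreviation \<Delta> :: "('r \<Rightarrow> nat) \<Rightarrow> ('n, 'v) mtensor \<Rightarrow> ('n, 'v) mtensor" where
  "\<Delta> k \<equiv> Delta_plus act \<nu> (B k) (\<phi> k)"

definition relevant_roots :: "('r \<Rightarrow> nat) set" where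
  "relevant_roots = {k. pos_root \<alpha> brk hh f k \<and> (\<exists>w\<in>weight_space \<alpha> hh \<Lambda> act mm. \<Delta> k w \<noteq> 0)}"

lemma relevant_roots_bounded: "relevant_roots \<subseteq> bounded_weights"
proof
  fix k assume k: "k \<in> relevant_roots"
  then obtain w where root: "pos_root \<alpha> brk hh f k" and w: "w \<in> weight_space \<alpha> hh \<Lambda> act mm" "\<Delta> k w \<noteq> 0"
    by (auto simp: relevant_roots_def)
  have "k i \<le> mm i" for i by (rule Delta_plus_weight_bound[OF bases[OF root] w])
  then show "k \<in> bounded_weights" using root by (auto simp: bounded_weights_def pos_root_def)
qed

lemma finite_relevant_roots: "finite relevant_roots"
  by (rule finite_subset[OF relevant_roots_bounded finite_weights])

lemma Delta_fvec:
  assumes "pos_root \<alpha> brk hh f k" "J \<in> arrangements {..<m}"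
  shows "\<Delta> k (fvec c J) = Delta_word (\<lambda>_. c) k J"
  unfolding fvec_def by (rule Delta_plus_word[OF bases[OF assms(1)], where col = "\<lambda>_. c"]) (rule arrangementsD(1)[OF assms(2)])

text \<open>A bounded weight that is not relevant is either no root, so that no bracket of this
  weight is nonzero, or a root whose \<Delta> vanishes on the weight space, to which the solution
  belongs.\<close>

lemma sum_relevant_roots:
  assumes zD: "(z, \<mu>) \<in> D"
  shows "(\<Sum>k\<in>bounded_weights. r k *\<^sub>C (\<Sum>J\<in>arrangements {..<m}. coeff z \<mu> J *\<^sub>C Delta_word (\<lambda>_. c) k J)) =
    (\<Sum>k\<in>relevant_roots. r k *\<^sub>C \<Delta> k (solution z \<mu>))"
proof (rule sum.mono_neutral_cong_right[OF finite_weights relevant_roots_bounded])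
  have root: "(\<Sum>J\<in>arrangements {..<m}. coeff z \<mu> J *\<^sub>C Delta_word (\<lambda>_. c) k J) = \<Delta> k (solution z \<mu>)"
    if "pos_root \<alpha> brk hh f k" for k
    unfolding solution_def clinear_sum_scale[OF Delta_plus_linear[OF bases[OF that]]]
    by (rule sum.cong) (simp_all add: Delta_fvec[OF that])
  show "\<forall>k\<in>bounded_weights - relevant_roots. r k *\<^sub>C (\<Sum>J\<in>arrangements {..<m}. coeff z \<mu> J *\<^sub>C Delta_word (\<lambda>_. c) k J) = 0"
  proof
    fix k assume k: "k \<in> bounded_weights - relevant_roots"
    have "(\<Sum>J\<in>arrangements {..<m}. coeff z \<mu> J *\<^sub>C Delta_word (\<lambda>_. c) k J) = 0"
    proof (cases "pos_root \<alpha> brk hh f k")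
      case True
      then show ?thesis using k solution_in_weight_space[OF zD] unfolding root[OF True] by (auto simp: relevant_roots_def)
    next
      case False
      then show ?thesis using k by (simp add: Delta_word_not_root bounded_weights_def)
    qed
    then show "r k *\<^sub>C (\<Sum>J\<in>arrangements {..<m}. coeff z \<mu> J *\<^sub>C Delta_word (\<lambda>_. c) k J) = 0" by simp
  qed
  show "r k *\<^sub>C (\<Sum>J\<in>arrangements {..<m}. coeff z \<mu> J *\<^sub>C Delta_word (\<lambda>_. c) k J) = r k *\<^sub>C \<Delta> k (solution z \<mu>)"
    if "k \<in> relevant_roots" for k
    using that by (simp add: root relevant_roots_def)
qed

definition dynamical_rhs :: "(complex, 'n) vec \<Rightarrow> complex^'d \<Rightarrow> complex^'d \<Rightarrow> ('n, 'v) mtensor \<Rightarrow> ('n, 'v) mtensor" where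
  "dynamical_rhs z \<mu> \<mu>' w = (\<Sum>i\<in>UNIV. z $ i *\<^sub>C factor_act act i (hh \<mu>') w) +
     (\<Sum>k\<in>relevant_roots. (wt \<alpha> k \<mu>' / wt \<alpha> k \<mu>) *\<^sub>C \<Delta> k w)"

lemma solution_derivative_generic:
  assumes zD: "(z, \<mu>) \<in> D"
    and good: "\<And>k. k \<in> bounded_weights \<Longrightarrow> wt \<alpha> k \<mu>' = 0 \<or> wt \<alpha> k \<mu> \<noteq> 0"
  shows "\<kappa> *\<^sub>C (\<Sum>J\<in>arrangements {..<m}. coeff_deriv z \<mu> \<mu>' J *\<^sub>C fvec c J) = dynamical_rhs z \<mu> \<mu>' (solution z \<mu>)"
proof -
  have "weight_sum S \<mu>' = 0 \<or> weight_sum S \<mu> \<noteq> 0" if "S \<subseteq> {..<m}" "S \<noteq> {}" for S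
  proof -
    have "finite S" using that(1) finite_subset by auto
    then have "weight_sum S h = wt \<alpha> (letter_weight c S) h" for h by (simp only: weight_sum_def wt_letter_weight)
    then show ?thesis using good[OF letter_weight_bounded[OF that]] by simp
  qed
  from solution_derivative[OF zD this] show ?thesis
    unfolding sum_subsets_by_weight sum_relevant_roots[OF zD] dynamical_rhs_def .
qed

lemma line_shift: "(\<mu> + a *s \<mu>') + b *s \<mu>' = \<mu> + (b + a) *s (\<mu>' :: complex^'d)"
  by (simp add: vec_eq_iff algebra_simps)

text \<open>
  The previous lemma does not cover parameters \<open>\<mu>\<close> where some \<open>\<langle>\<alpha>, \<mu>\<rangle>\<close> with \<open>\<Delta>\<^bsub>+,\<alpha>\<^esub> = 0\<close> on the weight space vanishes.
  It does cover all points \<open>\<mu> + a \<mu>'\<close> with \<open>a \<noteq> 0\<close> small, and both sides have limits as \<open>a\<close> tends to \<open>0\<close>.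
\<close>

lemma solution_derivative_all:
  assumes zD: "(z, \<mu>) \<in> D" and reg: "\<And>k. k \<in> relevant_roots \<Longrightarrow> wt \<alpha> k \<mu> \<noteq> 0"
  shows "\<kappa> *\<^sub>C (\<Sum>J\<in>arrangements {..<m}. coeff_deriv z \<mu> \<mu>' J *\<^sub>C fvec c J) = dynamical_rhs z \<mu> \<mu>' (solution z \<mu>)"
proof (rule clinear_functionals_separate)
  fix \<psi> :: "('n, 'v) mtensor \<Rightarrow> complex" assume \<psi>: "clinear \<psi>"
  let ?\<mu> = "\<lambda>a. \<mu> + a *s \<mu>'" and ?A = "arrangements {..<m} :: ('n \<Rightarrow> nat list) set"
  have \<psi>_sum: "\<psi> (\<Sum>J\<in>?A. x J *\<^sub>C w J) = (\<Sum>J\<in>?A. x J * \<psi> (w J))" for x w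
    by (simp only: clinear_sum_scale[OF \<psi>] scaleC_complex_def)
  have \<psi>_scale: "\<psi> (b *\<^sub>C w) = b * \<psi> w" for b w by (simp only: clinear_scale[OF \<psi>] scaleC_complex_def)
  define F where "F a = (\<Sum>J\<in>?A. coeff z (?\<mu> a) J * \<psi> (fvec c J))" for a
  define F' where "F' a = (\<Sum>J\<in>?A. coeff_deriv z (?\<mu> a) \<mu>' J * \<psi> (fvec c J))" for a
  define G where "G a = \<psi> (dynamical_rhs z (?\<mu> a) \<mu>' (solution z (?\<mu> a))) / \<kappa>" for a
  have F: "(F has_field_derivative F' a) (at a)" if a: "(z, ?\<mu> a) \<in> D" for a
  proof -
    have "((\<lambda>b. coeff z (?\<mu> b) J) has_field_derivative coeff_deriv z (?\<mu> a) \<mu>' J) (at (0 + a))" if "J \<in> ?A" for J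
      using coeff_has_derivative(2)[OF a that, of \<mu>'] unfolding line_shift by (subst DERIV_shift)
    then show ?thesis unfolding F_def F'_def by (intro DERIV_sum DERIV_cmult_right) simp
  qed
  have near: "eventually (\<lambda>a. (z, ?\<mu> a) \<in> D) (nhds 0)"
    by (rule eventually_line_in_open[OF horizontalD(1) zD])
  have wt_line: "wt \<alpha> k (?\<mu> a) = wt \<alpha> k \<mu> + a * wt \<alpha> k \<mu>'" for k a
    unfolding wt_def functional_add[OF fun_alpha] functional_scale[OF fun_alpha]
    by (simp add: sum.distrib sum_distrib_left algebra_simps)
  \<comment> \<open>The pairing is affine in \<open>a\<close> with slope \<langle>\<alpha>,
    \<mu>'\<rangle>. Unless the slope is 0, it vanishes for a single value of \<open>a\<close>,
    which is avoided near 0.\<close>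
  have generic: "eventually (\<lambda>a. \<forall>k\<in>bounded_weights. wt \<alpha> k \<mu>' = 0 \<or> wt \<alpha> k (?\<mu> a) \<noteq> 0) (at 0)"
  proof (intro eventually_ball_finite finite_weights ballI)
    fix k
    have "eventually (\<lambda>a. a \<noteq> - wt \<alpha> k \<mu> / wt \<alpha> k \<mu>') (at (0 :: complex))" by (rule eventually_neq_at_within)
    then show "eventually (\<lambda>a. wt \<alpha> k \<mu>' = 0 \<or> wt \<alpha> k (?\<mu> a) \<noteq> 0) (at 0)"
    proof eventually_elim
      case (elim a)
      then show ?case unfolding wt_line by (metis add_eq_0_iff nonzero_eq_divide_eq)
    qed
  qed
  have near0: "eventually (\<lambda>a. (z, ?\<mu> a) \<in> D) (at 0)"
    using near by (auto simp: eventually_at_filter elim: eventually_mono)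
  have FG: "eventually (\<lambda>a. (F has_field_derivative G a) (at a)) (at 0)"
    using generic near0
  proof eventually_elim
    case (elim a)
    have "\<kappa> *\<^sub>C (\<Sum>J\<in>?A. coeff_deriv z (?\<mu> a) \<mu>' J *\<^sub>C fvec c J) = dynamical_rhs z (?\<mu> a) \<mu>' (solution z (?\<mu> a))"
      by (rule solution_derivative_generic[OF elim(2)]) (use elim(1) in blast)
    from arg_cong[OF this, of \<psi>] have "\<kappa> * F' a = \<psi> (dynamical_rhs z (?\<mu> a) \<mu>' (solution z (?\<mu> a)))"
      unfolding \<psi>_scale \<psi>_sum F'_def .
    then have "F' a = G a" using kappa by (simp add: G_def field_simps)
    then show ?case using F[OF elim(2)] by simp
  qed
  have coeff_lim: "((\<lambda>a. coeff z (?\<mu> a) J) \<longlongrightarrow> coeff z (?\<mu> 0) J) (at 0)" if "J \<in> ?A" for J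
    using DERIV_isCont[OF coeff_has_derivative(2)[OF zD that, of \<mu>']] by (simp only: isCont_def)
  \<comment> \<open>Written out in scalars, the right hand side has denominators from relevant roots
    only. These are nonzero at a = 0, so the limit can be taken term by term.\<close>
  have G_eq: "G a = ((\<Sum>i\<in>UNIV. z $ i * (\<Sum>J\<in>?A. coeff z (?\<mu> a) J * \<psi> (factor_act act i (hh \<mu>') (fvec c J)))) +
      (\<Sum>k\<in>relevant_roots. wt \<alpha> k \<mu>' / (wt \<alpha> k \<mu> + a * wt \<alpha> k \<mu>') * (\<Sum>J\<in>?A. coeff z (?\<mu> a) J * \<psi> (\<Delta> k (fvec c J))))) / \<kappa>" for a
  proof -
    have 1: "\<psi> (factor_act act i (hh \<mu>') (solution z (?\<mu> a))) = (\<Sum>J\<in>?A. coeff z (?\<mu> a) J * \<psi> (factor_act act i (hh \<mu>') (fvec c J)))" for i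
      unfolding solution_def clinear_sum_scale[OF factor_act_linear] \<psi>_sum ..
    have 2: "\<psi> (\<Delta> k (solution z (?\<mu> a))) = (\<Sum>J\<in>?A. coeff z (?\<mu> a) J * \<psi> (\<Delta> k (fvec c J)))" if "k \<in> relevant_roots" for k
    proof -
      have "clinear (\<Delta> k)" using that by (intro Delta_plus_linear[OF bases]) (simp add: relevant_roots_def)
      then show ?thesis unfolding solution_def by (simp only: clinear_sum_scale \<psi>_sum)
    qed
    show ?thesis
      unfolding G_def dynamical_rhs_def clinear_add[OF \<psi>] clinear_sum[OF \<psi>] \<psi>_scale 1 wt_line by (simp add: 2)
  qed
  have G: "(G \<longlongrightarrow> G 0) (at 0)"
    unfolding G_eq[abs_def]
    by (intro tendsto_divide tendsto_add tendsto_sum tendsto_mult tendsto_const tendsto_ident_at coeff_lim)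
      (use reg kappa in auto)
  have "F' 0 = G 0"
    by (rule DERIV_eq_limit[OF FG G F]) (use zD in simp)
  then show "\<psi> (\<kappa> *\<^sub>C (\<Sum>J\<in>?A. coeff_deriv z \<mu> \<mu>' J *\<^sub>C fvec c J)) = \<psi> (dynamical_rhs z \<mu> \<mu>' (solution z \<mu>))"
    using kappa by (simp add: F'_def G_def \<psi>_sum \<psi>_scale)
qed

end

theorem theorem7p2:
  fixes form :: "complex^'d \<Rightarrow> complex^'d \<Rightarrow> complex"
    and \<alpha> :: "'r::{finite,linorder} \<Rightarrow> complex^'d \<Rightarrow> complex"
    and brk :: "'g::complex_vector \<Rightarrow> 'g \<Rightarrow> 'g"
    and hh :: "complex^'d \<Rightarrow> 'g" and e f :: "'r \<Rightarrow> 'g"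
    and \<Lambda> :: "'n::{finite,linorder} \<Rightarrow> complex^'d \<Rightarrow> complex"
    and act :: "'n \<Rightarrow> 'g \<Rightarrow> 'v::complex_vector \<Rightarrow> 'v" and v :: "'n \<Rightarrow> 'v"
    and \<nu> :: "'n \<Rightarrow> 'v \<Rightarrow> ('g, 'v) tensor"
    and B :: "('r \<Rightarrow> nat) \<Rightarrow> 'g set" and \<phi> :: "('r \<Rightarrow> nat) \<Rightarrow> 'g \<Rightarrow> 'g \<Rightarrow> complex"
    and mm :: "'r \<Rightarrow> nat" and c :: "nat \<Rightarrow> 'r" and \<kappa> :: complex
    and D :: "((complex, 'n) vec \<times> (complex, 'd) vec) set"
    and \<gamma> :: "(complex, 'n) vec \<Rightarrow> complex^'d \<Rightarrow> 'n chain"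
    and u :: "(complex, 'n) vec \<Rightarrow> complex^'d \<Rightarrow> ('n, 'v) mtensor"
    and \<Delta> :: "('r \<Rightarrow> nat) \<Rightarrow> ('n, 'v) mtensor \<Rightarrow> ('n, 'v) mtensor"
    and M_wt :: "('n, 'v) mtensor set" and R :: "('r \<Rightarrow> nat) set"
  assumes "cartan_datum form \<alpha>"
    and "kac_moody form \<alpha> brk hh e f"
    and "\<And>j. functional (\<Lambda> j)"
    and "\<And>j. verma brk hh e (\<Lambda> j) (act j) (v j)"
    and "\<And>j. is_nu_minus form \<alpha> brk hh f (act j) (v j) (\<nu> j)"
    and "\<And>k. pos_root \<alpha> brk hh f k \<Longrightarrow> root_dual_bases \<alpha> brk hh f k (B k) (\<phi> k)"
    and "\<Delta> = (\<lambda>k. Delta_plus act \<nu> (B k) (\<phi> k))"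
    and "M_wt = weight_space \<alpha> hh \<Lambda> act mm"
    and "R = {k. pos_root \<alpha> brk hh f k \<and> (\<exists>w\<in>M_wt. \<Delta> k w \<noteq> 0)}"
    and "\<kappa> \<noteq> 0"
    and "is_coloring mm c"
    and "master_function.horizontal_family form \<alpha> \<Lambda> \<kappa> (sum mm UNIV) c D \<gamma>"
    and "u = (\<lambda>z \<mu>. \<Sum>I\<in>sequences mm.
           master_function.hyp_coeff form \<alpha> \<Lambda> \<kappa> (sum mm UNIV) c \<gamma> z \<mu> I *\<^sub>C f_vector f act v I)"
  shows "\<forall>(z, \<mu>)\<in>D. (\<forall>k\<in>R. wt \<alpha> k \<mu> \<noteq> 0) \<longrightarrow>
     u z \<mu> \<in> M_wt \<and> finite R \<and>
     (\<forall>\<mu>'. \<exists>u'. has_cderivative (\<lambda>a. u z (\<mu> + a *s \<mu>')) u' 0 \<and>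
        \<kappa> *\<^sub>C u' = (\<Sum>i\<in>UNIV. (z $ i) *\<^sub>C factor_act act i (hh \<mu>') (u z \<mu>))
                 + (\<Sum>k\<in>R. (wt \<alpha> k \<mu>' / wt \<alpha> k \<mu>) *\<^sub>C \<Delta> k (u z \<mu>)))"
proof -
  interpret K: kz_roots form \<alpha> brk hh e f \<Lambda> act v \<nu> \<kappa> "sum mm UNIV" c mm D \<gamma> B \<phi>
    by (intro kz_roots.intro kz_integral.intro kz_data.intro kz_integral_axioms.intro kz_roots_axioms.intro;
      fact assms HOL.refl)
  have R: "R = K.relevant_roots" unfolding assms(7-9) K.relevant_roots_def ..
  have u: "u z \<mu> = K.solution z \<mu>" if "(z, \<mu>) \<in> D" for z \<mu>
    unfolding assms(13) by (rule K.solution_eq[OF that])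
  let ?A = "arrangements {..<sum mm UNIV} :: ('n \<Rightarrow> nat list) set"
  have main: "\<exists>u'. has_cderivative (\<lambda>a. u z (\<mu> + a *s \<mu>')) u' 0 \<and>
      \<kappa> *\<^sub>C u' = (\<Sum>i\<in>UNIV. (z $ i) *\<^sub>C factor_act act i (hh \<mu>') (u z \<mu>))
        + (\<Sum>k\<in>R. (wt \<alpha> k \<mu>' / wt \<alpha> k \<mu>) *\<^sub>C \<Delta> k (u z \<mu>))"
    if zD: "(z, \<mu>) \<in> D" and reg: "\<forall>k\<in>R. wt \<alpha> k \<mu> \<noteq> 0" for z \<mu> \<mu>'
  proof (intro exI conjI)
    let ?u' = "\<Sum>J\<in>?A. K.coeff_deriv z \<mu> \<mu>' J *\<^sub>C K.fvec c J"
    \<comment> \<open>\<open>has_cderivative\<close> asks for a linear combination indexed by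
      natural numbers, so the arrangements are enumerated.\<close>
    obtain N and a :: "nat \<Rightarrow> 'n \<Rightarrow> nat list" where a: "bij_betw a {..<N} ?A"
      using ex_bij_betw_nat_finite[OF finite_arrangements[OF finite_lessThan]] by (metis atLeast0LessThan)
    have 1: "\<forall>i<N. ((\<lambda>s. K.coeff z (\<mu> + s *s \<mu>') (a i)) has_field_derivative K.coeff_deriv z \<mu> \<mu>' (a i)) (at 0)"
      using K.coeff_has_derivative(2)[OF zD] bij_betwE[OF a] by blast
    \<comment> \<open>The expression of \<open>u\<close> by arrangements is available on
      \<open>D\<close> only; as \<open>D\<close> is open, it holds for all small
      \<open>s\<close>.\<close>
    have 2: "eventually (\<lambda>s. u z (\<mu> + s *s \<mu>') = (\<Sum>i<N. K.coeff z (\<mu> + s *s \<mu>') (a i) *\<^sub>C K.fvec c (a i))) (nhds 0)"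
      using eventually_line_in_open[OF K.horizontalD(1) zD, of \<mu>']
    proof eventually_elim
      case (elim s)
      show ?case
        unfolding u[OF elim] K.solution_def by (rule sum.reindex_bij_betw[OF a, symmetric])
    qed
    have 3: "?u' = (\<Sum>i<N. K.coeff_deriv z \<mu> \<mu>' (a i) *\<^sub>C K.fvec c (a i))"
      by (rule sum.reindex_bij_betw[OF a, symmetric])
    show "has_cderivative (\<lambda>a. u z (\<mu> + a *s \<mu>')) ?u' 0"
      unfolding has_cderivative_def
      by (rule exI[of _ N], rule exI[of _ "\<lambda>i. K.fvec c (a i)"],
          rule exI[of _ "\<lambda>i s. K.coeff z (\<mu> + s *s \<mu>') (a i)"],
          rule exI[of _ "\<lambda>i. K.coeff_deriv z \<mu> \<mu>' (a i)"]) (intro conjI 1 2 3)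
    have "\<kappa> *\<^sub>C ?u' = K.dynamical_rhs z \<mu> \<mu>' (K.solution z \<mu>)"
      by (rule K.solution_derivative_all[OF zD]) (use reg R in blast)
    then show "\<kappa> *\<^sub>C ?u' = (\<Sum>i\<in>UNIV. (z $ i) *\<^sub>C factor_act act i (hh \<mu>') (u z \<mu>))
        + (\<Sum>k\<in>R. (wt \<alpha> k \<mu>' / wt \<alpha> k \<mu>) *\<^sub>C \<Delta> k (u z \<mu>))"
      unfolding K.dynamical_rhs_def u[OF zD] R assms(7) .
  qed
  have "u z \<mu> \<in> M_wt \<and> finite R" if "(z, \<mu>) \<in> D" for z \<mu>
    unfolding u[OF that] R assms(8) using K.solution_in_weight_space[OF that] K.finite_relevant_roots by (rule conjI)
  with main show ?thesis by blast
qed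

end
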